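(* Let $s\in\mathbb{R}$ and let $u_0$ be a divergence-free initial vector field on $\mathbb{T}^2$. Then there exists $T>0$ (independent of $M$, $n$, $\nu$ below) such that the following statements hold for every $M\in\mathbb{Z}^+$, every viscosity $\nu\ge 0$ and every $0\le n\le M$, where $\tau=\frac{T}{M}$ and $(u^n)_{0\le n\le M}$ is the sequence generated by the semi-implicit scheme $$\frac{u^{n+1}-u^n}{\tau}+\mathbb{P}\big(u^n\cdot\nabla u^{n+1}\big)=\nu\Delta u^{n+1},\qquad \operatorname{div}u^{n+1}=0,\qquad u^0=u_0 .$$ (i) If $s\ge 1$ and $u_0\in B^{s}_{\infty,1}(\mathbb{T}^2)$, then $\sup_{n}\|u^n\|_{B^{s}_{\infty,1}}\le 8\|u_0\|_{B^{s}_{\infty,1}}$. (ii) If $s>1$ and $u_0\in B^{s}_{\infty,2}(\mathbb{T}^2)$, then $\sup_{n}\|u^n\|_{B^{s}_{\infty,2}}\le 8\|u_0\|_{B^{s}_{\infty,2}}$.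
   Context: $\mathbb{T}^2=(\mathbb{R}/2\pi\mathbb{Z})^2$ (periodic boundary conditions). The scheme discretizes in time the incompressible Navier-Stokes system $\partial_t u+u\cdot\nabla u+\nabla p=\nu\Delta u$, $\nabla\cdot u=0$, $u|_{t=0}=u_0$ (Euler if $\nu=0$). $\mathbb{P}$ is the Leray projection, i.e. the $L^2$-orthogonal projection onto divergence-free vector fields: $\mathbb{P}v=v-\nabla q$ with $\Delta q=\nabla\cdot v$. The scheme is equivalent to $\frac{u^{n+1}-u^n}{\tau}+(u^n\cdot\nabla)u^{n+1}+\nabla p^n=\nu\Delta u^{n+1}$, $\operatorname{div}u^{n+1}=0$. Besov spaces: let $\chi:[0,\infty)\to[0,1]$ be a fixed smooth monotone function with $\chi(x)=1$ for $0\le x\le\frac12$, $\chi(\frac34)=\frac12$, $\chi(x)=0$ for $x\ge1$, and let $\varphi(x)=\chi(x)-\chi(2x)$. For $f=\sum_{k\in\mathbb{Z}^2}\hat f(k)e^{ik\cdot x}$ put $\Delta_0 f=\hat f(0)$ and $\Delta_j f=\sum_{k}\hat f(k)\varphi(|k|/2^j)e^{ik\cdot x}$ for $j\ge1$, so $f=\sum_{j\ge0}\Delta_j f$. For $s\in\mathbb{R}$, $1\le p,r\le\infty$, $\|f\|_{B^s_{p,r}}=\big\|(2^{js}\|\Delta_j f\|_{L^p})_{j\ge0}\big\|_{\ell^r}$ (componentwise for vector fields), and $B^s_{p,r}$ is the space of periodic distributions with finite norm. *)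

theory Defs
  imports "HOL-Analysis.Analysis" "HOL-Probability.Essential_Supremum"
begin

text \<open>
  Functions, fields and distributions on the torus of side \<open>2\<pi>\<close> are represented by
  \<open>2\<pi>\<close>-periodic objects on \<open>real^2\<close>. Physical fields are real-valued, so test functions and
  distributions are real; complex numbers enter only through Fourier coefficients.
\<close>

definition periodic :: "(real^2 \<Rightarrow> 'b) \<Rightarrow> bool" where
  "periodic f \<longleftrightarrow> (\<forall>x i. f (x + (2 * pi) *\<^sub>R axis i 1) = f x)"

definition torus :: "(real^2) measure" where
  "torus = restrict_space lborel (cbox 0 (\<chi> i. 2 * pi))"

definition pd :: "2 \<Rightarrow> (real^2 \<Rightarrow> real) \<Rightarrow> real^2 \<Rightarrow> real" where
  "pd i f x = deriv (\<lambda>t. f (x + t *\<^sub>R axis i 1)) 0"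

definition pds :: "2 list \<Rightarrow> (real^2 \<Rightarrow> real) \<Rightarrow> real^2 \<Rightarrow> real" where
  "pds is f = foldr pd is f"

definition test_functions :: "(real^2 \<Rightarrow> real) set" where
  "test_functions = {f. periodic f \<and> (\<forall>is. pds is f differentiable_on UNIV)}"


subsection \<open>Periodic distributions\<close>

text \<open>
  A distribution is a linear functional on test functions that is continuous for the
  \<open>C\<^sup>\<infinity>\<close> topology. Its values off the test functions carry no meaning, so equality of
  distributions is \<open>distr_eq\<close>.
\<close>

type_synonym distr = "(real^2 \<Rightarrow> real) \<Rightarrow> real"

definition periodic_distr :: "distr set" where
  "periodic_distr = {F.
     (\<forall>f\<in>test_functions. \<forall>g\<in>test_functions. F (\<lambda>x. f x + g x) = F f + F g) \<and>
     (\<forall>c. \<forall>f\<in>test_functions. F (\<lambda>x. c * f x) = c * F f) \<and>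
     (\<exists>C N. \<forall>f\<in>test_functions.
        \<bar>F f\<bar> \<le> C * (\<Sum>is\<in>{is. length is \<le> N}. SUP x. \<bar>pds is f x\<bar>))}"

definition distr_eq :: "distr \<Rightarrow> distr \<Rightarrow> bool" (infix "\<simeq>\<^sub>D" 50) where
  "F \<simeq>\<^sub>D G \<longleftrightarrow> (\<forall>f\<in>test_functions. F f = G f)"

definition distr_of :: "(real^2 \<Rightarrow> real) \<Rightarrow> distr" where
  "distr_of u f = (LINT x|torus. u x * f x)"

definition dpd :: "2 \<Rightarrow> distr \<Rightarrow> distr" where
  "dpd i F f = - F (pd i f)"

definition dlaplacian :: "distr \<Rightarrow> distr" where
  "dlaplacian F f = (\<Sum>i\<in>UNIV. dpd i (dpd i F) f)"

definition distr_field_of :: "(real^2 \<Rightarrow> real^2) \<Rightarrow> distr^2" where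
  "distr_field_of u = (\<chi> i. distr_of (\<lambda>x. u x $ i))"

definition ddiv :: "distr^2 \<Rightarrow> distr" where
  "ddiv F f = (\<Sum>i\<in>UNIV. dpd i (F $ i) f)"

definition zero_distr :: distr where
  "zero_distr f = 0"


subsection \<open>Besov spaces\<close>

text \<open>
  Only the values of \<open>h\<close> on \<open>[0,\<infinity>)\<close> are constrained and used. Smoothness at the endpoint
  \<open>0\<close> is automatic, since \<open>h = 1\<close> on \<open>[0,1/2]\<close>.
\<close>

definition cutoff :: "(real \<Rightarrow> real) \<Rightarrow> bool" where
  "cutoff h \<longleftrightarrow>
     (\<forall>n. (deriv ^^ n) h differentiable_on {0<..}) \<and>
     h ` {0..} \<subseteq> {0..1} \<and> antimono_on {0..} h \<and>
     (\<forall>x\<in>{0..1/2}. h x = 1) \<and> h (3/4) = 1/2 \<and> (\<forall>x\<ge>1. h x = 0)"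

definition lp_phi :: "(real \<Rightarrow> real) \<Rightarrow> real \<Rightarrow> real" where
  "lp_phi h x = h x - h (2 * x)"

definition freq :: "int^2 \<Rightarrow> real^2" where
  "freq k = (\<chi> i. real_of_int (k $ i))"

text \<open>\<open>(2\<pi>)\<^sup>-\<^sup>2 F(e\<^sup>-\<^sup>i\<^sup>k\<^sup>x)\<close>, with the real functional \<open>F\<close> extended complex-linearly.\<close>

definition fourier :: "distr \<Rightarrow> int^2 \<Rightarrow> complex" where
  "fourier F k =
     Complex (F (\<lambda>x. cos (freq k \<bullet> x))) (- F (\<lambda>x. sin (freq k \<bullet> x))) / of_real ((2 * pi)^2)"

text \<open>For a cutoff \<open>h\<close> the sum below has only finitely many nonzero terms.\<close>

definition lp_block :: "(real \<Rightarrow> real) \<Rightarrow> nat \<Rightarrow> distr \<Rightarrow> real^2 \<Rightarrow> complex" where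
  "lp_block h j F x =
     (if j = 0 then fourier F 0
      else (\<Sum>\<^sub>\<infinity>k. fourier F k * of_real (lp_phi h (norm (freq k) / 2^j)) * cis (freq k \<bullet> x)))"

text \<open>Real power on \<open>[0,\<infinity>]\<close>, used only for positive exponents.\<close>

definition epow :: "ennreal \<Rightarrow> real \<Rightarrow> ennreal" where
  "epow x a = (if x = \<infinity> then \<infinity> else ennreal (enn2real x powr a))"

definition Lp_norm :: "ennreal \<Rightarrow> (real^2 \<Rightarrow> complex) \<Rightarrow> ennreal" where
  "Lp_norm p f =
     (if p = \<infinity> then esssup torus (\<lambda>x. ennreal (norm (f x)))
      else epow (\<integral>\<^sup>+x. ennreal (norm (f x) powr enn2real p) \<partial>torus) (1 / enn2real p))"

definition lr_norm :: "ennreal \<Rightarrow> (nat \<Rightarrow> ennreal) \<Rightarrow> ennreal" where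
  "lr_norm r a =
     (if r = \<infinity> then (SUP j. a j)
      else epow (\<Sum>j. epow (a j) (enn2real r)) (1 / enn2real r))"

definition besov_norm1 :: "(real \<Rightarrow> real) \<Rightarrow> real \<Rightarrow> ennreal \<Rightarrow> ennreal \<Rightarrow> distr \<Rightarrow> ennreal" where
  "besov_norm1 h s p r F =
     lr_norm r (\<lambda>j. ennreal (2 powr (real j * s)) * Lp_norm p (lp_block h j F))"

definition besov_norm :: "(real \<Rightarrow> real) \<Rightarrow> real \<Rightarrow> ennreal \<Rightarrow> ennreal \<Rightarrow> distr^2 \<Rightarrow> ennreal" where
  "besov_norm h s p r F = (\<Sum>i\<in>UNIV. besov_norm1 h s p r (F $ i))"

definition besov_space :: "(real \<Rightarrow> real) \<Rightarrow> real \<Rightarrow> ennreal \<Rightarrow> ennreal \<Rightarrow> (distr^2) set" where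
  "besov_space h s p r = {F. (\<forall>i. F $ i \<in> periodic_distr) \<and> besov_norm h s p r F < \<infinity>}"


subsection \<open>The semi-implicit scheme\<close>

text \<open>
  \<open>w = \<P>v\<close>. Since \<open>q\<close> is determined up to an additive constant, \<open>w\<close> is determined as a
  distribution.
\<close>

definition is_leray_projection :: "distr^2 \<Rightarrow> distr^2 \<Rightarrow> bool" where
  "is_leray_projection v w \<longleftrightarrow>
     (\<exists>q\<in>periodic_distr. dlaplacian q \<simeq>\<^sub>D ddiv v \<and>
        (\<forall>i. w $ i \<simeq>\<^sub>D (\<lambda>f. (v $ i) f - dpd i q f)))"

definition c1_field :: "(real^2 \<Rightarrow> real^2) \<Rightarrow> bool" where
  "c1_field u \<longleftrightarrow>
     periodic u \<and> u differentiable_on UNIV \<and>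
     (\<forall>i j. continuous_on UNIV (pd j (\<lambda>x. u x $ i)))"

definition advect :: "(real^2 \<Rightarrow> real^2) \<Rightarrow> (real^2 \<Rightarrow> real^2) \<Rightarrow> real^2 \<Rightarrow> real^2" where
  "advect b v x = (\<chi> i. \<Sum>j\<in>UNIV. b x $ j * pd j (\<lambda>y. v y $ i) x)"

text \<open>
  The iterates are \<open>C\<^sup>1\<close> fields, so that \<open>u\<^sup>n \<cdot> \<nabla>u\<^sup>n\<^sup>+\<^sup>1\<close> is a classical product; the
  equation itself, and the initial condition, hold in the sense of distributions. Only
  \<open>u 0, \<dots>, u M\<close> are constrained.
\<close>

definition semi_implicit_scheme ::
  "distr^2 \<Rightarrow> real \<Rightarrow> real \<Rightarrow> nat \<Rightarrow> (nat \<Rightarrow> real^2 \<Rightarrow> real^2) \<Rightarrow> bool" where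
  "semi_implicit_scheme u0 \<nu> \<tau> M u \<longleftrightarrow>
     (\<forall>n\<le>M. c1_field (u n)) \<and>
     (\<forall>i. distr_field_of (u 0) $ i \<simeq>\<^sub>D u0 $ i) \<and>
     (\<forall>n<M.
        ddiv (distr_field_of (u (Suc n))) \<simeq>\<^sub>D zero_distr \<and>
        (\<exists>w. is_leray_projection (distr_field_of (advect (u n) (u (Suc n)))) w \<and>
           (\<forall>i. (\<lambda>f. ((distr_field_of (u (Suc n)) $ i) f - (distr_field_of (u n) $ i) f) / \<tau>
                       + (w $ i) f)
                \<simeq>\<^sub>D (\<lambda>f. \<nu> * dlaplacian (distr_field_of (u (Suc n)) $ i) f))))"

end

theory Submission
  imports Defs "HOL-Library.Diagonal_Subsequence"
begin

text \<open>
  The implicit step costs no derivatives. For given \<open>u\<^sup>n = b\<close> the unknown \<open>v = u\<^sup>n\<^sup>+\<^sup>1\<close> solves the linear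
  equation \<open>v + \<tau> \<P>(b \<cdot> \<nabla>v) - \<tau>\<nu> \<Delta>v = b\<close>. A Littlewood-Paley block of this equation reads
  \<open>\<Delta>\<^sub>j v + \<tau> b \<cdot> \<nabla>\<Delta>\<^sub>j v - \<tau>\<nu> \<Delta>\<Delta>\<^sub>j v = \<Delta>\<^sub>j b - \<tau> R\<^sub>j\<close>, and since transport and viscosity obey the maximum
  principle (\<open>max_principle\<close>), \<open>\<parallel>\<Delta>\<^sub>j v\<parallel> \<le> \<parallel>\<Delta>\<^sub>j b\<parallel> + \<tau> \<parallel>R\<^sub>j\<parallel>\<close> in the supremum norm, with no condition
  relating \<open>\<tau>\<close> to \<open>j\<close> or \<open>\<nu>\<close>.

  The remainder \<open>R\<^sub>j\<close> consists of the commutator of \<open>\<Delta>\<^sub>j\<close> with \<open>b \<cdot> \<nabla>\<close> and of the pressure. Both are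
  sums over pairs of blocks of \<open>b\<close> and \<open>v\<close>, and both can be charged to the gradient of the factor of lower
  frequency (\<open>norm_inter_le\<close>): the commutator by the first moment of the kernel of \<open>\<Delta>\<^sub>j\<close>, the pressure because the
  divergence of \<open>b \<cdot> \<nabla>v\<close> is symmetric in \<open>b\<close> and \<open>v\<close> for divergence-free fields. In the two cases of the
  theorem the norm controls \<open>\<Sum> 2\<^sup>j \<parallel>\<Delta>\<^sub>j u\<parallel>\<close>, and summing over \<open>j\<close> gives
  \<open>\<parallel>v\<parallel> \<le> \<parallel>b\<parallel> + C \<tau> \<parallel>b\<parallel> \<parallel>v\<parallel>\<close> (\<open>a_priori_estimate\<close>). The underlying multiplier bounds on bounded
  functions, uniform in \<open>j\<close>, come from an \<open>L\<^sup>1\<close> estimate for the kernels of smooth symbols (\<open>Mn_bound\<close>).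

  A step is solved first for trigonometric polynomials and positive viscosity. There a damped Picard iteration contracts in the
  energy norm, because transport is skew-symmetric (\<open>linear_step_solvable\<close>), and the solution is smooth
  (\<open>elliptic_decay\<close>), so that its norm is finite and can be absorbed. Approximation by Fejer means and a compactness
  argument yield a step for all data in the Besov class and all \<open>\<nu> \<ge> 0\<close> (\<open>step_solution\<close>), with
  \<open>\<parallel>v\<parallel> \<le> \<parallel>b\<parallel> / (1 - C \<tau> \<parallel>b\<parallel>)\<close>. Iterating it, a discrete Gronwall argument keeps the norms below twice the initial norm
  up to a time of order \<open>1 / (C (1 + \<parallel>u\<^sub>0\<parallel>))\<close>, uniformly in \<open>M\<close> and \<open>\<nu>\<close> (\<open>gronwall_step\<close>).

  The scheme itself speaks of continuously differentiable fields and of distributions. A distribution is determined by its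
  Fourier coefficients (\<open>distr_eqI\<close>), so a step is equivalent to an equation between coefficients, and an energy estimate
  shows that it has at most one solution (\<open>step_unique\<close>). Hence every sequence generated by the scheme is the constructed
  one, and the bound holds for all of them.
\<close>

section \<open>Continuous periodic functions and their Fourier coefficients\<close>

definition ek :: "int^2 \<Rightarrow> real^2 \<Rightarrow> complex" where
  "ek k x = cis (freq k \<bullet> x)"

definition mean :: "(real^2 \<Rightarrow> complex) \<Rightarrow> complex" where
  "mean f = (LINT x|torus. f x) / of_real ((2 * pi)^2)"

text \<open>
  The class of functions on which everything is done: the target is an arbitrary topological space, so
  that real, complex and norm-valued functions share the closure lemmas.
\<close>

definition cper :: "(real^2 \<Rightarrow> 'b::topological_space) \<Rightarrow> bool" where
  "cper f \<longleftrightarrow> continuous_on UNIV f \<and> periodic f"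

definition fc :: "(real^2 \<Rightarrow> complex) \<Rightarrow> int^2 \<Rightarrow> complex" where
  "fc f k = mean (\<lambda>x. f x * cnj (ek k x))"

lemma freq_add: "freq (k + l) = freq k + freq l"
  and freq_diff: "freq (k - l) = freq k - freq l"
  and freq_minus: "freq (- k) = - freq k"
  and freq_0 [simp]: "freq 0 = 0"
  and freq_nth [simp]: "freq k $ i = of_int (k $ i)"
  by (simp_all add: freq_def vec_eq_iff)

lemma freq_eq_0_iff [simp]: "freq k = 0 \<longleftrightarrow> k = 0"
  by (simp add: freq_def vec_eq_iff)

lemma inner_real2: "(x::real^2) \<bullet> y = x $ 1 * y $ 1 + x $ 2 * y $ 2"
  by (simp add: inner_vec_def UNIV_2)

lemma ek_add: "ek (k + l) x = ek k x * ek l x"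
  by (simp add: ek_def freq_add inner_add_left cis_mult)

lemma ek_minus: "ek (- k) x = cnj (ek k x)"
  by (simp add: ek_def freq_minus cis_cnj)

lemma ek_diff: "ek (k - l) x = ek k x * cnj (ek l x)"
  using ek_add[of k "-l" x] by (simp add: ek_minus)

lemma ek_0 [simp]: "ek 0 x = 1"
  by (simp add: ek_def)

lemma ek_at_0 [simp]: "ek k 0 = 1"
  by (simp add: ek_def)

lemma norm_ek [simp]: "norm (ek k x) = 1"
  by (simp add: ek_def)

lemma ek_minus_arg: "ek k (x - y) = ek k x * cnj (ek k y)"
  by (simp add: ek_def inner_diff_right cis_divide[symmetric] cis_cnj field_simps cis_mult)

lemma ek_cnj_self: "ek k x * cnj (ek k x) = 1" "cnj (ek k x) * ek k x = 1"
  by (simp_all add: complex_norm_square[symmetric] mult.commute[of "cnj _"])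

lemma continuous_ek [continuous_intros]:
  assumes "continuous_on S g" shows "continuous_on S (\<lambda>x. ek k (g x))"
  unfolding ek_def by (intro continuous_intros assms)

lemma periodic_ek: "periodic (ek k)"
  unfolding periodic_def
proof (intro allI)
  fix x :: "real^2" and i
  have "ek k (x + (2 * pi) *\<^sub>R axis i 1) = cis (freq k \<bullet> x + 2 * pi * of_int (k $ i))"
    by (simp add: ek_def inner_add_right inner_axis)
  also have "\<dots> = ek k x"
    using cis_multiple_2pi[of "of_int (k $ i)"] by (simp only: cis_mult[symmetric] ek_def) simp
  finally show "ek k (x + (2 * pi) *\<^sub>R axis i 1) = ek k x" .
qed

lemma cper_ek: "cper (ek k)"
  by (auto simp: cper_def periodic_ek intro!: continuous_intros)

lemma cperI: "continuous_on UNIV f \<Longrightarrow> periodic f \<Longrightarrow> cper f"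
  by (simp add: cper_def)

lemma cper_cont: "cper f \<Longrightarrow> continuous_on S f"
  unfolding cper_def by (blast intro: continuous_on_subset)

lemma cper_const [simp]: "cper (\<lambda>x. c)"
  by (simp add: cper_def periodic_def)

lemma cper_comp1: "continuous_on UNIV g \<Longrightarrow> cper f \<Longrightarrow> cper (\<lambda>x. g (f x))"
  unfolding cper_def periodic_def by (auto intro: continuous_on_compose2)

lemma cper_add: fixes f :: "real^2 \<Rightarrow> 'b::real_normed_vector"
  shows "cper f \<Longrightarrow> cper g \<Longrightarrow> cper (\<lambda>x. f x + g x)"
  unfolding cper_def periodic_def by (auto intro!: continuous_intros)

lemma cper_diff: fixes f :: "real^2 \<Rightarrow> 'b::real_normed_vector"
  shows "cper f \<Longrightarrow> cper g \<Longrightarrow> cper (\<lambda>x. f x - g x)"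
  unfolding cper_def periodic_def by (auto intro!: continuous_intros)

lemma cper_mult: fixes f :: "real^2 \<Rightarrow> 'b::real_normed_algebra"
  shows "cper f \<Longrightarrow> cper g \<Longrightarrow> cper (\<lambda>x. f x * g x)"
  unfolding cper_def periodic_def by (auto intro!: continuous_intros)

lemma cper_cnj: "cper f \<Longrightarrow> cper (\<lambda>x. cnj (f x))"
  by (rule cper_comp1) (auto intro!: continuous_intros)

lemma cper_of_real: "cper f \<Longrightarrow> cper (\<lambda>x. complex_of_real (f x))"
  by (rule cper_comp1) (auto intro!: continuous_intros)

lemma cper_Re: "cper f \<Longrightarrow> cper (\<lambda>x. Re (f x))"
  by (rule cper_comp1) (auto intro!: continuous_intros)

lemma cper_norm: fixes f :: "real^2 \<Rightarrow> 'b::real_normed_vector"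
  shows "cper f \<Longrightarrow> cper (\<lambda>x. norm (f x))"
  by (rule cper_comp1) (auto intro!: continuous_intros)

lemma cper_sum: fixes f :: "'i \<Rightarrow> real^2 \<Rightarrow> 'b::real_normed_vector"
  shows "(\<And>i. i \<in> I \<Longrightarrow> cper (f i)) \<Longrightarrow> cper (\<lambda>x. \<Sum>i\<in>I. f i x)"
  by (induction I rule: infinite_finite_induct) (auto intro: cper_add)

lemma cper_shift: "cper f \<Longrightarrow> cper (\<lambda>y. f (y + a))"
  unfolding cper_def periodic_def
  by (auto simp: add.assoc add.commute[of _ a] intro!: continuous_on_compose2[of UNIV f UNIV] continuous_intros)
     (simp add: add.assoc[symmetric] add.commute)

text \<open>
  The lattice of periods is \<open>2\<pi>\<close> times the image of \<open>freq\<close>, so that frequencies also index translations.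
\<close>

lemma periodic_freq:
  assumes "periodic f" shows "f (x + (2 * pi) *\<^sub>R freq m) = f x"
proof -
  have nat: "f (x + (of_nat n * (2 * pi)) *\<^sub>R axis i 1) = f x" for x i n
  proof (induction n)
    case (Suc n)
    have "x + (of_nat (Suc n) * (2 * pi)) *\<^sub>R axis i 1
        = (x + (of_nat n * (2 * pi)) *\<^sub>R axis i 1) + (2 * pi) *\<^sub>R axis i 1"
      by (simp add: algebra_simps)
    then show ?case using assms Suc unfolding periodic_def by metis
  qed simp
  have int: "f (x + (of_int n * (2 * pi)) *\<^sub>R axis i 1) = f x" for x i n
  proof (cases "n \<ge> 0")
    case True then show ?thesis using nat[of x "nat n" i] by simp
  next
    case False
    then show ?thesis using nat[of "x + (of_int n * (2 * pi)) *\<^sub>R axis i 1" "nat (- n)" i] by (simp add: add.assoc)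
  qed
  have "(2 * pi) *\<^sub>R freq m = (of_int (m $ 1) * (2 * pi)) *\<^sub>R axis 1 1 + (of_int (m $ 2) * (2 * pi)) *\<^sub>R axis 2 1"
    by (simp add: vec_eq_iff forall_2 axis_def)
  then have "x + (2 * pi) *\<^sub>R freq m = (x + (of_int (m $ 1) * (2 * pi)) *\<^sub>R axis 1 1) + (of_int (m $ 2) * (2 * pi)) *\<^sub>R axis 2 1"
    by (simp only: add.assoc)
  then show ?thesis by (simp only: int)
qed

lemma cper_reflect: assumes "cper f" shows "cper (\<lambda>y. f (x - y))"
proof -
  have "f (x - (y + (2 * pi) *\<^sub>R axis i 1)) = f (x - y)" for y i
    using assms[unfolded cper_def periodic_def, THEN conjunct2, rule_format, of "x - (y + (2 * pi) *\<^sub>R axis i 1)" i]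
    by (simp add: algebra_simps)
  then show ?thesis using assms unfolding cper_def periodic_def
    by (auto intro!: continuous_on_compose2[of UNIV f UNIV] continuous_intros)
qed

abbreviation box2 :: "(real^2) set" where "box2 \<equiv> cbox 0 (\<chi> i. 2 * pi)"

lemma mem_box2: "x \<in> box2 \<longleftrightarrow> (\<forall>i. 0 \<le> x $ i \<and> x $ i \<le> 2 * pi)"
  by (simp add: mem_box_cart)

lemma reduce_to_box: "\<exists>m. x + (2 * pi) *\<^sub>R freq m \<in> box2"
proof
  let ?m = "\<chi> i. - \<lfloor>x $ i / (2 * pi)\<rfloor>"
  show "x + (2 * pi) *\<^sub>R freq ?m \<in> box2"
  proof (unfold mem_box2, intro allI)
    fix i
    have "of_int \<lfloor>x $ i / (2 * pi)\<rfloor> \<le> x $ i / (2 * pi)" "x $ i / (2 * pi) \<le> of_int \<lfloor>x $ i / (2 * pi)\<rfloor> + 1"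
      by linarith+
    then have "of_int \<lfloor>x $ i / (2 * pi)\<rfloor> * (2 * pi) \<le> x $ i" "x $ i \<le> (of_int \<lfloor>x $ i / (2 * pi)\<rfloor> + 1) * (2 * pi)"
      by (simp_all only: pos_le_divide_eq pos_divide_le_eq pi_gt_zero zero_less_mult_iff zero_less_numeral simp_thms)
    then show "0 \<le> (x + (2 * pi) *\<^sub>R freq ?m) $ i \<and> (x + (2 * pi) *\<^sub>R freq ?m) $ i \<le> 2 * pi"
      by (simp add: algebra_simps)
  qed
qed

text \<open>
  Compactness of the torus. The maximum principle needs the maximum to be attained on the whole plane,
  where it is an interior critical point.
\<close>

lemma cper_attains_sup:
  fixes f :: "real^2 \<Rightarrow> real"
  assumes "cper f" shows "\<exists>x0. \<forall>x. f x \<le> f x0"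
proof -
  have "compact box2" "box2 \<noteq> {}" using mem_box2[of 0] by auto
  then obtain x0 where x0: "\<And>x. x \<in> box2 \<Longrightarrow> f x \<le> f x0"
    using continuous_attains_sup[OF _ _ cper_cont[OF assms]] by blast
  have "f x \<le> f x0" for x
    using reduce_to_box[of x] x0 periodic_freq[of f x] assms unfolding cper_def by metis
  then show ?thesis by blast
qed

lemma cper_bounded:
  fixes f :: "real^2 \<Rightarrow> 'b::real_normed_vector"
  assumes "cper f" obtains B where "B \<ge> 0" "\<And>x. norm (f x) \<le> B"
  using cper_attains_sup[OF cper_norm[OF assms]] norm_ge_zero by (metis order_trans)

lemma space_torus [simp]: "space torus = box2"
  by (simp add: torus_def space_restrict_space)

lemma emeasure_torus: "emeasure torus (space torus) = ennreal ((2 * pi)^2)"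
proof -
  have "emeasure torus (space torus) = emeasure lborel box2"
    by (simp add: torus_def emeasure_restrict_space space_restrict_space)
  also have "\<dots> = ennreal (\<Prod>b\<in>Basis. ((\<chi> i. 2 * pi) - 0 :: real^2) \<bullet> b)"
    by (rule emeasure_lborel_cbox) (auto simp: Basis_vec_def inner_axis)
  also have "(\<Prod>b\<in>Basis. ((\<chi> i. 2 * pi) - 0 :: real^2) \<bullet> b) = (2 * pi)^2"
    by (simp add: Basis_vec_def UNIV_2 inner_axis power2_eq_square axis_eq_axis prod.insert_if)
  finally show ?thesis .
qed

interpretation torus: finite_measure torus
  by standard (simp add: emeasure_torus del: space_torus)

lemma measure_torus: "measure torus (space torus) = (2 * pi)^2"
  by (simp add: measure_def emeasure_torus del: space_torus)

lemma measurable_torus_cont: "continuous_on UNIV f \<Longrightarrow> f \<in> borel_measurable torus"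
  unfolding torus_def by (intro measurable_restrict_space1) (simp add: borel_measurable_continuous_onI)

lemma integrable_torus:
  fixes f :: "real^2 \<Rightarrow> 'b::{banach,second_countable_topology}"
  assumes "cper f" shows "integrable torus f"
proof -
  obtain B where "\<And>x. norm (f x) \<le> B" using cper_bounded[OF assms] by blast
  then show ?thesis using assms
    by (intro torus.integrable_const_bound[where B=B] measurable_torus_cont) (auto simp: cper_def)
qed

lemma mean_add: "cper f \<Longrightarrow> cper g \<Longrightarrow> mean (\<lambda>x. f x + g x) = mean f + mean g"
  by (simp add: mean_def integrable_torus add_divide_distrib)

lemma mean_diff: "cper f \<Longrightarrow> cper g \<Longrightarrow> mean (\<lambda>x. f x - g x) = mean f - mean g"
  by (simp add: mean_def integrable_torus diff_divide_distrib)

lemma mean_cmult: "mean (\<lambda>x. c * f x) = c * mean f"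
  by (simp add: mean_def)

lemma mean_multc: "mean (\<lambda>x. f x * c) = mean f * c"
  by (simp add: mean_def)

lemma mean_zero [simp]: "mean (\<lambda>x. 0) = 0"
  by (simp add: mean_def)

lemma mean_const [simp]: "mean (\<lambda>x. c) = c"
  using measure_torus by (simp add: mean_def scaleR_conv_of_real)

lemma mean_sum: "(\<And>i. i \<in> I \<Longrightarrow> cper (f i)) \<Longrightarrow> mean (\<lambda>x. \<Sum>i\<in>I. f i x) = (\<Sum>i\<in>I. mean (f i))"
  by (simp add: mean_def integrable_torus sum_divide_distrib)

lemma mean_cnj: "mean (\<lambda>x. cnj (f x)) = cnj (mean f)"
  by (simp add: mean_def integral_cnj)

lemma mean_of_real: "mean (\<lambda>x. of_real (f x)) = of_real ((LINT x|torus. f x) / (2 * pi)^2)"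
  by (simp add: mean_def)

lemma norm_mean_le:
  assumes "cper f" "cper g" "\<And>x. norm (f x) \<le> g x"
  shows "norm (mean f) \<le> Re (mean (\<lambda>x. of_real (g x)))"
proof -
  have "norm (LINT x|torus. f x) \<le> (LINT x|torus. norm (f x))" by (rule integral_norm_bound)
  also have "\<dots> \<le> (LINT x|torus. g x)"
    using assms by (intro integral_mono integrable_torus cper_norm)
  finally show ?thesis unfolding mean_of_real
    by (simp add: mean_def norm_divide norm_power norm_mult divide_right_mono)
qed

lemma norm_mean_le_const:
  assumes "cper f" "\<And>x. norm (f x) \<le> B" shows "norm (mean f) \<le> B"
  using norm_mean_le[of f "\<lambda>_. B"] assms by simp

lemma mean_cong: "(\<And>x. f x = g x) \<Longrightarrow> mean f = mean g"
  by presburger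

lemma Re_mean_nonneg:
  assumes "cper g" "\<And>x. g x \<ge> 0" shows "Re (mean (\<lambda>x. of_real (g x))) \<ge> 0"
  using norm_mean_le[of "\<lambda>_. 0" g] assms by simp

lemma Re_mean_mono:
  assumes "cper f" "cper g" "\<And>x. f x \<le> g x"
  shows "Re (mean (\<lambda>x. of_real (f x))) \<le> Re (mean (\<lambda>x. of_real (g x)))"
  unfolding mean_of_real using assms by (simp add: divide_right_mono integral_mono integrable_torus)

lemma has_vector_derivative_cis_linear:
  "((\<lambda>t. cis (a + c * t)) has_vector_derivative (\<i> * of_real c) * cis (a + c * t)) (at t within S)"
proof -
  have "((\<lambda>z. exp (\<i> * (of_real a + of_real c * z))) has_field_derivative (\<i> * of_real c) * exp (\<i> * (of_real a + of_real c * of_real t))) (at (of_real t))"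
    by (auto intro!: derivative_eq_intros)
  from has_vector_derivative_real_field[OF this, of S] show ?thesis
    by (simp add: cis_conv_exp)
qed

lemma integral_circle:
  "(LINT t|lborel. indicator {0..2*pi} t *\<^sub>R cis (of_int m * t)) = (if m = 0 then 2 * pi else 0)"
proof (cases "m = 0")
  case True then show ?thesis by (simp add: scaleR_conv_of_real)
next
  case False
  have "(LINT t|lborel. indicator {0..2*pi} t *\<^sub>R cis (of_int m * t))
     = cis (of_int m * (2*pi)) / (\<i> * of_int m) - cis (of_int m * 0) / (\<i> * of_int m)"
  proof (rule integral_FTC_Icc)
    fix x :: real
    show "((\<lambda>t. cis (real_of_int m * t) / (\<i> * of_int m)) has_vector_derivative cis (of_int m * x)) (at x within {0..2*pi})"
      using has_vector_derivative_divide[OF has_vector_derivative_cis_linear[of 0 "of_int m" x "{0..2*pi}"], of "\<i> * of_int m"] False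
      by simp
  qed (auto intro!: continuous_intros)
  moreover have "cis (real_of_int m * (2 * pi)) = 1"
    using cis_multiple_2pi[of "of_int m"] by (simp add: mult.commute)
  ultimately show ?thesis using False by simp
qed

text \<open>
  Orthogonality of the characters: the integral over the square factors into two integrals over circles.
\<close>

lemma mean_ek: "mean (ek k) = of_bool (k = 0)"
proof -
  let ?g = "\<lambda>b::real^2. \<lambda>t. indicator {0..2*pi} t *\<^sub>R cis ((freq k \<bullet> b) * t)"
  have B: "Basis = {axis 1 1, axis 2 1 :: real^2}" "axis 1 1 \<noteq> (axis 2 1 :: real^2)"
    by (auto simp: Basis_vec_def UNIV_2 axis_eq_axis)
  have prodB: "(\<Prod>b\<in>Basis. f b) = f (axis 1 1) * f (axis 2 1)" for f :: "real^2 \<Rightarrow> complex"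
    unfolding B(1) using B(2) by (subst prod.insert) auto
  have eq: "indicator box2 x *\<^sub>R ek k x = (\<Prod>b\<in>Basis. ?g b (x \<bullet> b))" for x
  proof -
    have "indicator box2 x = (indicator {0..2*pi} (x $ 1) * indicator {0..2*pi} (x $ 2) :: real)"
      by (auto simp: indicator_def mem_box2 forall_2)
    moreover have "ek k x = cis (freq k $ 1 * x $ 1) * cis (freq k $ 2 * x $ 2)"
      by (simp add: ek_def inner_real2 cis_mult)
    ultimately show ?thesis unfolding prodB by (simp add: inner_axis scaleR_conv_of_real)
  qed
  have int: "integrable lborel (?g b)" for b
    by (rule borel_integrable_compact) (auto intro!: continuous_intros)
  have meas: "(\<lambda>x. ?g b (x \<bullet> b)) \<in> borel_measurable borel" for b
    using measurable_compose[OF _ borel_measurable_integrable[OF int[of b]], of "\<lambda>x. x \<bullet> b" borel] by simp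
  interpret product_sigma_finite "\<lambda>_::real^2. lborel :: real measure" ..
  have sumb: "(\<Sum>b\<in>Basis. f b *\<^sub>R b) \<bullet> b = f b" if "b \<in> Basis" for f and b :: "real^2"
    using that by (rule inner_sum_left_Basis)
  have "(LINT x|torus. ek k x) = (LINT x|lborel. indicator box2 x *\<^sub>R ek k x)"
    unfolding torus_def by (subst integral_restrict_space) simp_all
  also have "\<dots> = (LINT x|(distr (\<Pi>\<^sub>M b\<in>Basis. lborel) borel (\<lambda>f. \<Sum>b\<in>Basis. f b *\<^sub>R b)). (\<Prod>b\<in>Basis. ?g b (x \<bullet> b)))"
    unfolding eq by (subst lborel_eq) simp
  also have "\<dots> = (LINT f|(\<Pi>\<^sub>M b\<in>Basis. lborel). (\<Prod>b\<in>Basis. ?g b ((\<Sum>b\<in>Basis. f b *\<^sub>R b) \<bullet> b)))"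
    by (subst integral_distr) (auto intro!: borel_measurable_prod meas)
  also have "\<dots> = (LINT f|(\<Pi>\<^sub>M b\<in>Basis. lborel). (\<Prod>b\<in>Basis. ?g b (f b)))"
    by (intro Bochner_Integration.integral_cong prod.cong refl) (simp add: sumb)
  also have "\<dots> = (\<Prod>b\<in>Basis. integral\<^sup>L lborel (?g b))"
    by (rule product_integral_prod) (auto intro: int)
  also have "\<dots> = (if k = 0 then (2 * pi)^2 else 0)"
    using integral_circle[of "k $ 1"] integral_circle[of "k $ 2"] unfolding prodB
    by (auto simp: inner_axis power2_eq_square vec_eq_iff forall_2)
  finally show ?thesis by (simp add: mean_def)
qed

lemma mean_ek_mult_cnj: "mean (\<lambda>x. ek k x * cnj (ek l x)) = of_bool (k = l)"
  using mean_ek[of "k - l"] by (simp add: ek_diff[symmetric])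

lemma mean_ek_scaled: "mean (\<lambda>x. c * ek k x) = c * of_bool (k = 0)"
  by (simp add: mean_cmult mean_ek)

section \<open>Fejer means\<close>

definition sq :: "nat \<Rightarrow> (int^2) set" where
  "sq n = {k. \<forall>i. 0 \<le> k $ i \<and> k $ i < int n}"

definition pt :: "int \<Rightarrow> int \<Rightarrow> int^2" where
  "pt a b = vector [a, b]"

lemma pt_nth [simp]: "pt a b $ 1 = a" "pt a b $ 2 = b"
  by (simp_all add: pt_def)

lemma int2_eq_iff: "(k::int^2) = l \<longleftrightarrow> k $ 1 = l $ 1 \<and> k $ 2 = l $ 2"
  by (simp add: vec_eq_iff forall_2)

lemma pt_eta [simp]: "pt (k $ 1) (k $ 2) = k"
  by (simp add: int2_eq_iff)

lemma sq_0 [simp]: "sq 0 = {}"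
  by (auto simp: sq_def)

lemma sum_sq: "sum f (sq n) = (\<Sum>a<n. \<Sum>b<n. f (pt (int a) (int b)))"
proof -
  have "sum f (sq n) = (\<Sum>(a,b)\<in>{..<n}\<times>{..<n}. f (pt (int a) (int b)))"
    by (rule sum.reindex_bij_witness[of _ "\<lambda>(a,b). pt (int a) (int b)" "\<lambda>k. (nat (k $ 1), nat (k $ 2))"])
       (auto simp: sq_def forall_2 int2_eq_iff)
  then show ?thesis by (simp add: sum.cartesian_product)
qed

lemma finite_sq [simp]: "finite (sq n)"
proof -
  have "sq n \<subseteq> (\<lambda>(a,b). pt a b) ` ({0..int n} \<times> {0..int n})"
    by (auto simp: sq_def forall_2 int2_eq_iff image_iff intro!: bexI[of _ "(_ $ 1, _ $ 2)"])
  then show ?thesis by (rule finite_subset) auto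
qed

lemma card_sq: "card (sq n) = n\<^sup>2"
  using sum_sq[of "\<lambda>_. 1::nat" n] by (simp add: power2_eq_square)

definition sq_diffs :: "nat \<Rightarrow> (int^2) set" where
  "sq_diffs n = (\<lambda>(a, b). a - b) ` (sq n \<times> sq n)"

definition fejer_weight :: "nat \<Rightarrow> int^2 \<Rightarrow> real" where
  "fejer_weight n k = (\<Sum>a\<in>sq n. \<Sum>b\<in>sq n. of_bool (a - b = k)) / (real n)\<^sup>2"

text \<open>
  The squared modulus of a Dirichlet kernel over a square, normalised by the number of its frequencies.
  It is nonnegative by construction, and its coefficients are the \<open>fejer_weight\<close>s.
\<close>

definition fejer_kernel :: "nat \<Rightarrow> real^2 \<Rightarrow> real" where
  "fejer_kernel n y = (norm (\<Sum>a\<in>sq n. ek a y))\<^sup>2 / (real n)\<^sup>2"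

definition fejer :: "nat \<Rightarrow> (real^2 \<Rightarrow> complex) \<Rightarrow> real^2 \<Rightarrow> complex" where
  "fejer n f x = (\<Sum>k\<in>sq_diffs n. of_real (fejer_weight n k) * fc f k * ek k x)"

lemma finite_sq_diffs [simp]: "finite (sq_diffs n)"
  by (simp add: sq_diffs_def)

lemma fejer_weight_outside: "k \<notin> sq_diffs n \<Longrightarrow> fejer_weight n k = 0"
  unfolding fejer_weight_def sq_diffs_def by (auto intro!: sum.neutral)

lemma fejer_weight_nonneg: "fejer_weight n k \<ge> 0"
  unfolding fejer_weight_def by (intro divide_nonneg_nonneg sum_nonneg) auto

lemma fejer_weight_uminus: "fejer_weight n (- k) = fejer_weight n k"
  unfolding fejer_weight_def
  by (subst sum.swap) (auto intro!: sum.cong arg_cong[where f = "\<lambda>x. x / _"] simp: algebra_simps)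

lemma fejer_weight_sum:
  "n > 0 \<Longrightarrow> fejer_weight n k * (real n)\<^sup>2 = (\<Sum>a\<in>sq n. of_bool (a - k \<in> sq n))"
proof -
  assume n: "n > 0"
  have "(\<Sum>b\<in>sq n. of_bool (a - b = k)) = (of_bool (a - k \<in> sq n) :: real)" for a
  proof -
    have "(\<Sum>b\<in>sq n. of_bool (a - b = k)) = (\<Sum>b\<in>sq n. if b = a - k then 1 else 0 :: real)"
      by (intro sum.cong refl) (auto simp: of_bool_def algebra_simps)
    also have "\<dots> = of_bool (a - k \<in> sq n)" by (simp add: of_bool_def)
    finally show ?thesis .
  qed
  then show ?thesis using n by (simp add: fejer_weight_def)
qed

lemma fejer_weight_0: "n > 0 \<Longrightarrow> fejer_weight n 0 = 1"
  using fejer_weight_sum[of n 0] by (simp add: card_sq)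

lemma fejer_weight_axis: "n > 0 \<Longrightarrow> fejer_weight n (axis i 1) = 1 - 1 / real n"
proof -
  assume n: "n > 0"
  have eq: "(\<Sum>a<n. of_bool (a \<ge> 1)) = real n - 1"
    using n by (subst lessThan_atLeast0, subst sum.atLeast_Suc_lessThan) (auto simp: sum.neutral of_nat_diff)
  have "(\<Sum>a\<in>sq n. of_bool (a - axis i 1 \<in> sq n)) = real n * (real n - 1)"
  proof (cases "i = 1")
    case True
    have "(\<Sum>a\<in>sq n. of_bool (a - axis i 1 \<in> sq n)) = (\<Sum>a<n. \<Sum>b<n. of_bool (a \<ge> 1) :: real)"
      unfolding sum_sq using True by (intro sum.cong refl) (auto simp: sq_def forall_2 axis_def)
    then show ?thesis by (simp only: sum_constant card_lessThan sum_distrib_left[symmetric] eq)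
  next
    case False
    then have "i = 2" using exhaust_2 by blast
    then have "(\<Sum>a\<in>sq n. of_bool (a - axis i 1 \<in> sq n)) = (\<Sum>a<n. \<Sum>b<n. of_bool (b \<ge> 1) :: real)"
      unfolding sum_sq by (intro sum.cong refl) (auto simp: sq_def forall_2 axis_def)
    then show ?thesis by (simp only: eq sum_constant card_lessThan)
  qed
  with fejer_weight_sum[OF n, of "axis i 1"] have "fejer_weight n (axis i 1) * (real n)\<^sup>2 = real n * (real n - 1)"
    by simp
  then have "fejer_weight n (axis i 1) = real n * (real n - 1) / (real n)\<^sup>2"
    using n by (simp only: eq_divide_eq) simp
  then show ?thesis using n by (simp add: power2_eq_square diff_divide_distrib)
qed

lemma fejer_kernel_sum:
  "complex_of_real (fejer_kernel n y) = (\<Sum>k\<in>sq_diffs n. of_real (fejer_weight n k) * ek k y)"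
proof -
  have "complex_of_real ((norm (\<Sum>a\<in>sq n. ek a y))\<^sup>2) = (\<Sum>a\<in>sq n. ek a y) * cnj (\<Sum>a\<in>sq n. ek a y)"
    by (rule complex_norm_square)
  also have "\<dots> = (\<Sum>a\<in>sq n. \<Sum>b\<in>sq n. ek (a - b) y)"
    by (simp add: sum_product ek_diff)
  also have "\<dots> = (\<Sum>a\<in>sq n. \<Sum>b\<in>sq n. \<Sum>k\<in>sq_diffs n. of_bool (a - b = k) * ek k y)"
  proof (intro sum.cong refl)
    fix a b assume "a \<in> sq n" "b \<in> sq n"
    then have "a - b \<in> sq_diffs n" by (auto simp: sq_diffs_def)
    moreover have "(\<Sum>k\<in>sq_diffs n. of_bool (a - b = k) * ek k y) = (\<Sum>k\<in>sq_diffs n. if a - b = k then ek k y else 0)"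
      by (intro sum.cong refl) auto
    ultimately show "ek (a - b) y = (\<Sum>k\<in>sq_diffs n. of_bool (a - b = k) * ek k y)"
      by simp
  qed
  also have "\<dots> = (\<Sum>k\<in>sq_diffs n. (\<Sum>a\<in>sq n. \<Sum>b\<in>sq n. of_bool (a - b = k)) * ek k y)"
  proof -
    have "(\<Sum>a\<in>sq n. \<Sum>b\<in>sq n. \<Sum>k\<in>sq_diffs n. of_bool (a - b = k) * ek k y)
       = (\<Sum>a\<in>sq n. \<Sum>k\<in>sq_diffs n. \<Sum>b\<in>sq n. of_bool (a - b = k) * ek k y)"
    proof (rule sum.cong[OF refl])
      fix a show "(\<Sum>b\<in>sq n. \<Sum>k\<in>sq_diffs n. of_bool (a - b = k) * ek k y)
        = (\<Sum>k\<in>sq_diffs n. \<Sum>b\<in>sq n. of_bool (a - b = k) * ek k y)"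
        by (rule sum.swap)
    qed
    also have "\<dots> = (\<Sum>k\<in>sq_diffs n. \<Sum>a\<in>sq n. \<Sum>b\<in>sq n. of_bool (a - b = k) * ek k y)"
      by (rule sum.swap)
    finally show ?thesis by (simp only: sum_distrib_right)
  qed
  finally have "complex_of_real ((norm (\<Sum>a\<in>sq n. ek a y))\<^sup>2) =
     (\<Sum>k\<in>sq_diffs n. (\<Sum>a\<in>sq n. \<Sum>b\<in>sq n. of_bool (a - b = k)) * ek k y)" .
  moreover have "complex_of_real (\<Sum>a\<in>sq n. \<Sum>b\<in>sq n. of_bool (a - b = k)) = (\<Sum>a\<in>sq n. \<Sum>b\<in>sq n. of_bool (a - b = k))" for k
    unfolding of_real_sum by (intro sum.cong refl) auto
  ultimately show ?thesis
    unfolding fejer_kernel_def fejer_weight_def of_real_divide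
    by (simp only: sum_divide_distrib[of _ "sq_diffs n"] times_divide_eq_left)
qed

lemma fejer_kernel_nonneg: "fejer_kernel n y \<ge> 0"
  by (simp add: fejer_kernel_def)

lemma cper_fejer_kernel: "cper (fejer_kernel n)"
proof -
  have "cper (\<lambda>y. \<Sum>a\<in>sq n. ek a y)" by (intro cper_sum cper_ek)
  moreover have "continuous_on UNIV (\<lambda>z::complex. (norm z)\<^sup>2 / (real n)\<^sup>2)"
    unfolding divide_inverse by (intro continuous_intros)
  ultimately show ?thesis
    unfolding fejer_kernel_def by (rule cper_comp1[rotated])
qed

lemma cper_ek_cmult: "cper (\<lambda>x. c * ek k x)"
  by (intro cper_mult cper_const cper_ek)

lemma cper_trig: "cper (\<lambda>x. \<Sum>k\<in>K. c k * ek k x)"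
  by (intro cper_sum cper_ek_cmult)

lemma cper_fejer: "cper (fejer n f)"
  unfolding fejer_def by (rule cper_trig)

lemma fejer_conv:
  assumes "cper f" shows "fejer n f x = mean (\<lambda>y. of_real (fejer_kernel n (x - y)) * f y)"
proof -
  have "mean (\<lambda>y. of_real (fejer_kernel n (x - y)) * f y)
      = mean (\<lambda>y. \<Sum>k\<in>sq_diffs n. (of_real (fejer_weight n k) * ek k x) * (f y * cnj (ek k y)))"
    by (rule mean_cong) (simp add: fejer_kernel_sum sum_distrib_right sum_distrib_left ek_minus_arg mult_ac)
  also have "\<dots> = (\<Sum>k\<in>sq_diffs n. (of_real (fejer_weight n k) * ek k x) * mean (\<lambda>y. f y * cnj (ek k y)))"
    by (subst mean_sum) (auto intro!: cper_mult cper_ek cper_cnj assms simp: mean_cmult)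
  finally show ?thesis by (simp add: fejer_def fc_def mult_ac)
qed

lemma mean_ek_reflect: "mean (\<lambda>y. ek k (x - y)) = of_bool (k = 0)"
  by (simp add: ek_minus_arg mean_cmult ek_minus[symmetric] mean_ek)

lemma cper_fejer_kernel_reflect: "cper (\<lambda>y. complex_of_real (fejer_kernel n (x - y)))"
  by (intro cper_of_real cper_reflect cper_fejer_kernel)

lemma mean_fejer_kernel_ek:
  "mean (\<lambda>y. of_real (fejer_kernel n (x - y)) * ek k (x - y)) = of_real (fejer_weight n k)"
proof -
  have "mean (\<lambda>y. of_real (fejer_kernel n (x - y)) * ek k (x - y))
      = mean (\<lambda>y. \<Sum>l\<in>sq_diffs n. of_real (fejer_weight n l) * ek (l + k) (x - y))"
    by (rule mean_cong) (simp add: fejer_kernel_sum sum_distrib_right sum_distrib_left ek_add mult_ac)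
  also have "\<dots> = (\<Sum>l\<in>sq_diffs n. of_real (fejer_weight n l) * of_bool (l + k = 0))"
    by (subst mean_sum) (auto intro!: cper_mult cper_const cper_reflect cper_ek simp: mean_cmult mean_ek_reflect)
  also have "\<dots> = (\<Sum>l\<in>sq_diffs n. if l = - k then complex_of_real (fejer_weight n l) else 0)"
    by (intro sum.cong refl) (auto simp: of_bool_def eq_neg_iff_add_eq_0)
  also have "\<dots> = of_real (fejer_weight n (- k))"
    by (simp add: fejer_weight_outside)
  finally show ?thesis by (simp add: fejer_weight_uminus)
qed

lemma mean_fejer_kernel: "n > 0 \<Longrightarrow> mean (\<lambda>y. of_real (fejer_kernel n (x - y))) = 1"
  using mean_fejer_kernel_ek[of n x 0] by (simp add: fejer_weight_0)

lemma norm_fejer_le: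
  assumes "cper f" "\<And>x. norm (f x) \<le> B" shows "norm (fejer n f x) \<le> B"
proof (cases "n > 0")
  case True
  have "norm (fejer n f x) \<le> Re (mean (\<lambda>y. of_real (fejer_kernel n (x - y) * B)))"
    unfolding fejer_conv[OF assms(1)]
  proof (rule norm_mean_le)
    show "cper (\<lambda>y. complex_of_real (fejer_kernel n (x - y)) * f y)"
      by (intro cper_mult assms cper_fejer_kernel_reflect)
    show "cper (\<lambda>y. fejer_kernel n (x - y) * B)"
      by (intro cper_mult cper_const cper_reflect cper_fejer_kernel)
    fix y show "norm (complex_of_real (fejer_kernel n (x - y)) * f y) \<le> fejer_kernel n (x - y) * B"
      using assms(2)[of y] fejer_kernel_nonneg by (simp add: norm_mult mult_left_mono)
  qed
  also have "\<dots> = B" using True by (simp add: mean_multc mean_fejer_kernel)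
  finally show ?thesis .
next
  case False
  then show ?thesis using order_trans[OF norm_ge_zero assms(2)]
    by (simp add: fejer_def sq_diffs_def)
qed

lemma cper_uniformly_continuous:
  fixes f :: "real^2 \<Rightarrow> 'b::real_normed_vector"
  assumes "cper f" "e > 0"
  shows "\<exists>d>0. \<forall>x y. norm (x - y) < d \<longrightarrow> norm (f x - f y) < e"
proof -
  let ?K = "cbox (\<chi> i. -1) (\<chi> i. 2 * pi + 1) :: (real^2) set"
  have "uniformly_continuous_on ?K f"
    by (intro compact_uniformly_continuous cper_cont assms compact_cbox)
  then obtain d where d: "d > 0" "\<And>x y. x \<in> ?K \<Longrightarrow> y \<in> ?K \<Longrightarrow> dist y x < d \<Longrightarrow> dist (f y) (f x) < e"
    unfolding uniformly_continuous_on_def using assms(2) by metis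
  show ?thesis
  proof (intro exI[of _ "min d 1"] conjI allI impI)
    fix x y :: "real^2" assume xy: "norm (x - y) < min d 1"
    obtain m where m: "x + (2 * pi) *\<^sub>R freq m \<in> box2" using reduce_to_box by blast
    let ?x = "x + (2 * pi) *\<^sub>R freq m" and ?y = "y + (2 * pi) *\<^sub>R freq m"
    have "?y \<in> ?K" unfolding mem_box_cart
    proof
      fix i
      have "\<bar>(x - y) $ i\<bar> < 1" using component_le_norm_cart[of "x - y" i] xy by linarith
      then show "(\<chi> i. -1) $ i \<le> ?y $ i \<and> ?y $ i \<le> (\<chi> i. 2 * pi + 1) $ i"
        using m[unfolded mem_box2, rule_format, of i] by auto
    qed
    moreover have "?x \<in> ?K" unfolding mem_box_cart
    proof
      fix i show "(\<chi> i. -1) $ i \<le> ?x $ i \<and> ?x $ i \<le> (\<chi> i. 2 * pi + 1) $ i"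
        using m[unfolded mem_box2, rule_format, of i] by auto
    qed
    moreover have "dist ?x ?y < d" using xy by (simp add: dist_norm)
    ultimately have "dist (f ?x) (f ?y) < e" using d(2) by blast
    then show "norm (f x - f y) < e"
      using periodic_freq[of f] assms(1) by (simp add: cper_def dist_norm)
  qed (use d in auto)
qed

text \<open>
  The modulus of continuity in the form that a positive kernel can integrate: away from the lattice of
  periods \<open>2 - cos - cos\<close> is bounded below, and close to it \<open>f\<close> varies by less than \<open>e\<close>.
\<close>

lemma cper_modulus:
  fixes f :: "real^2 \<Rightarrow> complex"
  assumes "cper f" "e > 0"
  obtains C where "C \<ge> 0" "\<And>x y. norm (f y - f x) \<le> e + C * (2 - cos ((x - y) $ 1) - cos ((x - y) $ 2))"
proof -
  obtain B where B: "B \<ge> 0" "\<And>x. norm (f x) \<le> B" using cper_bounded[OF assms(1)] by blast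
  obtain d0 where d0: "d0 > 0" "\<And>x y. norm (x - y) < d0 \<Longrightarrow> norm (f x - f y) < e"
    using cper_uniformly_continuous[OF assms] by metis
  define d where "d = min (d0 / 2) 1"
  have d: "0 < d" "d \<le> d0 / 2" "d \<le> pi" using d0 pi_gt3 by (auto simp: d_def)
  define c where "c = 1 - cos d"
  have c: "c > 0" using cos_monotone_0_pi[of 0 d] d by (simp add: c_def)
  show thesis
  proof (rule that[of "2 * B / c"])
    show "2 * B / c \<ge> 0" using B c by simp
    fix x y :: "real^2"
    let ?S = "2 - cos ((x - y) $ 1) - cos ((x - y) $ 2)"
    have S0: "?S \<ge> 0" using cos_le_one[of "(x - y) $ 1"] cos_le_one[of "(x - y) $ 2"] by linarith
    show "norm (f y - f x) \<le> e + 2 * B / c * ?S"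
    proof (cases "?S < c")
      case True
      \<comment> \<open>The period nearest to the difference brings it into a cell of half-width \<open>\<pi>\<close>, where \<open>cos\<close> is monotone in the modulus.\<close>
      define m :: "int^2" where "m = (\<chi> i. round ((x - y) $ i / (2 * pi)))"
      define z where "z = x - y - (2 * pi) *\<^sub>R freq m"
      have zi: "\<bar>z $ i\<bar> < d" for i
      proof (rule ccontr)
        assume n: "\<not> \<bar>z $ i\<bar> < d"
        have "\<bar>of_int (m $ i) - (x - y) $ i / (2 * pi)\<bar> \<le> 1 / 2"
          unfolding m_def using of_int_round_abs_le[of "(x - y) $ i / (2 * pi)"] by simp
        then have "\<bar>of_int (m $ i) - (x - y) $ i / (2 * pi)\<bar> * (2 * pi) \<le> 1 / 2 * (2 * pi)"
          by (intro mult_right_mono) auto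
        moreover have "\<bar>of_int (m $ i) - (x - y) $ i / (2 * pi)\<bar> * (2 * pi) = \<bar>z $ i\<bar>"
        proof -
          have "z $ i = - ((of_int (m $ i) - (x - y) $ i / (2 * pi)) * (2 * pi))"
            by (simp add: z_def field_simps)
          then show ?thesis by (simp add: abs_mult)
        qed
        ultimately have "\<bar>z $ i\<bar> \<le> 1 / 2 * (2 * pi)" by (simp only:)
        then have "\<bar>z $ i\<bar> \<le> pi" by simp
        then have "cos \<bar>z $ i\<bar> \<le> cos d" using n d by (intro cos_monotone_0_pi_le) auto
        moreover have "cos (z $ i) = cos ((x - y) $ i)"
          unfolding z_def using cos_diff[of "(x - y) $ i" "2 * pi * of_int (m $ i)"] cos_int_2pin[of "m $ i"] sin_int_2pin[of "m $ i"]
          by simp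
        ultimately have "cos ((x - y) $ i) \<le> cos d" by simp
        then have ge: "1 - cos ((x - y) $ i) \<ge> c" unfolding c_def by linarith
        have lt: "1 - cos ((x - y) $ 1) < c" "1 - cos ((x - y) $ 2) < c"
          using True cos_le_one[of "(x - y) $ 1"] cos_le_one[of "(x - y) $ 2"] by linarith+
        have "i = 1 \<or> i = 2" using exhaust_2 by blast
        then show False
        proof
          assume "i = 1" then show False using ge lt(1) by simp
        next
          assume "i = 2" then show False using ge lt(2) by simp
        qed
      qed
      have "norm z \<le> \<bar>z $ 1\<bar> + \<bar>z $ 2\<bar>" using norm_le_l1_cart[of z] by (simp add: UNIV_2)
      then have "norm z < d0" using zi[of 1] zi[of 2] d by linarith
      moreover have "(y + (2 * pi) *\<^sub>R freq m) - x = - z" by (simp add: z_def)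
      ultimately have "norm ((y + (2 * pi) *\<^sub>R freq m) - x) < d0" by simp
      from d0(2)[OF this] have "norm (f y - f x) < e"
        using periodic_freq[of f] assms(1) by (simp add: cper_def)
      moreover have "2 * B / c * ?S \<ge> 0" using B c S0 by simp
      ultimately show ?thesis by linarith
    next
      case False
      then have "2 * B / c * c \<le> 2 * B / c * ?S" using B c by (intro mult_left_mono) auto
      moreover have "norm (f y - f x) \<le> 2 * B" using norm_triangle_ineq4[of "f y" "f x"] B(2)[of x] B(2)[of y] by linarith
      ultimately show ?thesis using c assms(2) by simp
    qed
  qed
qed

lemma freq_axis: "freq (axis i 1) = axis i 1"
  by (simp add: freq_def vec_eq_iff axis_def)

lemma ek_axis: "ek (axis i 1) z = cis (z $ i)"
  by (simp add: ek_def freq_axis inner_axis')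

text \<open>
  Korovkin's argument: the Fejer kernels are nonnegative of mean one, so with the modulus of
  \<open>cper_modulus\<close> convergence for all \<open>f\<close> follows from convergence for the two cosines, and their weight
  is \<open>1 - 1/n\<close>.
\<close>

theorem fejer_uniform:
  assumes "cper f" "e > 0"
  shows "\<exists>N>0. \<forall>n\<ge>N. \<forall>x. norm (fejer n f x - f x) \<le> e"
proof -
  obtain C where C: "C \<ge> 0" "\<And>x y. norm (f y - f x) \<le> e / 2 + C * (2 - cos ((x - y) $ 1) - cos ((x - y) $ 2))"
    using cper_modulus[OF assms(1), of "e/2"] assms(2) by auto
  obtain N0 where N0: "real N0 > 4 * C / e" using reals_Archimedean2 by blast
  define N where "N = Suc N0"
  have N: "N > 0" "real N > 4 * C / e" using N0 by (auto simp: N_def)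
  show ?thesis
  proof (intro exI[of _ N] conjI allI impI N)
    fix n x assume "n \<ge> N"
    then have n: "n > 0" "real n > 4 * C / e" using N by auto
    let ?F = "\<lambda>y. fejer_kernel n (x - y)"
    let ?S = "\<lambda>y. 2 - cos ((x - y) $ 1) - cos ((x - y) $ 2)"
    have cosek: "complex_of_real (cos (z $ i)) = (ek (axis i 1) z + ek (- axis i 1) z) / 2" for z i
      by (simp add: ek_minus ek_axis complex_eq_iff)
    have meancos: "mean (\<lambda>y. of_real (?F y) * of_real (cos ((x - y) $ i))) = of_real (1 - 1 / real n)" for i
    proof -
      have "mean (\<lambda>y. of_real (?F y) * of_real (cos ((x - y) $ i)))
         = mean (\<lambda>y. of_real (?F y) * ek (axis i 1) (x - y) * (1/2) + of_real (?F y) * ek (- axis i 1) (x - y) * (1/2))"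
        unfolding cosek by (simp add: ring_distribs add_divide_distrib)
      also have "\<dots> = mean (\<lambda>y. of_real (?F y) * ek (axis i 1) (x - y) * (1/2)) + mean (\<lambda>y. of_real (?F y) * ek (- axis i 1) (x - y) * (1/2))"
        by (intro mean_add cper_mult cper_const cper_fejer_kernel_reflect cper_reflect[OF cper_ek])
      finally show ?thesis unfolding mean_multc mean_fejer_kernel_ek
        by (simp add: fejer_weight_uminus fejer_weight_axis n)
    qed
    have cF: "cper ?F" by (intro cper_reflect cper_fejer_kernel)
    have cS: "cper (\<lambda>y. cos ((x - y) $ i))" for i
    proof -
      have "cper (\<lambda>y. Re (ek (axis i 1) (x - y)))" by (intro cper_Re cper_reflect cper_ek)
      moreover have "Re (ek (axis i 1) z) = cos (z $ i)" for z
        by (simp add: ek_axis)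
      ultimately show ?thesis by simp
    qed
    have "fejer n f x - f x = mean (\<lambda>y. of_real (?F y) * f y) - mean (\<lambda>y. of_real (?F y) * f x)"
      using n by (simp add: fejer_conv assms mean_multc mean_fejer_kernel)
    also have "\<dots> = mean (\<lambda>y. of_real (?F y) * (f y - f x))"
      by (subst mean_diff[symmetric]) (auto intro!: cper_mult assms cper_fejer_kernel_reflect simp: algebra_simps)
    also have "norm \<dots> \<le> Re (mean (\<lambda>y. of_real (?F y * (e / 2 + C * ?S y))))"
    proof (rule norm_mean_le)
      show "cper (\<lambda>y. complex_of_real (?F y) * (f y - f x))"
        by (intro cper_mult cper_diff assms cper_const cper_fejer_kernel_reflect)
      show "cper (\<lambda>y. ?F y * (e / 2 + C * ?S y))"
        by (intro cper_mult cper_add cper_diff cper_const cF cS)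
      fix y show "norm (complex_of_real (?F y) * (f y - f x)) \<le> ?F y * (e / 2 + C * ?S y)"
        using C(2)[of y x] fejer_kernel_nonneg by (simp add: norm_mult mult_left_mono)
    qed
    also have "mean (\<lambda>y. of_real (?F y * (e / 2 + C * ?S y)))
       = mean (\<lambda>y. (of_real (?F y) * of_real (e/2 + 2 * C) - of_real (?F y) * of_real (cos ((x - y) $ 1)) * of_real C)
              - of_real (?F y) * of_real (cos ((x - y) $ 2)) * of_real C)"
      by (rule mean_cong) (simp add: algebra_simps)
    also have "\<dots> = mean (\<lambda>y. of_real (?F y)) * of_real (e/2 + 2 * C)
        - mean (\<lambda>y. of_real (?F y) * of_real (cos ((x - y) $ 1))) * of_real C
        - mean (\<lambda>y. of_real (?F y) * of_real (cos ((x - y) $ 2))) * of_real C"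
    proof -
      have c: "cper (\<lambda>y. complex_of_real (?F y) * c)" "cper (\<lambda>y. complex_of_real (?F y) * of_real (cos ((x - y) $ i)) * c)" for c i
        by (intro cper_mult cper_of_real cF cS cper_const)+
      show ?thesis by (simp only: mean_diff c cper_diff mean_multc)
    qed
    also have "\<dots> = of_real (e/2 + 2 * C) - of_real (1 - 1 / real n) * of_real C - of_real (1 - 1 / real n) * of_real C"
      using n(1) by (simp only: mean_fejer_kernel meancos mult_1_left)
    also have "Re \<dots> = e / 2 + 2 * C / real n" by (simp add: algebra_simps)
    also have "\<dots> \<le> e" using n assms(2) by (simp add: field_simps)
    finally show "norm (fejer n f x - f x) \<le> e" .
  qed
qed

section \<open>Partial derivatives and Fourier coefficients\<close>

text \<open>
  A relation, because the derivative is usually given explicitly by its own series. Directional derivatives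
  suffice for the Fourier calculus; total differentiability is only needed for the final fields.
\<close>

definition pder :: "2 \<Rightarrow> (real^2 \<Rightarrow> complex) \<Rightarrow> (real^2 \<Rightarrow> complex) \<Rightarrow> bool" where
  "pder i f g \<longleftrightarrow> (\<forall>x. ((\<lambda>t. f (x + t *\<^sub>R axis i 1)) has_vector_derivative g x) (at 0))"

text \<open>
  The weight of the frequency zero is one. Together with uniform approximation this reduces the invariance of the mean
  under translation and reflection to trigonometric polynomials.
\<close>

lemma mean_fejer: "cper f \<Longrightarrow> n > 0 \<Longrightarrow> mean (fejer n f) = mean f"
proof -
  assume f: "cper f" and n: "n > 0"
  have "mean (fejer n f) = (\<Sum>k\<in>sq_diffs n. of_real (fejer_weight n k) * fc f k * of_bool (k = 0))"
    unfolding fejer_def by (subst mean_sum) (auto intro!: cper_ek_cmult simp: mean_ek_scaled)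
  also have "\<dots> = (\<Sum>k\<in>sq_diffs n. if k = 0 then of_real (fejer_weight n k) * fc f k else 0)"
    by (intro sum.cong refl) auto
  also have "\<dots> = of_real (fejer_weight n 0) * fc f 0"
    using n fejer_weight_outside[of 0 n] by simp
  finally show ?thesis using n by (simp add: fejer_weight_0 fc_def)
qed

lemma mean_reflect: assumes f: "cper f" shows "mean (\<lambda>y. f (x - y)) = mean f"
proof -
  have "norm (mean (\<lambda>y. f (x - y)) - mean f) \<le> 0 + e" if e: "e > 0" for e
  proof -
    obtain n where n: "n > 0" "\<And>x. norm (fejer n f x - f x) \<le> e" using fejer_uniform[OF f e] by blast
    have "mean (\<lambda>y. fejer n f (x - y)) = (\<Sum>k\<in>sq_diffs n. of_real (fejer_weight n k) * fc f k * of_bool (k = 0))"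
      unfolding fejer_def
      by (subst mean_sum) (auto intro!: cper_mult cper_const cper_reflect cper_ek simp: mean_cmult mean_ek_reflect)
    also have "\<dots> = mean (fejer n f)"
      unfolding fejer_def by (subst mean_sum) (auto intro!: cper_ek_cmult simp: mean_ek_scaled)
    finally have *: "mean (\<lambda>y. fejer n f (x - y)) = mean f" using mean_fejer[OF f] n by simp
    have "mean (\<lambda>y. f (x - y)) - mean f = mean (\<lambda>y. f (x - y) - fejer n f (x - y))"
      unfolding *[symmetric] by (rule mean_diff[symmetric]) (intro cper_reflect f cper_fejer)+
    also have "norm \<dots> \<le> e"
      by (rule norm_mean_le_const) (use n(2) in \<open>auto intro!: cper_diff cper_reflect[OF f] cper_reflect[OF cper_fejer] simp: norm_minus_commute[of "f _"]\<close>)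
    finally show ?thesis by simp
  qed
  from field_le_epsilon[OF this] show ?thesis by simp
qed

lemma mean_shift: assumes f: "cper f" shows "mean (\<lambda>y. f (y + x)) = mean f"
  using mean_reflect[OF cper_reflect[OF f, of x], of 0] mean_reflect[OF f, of x] by (simp add: add.commute)

lemma pder_at:
  assumes "pder i f g"
  shows "((\<lambda>t. f (x + t *\<^sub>R axis i 1)) has_vector_derivative g (x + s *\<^sub>R axis i 1)) (at s within S)"
proof -
  have "((\<lambda>t. t - s) has_vector_derivative 1) (at s)"
    by (auto intro!: derivative_eq_intros)
  moreover have "((\<lambda>t. f ((x + s *\<^sub>R axis i 1) + t *\<^sub>R axis i 1)) has_vector_derivative g (x + s *\<^sub>R axis i 1)) (at (s - s))"
    using assms by (simp add: pder_def)
  ultimately have "((\<lambda>t. f ((x + s *\<^sub>R axis i 1) + t *\<^sub>R axis i 1)) \<circ> (\<lambda>t. t - s) has_vector_derivative 1 *\<^sub>R g (x + s *\<^sub>R axis i 1)) (at s)"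
    by (rule vector_diff_chain_at)
  then show ?thesis by (auto simp: o_def algebra_simps intro: has_vector_derivative_at_within)
qed

lemma pder_add: "pder i f f' \<Longrightarrow> pder i g g' \<Longrightarrow> pder i (\<lambda>x. f x + g x) (\<lambda>x. f' x + g' x)"
  unfolding pder_def by (auto intro!: derivative_eq_intros)

lemma pder_diff: "pder i f f' \<Longrightarrow> pder i g g' \<Longrightarrow> pder i (\<lambda>x. f x - g x) (\<lambda>x. f' x - g' x)"
  unfolding pder_def by (auto intro!: derivative_eq_intros)

lemma pder_const: "pder i (\<lambda>x. c) (\<lambda>x. 0)"
  unfolding pder_def by (auto intro!: derivative_eq_intros)

lemma pder_mult:
  assumes "pder i f f'" "pder i g g'"
  shows "pder i (\<lambda>x. f x * g x) (\<lambda>x. f x * g' x + f' x * g x)"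
  unfolding pder_def
proof
  fix x
  show "((\<lambda>t. f (x + t *\<^sub>R axis i 1) * g (x + t *\<^sub>R axis i 1)) has_vector_derivative f x * g' x + f' x * g x) (at 0)"
    using has_vector_derivative_mult[OF assms(1)[unfolded pder_def, rule_format, of x] assms(2)[unfolded pder_def, rule_format, of x]]
    by simp
qed

lemma pder_cmult: "pder i f f' \<Longrightarrow> pder i (\<lambda>x. c * f x) (\<lambda>x. c * f' x)"
  using pder_mult[OF pder_const[of i c], of f f'] by simp

lemma pder_cong: "pder i f f' \<Longrightarrow> (\<And>x. f x = g x) \<Longrightarrow> (\<And>x. f' x = g' x) \<Longrightarrow> pder i g g'"
  by (simp add: pder_def)

lemma pder_sum: "(\<And>j. j \<in> J \<Longrightarrow> pder i (f j) (f' j)) \<Longrightarrow> pder i (\<lambda>x. \<Sum>j\<in>J. f j x) (\<lambda>x. \<Sum>j\<in>J. f' j x)"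
  by (induction J rule: infinite_finite_induct) (auto intro: pder_add pder_const)

lemma pder_cnj: "pder i f f' \<Longrightarrow> pder i (\<lambda>x. cnj (f x)) (\<lambda>x. cnj (f' x))"
  unfolding pder_def by (auto intro: has_vector_derivative_cnj)

lemma pder_ek: "pder i (ek k) (\<lambda>x. \<i> * of_int (k $ i) * ek k x)"
  unfolding pder_def
proof
  fix x
  show "((\<lambda>t. ek k (x + t *\<^sub>R axis i 1)) has_vector_derivative \<i> * of_int (k $ i) * ek k x) (at 0)"
    using has_vector_derivative_cis_linear[of "freq k \<bullet> x" "of_int (k $ i)" 0 UNIV]
    by (simp add: ek_def inner_add_right inner_axis mult.commute)
qed

lemma pder_trig:
  "pder i (\<lambda>x. \<Sum>k\<in>K. c k * ek k x) (\<lambda>x. \<Sum>k\<in>K. (\<i> * of_int (k $ i) * c k) * ek k x)"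
  by (rule pder_cong[OF pder_sum[OF pder_cmult[OF pder_ek]]]) (auto simp: mult_ac)

lemma pder_of_real:
  assumes "\<And>x. ((\<lambda>t. f (x + t *\<^sub>R axis i 1)) has_real_derivative g x) (at 0)"
  shows "pder i (\<lambda>x. complex_of_real (f x)) (\<lambda>x. complex_of_real (g x))"
  using assms unfolding pder_def by (auto intro!: has_vector_derivative_of_real simp: has_real_derivative_iff_has_vector_derivative)

lemma mean_pder:
  assumes F: "cper F" and G: "cper G" and d: "pder i F G" shows "mean G = 0"
proof -
  have "norm (mean G) \<le> 0 + e" if e: "e > 0" for e
  proof -
    obtain d where d0: "d > 0" "\<And>x y. norm (x - y) < d \<Longrightarrow> norm (G x - G y) < e"
      using cper_uniformly_continuous[OF G e] by blast
    define t where "t = d / 2"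
    have t: "t > 0" "t < d" using d0 by (auto simp: t_def)
    have bd: "norm (F (x + t *\<^sub>R axis i 1) - F x - of_real t * G x) \<le> t * e" for x
    proof -
      let ?h = "\<lambda>s. F (x + s *\<^sub>R axis i 1) - of_real s * G x"
      have "norm (?h t - ?h 0) \<le> e * norm (t - 0)"
      proof (rule differentiable_bound[where S = "{0..t}" and f' = "\<lambda>s u. u *\<^sub>R (G (x + s *\<^sub>R axis i 1) - G x)"])
        fix s assume s: "s \<in> {0..t}"
        have "((\<lambda>s. of_real s * G x) has_vector_derivative G x) (at s within {0..t})"
          by (auto intro!: derivative_eq_intros)
        from has_vector_derivative_diff[OF pder_at[OF d] this, of x]
        show "(?h has_derivative (\<lambda>u. u *\<^sub>R (G (x + s *\<^sub>R axis i 1) - G x))) (at s within {0..t})"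
          by (simp add: has_vector_derivative_def)
        have "norm (x + s *\<^sub>R axis i 1 - x) < d" using s t by (simp add: norm_axis_1)
        from d0(2)[OF this] show "onorm (\<lambda>u. u *\<^sub>R (G (x + s *\<^sub>R axis i 1) - G x)) \<le> e"
          by (intro onorm_le) (auto simp: mult.commute[of e] intro!: mult_left_mono)
      qed (use t in auto)
      then show ?thesis using t by (simp add: algebra_simps)
    qed
    have "of_real t * mean G = - mean (\<lambda>x. F (x + t *\<^sub>R axis i 1) - F x - of_real t * G x)"
    proof -
      have c: "cper (\<lambda>x. F (x + t *\<^sub>R axis i 1))" "cper (\<lambda>x. of_real t * G x)"
        by (intro cper_shift[OF F] G cper_mult cper_const)+
      show ?thesis
        unfolding mean_diff[OF cper_diff[OF c(1) F] c(2)] mean_diff[OF c(1) F] mean_shift[OF F] mean_cmult by simp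
    qed
    also have "norm \<dots> \<le> t * e"
      unfolding norm_minus_cancel
    proof (rule norm_mean_le_const)
      show "cper (\<lambda>x. F (x + t *\<^sub>R axis i 1) - F x - of_real t * G x)"
        by (intro cper_diff cper_shift[OF F] F G cper_mult cper_const)
    qed (rule bd)
    finally show ?thesis using t by (simp add: norm_mult)
  qed
  from field_le_epsilon[OF this] show ?thesis by simp
qed

lemma fc_pder:
  assumes "cper f" "cper g" "pder i f g"
  shows "fc g k = \<i> * of_int (k $ i) * fc f k"
proof -
  have p: "pder i (\<lambda>x. f x * cnj (ek k x)) (\<lambda>x. f x * cnj (\<i> * of_int (k $ i) * ek k x) + g x * cnj (ek k x))"
    by (intro pder_mult assms pder_cnj pder_ek)
  have "mean (\<lambda>x. f x * cnj (\<i> * of_int (k $ i) * ek k x) + g x * cnj (ek k x)) = 0"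
    by (intro mean_pder[OF _ _ p] cper_add cper_mult assms cper_cnj cper_ek cper_const)
  then have "mean (\<lambda>x. - (\<i> * of_int (k $ i)) * (f x * cnj (ek k x)) + g x * cnj (ek k x)) = 0"
    by (simp add: mult_ac)
  moreover have c: "cper (\<lambda>x. - (\<i> * of_int (k $ i)) * (f x * cnj (ek k x)))" "cper (\<lambda>x. g x * cnj (ek k x))"
    by (intro cper_mult assms cper_cnj cper_ek cper_const)+
  ultimately have "- (\<i> * of_int (k $ i)) * fc f k + fc g k = 0"
    unfolding mean_add[OF c] mean_cmult fc_def[symmetric] by blast
  then show ?thesis by (simp add: algebra_simps)
qed

lemma cper_fc: "cper f \<Longrightarrow> cper (\<lambda>x. f x * cnj (ek k x))"
  by (intro cper_mult cper_cnj cper_ek)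

lemma fc_diff: "cper f \<Longrightarrow> cper g \<Longrightarrow> fc (\<lambda>x. f x - g x) k = fc f k - fc g k"
  by (simp add: fc_def left_diff_distrib mean_diff cper_fc)

lemma fc_cmult: "fc (\<lambda>x. c * f x) k = c * fc f k"
  by (simp add: fc_def mult.assoc mean_cmult)

lemma fc_zero [simp]: "fc (\<lambda>x. 0) k = 0"
  by (simp add: fc_def)

lemma fc_sum: "(\<And>i. i \<in> I \<Longrightarrow> cper (f i)) \<Longrightarrow> fc (\<lambda>x. \<Sum>i\<in>I. f i x) k = (\<Sum>i\<in>I. fc (f i) k)"
  by (simp add: fc_def sum_distrib_right mean_sum cper_fc)

lemma fc_ek: "fc (ek l) k = of_bool (l = k)"
  by (simp add: fc_def mean_ek_mult_cnj)

lemma fc_trig: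
  assumes "finite K" shows "fc (\<lambda>x. \<Sum>k\<in>K. c k * ek k x) l = (if l \<in> K then c l else 0)"
proof -
  have "fc (\<lambda>x. \<Sum>k\<in>K. c k * ek k x) l = (\<Sum>k\<in>K. c k * of_bool (k = l))"
    by (subst fc_sum) (auto intro: cper_ek_cmult simp: fc_cmult fc_ek)
  also have "\<dots> = (\<Sum>k\<in>K. if k = l then c k else 0)" by (intro sum.cong) auto
  finally show ?thesis using assms by simp
qed

lemma fc_cnj: "fc (\<lambda>x. cnj (f x)) k = cnj (fc f (- k))"
  by (simp add: fc_def mean_cnj[symmetric] ek_minus)

lemma fc_real: assumes "\<And>x. Im (f x) = 0" shows "fc f (- k) = cnj (fc f k)"
proof -
  have "(\<lambda>x. cnj (f x)) = f" using assms by (auto simp: complex_eq_iff)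
  then show ?thesis using fc_cnj[of f "-k"] by simp
qed

lemma norm_fc_le: "cper f \<Longrightarrow> (\<And>x. norm (f x) \<le> B) \<Longrightarrow> norm (fc f k) \<le> B"
  unfolding fc_def by (rule norm_mean_le_const) (auto intro: cper_fc simp: norm_mult)

lemma fc_ek_mult: "fc (\<lambda>x. ek l x * f x) k = fc f (k - l)"
  by (simp add: fc_def ek_diff mult_ac)

lemma fc_trig_mult:
  assumes "cper f"
  shows "fc (\<lambda>x. (\<Sum>l\<in>L. c l * ek l x) * f x) k = (\<Sum>l\<in>L. c l * fc f (k - l))"
proof -
  have "fc (\<lambda>x. (\<Sum>l\<in>L. c l * ek l x) * f x) k = fc (\<lambda>x. \<Sum>l\<in>L. c l * (ek l x * f x)) k"
    by (simp add: sum_distrib_right sum_distrib_left mult_ac)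
  also have "\<dots> = (\<Sum>l\<in>L. c l * fc f (k - l))"
    by (subst fc_sum) (auto intro!: cper_mult cper_ek assms simp: fc_cmult fc_ek_mult)
  finally show ?thesis .
qed

lemma fejer_cong: "(\<And>k. fc f k = fc g k) \<Longrightarrow> fejer n f x = fejer n g x"
  by (simp add: fejer_def)

lemma fc_eqI:
  assumes "cper f" "cper g" "\<And>k. fc f k = fc g k" shows "f x = g x"
proof -
  have "norm (f x - g x) \<le> 0 + e" if e: "e > 0" for e
  proof -
    have e2: "e / 2 > 0" using e by simp
    obtain N1 where N1: "\<And>n x. n \<ge> N1 \<Longrightarrow> norm (fejer n f x - f x) \<le> e / 2"
      using fejer_uniform[OF assms(1) e2] by blast
    obtain N2 where N2: "\<And>n x. n \<ge> N2 \<Longrightarrow> norm (fejer n g x - g x) \<le> e / 2"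
      using fejer_uniform[OF assms(2) e2] by blast
    show ?thesis
      using N1[of "max N1 N2" x] N2[of "max N1 N2" x] fejer_cong[OF assms(3), of "max N1 N2" x]
        norm_triangle_ineq4[of "fejer (max N1 N2) g x - g x" "fejer (max N1 N2) f x - f x"] by simp
  qed
  from field_le_epsilon[OF this] show ?thesis by simp
qed

lemma fc_real_iff:
  assumes "cper f" "\<And>k. fc f (- k) = cnj (fc f k)" shows "Im (f x) = 0"
proof -
  have "f x = cnj (f x)"
    by (rule fc_eqI[OF assms(1) cper_cnj[OF assms(1)]]) (simp add: fc_cnj assms(2))
  then show ?thesis by (simp add: complex_eq_iff)
qed

lemma fc_fejer: "fc (fejer n f) k = of_real (fejer_weight n k) * fc f k"
  unfolding fejer_def using fejer_weight_outside[of k n] by (subst fc_trig) auto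

lemma mean_fejer_mult_cnj:
  assumes "cper g"
  shows "mean (\<lambda>x. fejer n f x * cnj (g x)) = (\<Sum>k\<in>sq_diffs n. of_real (fejer_weight n k) * (fc f k * cnj (fc g k)))"
proof -
  have "mean (\<lambda>x. fejer n f x * cnj (g x))
      = mean (\<lambda>x. \<Sum>k\<in>sq_diffs n. (of_real (fejer_weight n k) * fc f k) * (ek k x * cnj (g x)))"
    by (rule mean_cong) (simp add: fejer_def sum_distrib_right sum_distrib_left mult_ac)
  also have "\<dots> = (\<Sum>k\<in>sq_diffs n. (of_real (fejer_weight n k) * fc f k) * mean (\<lambda>x. ek k x * cnj (g x)))"
    by (subst mean_sum) (auto intro!: cper_mult cper_cnj cper_ek assms simp: mean_cmult)
  also have "(\<lambda>k. mean (\<lambda>x. ek k x * cnj (g x))) = (\<lambda>k. cnj (fc g k))"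
    by (simp add: fc_def mean_cnj[symmetric] mult.commute)
  finally show ?thesis by (simp add: mult.assoc)
qed

text \<open>
  Parseval's identity in a form without square summability: the weighted sums are exactly the means of
  \<open>fejer n f\<close> against \<open>g\<close>. It is what turns energy identities between coefficients into
  identities between fields.
\<close>

lemma fejer_mean_limit:
  assumes "cper f" "cper g"
  shows "(\<lambda>n. \<Sum>k\<in>sq_diffs n. of_real (fejer_weight n k) * (fc f k * cnj (fc g k))) \<longlonglongrightarrow> mean (\<lambda>x. f x * cnj (g x))"
proof (rule LIMSEQ_I)
  fix r :: real assume r: "r > 0"
  obtain B where B: "B \<ge> 0" "\<And>x. norm (g x) \<le> B" using cper_bounded[OF assms(2)] by blast
  obtain N where N: "\<And>n x. n \<ge> N \<Longrightarrow> norm (fejer n f x - f x) \<le> r / 2 / (B + 1)"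
    using fejer_uniform[OF assms(1), of "r / 2 / (B + 1)"] r B by auto
  have "norm (mean (\<lambda>x. fejer n f x * cnj (g x)) - mean (\<lambda>x. f x * cnj (g x))) < r" if "n \<ge> N" for n
  proof -
    have "mean (\<lambda>x. fejer n f x * cnj (g x)) - mean (\<lambda>x. f x * cnj (g x)) = mean (\<lambda>x. (fejer n f x - f x) * cnj (g x))"
      by (subst mean_diff[symmetric]) (auto intro!: cper_mult cper_cnj assms cper_fejer simp: algebra_simps)
    also have "norm \<dots> \<le> r / 2 / (B + 1) * (B + 1)"
    proof (rule norm_mean_le_const)
      show "cper (\<lambda>x. (fejer n f x - f x) * cnj (g x))" by (intro cper_mult cper_diff cper_cnj assms cper_fejer)
      fix x show "norm ((fejer n f x - f x) * cnj (g x)) \<le> r / 2 / (B + 1) * (B + 1)"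
        using N[OF that, of x] B(2)[of x] B(1) r unfolding norm_mult by (intro mult_mono) auto
    qed
    also have "\<dots> = r / 2" using B by (intro nonzero_divide_eq_eq[THEN iffD1, OF _ refl, symmetric]) linarith
    also have "\<dots> < r" using r by simp
    finally show ?thesis .
  qed
  then show "\<exists>no. \<forall>n\<ge>no. norm ((\<Sum>k\<in>sq_diffs n. of_real (fejer_weight n k) * (fc f k * cnj (fc g k))) - mean (\<lambda>x. f x * cnj (g x))) < r"
    unfolding mean_fejer_mult_cnj[OF assms(2), symmetric] by blast
qed

lemma mean_norm_sq_eq_0:
  assumes "cper f" "mean (\<lambda>x. f x * cnj (f x)) = 0" shows "f x = 0"
proof -
  have "fc f k = 0" for k
  proof (rule ccontr)
    assume k: "fc f k \<noteq> 0"
    define S where "S n = (\<Sum>l\<in>sq_diffs n. fejer_weight n l * (norm (fc f l))\<^sup>2)" for n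
    have lim: "(\<lambda>n. complex_of_real (S n)) \<longlonglongrightarrow> 0"
      using fejer_mean_limit[OF assms(1) assms(1)] assms(2) by (simp add: S_def complex_norm_square[symmetric])
    then have lim: "S \<longlonglongrightarrow> 0" using tendsto_Re by fastforce
    have w: "(\<lambda>n. fejer_weight n k) \<longlonglongrightarrow> 1"
    proof -
      have "(\<lambda>n. fejer_weight n k) \<longlonglongrightarrow> Re (ek k 0)"
      proof (rule LIMSEQ_I)
        fix r :: real assume "r > 0"
        then obtain N where N: "N > 0" "\<And>n x. n \<ge> N \<Longrightarrow> norm (fejer n (ek k) x - ek k x) \<le> r / 2"
          using fejer_uniform[OF cper_ek, of "r/2" k] by auto
        have "norm (fejer_weight n k - 1) < r" if "n \<ge> N" for n
        proof -
          have "fejer n (ek k) 0 = (\<Sum>l\<in>sq_diffs n. if l = k then of_real (fejer_weight n l) else 0)"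
            unfolding fejer_def by (intro sum.cong refl) (auto simp: fc_ek)
          also have "\<dots> = of_real (fejer_weight n k)" using fejer_weight_outside[of k n] by simp
          finally have "norm (complex_of_real (fejer_weight n k - 1)) \<le> r / 2" using N(2)[OF that, of 0] by simp
          then show ?thesis using \<open>r > 0\<close> unfolding norm_of_real by simp
        qed
        then show "\<exists>no. \<forall>n\<ge>no. norm (fejer_weight n k - Re (ek k 0)) < r" by auto
      qed
      then show ?thesis by simp
    qed
    have "fejer_weight n k * (norm (fc f k))\<^sup>2 \<le> S n" for n
    proof (cases "k \<in> sq_diffs n")
      case True
      then show ?thesis unfolding S_def
        by (intro member_le_sum) (auto simp: fejer_weight_nonneg)
    next
      case False
      then show ?thesis unfolding S_def by (auto simp: fejer_weight_outside fejer_weight_nonneg intro!: sum_nonneg)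
    qed
    then have "1 * (norm (fc f k))\<^sup>2 \<le> 0"
      by (intro LIMSEQ_le[OF tendsto_mult[OF w tendsto_const] lim]) auto
    then show False using k by simp
  qed
  then show ?thesis using fc_eqI[OF assms(1), of "\<lambda>_. 0"] by simp
qed

section \<open>Finite Fourier multipliers on bounded functions\<close>

abbreviation fsupp :: "(int^2 \<Rightarrow> complex) \<Rightarrow> bool" where
  "fsupp n \<equiv> finite {k. n k \<noteq> 0}"

definition ker :: "(int^2 \<Rightarrow> complex) \<Rightarrow> real^2 \<Rightarrow> complex" where
  "ker n x = (\<Sum>k | n k \<noteq> 0. n k * ek k x)"

definition Op :: "(int^2 \<Rightarrow> complex) \<Rightarrow> (real^2 \<Rightarrow> complex) \<Rightarrow> real^2 \<Rightarrow> complex" where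
  "Op n f x = ker (\<lambda>k. n k * fc f k) x"

text \<open>
  The mean of the modulus of the kernel, which is the norm of the multiplier on bounded functions.
\<close>

definition Mn :: "(int^2 \<Rightarrow> complex) \<Rightarrow> real" where
  "Mn n = Re (mean (\<lambda>y. of_real (norm (ker n y))))"

definition sdiff :: "2 \<Rightarrow> (int^2 \<Rightarrow> complex) \<Rightarrow> int^2 \<Rightarrow> complex" where
  "sdiff i n k = n k - n (k - axis i 1)"

lemma ker_superset: "finite K \<Longrightarrow> (\<And>k. n k \<noteq> 0 \<Longrightarrow> k \<in> K) \<Longrightarrow> ker n x = (\<Sum>k\<in>K. n k * ek k x)"
  unfolding ker_def by (rule sum.mono_neutral_left) auto

lemma cper_ker: "cper (ker n)"
  unfolding ker_def by (rule cper_trig)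

lemma fsupp_subset: "fsupp n \<Longrightarrow> (\<And>k. n k = 0 \<Longrightarrow> m k = 0) \<Longrightarrow> fsupp m"
  by (erule finite_subset[rotated]) auto

lemma fsupp_mult_right [simp]: "fsupp n \<Longrightarrow> fsupp (\<lambda>k. n k * c k)"
  by (erule fsupp_subset) simp

lemma fsupp_mult_left [simp]: "fsupp n \<Longrightarrow> fsupp (\<lambda>k. c k * n k)"
  by (erule fsupp_subset) simp

lemma fsupp_add: "fsupp n \<Longrightarrow> fsupp m \<Longrightarrow> fsupp (\<lambda>k. n k + m k)"
  by (rule finite_subset[of _ "{k. n k \<noteq> 0} \<union> {k. m k \<noteq> 0}"]) auto

lemma fsupp_diff: "fsupp n \<Longrightarrow> fsupp m \<Longrightarrow> fsupp (\<lambda>k. n k - m k)"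
  by (rule finite_subset[of _ "{k. n k \<noteq> 0} \<union> {k. m k \<noteq> 0}"]) auto

lemma fsupp_sum: "(\<And>j. j \<in> J \<Longrightarrow> fsupp (n j)) \<Longrightarrow> fsupp (\<lambda>k. \<Sum>j\<in>J. n j k)"
  by (induction J rule: infinite_finite_induct) (auto intro!: fsupp_add)

lemma fsupp_shift: "fsupp n \<Longrightarrow> fsupp (\<lambda>k. n (k - l))"
proof -
  assume n: "fsupp n"
  have "{k. n (k - l) \<noteq> 0} \<subseteq> (\<lambda>k. k + l) ` {k. n k \<noteq> 0}"
  proof
    fix k assume "k \<in> {k. n (k - l) \<noteq> 0}"
    then show "k \<in> (\<lambda>k. k + l) ` {k. n k \<noteq> 0}" by (intro image_eqI[of _ _ "k - l"]) auto
  qed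
  then show ?thesis using n by (meson finite_imageI finite_subset)
qed

lemma ker_add: "fsupp n \<Longrightarrow> fsupp m \<Longrightarrow> ker (\<lambda>k. n k + m k) x = ker n x + ker m x"
  by (subst (1 2 3) ker_superset[of "{k. n k \<noteq> 0} \<union> {k. m k \<noteq> 0}"]) (auto simp: distrib_right sum.distrib)

lemma ker_diff: "fsupp n \<Longrightarrow> fsupp m \<Longrightarrow> ker (\<lambda>k. n k - m k) x = ker n x - ker m x"
  by (subst (1 2 3) ker_superset[of "{k. n k \<noteq> 0} \<union> {k. m k \<noteq> 0}"]) (auto simp: left_diff_distrib sum_subtractf)

lemma ker_cmult: "ker (\<lambda>k. c * n k) x = c * ker n x"
  by (cases "c = 0") (simp_all add: ker_def sum_distrib_left mult.assoc)

lemma ker_zero [simp]: "ker (\<lambda>k. 0) x = 0"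
  by (simp add: ker_def)

lemma ker_sum: "(\<And>j. j \<in> J \<Longrightarrow> fsupp (n j)) \<Longrightarrow> ker (\<lambda>k. \<Sum>j\<in>J. n j k) x = (\<Sum>j\<in>J. ker (n j) x)"
  by (induction J rule: infinite_finite_induct) (auto simp: ker_add fsupp_sum)

lemma ker_shift: "ker (\<lambda>k. n (k - l)) x = ek l x * ker n x"
proof -
  have "ker (\<lambda>k. n (k - l)) x = (\<Sum>k | n k \<noteq> 0. n k * ek (k + l) x)"
    unfolding ker_def
    by (rule sum.reindex_bij_witness[of _ "\<lambda>k. k + l" "\<lambda>k. k - l"]) auto
  then show ?thesis by (simp add: ker_def ek_add sum_distrib_left mult_ac)
qed

lemma ker_sdiff: "fsupp n \<Longrightarrow> ker (sdiff i n) x = (1 - ek (axis i 1) x) * ker n x"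
  unfolding sdiff_def by (simp add: ker_diff fsupp_shift ker_shift algebra_simps)

lemma fc_ker: "fsupp n \<Longrightarrow> fc (ker n) k = n k"
  unfolding ker_def by (subst fc_trig) auto

lemma pder_ker: "pder i (ker n) (ker (\<lambda>k. \<i> * of_int (k $ i) * n k))" if "fsupp n"
proof -
  have "ker (\<lambda>k. \<i> * of_int (k $ i) * n k) x = (\<Sum>k | n k \<noteq> 0. (\<i> * of_int (k $ i) * n k) * ek k x)" for x
    by (rule ker_superset) (use that in auto)
  then show ?thesis using pder_trig[of i n "{k. n k \<noteq> 0}"]
    by (simp add: ker_def[of n, abs_def] pder_def)
qed

lemma Op_superset: "finite K \<Longrightarrow> (\<And>k. n k \<noteq> 0 \<Longrightarrow> k \<in> K) \<Longrightarrow> Op n f x = (\<Sum>k\<in>K. n k * fc f k * ek k x)"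
  unfolding Op_def by (rule ker_superset) auto

lemma Op_conv:
  assumes "fsupp n" "cper f" shows "Op n f x = mean (\<lambda>y. ker n (x - y) * f y)"
proof -
  have "mean (\<lambda>y. ker n (x - y) * f y) = mean (\<lambda>y. \<Sum>k | n k \<noteq> 0. (n k * ek k x) * (f y * cnj (ek k y)))"
    by (rule mean_cong) (simp add: ker_def sum_distrib_right sum_distrib_left ek_minus_arg mult_ac)
  also have "\<dots> = (\<Sum>k | n k \<noteq> 0. (n k * ek k x) * fc f k)"
    by (subst mean_sum) (auto intro!: cper_mult cper_const cper_cnj cper_ek assms simp: mean_cmult fc_def)
  also have "\<dots> = Op n f x"
    by (subst Op_superset[OF assms(1)]) (auto simp: mult_ac)
  finally show ?thesis by simp
qed

lemma Mn_reflect: "Re (mean (\<lambda>y. of_real (norm (ker n (x - y))))) = Mn n"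
  unfolding Mn_def by (rule arg_cong[where f = Re], rule mean_reflect) (intro cper_of_real cper_norm cper_ker)

lemma norm_Op_le:
  assumes "fsupp n" "cper f" "\<And>x. norm (f x) \<le> B" shows "norm (Op n f x) \<le> Mn n * B"
proof -
  have "norm (Op n f x) \<le> Re (mean (\<lambda>y. of_real (norm (ker n (x - y)) * B)))"
    unfolding Op_conv[OF assms(1,2)]
  proof (rule norm_mean_le)
    show "cper (\<lambda>y. ker n (x - y) * f y)" by (intro cper_mult cper_reflect cper_ker assms)
    show "cper (\<lambda>y. norm (ker n (x - y)) * B)" by (intro cper_mult cper_const cper_norm cper_reflect[OF cper_ker])
  qed (auto simp: norm_mult intro: mult_left_mono assms)
  then show ?thesis by (simp add: mean_multc Mn_reflect)
qed

text \<open>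
  The commutator of a multiplier with multiplication by \<open>a\<close> has the kernel
  \<open>ker n (x - y) (a y - a x)\<close>. If \<open>a\<close> is Lipschitz for the chordal distance, the increment of
  \<open>a\<close> is absorbed into the kernel, because \<open>1 - e\<^sub>i\<close> times the kernel of \<open>n\<close> is the
  kernel of the difference \<open>sdiff i n\<close>. So one derivative is traded for one difference of the symbol.
\<close>

lemma norm_Op_commutator_le:
  assumes n: "fsupp n" and a: "cper a" and g: "cper g" "\<And>x. norm (g x) \<le> B"
    and L: "\<And>x z. norm (a z - a x) \<le> L * (norm (1 - ek (axis 1 1) (x - z)) + norm (1 - ek (axis 2 1) (x - z)))"
  shows "norm (Op n (\<lambda>x. a x * g x) x - a x * Op n g x) \<le> L * (Mn (sdiff 1 n) + Mn (sdiff 2 n)) * B"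
proof -
  let ?e = "\<lambda>i. axis i 1 :: int^2"
  have "Op n (\<lambda>x. a x * g x) x - a x * Op n g x
     = mean (\<lambda>y. ker n (x - y) * (a y * g y)) - mean (\<lambda>y. a x * (ker n (x - y) * g y))"
    using n a g by (simp add: Op_conv cper_mult mean_cmult)
  also have "\<dots> = mean (\<lambda>y. ker n (x - y) * (a y * g y) - a x * (ker n (x - y) * g y))"
    by (intro mean_diff[symmetric] cper_mult cper_const cper_reflect[OF cper_ker] a g)
  also have "norm \<dots> \<le> Re (mean (\<lambda>y. of_real ((norm (ker (sdiff 1 n) (x - y)) + norm (ker (sdiff 2 n) (x - y))) * (L * B))))"
  proof (rule norm_mean_le)
    show "cper (\<lambda>y. ker n (x - y) * (a y * g y) - a x * (ker n (x - y) * g y))"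
      by (intro cper_diff cper_mult cper_const cper_reflect[OF cper_ker] a g)
    show "cper (\<lambda>y. (norm (ker (sdiff 1 n) (x - y)) + norm (ker (sdiff 2 n) (x - y))) * (L * B))"
      by (intro cper_mult cper_add cper_const cper_norm cper_reflect[OF cper_ker])
    fix y
    have "norm (ker n (x - y) * (a y * g y) - a x * (ker n (x - y) * g y)) = norm (ker n (x - y)) * norm (a y - a x) * norm (g y)"
      by (simp add: norm_mult[symmetric] algebra_simps)
    also have "\<dots> \<le> norm (ker n (x - y)) * (L * (norm (1 - ek (?e 1) (x - y)) + norm (1 - ek (?e 2) (x - y)))) * B"
    proof -
      define X where "X = L * (norm (1 - ek (?e 1) (x - y)) + norm (1 - ek (?e 2) (x - y)))"
      have X: "norm (a y - a x) \<le> X" using L[of y x] by (simp add: X_def)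
      then have "0 \<le> X" by (rule order_trans[OF norm_ge_zero])
      with X show ?thesis unfolding X_def[symmetric] by (intro mult_mono mult_left_mono g) auto
    qed
    also have "\<dots> = (norm (ker (sdiff 1 n) (x - y)) + norm (ker (sdiff 2 n) (x - y))) * (L * B)"
      unfolding ker_sdiff[OF n] norm_mult by (simp only: distrib_left distrib_right mult_ac)
    finally show "norm (ker n (x - y) * (a y * g y) - a x * (ker n (x - y) * g y))
      \<le> (norm (ker (sdiff 1 n) (x - y)) + norm (ker (sdiff 2 n) (x - y))) * (L * B)" .
  qed
  also have "mean (\<lambda>y. of_real ((norm (ker (sdiff 1 n) (x - y)) + norm (ker (sdiff 2 n) (x - y))) * (L * B)))
     = (mean (\<lambda>y. of_real (norm (ker (sdiff 1 n) (x - y)))) + mean (\<lambda>y. of_real (norm (ker (sdiff 2 n) (x - y))))) * of_real (L * B)"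
    unfolding of_real_mult[of "_ + _"] of_real_add mean_multc
    by (subst mean_add) (intro cper_of_real cper_norm cper_reflect[OF cper_ker] refl)+
  also have "Re \<dots> = L * (Mn (sdiff 1 n) + Mn (sdiff 2 n)) * B"
    by (simp add: Mn_reflect algebra_simps)
  finally show ?thesis .
qed

lemma abs_le_chord:
  assumes "\<bar>t\<bar> \<le> pi" shows "\<bar>t\<bar> \<le> 2 * norm (1 - cis t)"
proof -
  have main: "s / 2 \<le> sin s" if "0 \<le> s" "s \<le> pi / 2" for s :: real
  proof -
    have "\<bar>sin s - (\<Sum>m<3. sin_coeff m * s ^ m)\<bar> \<le> inverse (fact 3) * \<bar>s\<bar> ^ 3"
      by (rule Maclaurin_sin_bound)
    then have "\<bar>sin s - s\<bar> \<le> s ^ 3 / 6" using that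
      by (simp add: sin_coeff_def numeral_3_eq_3 fact_numeral)
    moreover have "s ^ 3 \<le> 3 * s"
    proof -
      have "s \<le> 1.6" using that pi_approx by simp
      then have "s * s \<le> 1.6 * 1.6" using that by (intro mult_mono) auto
      then have "s * (s * s) \<le> s * 3" using that by (intro mult_left_mono) auto
      then show ?thesis by (simp add: power3_eq_cube mult_ac)
    qed
    ultimately show ?thesis by linarith
  qed
  have "(norm (1 - cis t))\<^sup>2 = (1 - cos t)\<^sup>2 + (sin t)\<^sup>2" by (simp add: cmod_def)
  also have "\<dots> = 2 - 2 * cos t" using sin_cos_squared_add[of t] by (simp add: power2_diff)
  also have "\<dots> = (2 * \<bar>sin (\<bar>t\<bar> / 2)\<bar>)\<^sup>2"
    using cos_double_sin[of "\<bar>t\<bar> / 2"] by (simp add: power_mult_distrib)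
  finally have "norm (1 - cis t) = 2 * \<bar>sin (\<bar>t\<bar> / 2)\<bar>" by (subst (asm) power2_eq_iff_nonneg) auto
  moreover have "\<bar>t\<bar> / 2 / 2 \<le> sin (\<bar>t\<bar> / 2)" using assms by (intro main) auto
  ultimately show ?thesis by linarith
qed

text \<open>
  Both sides are periodic in \<open>x - z\<close>, so the difference may be reduced to the cell where arc and chord
  are comparable; the two coordinates are then changed one at a time.
\<close>

lemma c1_chord_lipschitz:
  assumes a: "cper a" and d: "\<And>i. pder i a (a' i)" and G: "\<And>i x. norm (a' i x) \<le> G"
  shows "norm (a z - a x) \<le> (2 * G) * (norm (1 - ek (axis 1 1) (x - z)) + norm (1 - ek (axis 2 1) (x - z)))"
proof -
  define m :: "int^2" where "m = (\<chi> i. round ((x - z) $ i / (2 * pi)))"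
  define w where "w = z + (2 * pi) *\<^sub>R freq m"
  have step: "norm (a (y + t *\<^sub>R axis i 1) - a y) \<le> G * \<bar>t\<bar>" for y t i
  proof -
    have "norm (a (y + t *\<^sub>R axis i 1) - a (y + 0 *\<^sub>R axis i 1)) \<le> G * norm (t - 0)"
    proof (rule differentiable_bound[where S = UNIV and f' = "\<lambda>s u. u *\<^sub>R a' i (y + s *\<^sub>R axis i 1)"])
      fix s
      show "((\<lambda>s. a (y + s *\<^sub>R axis i 1)) has_derivative (\<lambda>u. u *\<^sub>R a' i (y + s *\<^sub>R axis i 1))) (at s within UNIV)"
        using pder_at[OF d[of i], of y s UNIV] by (simp add: has_vector_derivative_def)
      show "onorm (\<lambda>u. u *\<^sub>R a' i (y + s *\<^sub>R axis i 1)) \<le> G"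
        by (intro onorm_le) (auto simp: mult.commute[of G] intro!: mult_left_mono G)
    qed auto
    then show ?thesis by simp
  qed
  define t where "t = x - w"
  have tb: "\<bar>t $ i\<bar> \<le> pi" and te: "cis (t $ i) = ek (axis i 1) (x - z)" for i
  proof -
    have "\<bar>of_int (m $ i) - (x - z) $ i / (2 * pi)\<bar> \<le> 1 / 2"
      unfolding m_def using of_int_round_abs_le[of "(x - z) $ i / (2 * pi)"] by simp
    then have "\<bar>of_int (m $ i) - (x - z) $ i / (2 * pi)\<bar> * (2 * pi) \<le> 1 / 2 * (2 * pi)"
      by (intro mult_right_mono) auto
    moreover have "t $ i = - ((of_int (m $ i) - (x - z) $ i / (2 * pi)) * (2 * pi))"
      by (simp add: t_def w_def field_simps)
    ultimately show "\<bar>t $ i\<bar> \<le> pi" by (simp add: abs_mult)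
    have "cis (t $ i) = ek (axis i 1) (x - w)" by (simp add: ek_axis t_def)
    also have "\<dots> = ek (axis i 1) (x - z)"
      unfolding w_def using periodic_freq[OF periodic_ek, of "axis i 1" z m] by (simp only: ek_minus_arg)
    finally show "cis (t $ i) = ek (axis i 1) (x - z)" .
  qed
  have x: "x = (w + t $ 1 *\<^sub>R axis 1 1) + t $ 2 *\<^sub>R axis 2 1"
    by (simp add: t_def vec_eq_iff forall_2 axis_def)
  have G0: "G \<ge> 0" using order_trans[OF norm_ge_zero G] .
  have "norm (a z - a x) = norm ((a x - a (w + t $ 1 *\<^sub>R axis 1 1)) + (a (w + t $ 1 *\<^sub>R axis 1 1) - a w))"
    using periodic_freq[of a z m] a by (simp add: w_def cper_def norm_minus_commute)
  also have "\<dots> \<le> G * \<bar>t $ 2\<bar> + G * \<bar>t $ 1\<bar>"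
    using step[of "w + t $ 1 *\<^sub>R axis 1 1" "t $ 2" 2] step[of w "t $ 1" 1]
    by (intro norm_triangle_mono) (simp_all add: x[symmetric])
  also have "\<dots> \<le> G * (2 * norm (1 - cis (t $ 2))) + G * (2 * norm (1 - cis (t $ 1)))"
    by (intro add_mono mult_left_mono G0 abs_le_chord tb)
  finally show ?thesis unfolding te by (simp add: algebra_simps)
qed

lemma mean_norm_sq_trig:
  assumes "finite K" shows "mean (\<lambda>x. of_real ((norm (\<Sum>k\<in>K. c k * ek k x))\<^sup>2)) = of_real (\<Sum>k\<in>K. (norm (c k))\<^sup>2)"
proof -
  let ?T = "\<lambda>x. \<Sum>k\<in>K. c k * ek k x"
  have "mean (\<lambda>x. of_real ((norm (?T x))\<^sup>2)) = mean (\<lambda>x. \<Sum>k\<in>K. c k * (ek k x * cnj (?T x)))"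
    by (rule mean_cong) (simp only: complex_norm_square sum_distrib_right mult.assoc)
  also have "\<dots> = (\<Sum>k\<in>K. c k * mean (\<lambda>x. ek k x * cnj (?T x)))"
    by (subst mean_sum) (auto intro!: cper_mult cper_const cper_ek cper_cnj[OF cper_trig] simp: mean_cmult simp del: cnj_sum)
  also have "\<dots> = (\<Sum>k\<in>K. c k * cnj (c k))"
  proof (rule sum.cong[OF refl])
    fix k assume "k \<in> K"
    have "mean (\<lambda>x. ek k x * cnj (?T x)) = cnj (fc ?T k)"
      by (simp add: fc_def mean_cnj[symmetric] mult.commute)
    also have "\<dots> = cnj (c k)" using \<open>k \<in> K\<close> assms by (subst fc_trig) auto
    finally show "c k * mean (\<lambda>x. ek k x * cnj (?T x)) = c k * cnj (c k)" by simp
  qed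
  finally show ?thesis by (simp add: complex_norm_square[symmetric])
qed

definition cube :: "real \<Rightarrow> (int^2) set" where
  "cube X = {k. \<forall>i. \<bar>real_of_int (k $ i)\<bar> \<le> X}"

lemma cube_image: "cube X = (\<lambda>(a, b). pt a b) ` ({- \<lfloor>X\<rfloor>..\<lfloor>X\<rfloor>} \<times> {- \<lfloor>X\<rfloor>..\<lfloor>X\<rfloor>})"
proof -
  have iff: "\<bar>real_of_int a\<bar> \<le> X \<longleftrightarrow> - \<lfloor>X\<rfloor> \<le> a \<and> a \<le> \<lfloor>X\<rfloor>" for a
    by (auto simp: abs_le_iff le_floor_iff minus_le_iff)
  show ?thesis unfolding cube_def iff forall_2
    by (auto simp: image_iff int2_eq_iff intro!: bexI[of _ "(_ $ 1, _ $ 2)"])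
qed

lemma finite_cube [simp]: "finite (cube X)"
  by (simp add: cube_image)

lemma card_cube_le: assumes "X \<ge> 0" shows "real (card (cube X)) \<le> (2 * X + 1)\<^sup>2"
proof -
  have "card (cube X) \<le> card ({- \<lfloor>X\<rfloor>..\<lfloor>X\<rfloor>} \<times> {- \<lfloor>X\<rfloor>..\<lfloor>X\<rfloor>})"
    unfolding cube_image by (rule card_image_le) simp
  also have "\<dots> = (nat (2 * \<lfloor>X\<rfloor> + 1))\<^sup>2" by (simp add: power2_eq_square algebra_simps)
  finally have "real (card (cube X)) \<le> (real (nat (2 * \<lfloor>X\<rfloor> + 1)))\<^sup>2"
    by (metis of_nat_le_iff of_nat_power)
  also have "\<dots> \<le> (2 * X + 1)\<^sup>2"
    using assms by (intro power_mono) (auto intro: of_nat_nat[THEN eq_refl])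
  finally show ?thesis .
qed

text \<open>
  A product of two truncated geometric series. Multiplied by \<open>(1 - r e\<^sub>1) (1 - r e\<^sub>2)\<close> it is
  nearly one, so dividing by that product amounts to multiplying by a kernel of known \<open>L\<^sup>2\<close> norm.
\<close>

definition gker :: "real \<Rightarrow> nat \<Rightarrow> real^2 \<Rightarrow> complex" where
  "gker r N y = (\<Sum>k\<in>sq N. of_real (r ^ nat (k $ 1 + k $ 2)) * ek k y)"

lemma gker_mult:
  "(1 - of_real r * ek (axis 1 1) y) * (1 - of_real r * ek (axis 2 1) y) * gker r N y
   = (1 - (of_real r * ek (axis 1 1) y) ^ N) * (1 - (of_real r * ek (axis 2 1) y) ^ N)"
proof -
  have ekpt: "ek (pt (int a) (int b)) y = ek (axis 1 1) y ^ a * ek (axis 2 1) y ^ b" for a b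
  proof -
    have "ek (pt (int a) (int b)) y = cis (real a * y $ 1) * cis (real b * y $ 2)"
      by (simp add: ek_def inner_real2 cis_mult)
    then show ?thesis by (simp only: ek_axis Complex.DeMoivre)
  qed
  have "gker r N y = (\<Sum>a<N. \<Sum>b<N. (of_real r * ek (axis 1 1) y) ^ a * (of_real r * ek (axis 2 1) y) ^ b)"
    unfolding gker_def sum_sq by (intro sum.cong refl) (simp add: ekpt nat_add_distrib power_add power_mult_distrib)
  also have "\<dots> = (\<Sum>a<N. (of_real r * ek (axis 1 1) y) ^ a) * (\<Sum>b<N. (of_real r * ek (axis 2 1) y) ^ b)"
    by (simp add: sum_product)
  finally show ?thesis
    using one_diff_power_eq[of "of_real r * ek (axis 1 1) y" N] one_diff_power_eq[of "of_real r * ek (axis 2 1) y" N]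
    by (simp add: mult_ac)
qed

lemma mean_gker_le:
  assumes "0 \<le> r" "r < 1"
  shows "Re (mean (\<lambda>y. of_real ((norm (gker r N y))\<^sup>2))) \<le> (1 / (1 - r))\<^sup>2"
proof -
  have geo: "(\<Sum>a<N. r ^ a) \<le> 1 / (1 - r)"
    using assms by (subst sum_gp_strict) (auto intro!: divide_right_mono)
  have "Re (mean (\<lambda>y. of_real ((norm (gker r N y))\<^sup>2))) = (\<Sum>k\<in>sq N. (norm (complex_of_real (r ^ nat (k $ 1 + k $ 2))))\<^sup>2)"
    unfolding gker_def by (subst mean_norm_sq_trig) auto
  also have "\<dots> \<le> (\<Sum>k\<in>sq N. r ^ nat (k $ 1) * r ^ nat (k $ 2))"
  proof (rule sum_mono)
    fix k assume k: "k \<in> sq N"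
    let ?z = "r ^ nat (k $ 1 + k $ 2)"
    have "?z * ?z \<le> ?z * 1" using assms by (intro mult_left_mono power_le_one) auto
    moreover have "?z = r ^ nat (k $ 1) * r ^ nat (k $ 2)"
      using k by (simp add: sq_def nat_add_distrib power_add)
    ultimately show "(norm (complex_of_real ?z))\<^sup>2 \<le> r ^ nat (k $ 1) * r ^ nat (k $ 2)"
      unfolding norm_of_real power2_abs by (simp add: power2_eq_square)
  qed
  also have "\<dots> = (\<Sum>a<N. r ^ a) * (\<Sum>b<N. r ^ b)"
    by (simp add: sum_sq sum_product)
  also have "\<dots> \<le> (1 / (1 - r)) * (1 / (1 - r))"
    using assms by (intro mult_mono geo) (auto intro: sum_nonneg)
  finally show ?thesis by (simp add: power2_eq_square)
qed

text \<open>
  Bernstein's estimate of an \<open>L\<^sup>1\<close> norm. The symbol \<open>q\<close> is a twisted mixed difference of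
  \<open>n\<close>; its kernel is \<open>(1 - r e\<^sub>1) (1 - r e\<^sub>2)\<close> times that of \<open>n\<close>, which is therefore at
  most four times \<open>ker q\<close> times \<open>gker\<close>. The arithmetic-geometric inequality with parameter \<open>s\<close>
  and Parseval finish the proof.
\<close>

lemma Mn_le_weighted:
  assumes n: "fsupp n" and r: "0 \<le> r" "r < 1" and s: "s > 0" and K: "finite K"
    and q: "\<And>k. q k = n k - of_real r * n (k - axis 1 1) - of_real r * (n (k - axis 2 1) - of_real r * n (k - axis 2 1 - axis 1 1))"
    and supp: "\<And>k. q k \<noteq> 0 \<Longrightarrow> k \<in> K"
  shows "Mn n \<le> 2 * (s * (\<Sum>k\<in>K. (norm (q k))\<^sup>2) + (1 / (1 - r))\<^sup>2 / s)"
proof -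
  \<comment> \<open>Truncating late enough keeps \<open>1 - (r e)^N\<close> away from zero.\<close>
  obtain N where N: "r ^ N < 1 / 2" using real_arch_pow_inv[of "1/2" r] r by auto
  let ?P = "\<lambda>y. (1 - of_real r * ek (axis 1 1) y) * (1 - of_real r * ek (axis 2 1) y)"
  have kq: "ker q y = ?P y * ker n y" for y
  proof -
    define m where "m = (\<lambda>k. n k - of_real r * n (k - axis 1 1))"
    have m: "fsupp m" unfolding m_def by (intro fsupp_diff fsupp_mult_left fsupp_shift n)
    have km: "ker m y = (1 - of_real r * ek (axis 1 1) y) * ker n y"
      unfolding m_def by (simp add: ker_diff fsupp_mult_left fsupp_shift n ker_cmult ker_shift algebra_simps)
    have "q = (\<lambda>k. m k - of_real r * m (k - axis 2 1))"
      by (auto simp: q m_def)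
    then have "ker q y = ker m y - of_real r * (ek (axis 2 1) y * ker m y)"
      by (simp add: ker_diff fsupp_mult_left fsupp_shift m ker_cmult ker_shift)
    then show ?thesis by (simp add: km algebra_simps)
  qed
  have kqK: "ker q y = (\<Sum>k\<in>K. q k * ek k y)" for y
    by (rule ker_superset[OF K supp])
  have pt: "norm (ker n y) \<le> 2 * (s * (norm (ker q y))\<^sup>2 + (norm (gker r N y))\<^sup>2 / s)" for y
  proof -
    have half: "norm (1 - (of_real r * ek k y) ^ N) \<ge> 1 / 2" for k
    proof -
      have "norm ((of_real r * ek k y) ^ N) = r ^ N" using r by (simp add: norm_power norm_mult)
      then show ?thesis using norm_triangle_ineq2[of 1 "(of_real r * ek k y) ^ N"] N by simp
    qed
    have "1 / 2 * (1 / 2) \<le> norm (?P y) * norm (gker r N y)"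
      unfolding norm_mult[symmetric] gker_mult unfolding norm_mult
      by (intro mult_mono half) auto
    then have "norm (ker n y) * (1 / 2 * (1 / 2)) \<le> norm (ker n y) * (norm (?P y) * norm (gker r N y))"
      by (rule mult_left_mono) simp
    also have "\<dots> = norm (ker q y) * norm (gker r N y)" unfolding kq norm_mult by (simp only: mult_ac)
    also have "2 * \<dots> \<le> s * (norm (ker q y))\<^sup>2 + (norm (gker r N y))\<^sup>2 / s"
    proof -
      have "0 \<le> (s * norm (ker q y) - norm (gker r N y))\<^sup>2 / s" using s by simp
      also have "\<dots> = s * (norm (ker q y))\<^sup>2 + (norm (gker r N y))\<^sup>2 / s - 2 * (norm (ker q y) * norm (gker r N y))"
        using s by (simp add: power2_diff power_mult_distrib diff_divide_distrib add_divide_distrib) (simp add: power2_eq_square)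
      finally show ?thesis by simp
    qed
    finally show ?thesis by (simp add: algebra_simps)
  qed
  have cg: "cper (gker r N)" unfolding gker_def[abs_def] by (rule cper_trig)
  have csq: "cper (\<lambda>y. (norm (f y))\<^sup>2)" if "cper f" for f :: "real^2 \<Rightarrow> complex"
    unfolding power2_eq_square by (intro cper_mult cper_norm that)
  have "Mn n \<le> Re (mean (\<lambda>y. of_real ((norm (ker q y))\<^sup>2 * (2 * s) + (norm (gker r N y))\<^sup>2 * (2 / s))))"
    unfolding Mn_def
  proof (rule Re_mean_mono)
    show "cper (\<lambda>x. norm (ker n x))" by (intro cper_norm cper_ker)
    show "cper (\<lambda>x. (norm (ker q x))\<^sup>2 * (2 * s) + (norm (gker r N x))\<^sup>2 * (2 / s))"
      by (intro cper_add cper_mult cper_const csq cper_ker cg)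
    fix y show "norm (ker n y) \<le> (norm (ker q y))\<^sup>2 * (2 * s) + (norm (gker r N y))\<^sup>2 * (2 / s)"
      by (rule order_trans[OF pt]) (simp add: algebra_simps)
  qed
  also have "\<dots> = Re (mean (\<lambda>y. of_real ((norm (ker q y))\<^sup>2))) * (2 * s) + Re (mean (\<lambda>y. of_real ((norm (gker r N y))\<^sup>2))) * (2 / s)"
  proof -
    have c: "cper (\<lambda>y. complex_of_real ((norm (ker q y))\<^sup>2) * of_real (2 * s))" "cper (\<lambda>y. complex_of_real ((norm (gker r N y))\<^sup>2) * of_real (2 / s))"
      by (intro cper_mult cper_of_real csq cper_ker cg cper_const)+
    show ?thesis unfolding of_real_add of_real_mult[of "_\<^sup>2"] mean_add[OF c] mean_multc
      by simp
  qed
  also have "\<dots> \<le> (\<Sum>k\<in>K. (norm (q k))\<^sup>2) * (2 * s) + (1 / (1 - r))\<^sup>2 * (2 / s)"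
    using s mean_gker_le[OF r, of N] unfolding kqK mean_norm_sq_trig[OF K] Re_complex_of_real
    by (intro add_mono mult_right_mono) auto
  finally show ?thesis by (simp add: algebra_simps)
qed

text \<open>
  A symbol that lives at scale \<open>l\<close> and is smooth at that scale has a kernel whose \<open>L\<^sup>1\<close> norm does
  not depend on \<open>l\<close>. The mixed second difference suffices, since the
  denominator of \<open>gker\<close> is a product of one factor for each direction.
\<close>

theorem Mn_bound:
  assumes l: "l \<ge> 1" and A: "A > 0" and R: "R \<ge> 0"
    and supp: "\<And>k. n k \<noteq> 0 \<Longrightarrow> k \<in> cube (R * l)"
    and n0: "\<And>k. norm (n k) \<le> A" and n1: "\<And>i k. norm (sdiff i n k) \<le> A / l"
    and n2: "\<And>k. norm (sdiff 1 (sdiff 2 n) k) \<le> A / l\<^sup>2"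
  shows "fsupp n" "Mn n \<le> 16 * A * (2 * R + 3)"
proof -
  show n: "fsupp n" by (rule finite_subset[OF _ finite_cube[of "R * l"]]) (use supp in auto)
  \<comment> \<open>With this ratio \<open>gker\<close> is concentrated at distance \<open>1/l\<close>, the scale of the kernel of \<open>n\<close>.\<close>
  define r where "r = 1 - 1 / l"
  have r: "0 \<le> r" "r < 1" "1 - r = 1 / l" using l by (auto simp: r_def field_simps)
  define q where "q k = n k - of_real r * n (k - axis 1 1) - of_real r * (n (k - axis 2 1) - of_real r * n (k - axis 2 1 - axis 1 1))" for k
  define K where "K = cube (R * l + 1)"
  define rho where "rho = 2 * R + 3"
  have rho: "rho > 0" using R by (simp add: rho_def)
  have qsupp: "k \<in> K" if "q k \<noteq> 0" for k
  proof (rule ccontr)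
    assume nk: "k \<notin> K"
    then obtain i where i: "\<bar>real_of_int (k $ i)\<bar> > R * l + 1" by (auto simp: K_def cube_def not_le)
    have z: "n (k - d) = 0" if "\<bar>real_of_int (d $ i)\<bar> \<le> 1" for d
    proof (rule ccontr)
      assume "n (k - d) \<noteq> 0"
      from supp[OF this] have "\<bar>real_of_int ((k - d) $ i)\<bar> \<le> R * l" by (auto simp: cube_def)
      then show False using i that by simp
    qed
    have "n k = 0" using z[of 0] by simp
    moreover have "n (k - axis 1 1) = 0" by (rule z) (simp add: axis_def)
    moreover have "n (k - axis 2 1) = 0" by (rule z) (simp add: axis_def)
    moreover have "n (k - (axis 2 1 + axis 1 1)) = 0" by (rule z) (use exhaust_2[of i] in \<open>auto simp: axis_def\<close>)
    ultimately show False using that by (simp add: q_def diff_diff_add)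
  qed
  have qb: "norm (q k) \<le> 4 * A / l\<^sup>2" for k
  proof -
    have "q k = of_real (1 - r) * (of_real (1 - r) * n k) + of_real (1 - r) * (of_real r * sdiff 1 n k)
        + of_real (1 - r) * (of_real r * sdiff 2 n k) + of_real r * (of_real r * sdiff 1 (sdiff 2 n) k)"
      by (simp add: q_def sdiff_def algebra_simps)
    also have "norm \<dots> \<le> norm (of_real (1 - r) * (of_real (1 - r) * n k)) + norm (of_real (1 - r) * (of_real r * sdiff 1 n k))
        + norm (of_real (1 - r) * (of_real r * sdiff 2 n k)) + norm (of_real r * (of_real r * sdiff 1 (sdiff 2 n) k))"
      by (intro norm_triangle_mono order_refl)
    also have "\<dots> \<le> 1 / l * (1 / l * A) + 1 / l * (1 * (A / l)) + 1 / l * (1 * (A / l)) + 1 * (1 * (A / l\<^sup>2))"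
      unfolding norm_mult norm_of_real r(3) using r l A
      by (intro add_mono mult_mono n0 n1 n2) (auto intro!: divide_nonneg_nonneg mult_nonneg_nonneg)
    also have "\<dots> = 4 * A / l\<^sup>2" by (simp add: power2_eq_square)
    finally show ?thesis .
  qed
  have cardK: "real (card K) \<le> rho\<^sup>2 * l\<^sup>2"
  proof -
    have "real (card K) \<le> (2 * (R * l + 1) + 1)\<^sup>2" unfolding K_def using l R by (intro card_cube_le) auto
    also have "2 * (R * l + 1) + 1 \<le> rho * l" using l by (simp add: rho_def algebra_simps)
    then have "(2 * (R * l + 1) + 1)\<^sup>2 \<le> (rho * l)\<^sup>2" using l R by (intro power_mono) auto
    finally show ?thesis by (simp add: power_mult_distrib)
  qed
  have Q: "(\<Sum>k\<in>K. (norm (q k))\<^sup>2) \<le> 16 * A\<^sup>2 * rho\<^sup>2 / l\<^sup>2"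
  proof -
    have "(\<Sum>k\<in>K. (norm (q k))\<^sup>2) \<le> (\<Sum>k\<in>K. (4 * A / l\<^sup>2)\<^sup>2)"
      by (intro sum_mono power_mono qb) auto
    also have "\<dots> = real (card K) * (4 * A / l\<^sup>2)\<^sup>2" by simp
    also have "\<dots> \<le> (rho\<^sup>2 * l\<^sup>2) * (4 * A / l\<^sup>2)\<^sup>2" by (intro mult_right_mono cardK) auto
    also have "\<dots> = 16 * A\<^sup>2 * rho\<^sup>2 / l\<^sup>2" using l by (simp add: power_divide power_mult_distrib power2_eq_square)
    finally show ?thesis .
  qed
  \<comment> \<open>This choice makes the two terms of the weighted bound equal.\<close>
  define s where "s = l\<^sup>2 / (4 * A * rho)"
  have s: "s > 0" using l A rho by (simp add: s_def)
  have "Mn n \<le> 2 * (s * (\<Sum>k\<in>K. (norm (q k))\<^sup>2) + (1 / (1 - r))\<^sup>2 / s)"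
    by (rule Mn_le_weighted[OF n r(1,2) s]) (auto simp: K_def q_def intro: qsupp[unfolded K_def q_def])
  also have "\<dots> \<le> 2 * (s * (16 * A\<^sup>2 * rho\<^sup>2 / l\<^sup>2) + (1 / (1 - r))\<^sup>2 / s)"
    using s by (intro mult_left_mono add_mono Q) auto
  also have "s * (16 * A\<^sup>2 * rho\<^sup>2 / l\<^sup>2) = 4 * A * rho"
    using l A rho by (simp add: s_def power2_eq_square)
  also have "(1 / (1 - r))\<^sup>2 / s = 4 * A * rho"
    using l A rho by (simp add: s_def r(3) power2_eq_square)
  finally show "Mn n \<le> 16 * A * (2 * R + 3)" by (simp add: rho_def)
qed

section \<open>Multipliers sampled from smooth symbols\<close>

text \<open>
  \<open>csm n A G\<close>: all partial derivatives of \<open>G\<close> up to order \<open>n\<close> exist and are at most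
  \<open>A\<close>. The recursive form keeps the derivatives existentially quantified, so that products and
  chain rules need no notation for mixed partials.
\<close>

fun csm :: "nat \<Rightarrow> real \<Rightarrow> (real \<Rightarrow> real \<Rightarrow> real) \<Rightarrow> bool" where
  "csm 0 A G \<longleftrightarrow> (\<forall>x y. \<bar>G x y\<bar> \<le> A)"
| "csm (Suc n) A G \<longleftrightarrow> (\<forall>x y. \<bar>G x y\<bar> \<le> A) \<and>
     (\<exists>G1 G2. (\<forall>x y. ((\<lambda>t. G t y) has_real_derivative G1 x y) (at x)) \<and>
              (\<forall>x y. ((\<lambda>t. G x t) has_real_derivative G2 x y) (at y)) \<and> csm n A G1 \<and> csm n A G2)"

lemma csm_bound: "csm n A G \<Longrightarrow> \<bar>G x y\<bar> \<le> A"
  by (cases n) auto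

lemma csm_SucI:
  assumes "\<And>x y. \<bar>G x y\<bar> \<le> A" "\<And>x y. ((\<lambda>t. G t y) has_real_derivative G1 x y) (at x)"
    "\<And>x y. ((\<lambda>t. G x t) has_real_derivative G2 x y) (at y)" "csm n A G1" "csm n A G2"
  shows "csm (Suc n) A G"
  unfolding csm.simps using assms by blast

lemma csm_SucE:
  assumes "csm (Suc n) A G"
  obtains G1 G2 where "\<And>x y. \<bar>G x y\<bar> \<le> A" "\<And>x y. ((\<lambda>t. G t y) has_real_derivative G1 x y) (at x)"
    "\<And>x y. ((\<lambda>t. G x t) has_real_derivative G2 x y) (at y)" "csm n A G1" "csm n A G2"
  using assms unfolding csm.simps by blast

lemma csm_SucD: "csm (Suc n) A G \<Longrightarrow> csm n A G"
proof (induction n arbitrary: G)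
  case (Suc n)
  from Suc.prems obtain G1 G2 where "\<And>x y. \<bar>G x y\<bar> \<le> A" "\<And>x y. ((\<lambda>t. G t y) has_real_derivative G1 x y) (at x)"
    "\<And>x y. ((\<lambda>t. G x t) has_real_derivative G2 x y) (at y)" "csm (Suc n) A G1" "csm (Suc n) A G2"
    by (rule csm_SucE) blast
  then show ?case using Suc.IH by (intro csm_SucI[of G A G1 G2]) blast+
qed auto

lemma csm_mono: "csm n A G \<Longrightarrow> A \<le> B \<Longrightarrow> csm n B G"
proof (induction n arbitrary: G)
  case (Suc n)
  then show ?case by (auto intro: order_trans)
qed (auto intro: order_trans)

lemma csm_add: "csm n A G \<Longrightarrow> csm n B H \<Longrightarrow> csm n (A + B) (\<lambda>x y. G x y + H x y)"
proof (induction n arbitrary: G H)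
  case 0 then show ?case by (auto intro: order_trans[OF abs_triangle_ineq add_mono])
next
  case (Suc n)
  obtain G1 G2 where G: "\<And>x y. \<bar>G x y\<bar> \<le> A" "\<And>x y. ((\<lambda>t. G t y) has_real_derivative G1 x y) (at x)"
    "\<And>x y. ((\<lambda>t. G x t) has_real_derivative G2 x y) (at y)" "csm n A G1" "csm n A G2"
    using Suc.prems(1) by (rule csm_SucE) blast
  obtain H1 H2 where H: "\<And>x y. \<bar>H x y\<bar> \<le> B" "\<And>x y. ((\<lambda>t. H t y) has_real_derivative H1 x y) (at x)"
    "\<And>x y. ((\<lambda>t. H x t) has_real_derivative H2 x y) (at y)" "csm n B H1" "csm n B H2"
    using Suc.prems(2) by (rule csm_SucE) blast
  show ?case
    by (rule csm_SucI[of _ _ "\<lambda>x y. G1 x y + H1 x y" "\<lambda>x y. G2 x y + H2 x y"])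
       (intro order_trans[OF abs_triangle_ineq] add_mono DERIV_add G H Suc.IH)+
qed

lemma csm_cmult: "csm n A G \<Longrightarrow> csm n (\<bar>c\<bar> * A) (\<lambda>x y. c * G x y)"
proof (induction n arbitrary: G)
  case 0 then show ?case by (auto simp: abs_mult intro: mult_left_mono)
next
  case (Suc n)
  obtain G1 G2 where G: "\<And>x y. \<bar>G x y\<bar> \<le> A" "\<And>x y. ((\<lambda>t. G t y) has_real_derivative G1 x y) (at x)"
    "\<And>x y. ((\<lambda>t. G x t) has_real_derivative G2 x y) (at y)" "csm n A G1" "csm n A G2"
    using Suc.prems(1) by (rule csm_SucE) blast
  show ?case
  proof (rule csm_SucI[of _ _ "\<lambda>x y. c * G1 x y" "\<lambda>x y. c * G2 x y"])
    fix x y show "\<bar>c * G x y\<bar> \<le> \<bar>c\<bar> * A" using G(1) by (simp add: abs_mult mult_left_mono)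
  qed (intro DERIV_cmult G Suc.IH)+
qed

definition dquot :: "2 \<Rightarrow> real \<Rightarrow> (real \<Rightarrow> real \<Rightarrow> real) \<Rightarrow> real \<Rightarrow> real \<Rightarrow> real" where
  "dquot i l G x y = l * (G x y - (if i = 1 then G (x - 1 / l) y else G x (y - 1 / l)))"

text \<open>
  The mean value theorem, with the step \<open>1 / l\<close> of the sampling.
\<close>

lemma csm_dquot: "l > 0 \<Longrightarrow> csm (Suc n) A G \<Longrightarrow> csm n A (dquot i l G)"
proof (induction n arbitrary: G)
  have mvt: "\<bar>l * (g x - g (x - 1 / l))\<bar> \<le> A"
    if "l > 0" "\<And>x. (g has_real_derivative g' x) (at x)" "\<And>x. \<bar>g' x\<bar> \<le> A" for g g' :: "real \<Rightarrow> real" and x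
  proof -
    have "x - 1 / l < x" using that by simp
    from MVT2[OF this, of g g'] that(2) obtain z where "g x - g (x - 1 / l) = (x - (x - 1 / l)) * g' z" by blast
    then show ?thesis using that by simp
  qed
  have bd: "\<bar>dquot i l G x y\<bar> \<le> A" if l0: "l > 0" and cG: "csm (Suc n) A G" for G x y n
  proof -
    obtain G1 G2 where G: "\<And>x y. ((\<lambda>t. G t y) has_real_derivative G1 x y) (at x)"
      "\<And>x y. ((\<lambda>t. G x t) has_real_derivative G2 x y) (at y)" "csm n A G1" "csm n A G2"
      using cG by (rule csm_SucE) blast
    show ?thesis
      using mvt[of "\<lambda>t. G t y" "\<lambda>t. G1 t y" x, OF l0 G(1) csm_bound[OF G(3)]]
         mvt[of "\<lambda>t. G x t" "\<lambda>t. G2 x t" y, OF l0 G(2) csm_bound[OF G(4)]]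
      by (simp add: dquot_def)
  qed
  { case 0 then show ?case unfolding csm.simps(1)[of A "dquot i l G"] using bd[OF 0(1) 0(2)] by blast }
  { case (Suc n)
    obtain G1 G2 where G: "\<And>x y. ((\<lambda>t. G t y) has_real_derivative G1 x y) (at x)"
      "\<And>x y. ((\<lambda>t. G x t) has_real_derivative G2 x y) (at y)" "csm (Suc n) A G1" "csm (Suc n) A G2"
      using Suc.prems(2) by (rule csm_SucE) blast
    have s1: "((\<lambda>t. G (t - c) y) has_real_derivative G1 (x - c) y) (at x)" for c x y
      using DERIV_shift[of "\<lambda>t. G t y" "G1 (x - c) y" x "- c"] G(1) by simp
    have s2: "((\<lambda>t. G x (t - c)) has_real_derivative G2 x (y - c)) (at y)" for c x y
      using DERIV_shift[of "\<lambda>t. G x t" "G2 x (y - c)" y "- c"] G(2) by simp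
    show ?case
    proof (rule csm_SucI[of _ _ "dquot i l G1" "dquot i l G2"])
      show "\<bar>dquot i l G x y\<bar> \<le> A" for x y using bd Suc.prems by blast
      show "((\<lambda>t. dquot i l G t y) has_real_derivative dquot i l G1 x y) (at x)" for x y
        unfolding dquot_def by (cases "i = 1") (simp_all add: DERIV_cmult DERIV_diff G s1)
      show "((\<lambda>t. dquot i l G x t) has_real_derivative dquot i l G2 x y) (at y)" for x y
        unfolding dquot_def by (cases "i = 1") (simp_all add: DERIV_cmult DERIV_diff G s2)
    qed (use Suc G in auto) }
qed

text \<open>
  Sampling a symbol at scale \<open>l\<close>. The difference quotients \<open>dquot\<close> of the profile become the differences
  of the samples, so bounds on derivatives turn into the hypotheses of \<open>Mn_bound\<close>.
\<close>

definition smp :: "real \<Rightarrow> (real \<Rightarrow> real \<Rightarrow> real) \<Rightarrow> int^2 \<Rightarrow> complex" where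
  "smp l G k = of_real (G (of_int (k $ 1) / l) (of_int (k $ 2) / l))"

lemma sdiff_smp: "l > 0 \<Longrightarrow> sdiff i (smp l G) = (\<lambda>k. of_real (1 / l) * smp l (dquot i l G) k)"
proof
  fix k assume l: "l > 0"
  consider "i = 1" | "i = 2" using exhaust_2 by blast
  then show "sdiff i (smp l G) k = of_real (1 / l) * smp l (dquot i l G) k"
    using l by cases (simp_all add: sdiff_def smp_def dquot_def axis_def diff_divide_distrib)
qed

lemma sdiff_cmult: "sdiff i (\<lambda>k. c * n k) = (\<lambda>k. c * sdiff i n k)"
  by (auto simp: sdiff_def algebra_simps)

lemma Mn_cmult: "Mn (\<lambda>k. c * n k) = norm c * Mn n"
  unfolding Mn_def ker_cmult norm_mult of_real_mult mean_cmult by simp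

lemma Mn_smp:
  assumes l: "l \<ge> 1" and A: "A > 0" and R: "R \<ge> 0" and G: "csm 2 A G"
    and supp: "\<And>x y. G x y \<noteq> 0 \<Longrightarrow> \<bar>x\<bar> \<le> R \<and> \<bar>y\<bar> \<le> R"
  shows "fsupp (smp l G)" "Mn (smp l G) \<le> 16 * A * (2 * R + 3)"
proof -
  have G: "csm (Suc (Suc 0)) A G" using G by (simp add: numeral_2_eq_2)
  have supp': "k \<in> cube (R * l)" if "smp l G k \<noteq> 0" for k
    using supp[of "of_int (k $ 1) / l" "of_int (k $ 2) / l"] that l
    by (auto simp: smp_def cube_def forall_2 field_simps)
  have n0: "norm (smp l G k) \<le> A" for k using csm_bound[OF G] by (simp add: smp_def)
  have n1: "norm (sdiff i (smp l G) k) \<le> A / l" for i k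
    using csm_bound[OF csm_dquot[OF _ G, of l i]] l
    by (simp add: sdiff_smp norm_mult norm_divide) (simp add: smp_def divide_right_mono)
  have n2: "norm (sdiff 1 (sdiff 2 (smp l G)) k) \<le> A / l\<^sup>2" for k
  proof -
    have l0: "l > 0" using l by simp
    have "sdiff 1 (sdiff 2 (smp l G)) k = of_real (1 / l) * (of_real (1 / l) * smp l (dquot 1 l (dquot 2 l G)) k)"
      by (simp only: sdiff_smp[OF l0] sdiff_cmult)
    moreover have "norm (smp l (dquot 1 l (dquot 2 l G)) k) \<le> A"
      using csm_bound[OF csm_dquot[OF l0 csm_dquot[OF l0 G]]] by (simp add: smp_def)
    ultimately show ?thesis using l by (simp add: norm_mult norm_divide power2_eq_square divide_right_mono)
  qed
  show "fsupp (smp l G)" "Mn (smp l G) \<le> 16 * A * (2 * R + 3)"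
    using Mn_bound[OF l A R supp' n0 n1 n2] by auto
qed

lemma Mn_sdiff_smp:
  assumes l: "l \<ge> 1" and A: "A > 0" and R: "R \<ge> 0" and G: "csm 3 A G"
    and supp: "\<And>x y. G x y \<noteq> 0 \<Longrightarrow> \<bar>x\<bar> \<le> R \<and> \<bar>y\<bar> \<le> R"
  shows "Mn (sdiff i (smp l G)) \<le> 1 / l * (16 * A * (2 * R + 5))"
proof -
  have d: "csm 2 A (dquot i l G)" using l G by (intro csm_dquot) (auto simp: numeral_3_eq_3 numeral_2_eq_2)
  have l': "0 \<le> 1 / l" "1 / l \<le> 1" using l by auto
  have "\<bar>x\<bar> \<le> R + 1 \<and> \<bar>y\<bar> \<le> R + 1" if "dquot i l G x y \<noteq> 0" for x y
  proof -
    have "G x y \<noteq> 0 \<or> G (x - 1 / l) y \<noteq> 0 \<or> G x (y - 1 / l) \<noteq> 0"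
      using that by (auto simp: dquot_def split: if_splits)
    then show ?thesis using supp[of x y] supp[of "x - 1/l" y] supp[of x "y - 1/l"] l' by linarith
  qed
  from Mn_smp(2)[OF l A _ d this] R have "Mn (smp l (dquot i l G)) \<le> 16 * A * (2 * R + 5)" by (simp add: algebra_simps)
  then have "1 / l * Mn (smp l (dquot i l G)) \<le> 1 / l * (16 * A * (2 * R + 5))" using l' by (intro mult_left_mono)
  moreover have "Mn (sdiff i (smp l G)) = 1 / l * Mn (smp l (dquot i l G))"
  proof -
    have "sdiff i (smp l G) = (\<lambda>k. of_real (1 / l) * smp l (dquot i l G) k)" using l by (intro sdiff_smp) simp
    then show ?thesis by (simp only: Mn_cmult norm_of_real abs_of_nonneg[OF l'(1)])
  qed
  ultimately show ?thesis by simp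
qed

text \<open>
  Smooth on the line and zero beyond \<open>R\<close>, with the chain of derivatives as a witness. Applied to
  \<open>x\<^sup>2 + y\<^sup>2\<close> such a profile gives a compactly supported smooth function of the plane.
\<close>

definition bump :: "real \<Rightarrow> (real \<Rightarrow> real) \<Rightarrow> bool" where
  "bump R P \<longleftrightarrow> (\<exists>D. D 0 = P \<and> (\<forall>n x. (D n has_real_derivative D (Suc n) x) (at x)) \<and>
      (\<forall>n x. x > R \<longrightarrow> D n x = 0))"

lemma bump_deriv:
  assumes "bump R P"
  shows "\<exists>P'. (\<forall>x. (P has_real_derivative P' x) (at x)) \<and> bump R P'"
proof -
  obtain D where D: "D 0 = P" "\<forall>n x. (D n has_real_derivative D (Suc n) x) (at x)" "\<forall>n x. x > R \<longrightarrow> D n x = 0"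
    using assms unfolding bump_def by blast
  have "bump R (D 1)" unfolding bump_def
    by (rule exI[of _ "\<lambda>n. D (Suc n)"]) (use D in auto)
  then show ?thesis using D by (metis One_nat_def)
qed

lemma bump_bounded: assumes "bump R P" shows "\<exists>A\<ge>0. \<forall>x\<ge>0. \<bar>P x\<bar> \<le> A"
proof -
  obtain P' where P': "\<And>x. (P has_real_derivative P' x) (at x)" using bump_deriv[OF assms] by blast
  have "continuous_on {0..R} P" by (meson DERIV_isCont P' continuous_at_imp_continuous_on)
  then have "compact (P ` {0..R})" by (intro compact_continuous_image) auto
  then have "bounded (P ` {0..R})" by (rule compact_imp_bounded)
  then obtain A where A: "\<And>x. x \<in> {0..R} \<Longrightarrow> \<bar>P x\<bar> \<le> A" unfolding bounded_iff real_norm_def by blast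
  have "\<bar>P x\<bar> \<le> max A 0" if "x \<ge> 0" for x
  proof (cases "x \<le> R")
    case True then show ?thesis using A[of x] that by (simp add: le_max_iff_disj)
  next
    case False then show ?thesis using assms by (auto simp: bump_def)
  qed
  then show ?thesis by (intro exI[of _ "max A 0"]) auto
qed

text \<open>
  Differentiating \<open>x\<^sup>a y\<^sup>b P(x\<^sup>2 + y\<^sup>2)\<close> gives a combination of terms of the same shape, so the
  induction is on the order with \<open>a\<close>, \<open>b\<close> and \<open>P\<close> arbitrary.
\<close>

lemma csm_bump:
  assumes "bump R P" "R \<ge> 0"
  shows "\<exists>A>0. csm n A (\<lambda>x y. x ^ a * y ^ b * P (x\<^sup>2 + y\<^sup>2))"
  using assms(1)
proof (induction n arbitrary: a b P)
  have bd: "\<exists>A>0. \<forall>x y. \<bar>x ^ a * y ^ b * P (x\<^sup>2 + y\<^sup>2)\<bar> \<le> A" if P: "bump R P" for a b P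
  proof -
    obtain A where A: "A \<ge> 0" "\<forall>x\<ge>0. \<bar>P x\<bar> \<le> A" using bump_bounded[OF P] by blast
    let ?B = "(1 + R) ^ a * (1 + R) ^ b * A + 1"
    have "\<bar>x ^ a * y ^ b * P (x\<^sup>2 + y\<^sup>2)\<bar> \<le> ?B" for x y
    proof (cases "x\<^sup>2 + y\<^sup>2 \<le> R")
      case True
      have *: "\<bar>z\<bar> \<le> 1 + R" if "z\<^sup>2 \<le> R" for z :: real
      proof -
        have "R \<le> (1 + R)\<^sup>2" using assms(2) by (simp add: power2_eq_square algebra_simps add_nonneg_nonneg)
        then have "z\<^sup>2 \<le> (1 + R)\<^sup>2" using that by (rule order_trans[rotated])
        then show ?thesis using assms(2) by (simp add: abs_le_square_iff[symmetric])
      qed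
      have "\<bar>x\<bar> \<le> 1 + R" "\<bar>y\<bar> \<le> 1 + R"
        using True by (auto intro!: * intro: order_trans[rotated])
      then have "\<bar>x\<bar> ^ a * \<bar>y\<bar> ^ b * \<bar>P (x\<^sup>2 + y\<^sup>2)\<bar> \<le> (1 + R) ^ a * (1 + R) ^ b * A"
        using A assms(2) by (intro mult_mono power_mono) auto
      then show ?thesis by (simp add: abs_mult power_abs)
    next
      case False
      then have "P (x\<^sup>2 + y\<^sup>2) = 0" using P by (auto simp: bump_def)
      then show ?thesis using A assms(2) by simp
    qed
    moreover have "?B > 0" using A assms(2) by (simp add: add_nonneg_pos)
    ultimately show ?thesis by blast
  qed
  { case 0 then show ?case using bd by simp }
  { case (Suc n)
    obtain P' where P': "\<And>x. (P has_real_derivative P' x) (at x)" "bump R P'" using bump_deriv[OF Suc.prems] by blast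
    obtain A0 where A0: "A0 > 0" "\<forall>x y. \<bar>x ^ a * y ^ b * P (x\<^sup>2 + y\<^sup>2)\<bar> \<le> A0" using bd[OF Suc.prems] by blast
    obtain A1 where A1: "A1 > 0" "csm n A1 (\<lambda>x y. x ^ (a - 1) * y ^ b * P (x\<^sup>2 + y\<^sup>2))" using Suc.IH[OF Suc.prems] by blast
    obtain A2 where A2: "A2 > 0" "csm n A2 (\<lambda>x y. x ^ (a + 1) * y ^ b * P' (x\<^sup>2 + y\<^sup>2))" using Suc.IH[OF P'(2)] by blast
    obtain A3 where A3: "A3 > 0" "csm n A3 (\<lambda>x y. x ^ a * y ^ (b - 1) * P (x\<^sup>2 + y\<^sup>2))" using Suc.IH[OF Suc.prems] by blast
    obtain A4 where A4: "A4 > 0" "csm n A4 (\<lambda>x y. x ^ a * y ^ (b + 1) * P' (x\<^sup>2 + y\<^sup>2))" using Suc.IH[OF P'(2)] by blast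
    define G1 where "G1 x y = real a * (x ^ (a - 1) * y ^ b * P (x\<^sup>2 + y\<^sup>2)) + 2 * (x ^ (a + 1) * y ^ b * P' (x\<^sup>2 + y\<^sup>2))" for x y
    define G2 where "G2 x y = real b * (x ^ a * y ^ (b - 1) * P (x\<^sup>2 + y\<^sup>2)) + 2 * (x ^ a * y ^ (b + 1) * P' (x\<^sup>2 + y\<^sup>2))" for x y
    define A where "A = A0 + (\<bar>real a\<bar> * A1 + \<bar>2\<bar> * A2) + (\<bar>real b\<bar> * A3 + \<bar>2\<bar> * A4)"
    have pos: "0 \<le> \<bar>real a\<bar> * A1 + \<bar>2\<bar> * A2" "0 \<le> \<bar>real b\<bar> * A3 + \<bar>2\<bar> * A4" using A1 A2 A3 A4 by simp_all
    have "csm n (\<bar>real a\<bar> * A1 + \<bar>2\<bar> * A2) G1" unfolding G1_def by (intro csm_add csm_cmult A1 A2)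
    then have c1: "csm n A G1" by (rule csm_mono) (use pos A0 in \<open>simp add: A_def\<close>)
    have "csm n (\<bar>real b\<bar> * A3 + \<bar>2\<bar> * A4) G2" unfolding G2_def by (intro csm_add csm_cmult A3 A4)
    then have c2: "csm n A G2" by (rule csm_mono) (use pos A0 in \<open>simp add: A_def\<close>)
    have "csm (Suc n) A (\<lambda>x y. x ^ a * y ^ b * P (x\<^sup>2 + y\<^sup>2))"
    proof (rule csm_SucI[of _ _ G1 G2, OF _ _ _ c1 c2])
      fix x y :: real
      show "\<bar>x ^ a * y ^ b * P (x\<^sup>2 + y\<^sup>2)\<bar> \<le> A"
        using A0(2)[rule_format, of x y] pos unfolding A_def by linarith
      have d1: "((\<lambda>t. P (t\<^sup>2 + y\<^sup>2)) has_real_derivative P' (x\<^sup>2 + y\<^sup>2) * (2 * x)) (at x)"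
        by (rule DERIV_chain2[OF P'(1)]) (auto intro!: derivative_eq_intros)
      have d2: "((\<lambda>t. P (x\<^sup>2 + t\<^sup>2)) has_real_derivative P' (x\<^sup>2 + y\<^sup>2) * (2 * y)) (at y)"
        by (rule DERIV_chain2[OF P'(1)]) (auto intro!: derivative_eq_intros)
      show "((\<lambda>t. t ^ a * y ^ b * P (t\<^sup>2 + y\<^sup>2)) has_real_derivative G1 x y) (at x)"
        by (rule derivative_eq_intros d1 refl)+ (simp add: G1_def algebra_simps)
      show "((\<lambda>t. x ^ a * t ^ b * P (x\<^sup>2 + t\<^sup>2)) has_real_derivative G2 x y) (at y)"
        by (rule derivative_eq_intros d2 refl)+ (simp add: G2_def algebra_simps)
    qed
    moreover have "A > 0" using A0 pos by (simp add: A_def)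
    ultimately show ?case by blast }
qed

fun smooth_pos :: "nat \<Rightarrow> (real \<Rightarrow> real) \<Rightarrow> bool" where
  "smooth_pos 0 f \<longleftrightarrow> True"
| "smooth_pos (Suc n) f \<longleftrightarrow> (\<exists>f'. (\<forall>x>0. (f has_real_derivative f' x) (at x)) \<and> smooth_pos n f')"

lemma smooth_pos_SucI: "(\<And>x. x > 0 \<Longrightarrow> (f has_real_derivative f' x) (at x)) \<Longrightarrow> smooth_pos n f' \<Longrightarrow> smooth_pos (Suc n) f"
  by auto

lemma smooth_pos_SucD: "smooth_pos (Suc n) f \<Longrightarrow> smooth_pos n f"
proof (induction n arbitrary: f)
  case (Suc n) then show ?case by (metis smooth_pos.simps(2))
qed simp

lemma has_derivative_cong_pos:
  assumes "\<And>x::real. x > 0 \<Longrightarrow> f x = g x" "x > 0" "(f has_real_derivative d) (at x)"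
  shows "(g has_real_derivative d) (at x)"
  by (rule has_field_derivative_transform_within_open[OF assms(3), of "{0<..}"]) (use assms in auto)

lemma smooth_pos_cong: "smooth_pos n f \<Longrightarrow> (\<And>x. x > 0 \<Longrightarrow> f x = g x) \<Longrightarrow> smooth_pos n g"
proof (cases n)
  case (Suc m)
  assume "smooth_pos n f" "\<And>x. x > 0 \<Longrightarrow> f x = g x"
  then show ?thesis using has_derivative_cong_pos[of f g] Suc by auto metis
qed simp

lemma smooth_pos_add: "smooth_pos n f \<Longrightarrow> smooth_pos n g \<Longrightarrow> smooth_pos n (\<lambda>x. f x + g x)"
proof (induction n arbitrary: f g)
  case (Suc n)
  then obtain f' g' where "\<forall>x>0. (f has_real_derivative f' x) (at x)" "smooth_pos n f'"
    "\<forall>x>0. (g has_real_derivative g' x) (at x)" "smooth_pos n g'" by auto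
  then show ?case using Suc.IH by (auto intro!: exI[of _ "\<lambda>x. f' x + g' x"] derivative_intros)
qed simp

lemma smooth_pos_const: "smooth_pos n (\<lambda>x. c)"
  by (induction n arbitrary: c) (auto intro!: exI[of _ "\<lambda>x. 0"])

lemma smooth_pos_mult: "smooth_pos n f \<Longrightarrow> smooth_pos n g \<Longrightarrow> smooth_pos n (\<lambda>x. f x * g x)"
proof (induction n arbitrary: f g)
  case (Suc n)
  then obtain f' g' where d: "\<forall>x>0. (f has_real_derivative f' x) (at x)" "smooth_pos n f'"
    "\<forall>x>0. (g has_real_derivative g' x) (at x)" "smooth_pos n g'" by auto
  have "smooth_pos n (\<lambda>x. f' x * g x + g' x * f x)"
    by (intro smooth_pos_add Suc.IH d smooth_pos_SucD[OF Suc.prems(1)] smooth_pos_SucD[OF Suc.prems(2)])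
  then show ?case using d by (auto intro!: exI[of _ "\<lambda>x. f' x * g x + g' x * f x"] DERIV_mult)
qed simp

lemma smooth_pos_inverse: "smooth_pos n (\<lambda>x. 1 / x)"
proof (induction n)
  case (Suc n)
  have "smooth_pos n (\<lambda>x. (-1) * (1 / x * (1 / x)))"
    by (intro smooth_pos_mult smooth_pos_const Suc)
  moreover have "((\<lambda>x. 1 / x) has_real_derivative (-1) * (1 / x * (1 / x))) (at x)" if "x > 0" for x :: real
    using that by (auto intro!: derivative_eq_intros)
  ultimately show ?case by (intro smooth_pos_SucI)
qed simp

lemma smooth_pos_sqrt: "smooth_pos n f \<Longrightarrow> smooth_pos n (\<lambda>x. f (sqrt x))"
proof (induction n arbitrary: f)
  case (Suc n)
  then obtain f' where d: "\<forall>x>0. (f has_real_derivative f' x) (at x)" "smooth_pos n f'" by auto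
  have "smooth_pos n (\<lambda>x. (\<lambda>y. f' y * (1 / 2 * (1 / y))) (sqrt x))"
    by (rule Suc.IH) (intro smooth_pos_mult smooth_pos_const smooth_pos_inverse d)
  moreover have "((\<lambda>x. f (sqrt x)) has_real_derivative f' (sqrt x) * (1 / 2 * (1 / sqrt x))) (at x)" if "x > 0" for x
    by (rule DERIV_chain2[of f]) (use d that in \<open>auto intro!: derivative_eq_intros simp: field_simps\<close>)
  ultimately show ?case by (intro smooth_pos_SucI)
qed simp

lemma smooth_pos_scale: "c > 0 \<Longrightarrow> smooth_pos n f \<Longrightarrow> smooth_pos n (\<lambda>x. f (c * x))"
proof (induction n arbitrary: f)
  case (Suc n)
  then obtain f' where d: "\<forall>x>0. (f has_real_derivative f' x) (at x)" "smooth_pos n f'" by auto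
  have "smooth_pos n (\<lambda>x. c * f' (c * x))"
    by (intro smooth_pos_mult smooth_pos_const Suc d)
  moreover have "((\<lambda>x. f (c * x)) has_real_derivative c * f' (c * x)) (at x)" if "x > 0" for x
  proof -
    have "((\<lambda>x. f (c * x)) has_real_derivative f' (c * x) * c) (at x)"
      by (rule DERIV_chain2[of f]) (use d that Suc.prems(1) in \<open>auto intro!: derivative_eq_intros\<close>)
    then show ?thesis by (simp add: mult.commute)
  qed
  ultimately show ?case by (intro smooth_pos_SucI)
qed simp

text \<open>
  A profile that is smooth on the half-line and vanishes near its end extends by zero.
\<close>

lemma bump_if_smooth_pos:
  assumes s: "\<And>n. smooth_pos n f" and d: "d > 0" and z: "\<And>x. 0 < x \<Longrightarrow> x < d \<Longrightarrow> f x = 0" "\<And>x. x > R \<Longrightarrow> f x = 0" and R: "R \<ge> 0"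
  shows "bump R (\<lambda>x. if x \<le> 0 then 0 else f x)"
proof -
  define g where "g n = (deriv ^^ n) f" for n
  have gs: "smooth_pos m (g n)" for m n
  proof (induction n arbitrary: m)
    case (Suc n)
    obtain f' where f': "\<forall>x>0. (g n has_real_derivative f' x) (at x)" "smooth_pos m f'" using Suc[of "Suc m"] by auto
    show ?case by (rule smooth_pos_cong[OF f'(2)]) (use f' DERIV_imp_deriv[of "g n"] in \<open>auto simp: g_def\<close>)
  qed (simp add: g_def s)
  have gd: "(g n has_real_derivative g (Suc n) x) (at x)" if x: "x > 0" for n x
  proof -
    obtain f' where "(g n has_real_derivative f' x) (at x)" using gs[of "Suc 0" n] x unfolding smooth_pos.simps by blast
    then show ?thesis by (simp add: g_def DERIV_imp_deriv)
  qed
  have zero: "g n x = 0" if "x \<in> S" "open S" "\<And>y. y \<in> S \<Longrightarrow> f y = 0" for n x S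
    using that(1)
  proof (induction n arbitrary: x)
    case (Suc n)
    have "(g n has_real_derivative 0) (at x)"
      by (rule has_field_derivative_transform_within_open[of "\<lambda>_. 0" _ _ S]) (use Suc that in auto)
    then show ?case by (simp add: g_def DERIV_imp_deriv)
  qed (simp add: g_def that)
  have z1: "g n x = 0" if "0 < x" "x < d" for n x
    by (rule zero[of _ "{0<..<d}"]) (use that z in auto)
  have z2: "g n x = 0" if "R < x" for n x
    by (rule zero[of _ "{R<..}"]) (use that z in auto)
  define D where "D n x = (if x \<le> 0 then 0 else g n x)" for n and x :: real
  have "(D n has_real_derivative D (Suc n) x) (at x)" for n x
  proof (cases "x \<le> 0")
    case True
    have "(D n has_real_derivative 0) (at x)"
      by (rule has_field_derivative_transform_within_open[of "\<lambda>_. 0" _ _ "{..<d}"]) (use True d z1 in \<open>auto simp: D_def\<close>)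
    then show ?thesis using True by (simp add: D_def)
  next
    case False
    then show ?thesis
      using has_derivative_cong_pos[of "g n" "D n" x "g (Suc n) x"] gd[of x n] by (simp add: D_def)
  qed
  moreover have "D 0 = (\<lambda>x. if x \<le> 0 then 0 else f x)" by (auto simp: D_def g_def)
  moreover have "D n x = 0" if "x > R" for n x using z2 that by (simp add: D_def)
  ultimately show ?thesis unfolding bump_def by blast
qed

definition annular :: "real \<Rightarrow> (real \<Rightarrow> real) \<Rightarrow> bool" where
  "annular R f \<longleftrightarrow> (\<forall>n. smooth_pos n f) \<and> (\<exists>d>0. \<forall>x. 0 \<le> x \<and> x < d \<longrightarrow> f x = 0) \<and> (\<forall>x>R. f x = 0) \<and> R > 0"

text \<open>
  The homogeneous factors \<open>x\<^sup>a y\<^sup>b |\<cdot>|\<^sup>-\<^sup>2\<^sup>m\<close> cover all symbols that occur: the blocks, their gradients,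
  the pressure and the inverse Laplacian of a divergence. At the origin the profile vanishes, so the value of
  \<open>1 / 0\<close> does not matter.
\<close>

definition radial :: "(real \<Rightarrow> real) \<Rightarrow> nat \<Rightarrow> nat \<Rightarrow> nat \<Rightarrow> real \<Rightarrow> real \<Rightarrow> real" where
  "radial f m a b x y = x ^ a * y ^ b * (f (sqrt (x\<^sup>2 + y\<^sup>2)) * (1 / (x\<^sup>2 + y\<^sup>2)) ^ m)"

lemma smooth_pos_power: "smooth_pos n f \<Longrightarrow> smooth_pos n (\<lambda>x. f x ^ m)"
  by (induction m) (auto intro: smooth_pos_mult smooth_pos_const)

lemma csm_radial:
  assumes "annular R f" shows "\<exists>A>0. csm n A (radial f m a b)"
proof -
  obtain d where d: "d > 0" "\<And>x. 0 \<le> x \<Longrightarrow> x < d \<Longrightarrow> f x = 0" and s: "\<And>n. smooth_pos n f"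
    and R: "R > 0" "\<And>x. x > R \<Longrightarrow> f x = 0" using assms unfolding annular_def by blast
  let ?P = "\<lambda>s. f (sqrt s) * (1 / s) ^ m"
  have "bump (R\<^sup>2) (\<lambda>x. if x \<le> 0 then 0 else ?P x)"
  proof (rule bump_if_smooth_pos[of _ "d\<^sup>2"])
    show "smooth_pos n ?P" for n by (intro smooth_pos_mult smooth_pos_sqrt s smooth_pos_power smooth_pos_inverse)
    show "?P x = 0" if "0 < x" "x < d\<^sup>2" for x
      using d(2)[of "sqrt x"] that real_less_lsqrt[of d x] d(1) by simp
    show "?P x = 0" if "x > R\<^sup>2" for x
      using R(2)[of "sqrt x"] that real_less_rsqrt[of R x] by simp
  qed (use d in auto)
  from csm_bump[OF this, of n a b]
  obtain A where "A > 0" "csm n A (\<lambda>x y. x ^ a * y ^ b * (if x\<^sup>2 + y\<^sup>2 \<le> 0 then 0 else ?P (x\<^sup>2 + y\<^sup>2)))" by auto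
  moreover have "(if x\<^sup>2 + y\<^sup>2 \<le> 0 then 0 else ?P (x\<^sup>2 + y\<^sup>2)) = ?P (x\<^sup>2 + y\<^sup>2)" for x y :: real
    using d(2)[of 0] d(1) by (auto simp: sum_power2_le_zero_iff)
  ultimately show ?thesis unfolding radial_def[abs_def] by auto
qed

lemma radial_support: "annular R f \<Longrightarrow> radial f m a b x y \<noteq> 0 \<Longrightarrow> \<bar>x\<bar> \<le> R \<and> \<bar>y\<bar> \<le> R"
proof -
  assume a: "annular R f" and "radial f m a b x y \<noteq> 0"
  then have "sqrt (x\<^sup>2 + y\<^sup>2) \<le> R" unfolding radial_def annular_def by force
  moreover have "\<bar>x\<bar> \<le> sqrt (x\<^sup>2 + y\<^sup>2)" "\<bar>y\<bar> \<le> sqrt (x\<^sup>2 + y\<^sup>2)"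
    by (auto intro!: real_le_rsqrt)
  ultimately show ?thesis by linarith
qed

text \<open>
  The singularity of \<open>|\<cdot>|\<^sup>-\<^sup>2\<^sup>m\<close> is cut off by the annulus, hence the symbol is smooth with compact support and
  its samples are multipliers uniformly in the scale.
\<close>

theorem radial_multiplier:
  assumes "annular R f"
  shows "\<exists>C>0. \<forall>l\<ge>1. fsupp (smp l (radial f m a b)) \<and> Mn (smp l (radial f m a b)) \<le> C \<and>
     (\<forall>i. Mn (sdiff i (smp l (radial f m a b))) \<le> C / l)"
proof -
  have R: "R \<ge> 0" using assms by (simp add: annular_def)
  obtain A where A: "A > 0" "csm 3 A (radial f m a b)" using csm_radial[OF assms] by blast
  have three: "(3::nat) = Suc 2" by simp
  have A2: "csm 2 A (radial f m a b)" using A(2) unfolding three by (rule csm_SucD)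
  have le: "16 * A * (2 * R + 3) \<le> 16 * A * (2 * R + 5)" and pos: "0 < 16 * A * (2 * R + 5)" using A R by simp_all
  show ?thesis
  proof (intro exI[of _ "16 * A * (2 * R + 5)"] conjI allI impI pos)
    fix l :: real assume l: "l \<ge> 1"
    show "fsupp (smp l (radial f m a b))" "Mn (smp l (radial f m a b)) \<le> 16 * A * (2 * R + 5)"
      using Mn_smp[OF l A(1) R A2, OF radial_support[OF assms, of m a b]] le by auto
    fix i show "Mn (sdiff i (smp l (radial f m a b))) \<le> 16 * A * (2 * R + 5) / l"
      using Mn_sdiff_smp[OF l A(1) R A(2), OF radial_support[OF assms, of m a b], of i] by simp
  qed
qed

section \<open>Littlewood-Paley blocks\<close>

definition snorm :: "(real^2 \<Rightarrow> complex) \<Rightarrow> real" where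
  "snorm f = (SUP x. norm (f x))"

lemma le_snorm: "cper f \<Longrightarrow> norm (f x) \<le> snorm f"
proof -
  assume "cper f"
  then obtain B where "\<And>x. norm (f x) \<le> B" using cper_bounded by blast
  then show ?thesis unfolding snorm_def by (intro cSUP_upper bdd_aboveI2[of _ _ B]) auto
qed

lemma snorm_le: "(\<And>x. norm (f x) \<le> B) \<Longrightarrow> snorm f \<le> B"
  unfolding snorm_def by (rule cSUP_least) auto

lemma snorm_nonneg: "cper f \<Longrightarrow> 0 \<le> snorm f"
  using le_snorm[of f 0] norm_ge_zero order_trans by blast

lemma norm_freq: "norm (freq k) = sqrt ((real_of_int (k $ 1))\<^sup>2 + (real_of_int (k $ 2))\<^sup>2)"
  by (simp add: norm_vec_def L2_set_def UNIV_2)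

lemma norm_freq_ge_1: "k \<noteq> 0 \<Longrightarrow> 1 \<le> norm (freq k)"
proof -
  assume "k \<noteq> 0"
  then obtain i where "k $ i \<noteq> 0" by (auto simp: vec_eq_iff)
  then have "1 \<le> \<bar>freq k $ i\<bar>" by simp
  then show ?thesis using component_le_norm_cart[of "freq k" i] by linarith
qed

lemma norm_freq_minus [simp]: "norm (freq (- k)) = norm (freq k)"
  by (simp add: freq_minus)

lemma finite_freq_ball: "finite {k. norm (freq k) \<le> X}"
proof -
  have "\<bar>real_of_int (k $ i)\<bar> \<le> norm (freq k)" for k i
    using component_le_norm_cart[of "freq k" i] by simp
  then have "{k. norm (freq k) \<le> X} \<subseteq> cube X" by (auto simp: cube_def intro: order_trans)
  then show ?thesis by (rule finite_subset) simp
qed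

lemma Mn_zero [simp]: "Mn (\<lambda>k. 0) = 0"
  by (simp add: Mn_def)

lemma Mn_one: "Mn (\<lambda>k. of_bool (k = 0)) = 1"
proof -
  have "ker (\<lambda>k. of_bool (k = 0)) x = (\<Sum>k\<in>{0}. of_bool (k = 0) * ek k x)" for x
    by (rule ker_superset) auto
  then show ?thesis by (simp add: Mn_def)
qed

lemma uniform_index_bound:
  fixes P :: "2 \<Rightarrow> real \<Rightarrow> bool"
  assumes "\<And>i. \<exists>C>0. P i C" "\<And>i C D. P i C \<Longrightarrow> C \<le> D \<Longrightarrow> P i D"
  shows "\<exists>C>0. \<forall>i. P i C"
proof -
  obtain C D where "C > 0" "P 1 C" "D > 0" "P 2 D" using assms(1) by metis
  then have "P 1 (max C D)" "P 2 (max C D)" "max C D > 0" using assms(2) by (auto simp: less_max_iff_disj)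
  then show ?thesis by (metis exhaust_2)
qed

text \<open>
  Equal to one on the annulus where \<open>lp_phi\<close> lives and supported in a slightly larger one.
\<close>

definition rho_cut :: "(real \<Rightarrow> real) \<Rightarrow> real \<Rightarrow> real" where
  "rho_cut h x = h (x / 2) - h (4 * x)"

definition msym :: "(real \<Rightarrow> real) \<Rightarrow> nat \<Rightarrow> int^2 \<Rightarrow> complex" where
  "msym h j k = (if j = 0 then of_bool (k = 0) else of_real (lp_phi h (norm (freq k) / 2 ^ j)))"

definition ssym :: "(real \<Rightarrow> real) \<Rightarrow> nat \<Rightarrow> int^2 \<Rightarrow> complex" where
  "ssym h J k = of_real (h (norm (freq k) / 2 ^ J))"

definition gsym :: "(real \<Rightarrow> real) \<Rightarrow> nat \<Rightarrow> 2 \<Rightarrow> int^2 \<Rightarrow> complex" where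
  "gsym h j l k = \<i> * of_int (k $ l) * msym h j k"

text \<open>
  The block of the projection onto gradients.
\<close>

definition psym :: "(real \<Rightarrow> real) \<Rightarrow> nat \<Rightarrow> 2 \<Rightarrow> 2 \<Rightarrow> int^2 \<Rightarrow> complex" where
  "psym h j i l k = msym h j k * of_real (of_int (k $ i) * of_int (k $ l) / (norm (freq k))\<^sup>2)"

text \<open>
  Up to the factor \<open>- \<i>\<close>, the block of the inverse Laplacian of a divergence.
\<close>

definition isym :: "(real \<Rightarrow> real) \<Rightarrow> nat \<Rightarrow> 2 \<Rightarrow> int^2 \<Rightarrow> complex" where
  "isym h j l k = msym h j k * of_real (of_int (k $ l) / (norm (freq k))\<^sup>2)"

text \<open>
  A derivative localised by the larger cutoff: it acts on a block as the derivative itself.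
\<close>

definition rsym :: "(real \<Rightarrow> real) \<Rightarrow> nat \<Rightarrow> 2 \<Rightarrow> int^2 \<Rightarrow> complex" where
  "rsym h j l k = (if j = 0 then 0 else \<i> * of_int (k $ l) * of_real (rho_cut h (norm (freq k) / 2 ^ j)))"

text \<open>
  Blocks are defined on arbitrary families of coefficients, not only on those of a function. The solutions are first
  constructed as such families.
\<close>

definition blk :: "(real \<Rightarrow> real) \<Rightarrow> nat \<Rightarrow> (int^2 \<Rightarrow> complex) \<Rightarrow> real^2 \<Rightarrow> complex" where
  "blk h j c = ker (\<lambda>k. msym h j k * c k)"

definition nb :: "(real \<Rightarrow> real) \<Rightarrow> nat \<Rightarrow> (int^2 \<Rightarrow> complex) \<Rightarrow> real" where
  "nb h j c = snorm (blk h j c)"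

locale lp_cutoff =
  fixes h :: "real \<Rightarrow> real"
  assumes cutoff: "cutoff h"
begin

lemma h_one: "0 \<le> x \<Longrightarrow> x \<le> 1 / 2 \<Longrightarrow> h x = 1"
  and h_zero: "x \<ge> 1 \<Longrightarrow> h x = 0"
  and h_range: "0 \<le> x \<Longrightarrow> 0 \<le> h x \<and> h x \<le> 1"
  using cutoff unfolding cutoff_def by (auto simp: image_subset_iff)

lemma smooth_pos_h: "smooth_pos n h"
proof -
  have d: "\<forall>n. (deriv ^^ n) h differentiable_on {0<..}" using cutoff by (simp add: cutoff_def)
  have "smooth_pos n ((deriv ^^ m) h)" for m
  proof (induction n arbitrary: m)
    case (Suc n)
    show ?case
    proof (rule smooth_pos_SucI[OF _ Suc[of "Suc m"]])
      fix x :: real assume "x > 0"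
      then have "(deriv ^^ m) h differentiable (at x)"
        using d[rule_format, of m] by (simp add: differentiable_on_eq_differentiable_at)
      then show "((deriv ^^ m) h has_real_derivative (deriv ^^ Suc m) h x) (at x)"
        by (simp add: DERIV_deriv_iff_real_differentiable)
    qed
  qed simp
  from this[of 0] show ?thesis by simp
qed

lemma phi_zero: "0 \<le> x \<Longrightarrow> x \<le> 1 / 4 \<or> x \<ge> 1 \<Longrightarrow> lp_phi h x = 0"
  by (auto simp: lp_phi_def h_one h_zero)

lemma annular_phi: "annular 1 (lp_phi h)"
proof -
  have "smooth_pos n (lp_phi h)" for n
  proof -
    have "smooth_pos n (\<lambda>x. h x + (-1) * h (2 * x))"
      by (intro smooth_pos_add smooth_pos_mult smooth_pos_const smooth_pos_scale smooth_pos_h) simp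
    then show ?thesis by (simp add: lp_phi_def[abs_def])
  qed
  then show ?thesis unfolding annular_def by (auto intro!: exI[of _ "1/4"] phi_zero)
qed

lemma annular_rho: "annular 2 (rho_cut h)"
proof -
  have "smooth_pos n (rho_cut h)" for n
  proof -
    have "smooth_pos n (\<lambda>x. h ((1/2) * x) + (-1) * h (4 * x))"
      by (intro smooth_pos_add smooth_pos_mult smooth_pos_const smooth_pos_scale smooth_pos_h) simp_all
    then show ?thesis by (simp add: rho_cut_def[abs_def])
  qed
  then show ?thesis unfolding annular_def by (auto intro!: exI[of _ "1/8"] simp: rho_cut_def h_one h_zero)
qed

lemma ssym_one: "norm (freq k) \<le> 2 ^ J / 2 \<Longrightarrow> ssym h J k = 1"
  by (simp add: ssym_def h_one field_simps)

lemma ssym_zero: "norm (freq k) \<ge> 2 ^ J \<Longrightarrow> ssym h J k = 0"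
  by (simp add: ssym_def h_zero)

text \<open>
  The blocks telescope: their partial sums are the smooth truncations at frequency \<open>2\<^sup>J\<close>.
\<close>

lemma ssym_eq_sum: "ssym h J k = (\<Sum>j\<le>J. msym h j k)"
proof (induction J)
  case 0
  show ?case
  proof (cases "k = 0")
    case False then show ?thesis using norm_freq_ge_1[OF False] by (simp add: msym_def ssym_def h_zero)
  qed (simp add: msym_def ssym_def h_one)
next
  case (Suc J)
  have "msym h (Suc J) k = ssym h (Suc J) k - ssym h J k"
    by (simp add: msym_def ssym_def lp_phi_def)
  then show ?case using Suc by simp
qed

lemma msym_nonzeroD:
  assumes "msym h j k \<noteq> 0"
  shows "norm (freq k) < 2 ^ j" "j \<noteq> 0 \<Longrightarrow> 2 ^ j / 4 < norm (freq k)"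
proof -
  show "norm (freq k) < 2 ^ j"
    using assms phi_zero[of "norm (freq k) / 2 ^ j"] by (auto simp: msym_def split: if_splits) (force simp: not_less)
  show "2 ^ j / 4 < norm (freq k)" if "j \<noteq> 0"
  proof (rule ccontr)
    assume "\<not> 2 ^ j / 4 < norm (freq k)"
    then have "norm (freq k) / 2 ^ j \<le> 1 / 4" by (simp add: field_simps)
    then have "lp_phi h (norm (freq k) / 2 ^ j) = 0" by (intro phi_zero) auto
    then show False using assms that by (simp add: msym_def)
  qed
qed

lemma fsupp_msym [simp]: "fsupp (msym h j)"
  by (rule finite_subset[OF _ finite_freq_ball[of "2 ^ j"]]) (auto dest: msym_nonzeroD)

lemma fsupp_ssym [simp]: "fsupp (ssym h J)"
  by (rule finite_subset[OF _ finite_freq_ball[of "2 ^ J"]]) (auto simp: not_le[symmetric] dest: ssym_zero[of J, rotated] intro: ccontr ssym_zero order.strict_implies_order)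

lemma norm_msym_le: "norm (msym h j k) \<le> 1"
proof -
  have "\<bar>lp_phi h x\<bar> \<le> 1" if "x \<ge> 0" for x
    using h_range[of x] h_range[of "2 * x"] that by (auto simp: lp_phi_def)
  then show ?thesis by (simp add: msym_def)
qed

lemma fsupp_gsym [simp]: "fsupp (gsym h j l)"
  unfolding gsym_def by simp

lemma fsupp_psym [simp]: "fsupp (psym h j i l)"
  unfolding psym_def by simp

lemma fsupp_isym [simp]: "fsupp (isym h j l)"
  unfolding isym_def by simp

lemma rho_one: "1 / 4 \<le> x \<Longrightarrow> x \<le> 1 \<Longrightarrow> rho_cut h x = 1"
  by (simp add: rho_cut_def h_one h_zero)

lemma rsym_msym: "rsym h j l k * msym h j k = \<i> * of_int (k $ l) * msym h j k"
proof (cases "msym h j k = 0")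
  case False
  from msym_nonzeroD[OF this] show ?thesis
  proof (cases "j = 0")
    case True
    then show ?thesis using False by (auto simp: rsym_def msym_def)
  next
    case j: False
    have "rho_cut h (norm (freq k) / 2 ^ j) = 1"
      using msym_nonzeroD(1)[OF False] msym_nonzeroD(2)[OF False j] by (intro rho_one) (auto simp: field_simps)
    then show ?thesis using j by (simp add: rsym_def)
  qed
qed simp

definition ex :: "2 \<Rightarrow> 2 \<Rightarrow> nat" where "ex d i = of_bool (d = i)"

lemma ex_simps: "x ^ ex 1 1 * y ^ ex 2 1 = x" "x ^ ex 1 2 * y ^ ex 2 2 = (y::real)"
  by (simp_all add: ex_def)

lemma ex_coord: "(real_of_int (k $ 1) / l) ^ ex 1 i * (real_of_int (k $ 2) / l) ^ ex 2 i = real_of_int (k $ i) / l"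
  using exhaust_2[of i] by (auto simp: ex_simps)

lemma sum_sq_scaled: "l > 0 \<Longrightarrow> (real_of_int (k $ 1) / l)\<^sup>2 + (real_of_int (k $ 2) / l)\<^sup>2 = (norm (freq k))\<^sup>2 / l\<^sup>2"
  by (simp add: norm_freq power_divide add_divide_distrib)

lemma smp_radial: "l > 0 \<Longrightarrow> smp l (radial f m a b) k =
    of_real ((of_int (k $ 1) / l) ^ a * (of_int (k $ 2) / l) ^ b * (f (norm (freq k) / l) * (l\<^sup>2 / (norm (freq k))\<^sup>2) ^ m))"
  unfolding smp_def radial_def sum_sq_scaled by (simp add: real_sqrt_divide)

lemma msym_smp: "j \<noteq> 0 \<Longrightarrow> msym h j = smp (2 ^ j) (radial (lp_phi h) 0 0 0)"
  by (intro ext) (auto simp: msym_def smp_radial)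

lemma gsym_smp: "j \<noteq> 0 \<Longrightarrow> gsym h j i = (\<lambda>k. (\<i> * 2 ^ j) * smp (2 ^ j) (radial (lp_phi h) 0 (ex 1 i) (ex 2 i)) k)"
  by (intro ext) (auto simp: gsym_def msym_def smp_radial ex_coord)

lemma rsym_smp: "j \<noteq> 0 \<Longrightarrow> rsym h j i = (\<lambda>k. (\<i> * 2 ^ j) * smp (2 ^ j) (radial (rho_cut h) 0 (ex 1 i) (ex 2 i)) k)"
  by (intro ext) (auto simp: rsym_def smp_radial ex_coord)

lemma isym_smp: "j \<noteq> 0 \<Longrightarrow> isym h j i = (\<lambda>k. (1 / 2 ^ j) * smp (2 ^ j) (radial (lp_phi h) 1 (ex 1 i) (ex 2 i)) k)"
  by (intro ext) (auto simp: isym_def msym_def smp_radial ex_coord power2_eq_square)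

lemma psym_smp: "j \<noteq> 0 \<Longrightarrow> psym h j i l = smp (2 ^ j) (radial (lp_phi h) 1 (ex 1 i + ex 1 l) (ex 2 i + ex 2 l))"
proof
  fix k :: "int^2" assume j: "j \<noteq> 0"
  let ?l = "2 ^ j :: real"
  have "(real_of_int (k $ 1) / ?l) ^ (ex 1 i + ex 1 l) * (real_of_int (k $ 2) / ?l) ^ (ex 2 i + ex 2 l)
    = ((real_of_int (k $ 1) / ?l) ^ ex 1 i * (real_of_int (k $ 2) / ?l) ^ ex 2 i) * ((real_of_int (k $ 1) / ?l) ^ ex 1 l * (real_of_int (k $ 2) / ?l) ^ ex 2 l)"
    by (simp add: power_add mult_ac)
  also have "\<dots> = (of_int (k $ i) / ?l) * (of_int (k $ l) / ?l)" by (simp only: ex_coord)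
  finally show "psym h j i l k = smp (2 ^ j) (radial (lp_phi h) 1 (ex 1 i + ex 1 l) (ex 2 i + ex 2 l)) k"
    using j by (simp add: psym_def msym_def smp_radial power2_eq_square)
qed

lemma one_le_pow2: "1 \<le> (2::real) ^ j"
  by simp

text \<open>
  All symbols are samples of \<open>radial\<close> profiles at scale \<open>2\<^sup>j\<close>, multiplied by the power of \<open>2\<^sup>j\<close> that
  corresponds to their degree of homogeneity. The block \<open>0\<close> consists of one frequency and is treated by hand.
\<close>

theorem multiplier_bounds:
  "\<exists>C\<ge>1. \<forall>j i l d. Mn (msym h j) \<le> C \<and> Mn (sdiff d (gsym h j i)) \<le> C \<and> Mn (psym h j i l) \<le> C \<and>
     fsupp (rsym h j i) \<and> Mn (rsym h j i) \<le> C * 2 ^ j \<and> Mn (isym h j i) \<le> C / 2 ^ j"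
proof -
  obtain C1 where C1: "C1 > 0" "\<And>l. l \<ge> 1 \<Longrightarrow> Mn (smp l (radial (lp_phi h) 0 0 0)) \<le> C1"
    using radial_multiplier[OF annular_phi] by blast
  have "\<exists>C>0. \<forall>i. \<forall>l\<ge>1. \<forall>d. Mn (sdiff d (smp l (radial (lp_phi h) 0 (ex 1 i) (ex 2 i)))) \<le> C / l"
  proof (rule uniform_index_bound)
    show "\<exists>C>0. \<forall>l\<ge>1. \<forall>d. Mn (sdiff d (smp l (radial (lp_phi h) 0 (ex 1 i) (ex 2 i)))) \<le> C / l" for i
      using radial_multiplier[OF annular_phi, of 0 "ex 1 i" "ex 2 i"] by blast
  qed (meson divide_right_mono order_trans zero_le_one)
  then obtain C2 where C2: "C2 > 0" "\<And>i l d. l \<ge> 1 \<Longrightarrow> Mn (sdiff d (smp l (radial (lp_phi h) 0 (ex 1 i) (ex 2 i)))) \<le> C2 / l" by blast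
  have "\<exists>C>0. \<forall>i. \<forall>j. \<forall>l\<ge>1. Mn (smp l (radial (lp_phi h) 1 (ex 1 i + ex 1 j) (ex 2 i + ex 2 j))) \<le> C"
  proof (rule uniform_index_bound)
    show "\<exists>C>0. \<forall>j. \<forall>l\<ge>1. Mn (smp l (radial (lp_phi h) 1 (ex 1 i + ex 1 j) (ex 2 i + ex 2 j))) \<le> C" for i
    proof (rule uniform_index_bound)
      show "\<exists>C>0. \<forall>l\<ge>1. Mn (smp l (radial (lp_phi h) 1 (ex 1 i + ex 1 j) (ex 2 i + ex 2 j))) \<le> C" for j
        using radial_multiplier[OF annular_phi, of 1 "ex 1 i + ex 1 j" "ex 2 i + ex 2 j"] by blast
    qed (meson order_trans)
  qed (meson order_trans)
  then obtain C3 where C3: "C3 > 0" "\<And>i j l. l \<ge> 1 \<Longrightarrow> Mn (smp l (radial (lp_phi h) 1 (ex 1 i + ex 1 j) (ex 2 i + ex 2 j))) \<le> C3" by blast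
  have "\<exists>C>0. \<forall>i. \<forall>l\<ge>1. fsupp (smp l (radial (rho_cut h) 0 (ex 1 i) (ex 2 i))) \<and> Mn (smp l (radial (rho_cut h) 0 (ex 1 i) (ex 2 i))) \<le> C"
  proof (rule uniform_index_bound)
    show "\<exists>C>0. \<forall>l\<ge>1. fsupp (smp l (radial (rho_cut h) 0 (ex 1 i) (ex 2 i))) \<and> Mn (smp l (radial (rho_cut h) 0 (ex 1 i) (ex 2 i))) \<le> C" for i
      using radial_multiplier[OF annular_rho, of 0 "ex 1 i" "ex 2 i"] by blast
  qed (meson order_trans)
  then obtain C4 where C4: "C4 > 0" "\<And>i l. l \<ge> 1 \<Longrightarrow> fsupp (smp l (radial (rho_cut h) 0 (ex 1 i) (ex 2 i)))"
    "\<And>i l. l \<ge> 1 \<Longrightarrow> Mn (smp l (radial (rho_cut h) 0 (ex 1 i) (ex 2 i))) \<le> C4" by blast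
  have "\<exists>C>0. \<forall>i. \<forall>l\<ge>1. Mn (smp l (radial (lp_phi h) 1 (ex 1 i) (ex 2 i))) \<le> C"
  proof (rule uniform_index_bound)
    show "\<exists>C>0. \<forall>l\<ge>1. Mn (smp l (radial (lp_phi h) 1 (ex 1 i) (ex 2 i))) \<le> C" for i
      using radial_multiplier[OF annular_phi, of 1 "ex 1 i" "ex 2 i"] by blast
  qed (meson order_trans)
  then obtain C5 where C5: "C5 > 0" "\<And>i l. l \<ge> 1 \<Longrightarrow> Mn (smp l (radial (lp_phi h) 1 (ex 1 i) (ex 2 i))) \<le> C5" by blast
  define C where "C = 1 + C1 + C2 + C3 + C4 + C5"
  have C: "C \<ge> 1" "C1 \<le> C" "C2 \<le> C" "C3 \<le> C" "C4 \<le> C" "C5 \<le> C"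
    using C1 C2 C3 C4 C5 by (auto simp: C_def)
  show ?thesis
  proof (intro exI[of _ C] conjI allI C(1))
    fix j i l d
    show "Mn (msym h j) \<le> C"
    proof (cases "j = 0")
      case True
      then have "msym h j = (\<lambda>k. of_bool (k = 0))" by (intro ext) (auto simp: msym_def)
      then show ?thesis using C by (simp add: Mn_one)
    qed (use C1(2)[OF one_le_pow2] C in \<open>simp add: msym_smp, meson order_trans\<close>)
    show "Mn (sdiff d (gsym h j i)) \<le> C"
    proof (cases "j = 0")
      case True
      then have "gsym h j i = (\<lambda>k. 0)" by (intro ext) (auto simp: gsym_def msym_def)
      moreover have "sdiff d (\<lambda>k. 0) = (\<lambda>k. 0)" by (intro ext) (auto simp: sdiff_def)
      ultimately show ?thesis using C by simp
    next
      case False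
      have "2 ^ j * Mn (sdiff d (smp (2 ^ j) (radial (lp_phi h) 0 (ex 1 i) (ex 2 i)))) \<le> 2 ^ j * (C2 / 2 ^ j)"
        by (intro mult_left_mono C2) auto
      then show ?thesis using C by (simp add: gsym_smp[OF False] sdiff_cmult Mn_cmult norm_mult norm_power)
    qed
    show "Mn (psym h j i l) \<le> C"
    proof (cases "j = 0")
      case True
      then have "psym h j i l = (\<lambda>k. 0)" by (intro ext) (auto simp: psym_def msym_def)
      then show ?thesis using C by simp
    qed (use C3(2)[OF one_le_pow2] C in \<open>simp add: psym_smp, meson order_trans\<close>)
    show "fsupp (rsym h j i)"
    proof (cases "j = 0")
      case True
      then show ?thesis by (simp add: rsym_def)
    next
      case False
      show ?thesis unfolding rsym_smp[OF False] by (rule fsupp_mult_left[OF C4(2)]) simp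
    qed
    show "Mn (rsym h j i) \<le> C * 2 ^ j"
    proof (cases "j = 0")
      case True
      then have "rsym h j i = (\<lambda>k. 0)" by (intro ext) (auto simp: rsym_def)
      then show ?thesis using C by simp
    next
      case False
      have "2 ^ j * Mn (smp (2 ^ j) (radial (rho_cut h) 0 (ex 1 i) (ex 2 i))) \<le> 2 ^ j * C"
        by (intro mult_left_mono order_trans[OF C4(3)] C) auto
      then show ?thesis by (simp add: rsym_smp[OF False] Mn_cmult norm_mult norm_power mult.commute)
    qed
    show "Mn (isym h j i) \<le> C / 2 ^ j"
    proof (cases "j = 0")
      case True
      then have "isym h j i = (\<lambda>k. 0)" by (intro ext) (auto simp: isym_def msym_def)
      then show ?thesis using C by simp
    next
      case False
      have "(1 / 2 ^ j) * Mn (smp (2 ^ j) (radial (lp_phi h) 1 (ex 1 i) (ex 2 i))) \<le> (1 / 2 ^ j) * C"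
        by (intro mult_left_mono order_trans[OF C5(2)] C) auto
      then show ?thesis unfolding isym_smp[OF False] Mn_cmult by (simp add: norm_power norm_divide)
    qed
  qed
qed

text \<open>
  One constant for the five families of multipliers; only its independence of \<open>j\<close> matters.
\<close>

definition CM :: real where
  "CM = (SOME C. C \<ge> 1 \<and> (\<forall>j i l d. Mn (msym h j) \<le> C \<and> Mn (sdiff d (gsym h j i)) \<le> C \<and> Mn (psym h j i l) \<le> C \<and>
     fsupp (rsym h j i) \<and> Mn (rsym h j i) \<le> C * 2 ^ j \<and> Mn (isym h j i) \<le> C / 2 ^ j))"

lemma CM: "CM \<ge> 1" "Mn (msym h j) \<le> CM" "Mn (sdiff d (gsym h j i)) \<le> CM" "Mn (psym h j i l) \<le> CM"
    "Mn (rsym h j i) \<le> CM * 2 ^ j" "Mn (isym h j i) \<le> CM / 2 ^ j"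
  and fsupp_rsym [simp]: "fsupp (rsym h j i)"
  using someI_ex[OF multiplier_bounds] unfolding CM_def by blast+

lemma cper_blk: "cper (blk h j c)"
  unfolding blk_def by (rule cper_ker)

lemma fsupp_blk [simp]: "fsupp (\<lambda>k. msym h j k * c k)"
  by simp

lemma fc_blk: "fc (blk h j c) k = msym h j k * c k"
  by (simp add: blk_def fc_ker)

lemma norm_blk_le: "norm (blk h j c x) \<le> nb h j c"
  unfolding nb_def by (rule le_snorm[OF cper_blk])

lemma nb_nonneg: "0 \<le> nb h j c"
  unfolding nb_def by (rule snorm_nonneg[OF cper_blk])

definition dblk :: "2 \<Rightarrow> nat \<Rightarrow> (int^2 \<Rightarrow> complex) \<Rightarrow> real^2 \<Rightarrow> complex" where
  "dblk i j c = ker (\<lambda>k. \<i> * of_int (k $ i) * (msym h j k * c k))"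

lemma pder_blk: "pder i (blk h j c) (dblk i j c)"
  unfolding blk_def dblk_def by (rule pder_ker) simp

lemma cper_dblk: "cper (dblk i j c)"
  unfolding dblk_def by (rule cper_ker)

lemma dblk_Op: "dblk i j c x = Op (rsym h j i) (blk h j c) x"
  unfolding dblk_def Op_def fc_blk mult.assoc[symmetric] rsym_msym ..

text \<open>
  Bernstein's inequality.
\<close>

lemma norm_dblk_le: "norm (dblk i j c x) \<le> CM * 2 ^ j * nb h j c"
proof -
  have "norm (dblk i j c x) \<le> Mn (rsym h j i) * nb h j c"
    unfolding dblk_Op by (intro norm_Op_le fsupp_rsym cper_blk norm_blk_le)
  then show ?thesis using mult_right_mono[OF CM(5) nb_nonneg] by (meson order_trans)
qed

end

section \<open>The interaction of two blocks\<close>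

text \<open>
  For a divergence-free \<open>A\<close> the transport term \<open>A \<cdot> \<nabla>g\<close> is the divergence of \<open>A g\<close>.
\<close>

lemma fc_div_free_transport:
  assumes A: "\<And>l. cper (A l)" "\<And>l. cper (A' l l)" "\<And>l. pder l (A l) (A' l l)" and div: "\<And>x. (\<Sum>l\<in>UNIV. A' l l x) = 0"
    and g: "cper g" "\<And>l. cper (g' l)" "\<And>l. pder l g (g' l)"
  shows "fc (\<lambda>x. \<Sum>l\<in>UNIV. A l x * g' l x) k = (\<Sum>l\<in>UNIV. \<i> * of_int (k $ l) * fc (\<lambda>x. A l x * g x) k)"
proof -
  have "fc (\<lambda>x. \<Sum>l\<in>UNIV. A l x * g' l x) k = fc (\<lambda>x. (\<Sum>l\<in>UNIV. A l x * g' l x + A' l l x * g x)) k"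
  proof (rule arg_cong2[where f = fc, OF _ refl], rule ext)
    fix x
    have "(\<Sum>l\<in>UNIV. A l x * g' l x + A' l l x * g x) = (\<Sum>l\<in>UNIV. A l x * g' l x) + (\<Sum>l\<in>UNIV. A' l l x) * g x"
      by (simp add: sum.distrib sum_distrib_right)
    then show "(\<Sum>l\<in>UNIV. A l x * g' l x) = (\<Sum>l\<in>UNIV. A l x * g' l x + A' l l x * g x)" by (simp add: div)
  qed
  also have "\<dots> = (\<Sum>l\<in>UNIV. fc (\<lambda>x. A l x * g' l x + A' l l x * g x) k)"
    by (intro fc_sum cper_add cper_mult A g)
  also have "\<dots> = (\<Sum>l\<in>UNIV. \<i> * of_int (k $ l) * fc (\<lambda>x. A l x * g x) k)"
    by (intro sum.cong refl fc_pder cper_add cper_mult A g pder_mult)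
  finally show ?thesis .
qed

lemma norm_sum2_le:
  fixes f :: "2 \<Rightarrow> 'b::real_normed_vector"
  shows "(\<And>l. norm (f l) \<le> B) \<Longrightarrow> norm (\<Sum>l\<in>UNIV. f l) \<le> 2 * B"
  using sum_norm_le[of "UNIV :: 2 set" f "\<lambda>_. B"] by simp

lemma norm_prod_sum2_le:
  fixes A g :: "2 \<Rightarrow> real^2 \<Rightarrow> complex"
  assumes "\<And>l x. norm (A l x) \<le> a" "\<And>l x. norm (g l x) \<le> c"
  shows "norm (\<Sum>l\<in>UNIV. A l x * g l x) \<le> 2 * (a * c)"
  using order_trans[OF norm_ge_zero assms(1)] by (intro norm_sum2_le) (auto simp: norm_mult intro!: mult_mono assms)

definition divfree :: "(2 \<Rightarrow> int^2 \<Rightarrow> complex) \<Rightarrow> bool" where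
  "divfree c \<longleftrightarrow> (\<forall>k. (\<Sum>l\<in>UNIV. of_int (k $ l) * c l k) = 0)"

context lp_cutoff
begin

lemma Op_deriv: "fsupp n \<Longrightarrow> cper g \<Longrightarrow> cper g' \<Longrightarrow> pder l g g' \<Longrightarrow> Op n g' x = Op (\<lambda>k. \<i> * of_int (k $ l) * n k) g x"
  unfolding Op_def by (simp add: fc_pder mult_ac)

text \<open>
  Two bounds for the commutator of a block with the transport, one for each order of the frequencies. The first bounds
  both terms separately and costs the gradient of \<open>g\<close>. For the second the transport is written as a divergence, so
  that the derivative falls on the multiplier and the commutator estimate costs only the gradient of \<open>A\<close>.
\<close>

lemma transport_commutator_le:
  assumes A: "\<And>l. cper (A l)" "\<And>l i. cper (A' l i)" "\<And>l i. pder i (A l) (A' l i)"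
    and div: "\<And>x. (\<Sum>l\<in>UNIV. A' l l x) = 0"
    and g: "cper g" "\<And>l. cper (g' l)" "\<And>l. pder l g (g' l)"
    and bA: "\<And>l x. norm (A l x) \<le> a" and bA': "\<And>l i x. norm (A' l i x) \<le> a'"
    and bg: "\<And>x. norm (g x) \<le> c" and bg': "\<And>l x. norm (g' l x) \<le> c'"
  shows "norm (Op (msym h j) (\<lambda>x. \<Sum>l\<in>UNIV. A l x * g' l x) x - (\<Sum>l\<in>UNIV. A l x * Op (msym h j) (g' l) x)) \<le> 4 * CM * a * c'"
    and "norm (Op (msym h j) (\<lambda>x. \<Sum>l\<in>UNIV. A l x * g' l x) x - (\<Sum>l\<in>UNIV. A l x * Op (msym h j) (g' l) x)) \<le> 8 * CM * a' * c"
proof -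
  have a: "0 \<le> a" "0 \<le> a'" "0 \<le> c" "0 \<le> c'"
    using order_trans[OF norm_ge_zero bA] order_trans[OF norm_ge_zero bA'] order_trans[OF norm_ge_zero bg] order_trans[OF norm_ge_zero bg'] by auto
  let ?L = "Op (msym h j) (\<lambda>x. \<Sum>l\<in>UNIV. A l x * g' l x) x"
  have "norm ?L \<le> Mn (msym h j) * (2 * (a * c'))"
    by (intro norm_Op_le fsupp_msym cper_sum cper_mult A g norm_prod_sum2_le bA bg')
  also have "\<dots> \<le> CM * (2 * (a * c'))" using a by (intro mult_right_mono CM) auto
  finally have 1: "norm ?L \<le> CM * (2 * (a * c'))" .
  have "norm (Op (msym h j) (g' l) x) \<le> CM * c'" for l x
  proof -
    have "norm (Op (msym h j) (g' l) x) \<le> Mn (msym h j) * c'" by (intro norm_Op_le fsupp_msym g bg')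
    also have "\<dots> \<le> CM * c'" using a by (intro mult_right_mono CM) auto
    finally show ?thesis .
  qed
  then have "norm (\<Sum>l\<in>UNIV. A l x * Op (msym h j) (g' l) x) \<le> 2 * (a * (CM * c'))"
    by (intro norm_prod_sum2_le bA)
  with 1 show "norm (?L - (\<Sum>l\<in>UNIV. A l x * Op (msym h j) (g' l) x)) \<le> 4 * CM * a * c'"
    using norm_triangle_ineq4[of ?L "\<Sum>l\<in>UNIV. A l x * Op (msym h j) (g' l) x"] by (simp add: algebra_simps)
  have g1: "gsym h j l = (\<lambda>k. \<i> * of_int (k $ l) * msym h j k)" for l by (simp add: gsym_def[abs_def])
  have "?L = ker (\<lambda>k. \<Sum>l\<in>UNIV. gsym h j l k * fc (\<lambda>x. A l x * g x) k) x"
    unfolding Op_def fc_div_free_transport[where A' = A', OF A(1) A(2) A(3) div g]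
    by (simp add: gsym_def sum_distrib_left mult_ac)
  also have "\<dots> = (\<Sum>l\<in>UNIV. Op (gsym h j l) (\<lambda>x. A l x * g x) x)"
    unfolding Op_def by (rule ker_sum) simp
  finally have L: "?L = (\<Sum>l\<in>UNIV. Op (gsym h j l) (\<lambda>x. A l x * g x) x)" .
  have "Op (msym h j) (g' l) x = Op (gsym h j l) g x" for l
    unfolding g1 by (rule Op_deriv) (simp_all add: g)
  then have "?L - (\<Sum>l\<in>UNIV. A l x * Op (msym h j) (g' l) x)
     = (\<Sum>l\<in>UNIV. Op (gsym h j l) (\<lambda>x. A l x * g x) x - A l x * Op (gsym h j l) g x)"
    by (simp add: L sum_subtractf)
  also have "norm \<dots> \<le> 2 * (2 * a' * (2 * CM) * c)"
  proof (rule norm_sum2_le)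
    fix l
    have "norm (Op (gsym h j l) (\<lambda>x. A l x * g x) x - A l x * Op (gsym h j l) g x)
       \<le> (2 * a') * (Mn (sdiff 1 (gsym h j l)) + Mn (sdiff 2 (gsym h j l))) * c"
      by (rule norm_Op_commutator_le[OF fsupp_gsym A(1) g(1) bg c1_chord_lipschitz[OF A(1) A(3) bA']])
    also have "\<dots> \<le> (2 * a') * (CM + CM) * c"
      using a by (intro mult_right_mono mult_left_mono add_mono CM) auto
    finally show "norm (Op (gsym h j l) (\<lambda>x. A l x * g x) x - A l x * Op (gsym h j l) g x) \<le> 2 * a' * (2 * CM) * c" by simp
  qed
  finally show "norm (?L - (\<Sum>l\<in>UNIV. A l x * Op (msym h j) (g' l) x)) \<le> 8 * CM * a' * c" by (simp add: mult_ac)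
qed

text \<open>
  The block \<open>j\<close> of the gradient part of \<open>f\<close>, which is what the Leray projection removes.
\<close>

definition press :: "nat \<Rightarrow> 2 \<Rightarrow> (2 \<Rightarrow> real^2 \<Rightarrow> complex) \<Rightarrow> real^2 \<Rightarrow> complex" where
  "press j i f x = (\<Sum>l\<in>UNIV. Op (psym h j i l) (f l) x)"

lemma norm_press_le:
  assumes "\<And>l. cper (f l)" "\<And>l x. norm (f l x) \<le> B"
  shows "norm (press j i f x) \<le> 2 * CM * B"
proof -
  have "norm (Op (psym h j i l) (f l) x) \<le> CM * B" for l
  proof -
    have "norm (Op (psym h j i l) (f l) x) \<le> Mn (psym h j i l) * B" by (intro norm_Op_le fsupp_psym assms)
    also have "\<dots> \<le> CM * B" using order_trans[OF norm_ge_zero assms(2)] by (intro mult_right_mono CM)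
    finally show ?thesis .
  qed
  from norm_sum2_le[of "\<lambda>l. Op (psym h j i l) (f l) x", OF this] show ?thesis by (simp add: press_def mult_ac)
qed

text \<open>
  For divergence-free fields the divergence of \<open>A \<cdot> \<nabla>V\<close> is \<open>\<Sum> \<partial>\<^sub>m A\<^sub>l \<partial>\<^sub>l V\<^sub>m\<close>, which is symmetric in
  \<open>A\<close> and \<open>V\<close>. So the pressure may be charged to the gradient of either factor.
\<close>

lemma press_symmetric:
  assumes A: "\<And>l. cper (A l)" "\<And>l i. cper (A' l i)" "\<And>l i. pder i (A l) (A' l i)"
    and divA: "\<And>x. (\<Sum>l\<in>UNIV. A' l l x) = 0"
    and V: "\<And>l. cper (V l)" "\<And>l i. cper (V' l i)" "\<And>l i. pder i (V l) (V' l i)"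
    and divV: "\<And>x. (\<Sum>l\<in>UNIV. V' l l x) = 0"
  shows "press j i (\<lambda>l x. \<Sum>m\<in>UNIV. A m x * V' l m x) x = press j i (\<lambda>m x. \<Sum>l\<in>UNIV. V l x * A' m l x) x"
proof -
  have pk: "press j i f x = ker (\<lambda>k. \<Sum>l\<in>UNIV. psym h j i l k * fc (f l) k) x" for f
    unfolding press_def Op_def by (rule ker_sum[symmetric]) simp
  have "(\<Sum>l\<in>UNIV. psym h j i l k * fc (\<lambda>x. \<Sum>m\<in>UNIV. A m x * V' l m x) k)
      = (\<Sum>m\<in>UNIV. psym h j i m k * fc (\<lambda>x. \<Sum>l\<in>UNIV. V l x * A' m l x) k)" for k
  proof -
    have 1: "fc (\<lambda>x. \<Sum>m\<in>UNIV. A m x * V' l m x) k = (\<Sum>m\<in>UNIV. \<i> * of_int (k $ m) * fc (\<lambda>x. A m x * V l x) k)" for l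
      by (rule fc_div_free_transport[where A' = A']) (rule A V divA)+
    have 2: "fc (\<lambda>x. \<Sum>l\<in>UNIV. V l x * A' m l x) k = (\<Sum>l\<in>UNIV. \<i> * of_int (k $ l) * fc (\<lambda>x. V l x * A m x) k)" for m
      by (rule fc_div_free_transport[where A' = V']) (rule A V divV)+
    have "(\<Sum>l\<in>UNIV. psym h j i l k * fc (\<lambda>x. \<Sum>m\<in>UNIV. A m x * V' l m x) k)
       = (\<Sum>l\<in>UNIV. \<Sum>m\<in>UNIV. psym h j i l k * (\<i> * of_int (k $ m) * fc (\<lambda>x. A m x * V l x) k))"
      unfolding 1 by (simp only: sum_distrib_left)
    also have "\<dots> = (\<Sum>m\<in>UNIV. \<Sum>l\<in>UNIV. psym h j i l k * (\<i> * of_int (k $ m) * fc (\<lambda>x. A m x * V l x) k))"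
      by (rule sum.swap)
    also have "\<dots> = (\<Sum>m\<in>UNIV. \<Sum>l\<in>UNIV. psym h j i m k * (\<i> * of_int (k $ l) * fc (\<lambda>x. V l x * A m x) k))"
      by (intro sum.cong refl) (simp add: psym_def mult.commute mult.left_commute)
    also have "\<dots> = (\<Sum>m\<in>UNIV. psym h j i m k * fc (\<lambda>x. \<Sum>l\<in>UNIV. V l x * A' m l x) k)"
      unfolding 2 by (simp only: sum_distrib_left)
    finally show ?thesis .
  qed
  then show ?thesis unfolding pk by simp
qed

lemma press_le:
  assumes A: "\<And>l. cper (A l)" "\<And>l i. cper (A' l i)" "\<And>l i. pder i (A l) (A' l i)"
    and divA: "\<And>x. (\<Sum>l\<in>UNIV. A' l l x) = 0"
    and V: "\<And>l. cper (V l)" "\<And>l i. cper (V' l i)" "\<And>l i. pder i (V l) (V' l i)"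
    and divV: "\<And>x. (\<Sum>l\<in>UNIV. V' l l x) = 0"
    and bA: "\<And>l x. norm (A l x) \<le> a" and bA': "\<And>l i x. norm (A' l i x) \<le> a'"
    and bV: "\<And>l x. norm (V l x) \<le> c" and bV': "\<And>l i x. norm (V' l i x) \<le> c'"
  shows "norm (press j i (\<lambda>l x. \<Sum>m\<in>UNIV. A m x * V' l m x) x) \<le> 4 * CM * a * c'"
    and "norm (press j i (\<lambda>l x. \<Sum>m\<in>UNIV. A m x * V' l m x) x) \<le> 4 * CM * a' * c"
proof -
  have "norm (press j i (\<lambda>l x. \<Sum>m\<in>UNIV. A m x * V' l m x) x) \<le> 2 * CM * (2 * (a * c'))"
    by (intro norm_press_le cper_sum cper_mult A V norm_prod_sum2_le bA bV')
  then show "norm (press j i (\<lambda>l x. \<Sum>m\<in>UNIV. A m x * V' l m x) x) \<le> 4 * CM * a * c'" by simp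
  have "norm (press j i (\<lambda>m x. \<Sum>l\<in>UNIV. V l x * A' m l x) x) \<le> 2 * CM * (2 * (c * a'))"
    by (intro norm_press_le cper_sum cper_mult A V norm_prod_sum2_le bA' bV)
  then show "norm (press j i (\<lambda>l x. \<Sum>m\<in>UNIV. A m x * V' l m x) x) \<le> 4 * CM * a' * c"
    by (simp add: press_symmetric[OF A divA V divV] mult_ac)
qed

lemma divfree_dblk: "divfree c \<Longrightarrow> (\<Sum>l\<in>UNIV. dblk l j (c l) x) = 0"
proof -
  assume c: "divfree c"
  have "(\<Sum>l\<in>UNIV. dblk l j (c l) x) = ker (\<lambda>k. \<Sum>l\<in>UNIV. \<i> * of_int (k $ l) * (msym h j k * c l k)) x"
    unfolding dblk_def by (rule ker_sum[symmetric]) simp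
  also have "(\<lambda>k. \<Sum>l\<in>UNIV. \<i> * of_int (k $ l) * (msym h j k * c l k)) = (\<lambda>k. \<i> * msym h j k * (\<Sum>l\<in>UNIV. of_int (k $ l) * c l k))"
    by (simp add: sum_distrib_left mult_ac)
  finally show ?thesis using c by (simp add: divfree_def)
qed

text \<open>
  The interaction of the block \<open>p\<close> of \<open>b\<close> with the block \<open>q\<close> of \<open>v\<close> at output frequency \<open>j\<close>:
  the commutator left over when the transport of the block stays on the left of the equation, minus the pressure.
\<close>

definition inter :: "nat \<Rightarrow> 2 \<Rightarrow> (2 \<Rightarrow> int^2 \<Rightarrow> complex) \<Rightarrow> (2 \<Rightarrow> int^2 \<Rightarrow> complex) \<Rightarrow> nat \<Rightarrow> nat \<Rightarrow> real^2 \<Rightarrow> complex" where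
  "inter j i b v p q x =
     (Op (msym h j) (\<lambda>x. \<Sum>l\<in>UNIV. blk h p (b l) x * dblk l q (v i) x) x
        - (\<Sum>l\<in>UNIV. blk h p (b l) x * Op (msym h j) (dblk l q (v i)) x))
     - press j i (\<lambda>m x. \<Sum>l\<in>UNIV. blk h p (b l) x * dblk l q (v m) x) x"

definition nb2 :: "nat \<Rightarrow> (2 \<Rightarrow> int^2 \<Rightarrow> complex) \<Rightarrow> real" where
  "nb2 j c = (\<Sum>l\<in>UNIV. nb h j (c l))"

lemma nb_le_nb2: "nb h j (c l) \<le> nb2 j c"
  unfolding nb2_def by (rule member_le_sum) (auto intro: nb_nonneg)

lemma nb2_nonneg: "0 \<le> nb2 j c"
  unfolding nb2_def by (auto intro: sum_nonneg nb_nonneg)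

text \<open>
  The gain of the whole argument: the derivative in \<open>b \<cdot> \<nabla>v\<close> costs only the smaller of the two frequencies,
  because the commutator and the pressure can both be charged to either factor.
\<close>

lemma norm_inter_le:
  assumes b: "divfree b" and v: "divfree v"
  shows "norm (inter j i b v p q x) \<le> 12 * CM\<^sup>2 * 2 ^ min p q * (nb2 p b * nb2 q v)"
proof -
  have bA: "norm (blk h p (b l) x) \<le> nb2 p b" for l x using norm_blk_le nb_le_nb2 order_trans by blast
  have bV: "norm (blk h q (v l) x) \<le> nb2 q v" for l x using norm_blk_le nb_le_nb2 order_trans by blast
  have CM0: "CM \<ge> 0" using CM(1) by simp
  have bd: "norm (dblk i p (c l) x) \<le> CM * 2 ^ p * nb2 p c" for i p c l x
    by (rule order_trans[OF norm_dblk_le mult_left_mono[OF nb_le_nb2]]) (simp add: CM0)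
  let ?A = "\<lambda>l. blk h p (b l)" and ?A' = "\<lambda>l i. dblk i p (b l)" and ?V = "\<lambda>l. blk h q (v l)" and ?V' = "\<lambda>l i. dblk i q (v l)"
  let ?C = "Op (msym h j) (\<lambda>x. \<Sum>l\<in>UNIV. blk h p (b l) x * dblk l q (v i) x) x
        - (\<Sum>l\<in>UNIV. blk h p (b l) x * Op (msym h j) (dblk l q (v i)) x)"
  let ?P = "press j i (\<lambda>m x. \<Sum>l\<in>UNIV. blk h p (b l) x * dblk l q (v m) x) x"
  note c1 = transport_commutator_le[where A = ?A and A' = ?A' and g = "blk h q (v i)" and g' = "\<lambda>l. dblk l q (v i)"
      and a = "nb2 p b" and a' = "CM * 2 ^ p * nb2 p b" and c = "nb2 q v" and c' = "CM * 2 ^ q * nb2 q v",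
      OF cper_blk cper_dblk pder_blk divfree_dblk[OF b] cper_blk cper_dblk pder_blk bA bd bV bd]
  note p1 = press_le[where A = ?A and A' = ?A' and V = ?V and V' = ?V'
      and a = "nb2 p b" and a' = "CM * 2 ^ p * nb2 p b" and c = "nb2 q v" and c' = "CM * 2 ^ q * nb2 q v",
      OF cper_blk cper_dblk pder_blk divfree_dblk[OF b] cper_blk cper_dblk pder_blk divfree_dblk[OF v] bA bd bV bd]
  have tri: "norm (inter j i b v p q x) \<le> norm ?C + norm ?P"
    unfolding inter_def by (rule norm_triangle_ineq4)
  have N: "0 \<le> nb2 p b * nb2 q v" by (intro mult_nonneg_nonneg nb2_nonneg)
  show ?thesis
  proof (cases "p \<le> q")
    case True
    have "norm ?C \<le> 8 * CM * (CM * 2 ^ p * nb2 p b) * nb2 q v" by (rule c1(2))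
    moreover have "norm ?P \<le> 4 * CM * (CM * 2 ^ p * nb2 p b) * nb2 q v" by (rule p1(2))
    ultimately show ?thesis using tri True by (simp add: min_def power2_eq_square algebra_simps)
  next
    case False
    have "norm ?C \<le> 4 * CM * nb2 p b * (CM * 2 ^ q * nb2 q v)" by (rule c1(1))
    moreover have "norm ?P \<le> 4 * CM * nb2 p b * (CM * 2 ^ q * nb2 q v)" by (rule p1(1))
    ultimately have "norm (inter j i b v p q x) \<le> 8 * (CM\<^sup>2 * 2 ^ q * (nb2 p b * nb2 q v))"
      using tri by (simp add: power2_eq_square algebra_simps)
    also have "\<dots> \<le> 12 * (CM\<^sup>2 * 2 ^ q * (nb2 p b * nb2 q v))" by (intro mult_right_mono mult_nonneg_nonneg nb2_nonneg) auto
    finally show ?thesis using False by (simp add: min_def mult_ac)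
  qed
qed

lemma fc_ker_mult_zero:
  assumes "fsupp a" "fsupp c" "\<And>l. a l \<noteq> 0 \<Longrightarrow> norm (freq l) < X" "\<And>l. c l \<noteq> 0 \<Longrightarrow> norm (freq l) < Y" "norm (freq k) \<ge> X + Y"
  shows "fc (\<lambda>x. ker a x * ker c x) k = 0"
proof -
  have "fc (\<lambda>x. ker a x * ker c x) k = (\<Sum>l | a l \<noteq> 0. a l * fc (ker c) (k - l))"
    unfolding ker_def[of a] by (rule fc_trig_mult[OF cper_ker])
  also have "\<dots> = 0"
  proof (rule sum.neutral, intro ballI)
    fix l assume "l \<in> {l. a l \<noteq> 0}"
    then have "norm (freq l) < X" using assms by blast
    then have "\<not> norm (freq (k - l)) < Y"
      using assms(5) norm_triangle_ineq[of "freq l" "freq (k - l)"] by (simp add: freq_diff)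
    then show "a l * fc (ker c) (k - l) = 0" using assms(2,4) by (auto simp: fc_ker)
  qed
  finally show ?thesis .
qed

text \<open>
  Products of blocks have frequencies below \<open>2\<^sup>p + 2\<^sup>q\<close>, hence do not reach much larger frequencies.
\<close>

lemma inter_zero:
  assumes "j \<ge> max p q + 3" shows "inter j i b v p q x = 0"
proof -
  have far: "norm (freq k) \<ge> 2 ^ p + 2 ^ q" if "msym h j k \<noteq> 0" for k
  proof -
    have "(2::real) ^ p \<le> 2 ^ (j - 3)" "(2::real) ^ q \<le> 2 ^ (j - 3)"
      using assms by (intro power_increasing; simp)+
    moreover have "(2::real) ^ j = 8 * 2 ^ (j - 3)"
      using assms power_add[of "2::real" 3 "j - 3"] by simp
    moreover have "2 ^ j / 4 < norm (freq k)" using msym_nonzeroD(2)[OF that] assms by simp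
    ultimately show ?thesis by linarith
  qed
  have z: "msym h j k * fc (\<lambda>x. blk h p (b l) x * dblk l q (v m) x) k = 0" for k l m
  proof (cases "msym h j k = 0")
    case False
    have "fc (\<lambda>x. blk h p (b l) x * dblk l q (v m) x) k = 0"
      unfolding blk_def dblk_def
      by (rule fc_ker_mult_zero[OF _ _ _ _ far[OF False]]) (auto dest: msym_nonzeroD(1))
    then show ?thesis by simp
  qed simp
  have fcs: "fc (\<lambda>x. \<Sum>l\<in>UNIV. blk h p (b l) x * dblk l q (v m) x) k = (\<Sum>l\<in>UNIV. fc (\<lambda>x. blk h p (b l) x * dblk l q (v m) x) k)" for m k
    by (intro fc_sum cper_mult cper_blk cper_dblk)
  have zs: "msym h j k * fc (\<lambda>x. \<Sum>l\<in>UNIV. blk h p (b l) x * dblk l q (v m) x) k = 0" for m k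
    unfolding fcs sum_distrib_left using z by (intro sum.neutral) auto
  have 1: "Op (msym h j) (\<lambda>x. \<Sum>l\<in>UNIV. blk h p (b l) x * dblk l q (v i) x) x = 0"
    unfolding Op_def zs by simp
  have mm: "msym h j k * msym h q k = 0" for k
  proof (rule ccontr)
    assume "msym h j k * msym h q k \<noteq> 0"
    then have "2 ^ p + 2 ^ q \<le> norm (freq k)" "norm (freq k) < 2 ^ q" using far[of k] msym_nonzeroD(1)[of q k] by auto
    then show False using zero_le_power[of "2::real" p] by linarith
  qed
  have e: "msym h j k * (\<i> * of_int (k $ l) * (msym h q k * v i k)) = 0" for k l
    using mm[of k] by auto
  have 2: "Op (msym h j) (dblk l q (v i)) x = 0" for l
    unfolding Op_def dblk_def fc_ker[OF fsupp_mult_left[OF fsupp_blk]] e by simp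
  have 3: "Op (psym h j i m) (\<lambda>x. \<Sum>l\<in>UNIV. blk h p (b l) x * dblk l q (v m) x) x = 0" for m
  proof -
    have "psym h j i m k * fc (\<lambda>x. \<Sum>l\<in>UNIV. blk h p (b l) x * dblk l q (v m) x) k = 0" for k
      unfolding psym_def using zs[of k m] by auto
    then show ?thesis unfolding Op_def by (simp only: ker_zero)
  qed
  show ?thesis unfolding inter_def press_def 1 2 3 by simp
qed

end

section \<open>The maximum principle and the equation of one block\<close>

lemma second_derivative_at_max:
  assumes d: "\<And>t. (f has_real_derivative f' t) (at t)" and d2: "(f' has_real_derivative D) (at 0)"
    and m: "\<And>t. f t \<le> f 0"
  shows "f' 0 = 0" "D \<le> 0"
proof -
  show z: "f' 0 = 0" by (rule DERIV_local_max[OF d, of 1]) (use m in auto)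
  show "D \<le> 0"
  proof (rule ccontr)
    assume "\<not> D \<le> 0"
    then obtain e where e: "e > 0" "\<And>u. 0 < u \<Longrightarrow> u < e \<Longrightarrow> f' 0 < f' u"
      using DERIV_pos_inc_right[OF d2] by auto
    obtain u where u: "0 < u" "u < e / 2" "f (e / 2) - f 0 = (e / 2 - 0) * f' u"
      using MVT2[of 0 "e/2" f f'] d e(1) by auto
    have "(e / 2 - 0) * f' u > 0" using e(2)[of u] z e(1) u by (intro mult_pos_pos) auto
    then have "f (e / 2) - f 0 > 0" using u(3) by simp
    then show False using m[of "e / 2"] by simp
  qed
qed

text \<open>
  At a maximum the gradient vanishes and the Laplacian is nonpositive, so transport drops out and viscosity helps. For
  complex values the maximum is taken of the real part after the rotation \<open>z\<close> that makes the value at the given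
  point real. The bound is independent of \<open>\<tau>\<close>, \<open>\<mu>\<close> and \<open>B\<close>.
\<close>

lemma max_principle:
  assumes c: "fsupp c" and B: "\<And>l x. Im (B l x) = 0" and mu: "\<mu> \<ge> 0"
    and eq: "\<And>x. ker c x + of_real \<tau> * (\<Sum>l\<in>UNIV. B l x * ker (\<lambda>k. \<i> * of_int (k $ l) * c k) x)
        + of_real \<mu> * ker (\<lambda>k. of_real ((norm (freq k))\<^sup>2) * c k) x = g x"
    and g: "\<And>x. norm (g x) \<le> G"
  shows "norm (ker c x) \<le> G"
proof -
  define z where "z = (if ker c x = 0 then 1 else cnj (ker c x) / of_real (norm (ker c x)))"
  have nz: "norm z \<le> 1" by (simp add: z_def norm_divide)
  have zx: "Re (z * ker c x) = norm (ker c x)"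
  proof (cases "ker c x = 0")
    case False
    have "cnj (ker c x) * ker c x = of_real ((norm (ker c x))\<^sup>2)" by (simp only: complex_norm_square mult.commute)
    then show ?thesis using False by (simp add: z_def power2_eq_square)
  qed simp
  define u where "u y = Re (z * ker c y)" for y
  have "cper u" unfolding u_def[abs_def] by (intro cper_Re cper_mult cper_const cper_ker)
  then obtain x0 where x0: "\<And>y. u y \<le> u x0" using cper_attains_sup by blast
  let ?d = "\<lambda>i k. \<i> * of_int (k $ i) * c k"
  let ?dd = "\<lambda>i k. \<i> * of_int (k $ i) * (\<i> * of_int (k $ i) * c k)"
  have deriv: "((\<lambda>t. Re (z * ker n (x0 + t *\<^sub>R axis i 1))) has_real_derivative Re (z * ker (\<lambda>k. \<i> * of_int (k $ i) * n k) (x0 + t *\<^sub>R axis i 1))) (at t)"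
    if "fsupp n" for n i t
  proof -
    have "((\<lambda>t. z * ker n (x0 + t *\<^sub>R axis i 1)) has_vector_derivative z * ker (\<lambda>k. \<i> * of_int (k $ i) * n k) (x0 + t *\<^sub>R axis i 1)) (at t)"
      by (rule pder_at[OF pder_cmult[OF pder_ker[OF that]]])
    from bounded_linear.has_vector_derivative[OF bounded_linear_Re this]
    show ?thesis by (simp only: has_real_derivative_iff_has_vector_derivative)
  qed
  have fd: "fsupp (?d i)" for i by (rule fsupp_mult_left[OF c])
  have d1: "Re (z * ker (?d i) x0) = 0" and d2: "Re (z * ker (?dd i) x0) \<le> 0" for i
    using second_derivative_at_max[OF deriv[OF c, of i], of "Re (z * ker (?dd i) x0)"] deriv[OF fd, of i i 0] x0
    by (auto simp: u_def)
  have lap: "ker (\<lambda>k. of_real ((norm (freq k))\<^sup>2) * c k) x0 = - (\<Sum>i\<in>UNIV. ker (?dd i) x0)"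
  proof -
    have "(\<lambda>k. complex_of_real ((norm (freq k))\<^sup>2) * c k) = (\<lambda>k. (-1) * (\<Sum>i\<in>UNIV. ?dd i k))"
    proof
      fix k :: "int^2"
      have "(norm (freq k))\<^sup>2 = (real_of_int (k $ 1))\<^sup>2 + (real_of_int (k $ 2))\<^sup>2" by (simp add: norm_freq)
      then show "complex_of_real ((norm (freq k))\<^sup>2) * c k = (-1) * (\<Sum>i\<in>UNIV. ?dd i k)"
        by (simp add: UNIV_2 power2_eq_square algebra_simps)
    qed
    then have "ker (\<lambda>k. of_real ((norm (freq k))\<^sup>2) * c k) x0 = (-1) * ker (\<lambda>k. \<Sum>i\<in>UNIV. ?dd i k) x0"
      by (simp only: ker_cmult)
    also have "ker (\<lambda>k. \<Sum>i\<in>UNIV. ?dd i k) x0 = (\<Sum>i\<in>UNIV. ker (?dd i) x0)"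
      by (rule ker_sum) (rule fsupp_mult_left[OF fd])
    finally show ?thesis by simp
  qed
  have "Re (z * g x0) = u x0 + \<tau> * Re (z * (\<Sum>l\<in>UNIV. B l x0 * ker (?d l) x0)) + \<mu> * Re (z * ker (\<lambda>k. of_real ((norm (freq k))\<^sup>2) * c k) x0)"
    unfolding eq[symmetric] by (simp add: u_def algebra_simps)
  also have "z * (\<Sum>l\<in>UNIV. B l x0 * ker (?d l) x0) = (\<Sum>l\<in>UNIV. of_real (Re (B l x0)) * (z * ker (?d l) x0))"
  proof -
    have "B l x0 = of_real (Re (B l x0))" for l using B by (simp add: complex_eq_iff)
    show ?thesis unfolding sum_distrib_left
    proof (rule sum.cong[OF refl])
      fix l
      have "z * (B l x0 * ker (?d l) x0) = B l x0 * (z * ker (?d l) x0)" by (rule mult.left_commute)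
      then show "z * (B l x0 * ker (?d l) x0) = of_real (Re (B l x0)) * (z * ker (?d l) x0)"
        using \<open>B l x0 = of_real (Re (B l x0))\<close> by (simp only:)
    qed
  qed
  also have "Re \<dots> = 0"
  proof -
    have "Re (of_real r * w) = r * Re w" for r w by simp
    then show ?thesis unfolding Re_sum by (simp only: d1) simp
  qed
  finally have "u x0 = Re (z * g x0) - \<mu> * Re (z * ker (\<lambda>k. of_real ((norm (freq k))\<^sup>2) * c k) x0)" by simp
  moreover have "Re (z * ker (\<lambda>k. of_real ((norm (freq k))\<^sup>2) * c k) x0) \<ge> 0"
    using d2[of 1] d2[of 2] unfolding lap by (simp add: UNIV_2 algebra_simps)
  then have "\<mu> * Re (z * ker (\<lambda>k. of_real ((norm (freq k))\<^sup>2) * c k) x0) \<ge> 0" using mu by (rule mult_nonneg_nonneg[rotated])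
  moreover have "Re (z * g x0) \<le> norm z * norm (g x0)" unfolding norm_mult[symmetric] by (rule complex_Re_le_cmod)
  moreover have "norm z * norm (g x0) \<le> 1 * G" by (intro mult_mono nz g) auto
  ultimately have "u x0 \<le> G" by linarith
  then show ?thesis using x0[of x] zx by (simp add: u_def)
qed

text \<open>
  Fourier coefficients of \<open>b \<cdot> \<nabla>v\<^sub>i\<close> for a trigonometric polynomial \<open>b\<close>. The sum over \<open>l\<close> is
  finite for every family \<open>v\<close>, so no convergence is needed to state the equation.
\<close>

definition advc :: "(2 \<Rightarrow> int^2 \<Rightarrow> complex) \<Rightarrow> (2 \<Rightarrow> int^2 \<Rightarrow> complex) \<Rightarrow> 2 \<Rightarrow> int^2 \<Rightarrow> complex" where
  "advc b v i k = (\<Sum>m\<in>UNIV. \<Sum>l | b m l \<noteq> 0. b m l * (\<i> * of_int ((k - l) $ m) * v i (k - l)))"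

text \<open>
  The symbol of the Leray projection. At \<open>k = 0\<close> the numerators vanish and the projection is the identity.
\<close>

definition leray :: "(2 \<Rightarrow> int^2 \<Rightarrow> complex) \<Rightarrow> 2 \<Rightarrow> int^2 \<Rightarrow> complex" where
  "leray N i k = N i k - (\<Sum>l\<in>UNIV. of_real (of_int (k $ i) * of_int (k $ l) / (norm (freq k))\<^sup>2) * N l k)"

text \<open>
  One implicit step with viscosity \<open>\<mu> = \<tau>\<nu>\<close> and right-hand side \<open>f\<close>, with the nonlinear term given by the
  coefficients \<open>N\<close>.
\<close>

definition step_eq :: "real \<Rightarrow> real \<Rightarrow> (2 \<Rightarrow> int^2 \<Rightarrow> complex) \<Rightarrow> (2 \<Rightarrow> int^2 \<Rightarrow> complex) \<Rightarrow> (2 \<Rightarrow> int^2 \<Rightarrow> complex) \<Rightarrow> bool" where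
  "step_eq \<tau> \<mu> N f v \<longleftrightarrow>
     (\<forall>i k. of_real (1 + \<mu> * (norm (freq k))\<^sup>2) * v i k + of_real \<tau> * leray N i k = f i k)"

lemma Op_sum: "fsupp n \<Longrightarrow> (\<And>j. j \<in> J \<Longrightarrow> cper (f j)) \<Longrightarrow> Op n (\<lambda>x. \<Sum>j\<in>J. f j x) x = (\<Sum>j\<in>J. Op n (f j) x)"
  unfolding Op_def by (simp add: fc_sum sum_distrib_left ker_sum)

context lp_cutoff
begin

lemma sum_blk: "(\<Sum>j\<le>J. blk h j c x) = ker (\<lambda>k. ssym h J k * c k) x"
  unfolding blk_def ssym_eq_sum by (simp add: ker_sum[symmetric] sum_distrib_right)

lemma sum_dblk: "(\<Sum>j\<le>J. dblk l j c x) = ker (\<lambda>k. \<i> * of_int (k $ l) * (ssym h J k * c k)) x"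
  unfolding dblk_def ssym_eq_sum by (simp add: ker_sum[symmetric] sum_distrib_right sum_distrib_left)

text \<open>
  The block \<open>j\<close> of a step is a transport equation for the block of \<open>v\<close>, with the commutators and the pressure on the
  right. Only frequencies of \<open>v\<close> below \<open>2\<^sup>Q\<close> reach the block, so both factors split into finitely many
  blocks.
\<close>

lemma block_equation:
  assumes b: "\<And>l. fsupp (b l)" and eq: "step_eq \<tau> \<mu> (advc b v) f v"
    and P: "\<And>l k. b l k \<noteq> 0 \<Longrightarrow> norm (freq k) \<le> 2 ^ P / 2"
    and Q: "2 ^ P / 2 + 2 ^ j \<le> (2::real) ^ Q / 2"
  shows "blk h j (v i) x + of_real \<tau> * (\<Sum>l\<in>UNIV. ker (b l) x * ker (\<lambda>k. \<i> * of_int (k $ l) * (msym h j k * v i k)) x)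
      + of_real \<mu> * ker (\<lambda>k. of_real ((norm (freq k))\<^sup>2) * (msym h j k * v i k)) x
     = blk h j (f i) x - of_real \<tau> * (\<Sum>p\<le>P. \<Sum>q\<le>Q. inter j i b v p q x)"
proof -
  let ?N = "advc b v"
  define F where "F m x = (\<Sum>l\<in>UNIV. ker (b l) x * ker (\<lambda>k. \<i> * of_int (k $ l) * (ssym h Q k * v m k)) x)" for m x
  have bP: "ker (b l) x = (\<Sum>p\<le>P. blk h p (b l) x)" for l x
  proof -
    have "(\<lambda>k. ssym h P k * b l k) = b l"
    proof
      fix k show "ssym h P k * b l k = b l k" using P[of l k] ssym_one[of k P] by (cases "b l k = 0") auto
    qed
    then show ?thesis by (simp add: sum_blk)
  qed
  have Fsum: "F m x = (\<Sum>p\<le>P. \<Sum>q\<le>Q. \<Sum>l\<in>UNIV. blk h p (b l) x * dblk l q (v m) x)" for m x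
  proof -
    have "F m x = (\<Sum>l\<in>UNIV. \<Sum>p\<le>P. \<Sum>q\<le>Q. blk h p (b l) x * dblk l q (v m) x)"
      unfolding F_def bP sum_dblk[symmetric] by (simp only: sum_product)
    also have "\<dots> = (\<Sum>p\<le>P. \<Sum>l\<in>UNIV. \<Sum>q\<le>Q. blk h p (b l) x * dblk l q (v m) x)" by (rule sum.swap)
    also have "\<dots> = (\<Sum>p\<le>P. \<Sum>q\<le>Q. \<Sum>l\<in>UNIV. blk h p (b l) x * dblk l q (v m) x)"
      by (rule sum.cong[OF refl]) (rule sum.swap)
    finally show ?thesis .
  qed
  have fcF: "msym h j k * fc (F m) k = msym h j k * ?N m k" for m k
  proof (cases "msym h j k = 0")
    case False
    have "fc (F m) k = (\<Sum>l\<in>UNIV. fc (\<lambda>x. ker (b l) x * ker (\<lambda>k. \<i> * of_int (k $ l) * (ssym h Q k * v m k)) x) k)"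
      unfolding F_def by (intro fc_sum cper_mult cper_ker)
    also have "\<dots> = (\<Sum>l\<in>UNIV. \<Sum>n | b l n \<noteq> 0. b l n * (\<i> * of_int ((k - n) $ l) * (ssym h Q (k - n) * v m (k - n))))"
      unfolding ker_def[of "b _"] by (simp add: fc_trig_mult[OF cper_ker] fc_ker)
    also have "\<dots> = ?N m k"
      unfolding advc_def
    proof (intro sum.cong refl)
      fix l :: 2 and n assume "n \<in> {n. b l n \<noteq> 0}"
      then have "norm (freq n) \<le> 2 ^ P / 2" using P by blast
      moreover have "norm (freq k) < 2 ^ j" by (rule msym_nonzeroD(1)[OF False])
      moreover have "norm (freq (k - n)) \<le> norm (freq k) + norm (freq n)" unfolding freq_diff by (rule norm_triangle_ineq4)
      ultimately have "norm (freq (k - n)) \<le> 2 ^ Q / 2" using Q by linarith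
      then have "ssym h Q (k - n) = 1" by (rule ssym_one)
      then show "b l n * (\<i> * of_int ((k - n) $ l) * (ssym h Q (k - n) * v m (k - n))) = b l n * (\<i> * of_int ((k - n) $ l) * v m (k - n))"
        by simp
    qed
    finally show ?thesis by simp
  qed simp
  have cF: "cper (F m)" for m unfolding F_def[abs_def] by (intro cper_sum cper_mult cper_ker)
  have 1: "(\<Sum>p\<le>P. \<Sum>q\<le>Q. Op n (\<lambda>x. \<Sum>l\<in>UNIV. blk h p (b l) x * dblk l q (v m) x) x) = Op n (F m) x" if "fsupp n" for n m
  proof -
    have c: "cper (\<lambda>x. \<Sum>l\<in>UNIV. blk h p (b l) x * dblk l q (v m) x)" for p q
      by (intro cper_sum cper_mult cper_blk cper_dblk)
    have "Op n (F m) x = Op n (\<lambda>x. \<Sum>p\<le>P. \<Sum>q\<le>Q. \<Sum>l\<in>UNIV. blk h p (b l) x * dblk l q (v m) x) x"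
      by (simp only: Fsum[abs_def])
    also have "\<dots> = (\<Sum>p\<le>P. Op n (\<lambda>x. \<Sum>q\<le>Q. \<Sum>l\<in>UNIV. blk h p (b l) x * dblk l q (v m) x) x)"
      by (rule Op_sum[OF that cper_sum[OF c]])
    also have "\<dots> = (\<Sum>p\<le>P. \<Sum>q\<le>Q. Op n (\<lambda>x. \<Sum>l\<in>UNIV. blk h p (b l) x * dblk l q (v m) x) x)"
      by (rule sum.cong[OF refl]) (rule Op_sum[OF that c])
    finally show ?thesis by simp
  qed
  have msQ: "msym h j k * ssym h Q k = msym h j k" for k
  proof (cases "msym h j k = 0")
    case False
    have "(0::real) \<le> 2 ^ P" by simp
    then have "norm (freq k) \<le> 2 ^ Q / 2" using msym_nonzeroD(1)[OF False] Q by linarith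
    then have "ssym h Q k = 1" by (rule ssym_one)
    then show ?thesis by simp
  qed simp
  have 2: "(\<Sum>p\<le>P. \<Sum>q\<le>Q. \<Sum>l\<in>UNIV. blk h p (b l) x * Op (msym h j) (dblk l q (v i)) x)
      = (\<Sum>l\<in>UNIV. ker (b l) x * ker (\<lambda>k. \<i> * of_int (k $ l) * (msym h j k * v i k)) x)"
  proof -
    have "(\<Sum>q\<le>Q. Op (msym h j) (dblk l q (v i)) x) = ker (\<lambda>k. \<i> * of_int (k $ l) * (msym h j k * v i k)) x" for l
    proof -
      have "(\<Sum>q\<le>Q. Op (msym h j) (dblk l q (v i)) x) = Op (msym h j) (\<lambda>x. \<Sum>q\<le>Q. dblk l q (v i) x) x"
        by (rule Op_sum[symmetric]) (simp_all add: cper_dblk)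
      also have "\<dots> = ker (\<lambda>k. msym h j k * (\<i> * of_int (k $ l) * (ssym h Q k * v i k))) x"
        unfolding Op_def sum_dblk by (simp add: fc_ker)
      also have "(\<lambda>k. msym h j k * (\<i> * of_int (k $ l) * (ssym h Q k * v i k))) = (\<lambda>k. \<i> * of_int (k $ l) * ((msym h j k * ssym h Q k) * v i k))"
        by (simp add: mult_ac)
      finally show ?thesis unfolding msQ .
    qed
    then have "(\<Sum>l\<in>UNIV. ker (b l) x * ker (\<lambda>k. \<i> * of_int (k $ l) * (msym h j k * v i k)) x)
       = (\<Sum>l\<in>UNIV. \<Sum>p\<le>P. \<Sum>q\<le>Q. blk h p (b l) x * Op (msym h j) (dblk l q (v i)) x)"
      unfolding bP by (simp add: sum_product[symmetric])
    also have "\<dots> = (\<Sum>p\<le>P. \<Sum>l\<in>UNIV. \<Sum>q\<le>Q. blk h p (b l) x * Op (msym h j) (dblk l q (v i)) x)" by (rule sum.swap)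
    also have "\<dots> = (\<Sum>p\<le>P. \<Sum>q\<le>Q. \<Sum>l\<in>UNIV. blk h p (b l) x * Op (msym h j) (dblk l q (v i)) x)"
      by (rule sum.cong[OF refl]) (rule sum.swap)
    finally show ?thesis by simp
  qed
  have 3: "(\<Sum>p\<le>P. \<Sum>q\<le>Q. press j i (\<lambda>m x. \<Sum>l\<in>UNIV. blk h p (b l) x * dblk l q (v m) x) x) = (\<Sum>m\<in>UNIV. Op (psym h j i m) (F m) x)"
  proof -
    have "(\<Sum>p\<le>P. \<Sum>q\<le>Q. press j i (\<lambda>m x. \<Sum>l\<in>UNIV. blk h p (b l) x * dblk l q (v m) x) x)
       = (\<Sum>p\<le>P. \<Sum>m\<in>UNIV. \<Sum>q\<le>Q. Op (psym h j i m) (\<lambda>x. \<Sum>l\<in>UNIV. blk h p (b l) x * dblk l q (v m) x) x)"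
      unfolding press_def by (rule sum.cong[OF refl]) (rule sum.swap)
    also have "\<dots> = (\<Sum>m\<in>UNIV. \<Sum>p\<le>P. \<Sum>q\<le>Q. Op (psym h j i m) (\<lambda>x. \<Sum>l\<in>UNIV. blk h p (b l) x * dblk l q (v m) x) x)"
      by (rule sum.swap)
    finally show ?thesis using 1[OF fsupp_psym] by simp
  qed
  have total: "(\<Sum>p\<le>P. \<Sum>q\<le>Q. inter j i b v p q x)
     = Op (msym h j) (F i) x - (\<Sum>l\<in>UNIV. ker (b l) x * ker (\<lambda>k. \<i> * of_int (k $ l) * (msym h j k * v i k)) x)
       - (\<Sum>m\<in>UNIV. Op (psym h j i m) (F m) x)"
    unfolding inter_def sum_subtractf 1[OF fsupp_msym] 2 3 ..
  have OpF: "Op (msym h j) (F i) x - (\<Sum>m\<in>UNIV. Op (psym h j i m) (F m) x) = ker (\<lambda>k. msym h j k * leray ?N i k) x"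
  proof -
    have "Op (msym h j) (F i) x = ker (\<lambda>k. msym h j k * ?N i k) x" unfolding Op_def fcF ..
    moreover have "Op (psym h j i m) (F m) x = ker (\<lambda>k. msym h j k * (of_real (of_int (k $ i) * of_int (k $ m) / (norm (freq k))\<^sup>2) * ?N m k)) x" for m
    proof -
      have "psym h j i m k * fc (F m) k = msym h j k * (of_real (of_int (k $ i) * of_int (k $ m) / (norm (freq k))\<^sup>2) * ?N m k)" for k
      proof -
        have "psym h j i m k * fc (F m) k = of_real (of_int (k $ i) * of_int (k $ m) / (norm (freq k))\<^sup>2) * (msym h j k * fc (F m) k)"
          by (simp only: psym_def mult_ac)
        also have "\<dots> = of_real (of_int (k $ i) * of_int (k $ m) / (norm (freq k))\<^sup>2) * (msym h j k * ?N m k)"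
          by (simp only: fcF)
        finally show ?thesis by (simp only: mult.left_commute)
      qed
      then show ?thesis unfolding Op_def by (simp only:)
    qed
    ultimately show ?thesis
      by (simp add: leray_def right_diff_distrib ker_diff sum_distrib_left ker_sum fsupp_sum)
  qed
  have "blk h j (f i) x = ker (\<lambda>k. (msym h j k * v i k + of_real \<mu> * (of_real ((norm (freq k))\<^sup>2) * (msym h j k * v i k)))
       + of_real \<tau> * (msym h j k * leray ?N i k)) x"
  proof -
    have "msym h j k * f i k = (msym h j k * v i k + of_real \<mu> * (of_real ((norm (freq k))\<^sup>2) * (msym h j k * v i k)))
       + of_real \<tau> * (msym h j k * leray ?N i k)" for k
      using eq[unfolded step_eq_def, rule_format, of k i, symmetric] by (simp add: algebra_simps)
    then show ?thesis unfolding blk_def by simp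
  qed
  also have "\<dots> = ker (\<lambda>k. msym h j k * v i k) x + of_real \<mu> * ker (\<lambda>k. of_real ((norm (freq k))\<^sup>2) * (msym h j k * v i k)) x
     + of_real \<tau> * ker (\<lambda>k. msym h j k * leray ?N i k) x"
    by (subst ker_add, simp_all add: fsupp_add ker_cmult, subst ker_add, simp_all add: ker_cmult)
  finally show ?thesis unfolding total OpF[symmetric] blk_def by (simp add: algebra_simps)
qed

end

section \<open>The a priori estimate\<close>

text \<open>
  The \<open>\<ell>\<^sup>r\<close> norm of a truncated sequence. Truncation keeps everything finite; bounds uniform in \<open>J\<close> carry the
  full norms.
\<close>

definition lN :: "nat \<Rightarrow> nat \<Rightarrow> (nat \<Rightarrow> real) \<Rightarrow> real" where
  "lN r J x = root r (\<Sum>j<J. x j ^ r)"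

lemma lN_mono:
  assumes "r > 0" "\<And>j. j < J \<Longrightarrow> 0 \<le> x j" "\<And>j. j < J \<Longrightarrow> x j \<le> y j" shows "lN r J x \<le> lN r J y"
  unfolding lN_def using assms by (intro real_root_le_mono sum_mono power_mono) auto

lemma lN_J_mono: "r > 0 \<Longrightarrow> (\<And>j. 0 \<le> x j) \<Longrightarrow> J \<le> K \<Longrightarrow> lN r J x \<le> lN r K x"
  unfolding lN_def by (intro real_root_le_mono sum_mono2) auto

lemma lN_nonneg: "r > 0 \<Longrightarrow> (\<And>j. 0 \<le> x j) \<Longrightarrow> 0 \<le> lN r J x"
  unfolding lN_def by (intro real_root_ge_zero sum_nonneg) auto

lemma lN_cmult: "r > 0 \<Longrightarrow> c \<ge> 0 \<Longrightarrow> lN r J (\<lambda>j. c * x j) = c * lN r J x"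
  unfolding lN_def by (simp add: power_mult_distrib sum_distrib_left[symmetric] real_root_mult real_root_power_cancel)

lemma lN_elem: "r > 0 \<Longrightarrow> (\<And>j. 0 \<le> x j) \<Longrightarrow> j < J \<Longrightarrow> x j \<le> lN r J x"
proof -
  assume r: "r > 0" "\<And>j. 0 \<le> x j" "j < J"
  have "x j ^ r \<le> (\<Sum>j<J. x j ^ r)" using r by (intro member_le_sum) auto
  then have "root r (x j ^ r) \<le> lN r J x" unfolding lN_def using r by (intro real_root_le_mono)
  then show ?thesis using r by (simp add: real_root_power_cancel)
qed

lemma lN_add:
  assumes r: "r = 1 \<or> r = 2" and "\<And>j. 0 \<le> x j" "\<And>j. 0 \<le> y j"
  shows "lN r J (\<lambda>j. x j + y j) \<le> lN r J x + lN r J y"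
  using r
proof
  assume "r = 2"
  then show ?thesis using L2_set_triangle_ineq[of x y "{..<J}"] by (simp add: lN_def L2_set_def sqrt_def)
qed (simp add: lN_def sum.distrib)

lemma lN_zero: "r > 0 \<Longrightarrow> lN r J (\<lambda>j. 0) = 0"
  by (simp add: lN_def power_0_left)

lemma lN_sum:
  assumes r: "r = 1 \<or> r = 2" and x: "\<And>m j. 0 \<le> x m j" and "finite S"
  shows "lN r J (\<lambda>j. \<Sum>m\<in>S. x m j) \<le> (\<Sum>m\<in>S. lN r J (x m))"
  using \<open>finite S\<close>
proof induction
  case empty then show ?case using r by (auto simp: lN_zero)
next
  case (insert a S)
  have "lN r J (\<lambda>j. x a j + (\<Sum>m\<in>S. x m j)) \<le> lN r J (x a) + lN r J (\<lambda>j. \<Sum>m\<in>S. x m j)"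
    by (intro lN_add r x sum_nonneg)
  then show ?case using insert by simp
qed

lemma lN_shift:
  assumes r: "r > 0" and x: "\<And>j. 0 \<le> x j"
  shows "lN r J (\<lambda>j. if 2 \<le> j + m then x (j + m - 2) else 0) \<le> lN r (J + m) x"
  unfolding lN_def
proof (rule real_root_le_mono[OF r])
  have "(\<Sum>j<J. (if 2 \<le> j + m then x (j + m - 2) else 0) ^ r) = (\<Sum>j\<in>{j. j < J \<and> 2 \<le> j + m}. x (j + m - 2) ^ r)"
    using r by (intro sum.mono_neutral_cong_right) (auto simp: power_0_left)
  also have "\<dots> = (\<Sum>j\<in>(\<lambda>j. j + m - 2) ` {j. j < J \<and> 2 \<le> j + m}. x j ^ r)"
    by (subst sum.reindex) (auto simp: inj_on_def)
  also have "\<dots> \<le> (\<Sum>j<J + m. x j ^ r)" using x by (intro sum_mono2) auto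
  finally show "(\<Sum>j<J. (if 2 \<le> j + m then x (j + m - 2) else 0) ^ r) \<le> (\<Sum>j<J + m. x j ^ r)" .
qed

lemma lN_tendsto:
  "r > 0 \<Longrightarrow> (\<And>j. (\<lambda>n. x n j) \<longlonglongrightarrow> y j) \<Longrightarrow> (\<lambda>n. lN r J (x n)) \<longlonglongrightarrow> lN r J y"
  unfolding lN_def by (intro tendsto_intros)

text \<open>
  Substituting \<open>q = j + m - 2\<close> writes the tail that starts at \<open>j - 2\<close> as a sum of shifts.
\<close>

lemma sum_window_le:
  fixes f :: "nat \<Rightarrow> real"
  assumes "\<And>q. 0 \<le> f q"
  shows "(\<Sum>q\<le>Q. if j \<le> q + 2 then f q else 0) \<le> (\<Sum>m\<le>Q + 2. if 2 \<le> j + m then f (j + m - 2) else 0)"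
proof -
  have "(\<Sum>q\<le>Q. if j \<le> q + 2 then f q else 0) = (\<Sum>q | q \<le> Q \<and> j \<le> q + 2. f q)"
    by (intro sum.mono_neutral_cong_right) auto
  also have "\<dots> \<le> (\<Sum>m\<le>Q + 2. if 2 \<le> j + m then f (j + m - 2) else 0)"
  proof (rule sum_le_included[where i = "\<lambda>m. j + m - 2"])
    show "\<forall>q\<in>{q. q \<le> Q \<and> j \<le> q + 2}. \<exists>m\<in>{..Q + 2}. j + m - 2 = q \<and> f q \<le> (if 2 \<le> j + m then f (j + m - 2) else 0)"
    proof
      fix q assume "q \<in> {q. q \<le> Q \<and> j \<le> q + 2}"
      then show "\<exists>m\<in>{..Q + 2}. j + m - 2 = q \<and> f q \<le> (if 2 \<le> j + m then f (j + m - 2) else 0)"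
        by (intro bexI[of _ "q + 2 - j"]) auto
    qed
  qed (use assms in auto)
  finally show ?thesis .
qed

lemma geometric_powr_bound:
  assumes "a > 0" shows "(\<Sum>m<n. 2 powr (- a * real m)) \<le> 1 / (1 - 2 powr (- a))"
proof -
  have q: "0 < 2 powr (- a)" "2 powr (- a) < 1" using assms powr_less_mono[of "-a" 0 2] by auto
  have "2 powr (- a * real m) = (2 powr (- a)) ^ m" for m by (simp add: powr_realpow[symmetric] powr_powr)
  then have "(\<Sum>m<n. 2 powr (- a * real m)) = (1 - (2 powr (- a)) ^ n) / (1 - 2 powr (- a))"
    using q assms by (simp add: sum_gp_strict)
  also have "\<dots> \<le> 1 / (1 - 2 powr (- a))" using q by (intro divide_right_mono) auto
  finally show ?thesis .
qed

context lp_cutoff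
begin

text \<open>\<open>bes r s c M\<close>: the norm of \<open>c\<close> in \<open>B\<^sup>s\<close> with inner exponent \<open>\<infinity>\<close> and outer exponent \<open>r\<close> is at most \<open>M\<close>.\<close>

definition wseq :: "real \<Rightarrow> (int^2 \<Rightarrow> complex) \<Rightarrow> nat \<Rightarrow> real" where
  "wseq s c j = 2 powr (real j * s) * nb h j c"

definition bes :: "nat \<Rightarrow> real \<Rightarrow> (2 \<Rightarrow> int^2 \<Rightarrow> complex) \<Rightarrow> real \<Rightarrow> bool" where
  "bes r s c M \<longleftrightarrow> (\<forall>J. (\<Sum>i\<in>UNIV. lN r J (wseq s (c i))) \<le> M)"

text \<open>
  The two admissible cases. In both, the weighted norm controls \<open>\<Sum> 2\<^sup>j \<parallel>\<Delta>\<^sub>j u\<parallel>\<close>, hence the gradient.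
\<close>

definition adm :: "nat \<Rightarrow> real \<Rightarrow> bool" where
  "adm r s \<longleftrightarrow> (r = 1 \<and> s \<ge> 1) \<or> (r = 2 \<and> s > 1)"

lemma adm_pos: "adm r s \<Longrightarrow> r > 0" "adm r s \<Longrightarrow> s \<ge> 1" "adm r s \<Longrightarrow> r = 1 \<or> r = 2"
  by (auto simp: adm_def)

lemma wseq_nonneg: "0 \<le> wseq s c j"
  unfolding wseq_def by (intro mult_nonneg_nonneg nb_nonneg) simp

lemma bes_nonneg: "adm r s \<Longrightarrow> bes r s c M \<Longrightarrow> 0 \<le> M"
  unfolding bes_def using sum_nonneg[of UNIV "\<lambda>i. lN r 0 (wseq s (c i))"] lN_nonneg[OF adm_pos(1) wseq_nonneg]
  by (meson order_trans)

lemma bes_lN_nb2: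
  assumes a: "adm r s" and c: "bes r s c M" shows "lN r J (\<lambda>j. 2 powr (real j * s) * nb2 j c) \<le> M"
proof -
  have "(\<lambda>j. 2 powr (real j * s) * nb2 j c) = (\<lambda>j. \<Sum>i\<in>UNIV. wseq s (c i) j)"
    by (simp add: nb2_def wseq_def sum_distrib_left)
  then have "lN r J (\<lambda>j. 2 powr (real j * s) * nb2 j c) \<le> (\<Sum>i\<in>UNIV. lN r J (wseq s (c i)))"
    using lN_sum[OF adm_pos(3)[OF a], of "\<lambda>i. wseq s (c i)" UNIV J] by (simp add: wseq_nonneg)
  then show ?thesis using c unfolding bes_def by (meson order_trans)
qed

text \<open>
  For \<open>r = 1\<close> the weights satisfy \<open>2\<^sup>j \<le> 2\<^sup>j\<^sup>s\<close>. For \<open>r = 2\<close> each term is at most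
  \<open>2\<^sup>-\<^sup>j\<^sup>(\<^sup>s\<^sup>-\<^sup>1\<^sup>)\<close> times the norm, and the geometric series converges because \<open>s > 1\<close>.
\<close>

lemma bes_C1_embedding:
  assumes a: "adm r s"
  shows "\<exists>C\<ge>1. \<forall>c M J. bes r s c M \<longrightarrow> (\<Sum>j<J. 2 ^ j * nb2 j c) \<le> C * M"
  using a[unfolded adm_def]
proof (elim disjE conjE)
  assume r: "r = 1" "s \<ge> 1"
  have "(\<Sum>j<J. 2 ^ j * nb2 j c) \<le> 1 * M" if "bes r s c M" for c M J
  proof -
    have "(\<Sum>j<J. 2 ^ j * nb2 j c) \<le> (\<Sum>j<J. 2 powr (real j * s) * nb2 j c)"
    proof (intro sum_mono mult_right_mono nb2_nonneg)
      fix j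
      have "(2::real) ^ j = 2 powr (real j * 1)" by (simp add: powr_realpow)
      also have "\<dots> \<le> 2 powr (real j * s)" using r by (intro powr_mono mult_left_mono) auto
      finally show "(2::real) ^ j \<le> 2 powr (real j * s)" .
    qed
    also have "\<dots> = lN r J (\<lambda>j. 2 powr (real j * s) * nb2 j c)" using r by (simp add: lN_def)
    also have "\<dots> \<le> M" by (rule bes_lN_nb2[OF a that])
    finally show ?thesis by simp
  qed
  then show ?thesis by blast
next
  assume r: "r = 2" "s > 1"
  define C where "C = max 1 (1 / (1 - 2 powr (- (s - 1))))"
  have "(\<Sum>j<J. 2 ^ j * nb2 j c) \<le> C * M" if b: "bes r s c M" for c M J
  proof -
    have M: "0 \<le> M" by (rule bes_nonneg[OF a b])
    have "(\<Sum>j<J. 2 ^ j * nb2 j c) \<le> (\<Sum>j<J. 2 powr (- (s - 1) * real j) * M)"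
    proof (rule sum_mono)
      fix j
      have "2 powr (real j * s) * nb2 j c \<le> lN r (Suc j) (\<lambda>j. 2 powr (real j * s) * nb2 j c)"
        by (rule lN_elem) (use r in \<open>auto intro!: mult_nonneg_nonneg nb2_nonneg\<close>)
      also have "\<dots> \<le> M" by (rule bes_lN_nb2[OF a b])
      finally have "2 powr (- (s - 1) * real j) * (2 powr (real j * s) * nb2 j c) \<le> 2 powr (- (s - 1) * real j) * M"
        by (rule mult_left_mono) simp
      moreover have "2 powr (- (s - 1) * real j) * 2 powr (real j * s) = 2 ^ j"
        by (simp add: powr_add[symmetric] powr_realpow[symmetric] algebra_simps)
      ultimately show "2 ^ j * nb2 j c \<le> 2 powr (- (s - 1) * real j) * M" by (metis mult.assoc)
    qed
    also have "\<dots> \<le> (1 / (1 - 2 powr (- (s - 1)))) * M"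
      unfolding sum_distrib_right[symmetric] using r by (intro mult_right_mono geometric_powr_bound M) simp
    also have "\<dots> \<le> C * M" by (intro mult_right_mono M) (simp add: C_def)
    finally show ?thesis .
  qed
  moreover have "C \<ge> 1" by (simp add: C_def)
  ultimately show ?thesis by blast
qed

text \<open>
  High frequencies act on low ones with the factor \<open>2\<^sup>(\<^sup>j\<^sup>-\<^sup>q\<^sup>)\<^sup>s\<close>. Written as a sum of shifts, the tail is
  dominated by a geometric series in the shift, because \<open>s > 0\<close>.
\<close>

lemma bes_window:
  assumes a: "adm r s"
  shows "\<exists>C\<ge>1. \<forall>c M J Q. bes r s c M \<longrightarrow>
     lN r J (\<lambda>j. 2 powr (real j * s) * (\<Sum>q\<le>Q. if j \<le> q + 2 then nb2 q c else 0)) \<le> C * M"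
proof -
  define C where "C = max 1 (2 powr (2 * s) * (1 / (1 - 2 powr (- s))))"
  have "lN r J (\<lambda>j. 2 powr (real j * s) * (\<Sum>q\<le>Q. if j \<le> q + 2 then nb2 q c else 0)) \<le> C * M" if b: "bes r s c M" for c M J Q
  proof -
    have M: "0 \<le> M" by (rule bes_nonneg[OF a b])
    have r: "r > 0" and r12: "r = 1 \<or> r = 2" and s: "s > 0" using adm_pos[OF a] by auto
    let ?x = "\<lambda>j. 2 powr (real j * s) * nb2 j c"
    let ?y = "\<lambda>m j. if 2 \<le> j + m then ?x (j + m - 2) else 0"
    have x0: "0 \<le> ?x j" for j by (intro mult_nonneg_nonneg nb2_nonneg) simp
    have "lN r J (\<lambda>j. 2 powr (real j * s) * (\<Sum>q\<le>Q. if j \<le> q + 2 then nb2 q c else 0))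
       \<le> lN r J (\<lambda>j. \<Sum>m\<le>Q + 2. 2 powr ((2 - real m) * s) * ?y m j)"
    proof (rule lN_mono[OF r])
      fix j
      show "0 \<le> 2 powr (real j * s) * (\<Sum>q\<le>Q. if j \<le> q + 2 then nb2 q c else 0)"
        by (intro mult_nonneg_nonneg sum_nonneg) (auto intro: nb2_nonneg)
      have "2 powr (real j * s) * (\<Sum>q\<le>Q. if j \<le> q + 2 then nb2 q c else 0)
         \<le> 2 powr (real j * s) * (\<Sum>m\<le>Q + 2. if 2 \<le> j + m then nb2 (j + m - 2) c else 0)"
        by (intro mult_left_mono sum_window_le nb2_nonneg) simp
      also have "\<dots> = (\<Sum>m\<le>Q + 2. 2 powr ((2 - real m) * s) * ?y m j)"
        unfolding sum_distrib_left
      proof (intro sum.cong refl)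
        fix m
        have "2 powr (real j * s) = 2 powr ((2 - real m) * s) * 2 powr (real (j + m - 2) * s)" if "2 \<le> j + m"
          using that by (simp add: powr_add[symmetric] of_nat_diff algebra_simps)
        then show "2 powr (real j * s) * (if 2 \<le> j + m then nb2 (j + m - 2) c else 0) = 2 powr ((2 - real m) * s) * ?y m j"
          by simp
      qed
      finally show "2 powr (real j * s) * (\<Sum>q\<le>Q. if j \<le> q + 2 then nb2 q c else 0) \<le> (\<Sum>m\<le>Q + 2. 2 powr ((2 - real m) * s) * ?y m j)" .
    qed
    also have "\<dots> \<le> (\<Sum>m\<le>Q + 2. lN r J (\<lambda>j. 2 powr ((2 - real m) * s) * ?y m j))"
      by (rule lN_sum[OF r12]) (auto intro!: mult_nonneg_nonneg nb2_nonneg)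
    also have "\<dots> \<le> (\<Sum>m\<le>Q + 2. 2 powr ((2 - real m) * s) * M)"
    proof (rule sum_mono)
      fix m
      have "lN r J (?y m) \<le> lN r (J + m) ?x" by (rule lN_shift[OF r x0])
      also have "\<dots> \<le> M" by (rule bes_lN_nb2[OF a b])
      finally show "lN r J (\<lambda>j. 2 powr ((2 - real m) * s) * ?y m j) \<le> 2 powr ((2 - real m) * s) * M"
        unfolding lN_cmult[OF r powr_ge_zero] by (rule mult_left_mono) simp
    qed
    also have "\<dots> = (2 powr (2 * s) * (\<Sum>m<Suc (Q + 2). 2 powr (- s * real m))) * M"
      by (simp add: sum_distrib_right[symmetric] sum_distrib_left powr_add[symmetric] algebra_simps lessThan_Suc_atMost del: sum.lessThan_Suc sum.atMost_Suc)
    also have "\<dots> \<le> (2 powr (2 * s) * (1 / (1 - 2 powr (- s)))) * M"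
      by (intro mult_right_mono mult_left_mono geometric_powr_bound s M) simp
    also have "\<dots> \<le> C * M" by (intro mult_right_mono M) (simp add: C_def)
    finally show ?thesis .
  qed
  moreover have "C \<ge> 1" by (simp add: C_def)
  ultimately show ?thesis by blast
qed

text \<open>
  The factor \<open>2\<^sup>m\<^sup>i\<^sup>n\<close> is given to the block of lower frequency, whose weighted sum is bounded by the gradient. The
  other block has a frequency comparable to the output or larger.
\<close>

lemma inter_sum_le:
  assumes b: "divfree b" and v: "divfree v"
    and B: "(\<Sum>p\<le>P. 2 ^ p * nb2 p b) \<le> \<beta>" and V: "(\<Sum>q\<le>Q. 2 ^ q * nb2 q v) \<le> \<gamma>"
  shows "norm (\<Sum>p\<le>P. \<Sum>q\<le>Q. inter j i b v p q x) \<le> 12 * CM\<^sup>2 *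
     (\<beta> * (\<Sum>q\<le>Q. if j \<le> q + 2 then nb2 q v else 0) + \<gamma> * (\<Sum>p\<le>P. if j \<le> p + 2 then nb2 p b else 0))"
proof -
  let ?b = "\<lambda>p. 2 ^ p * nb2 p b" and ?v = "\<lambda>q. 2 ^ q * nb2 q v"
  let ?wb = "\<lambda>p. if j \<le> p + 2 then nb2 p b else 0" and ?wv = "\<lambda>q. if j \<le> q + 2 then nb2 q v else 0"
  have w0: "0 \<le> ?wb p" "0 \<le> ?wv p" for p by (auto intro: nb2_nonneg)
  have pt: "norm (inter j i b v p q x) \<le> 12 * CM\<^sup>2 * (?b p * ?wv q + ?v q * ?wb p)" for p q
  proof (cases "j \<ge> max p q + 3")
    case True
    then have "inter j i b v p q x = 0" by (rule inter_zero)
    then show ?thesis by (simp add: nb2_nonneg)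
  next
    case False
    have "2 ^ min p q * (nb2 p b * nb2 q v) \<le> ?b p * ?wv q + ?v q * ?wb p"
    proof (cases "p \<le> q")
      case True
      then have "?b p * ?wv q = 2 ^ min p q * (nb2 p b * nb2 q v)" using False by (simp add: min_def)
      moreover have "0 \<le> ?v q * ?wb p" by (intro mult_nonneg_nonneg w0 nb2_nonneg) simp
      ultimately show ?thesis by linarith
    next
      case pq: False
      then have "?v q * ?wb p = 2 ^ min p q * (nb2 p b * nb2 q v)" using False by (simp add: min_def)
      moreover have "0 \<le> ?b p * ?wv q" by (intro mult_nonneg_nonneg w0 nb2_nonneg) simp
      ultimately show ?thesis by linarith
    qed
    then have "12 * CM\<^sup>2 * (2 ^ min p q * (nb2 p b * nb2 q v)) \<le> 12 * CM\<^sup>2 * (?b p * ?wv q + ?v q * ?wb p)"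
      by (rule mult_left_mono) simp
    then show ?thesis using norm_inter_le[OF b v, of j i p q x] by (simp only: mult.assoc)
  qed
  have "norm (\<Sum>p\<le>P. \<Sum>q\<le>Q. inter j i b v p q x) \<le> (\<Sum>p\<le>P. \<Sum>q\<le>Q. 12 * CM\<^sup>2 * (?b p * ?wv q + ?v q * ?wb p))"
    by (intro sum_norm_le pt)
  also have "\<dots> = 12 * CM\<^sup>2 * ((\<Sum>p\<le>P. ?b p) * (\<Sum>q\<le>Q. ?wv q) + (\<Sum>q\<le>Q. ?v q) * (\<Sum>p\<le>P. ?wb p))"
  proof -
    have "(\<Sum>p\<le>P. \<Sum>q\<le>Q. ?b p * ?wv q) = (\<Sum>p\<le>P. ?b p) * (\<Sum>q\<le>Q. ?wv q)" by (simp only: sum_product)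
    moreover have "(\<Sum>p\<le>P. \<Sum>q\<le>Q. ?v q * ?wb p) = (\<Sum>q\<le>Q. ?v q) * (\<Sum>p\<le>P. ?wb p)"
      by (subst sum.swap) (simp only: sum_product)
    ultimately show ?thesis by (simp only: sum_distrib_left[symmetric] sum.distrib)
  qed
  also have "\<dots> \<le> 12 * CM\<^sup>2 * (\<beta> * (\<Sum>q\<le>Q. ?wv q) + \<gamma> * (\<Sum>p\<le>P. ?wb p))"
    by (intro mult_left_mono add_mono mult_right_mono B V sum_nonneg w0) simp
  finally show ?thesis .
qed

text \<open>
  The maximum principle for the equation of each block gives
  \<open>\<parallel>\<Delta>\<^sub>j v\<parallel> \<le> \<parallel>\<Delta>\<^sub>j f\<parallel> + \<tau> \<parallel>interactions\<parallel>\<close>, and summing with the weights estimates the interactions by the product of the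
  norms of \<open>b\<close> and \<open>v\<close>. No derivative of \<open>v\<close> is lost, and the constant depends neither on \<open>\<tau>\<close> nor on
  \<open>\<mu>\<close>, nor on the number of frequencies of \<open>b\<close>.
\<close>

theorem a_priori_estimate:
  assumes a: "adm r s"
  shows "\<exists>C\<ge>1. \<forall>b v f \<tau> \<mu> F B M. \<tau> \<ge> 0 \<longrightarrow> \<mu> \<ge> 0 \<longrightarrow> (\<forall>l. fsupp (b l)) \<longrightarrow> (\<forall>l k. b l (- k) = cnj (b l k)) \<longrightarrow>
     divfree b \<longrightarrow> divfree v \<longrightarrow> step_eq \<tau> \<mu> (advc b v) f v \<longrightarrow> bes r s f F \<longrightarrow> bes r s b B \<longrightarrow> bes r s v M \<longrightarrow>
     bes r s v (F + C * \<tau> * B * M)"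
proof -
  obtain C1 where C1: "C1 \<ge> 1" "\<And>c M J. bes r s c M \<Longrightarrow> (\<Sum>j<J. 2 ^ j * nb2 j c) \<le> C1 * M"
    using bes_C1_embedding[OF a] by blast
  obtain C2 where C2: "C2 \<ge> 1" "\<And>c M J Q. bes r s c M \<Longrightarrow>
     lN r J (\<lambda>j. 2 powr (real j * s) * (\<Sum>q\<le>Q. if j \<le> q + 2 then nb2 q c else 0)) \<le> C2 * M"
    using bes_window[OF a] by blast
  have r: "r > 0" and r12: "r = 1 \<or> r = 2" using adm_pos[OF a] by auto
  define C where "C = 48 * CM\<^sup>2 * C1 * C2"
  have "bes r s v (F + C * \<tau> * B * M)"
    if t: "\<tau> \<ge> 0" and mu: "\<mu> \<ge> 0" and bs: "\<And>l. fsupp (b l)" and br: "\<And>l k. b l (- k) = cnj (b l k)"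
      and bd: "divfree b" and vd: "divfree v" and eq: "step_eq \<tau> \<mu> (advc b v) f v"
      and F: "bes r s f F" and B: "bes r s b B" and M: "bes r s v M" for b v f \<tau> \<mu> F B M
    unfolding bes_def
  proof
    fix J
    have "finite (\<Union>l. {k. b l k \<noteq> 0})" using bs by simp
    then obtain X where X: "\<And>l k. b l k \<noteq> 0 \<Longrightarrow> norm (freq k) \<le> X"
      using finite_imp_bounded[of "freq ` (\<Union>l. {k. b l k \<noteq> 0})"] unfolding bounded_iff by auto
    obtain P where "X < 2 ^ P" using real_arch_pow[of 2 X] by auto
    then have P: "norm (freq k) \<le> 2 ^ Suc P / 2" if "b l k \<noteq> 0" for l k using X[OF that] by simp
    \<comment> \<open>Large enough for the frequency condition of the block equation in all blocks below \<open>J\<close>.\<close>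
    define Q where "Q = Suc P + J + 1"
    have Q: "2 ^ Suc P / 2 + 2 ^ j \<le> (2::real) ^ Q / 2" if "j < J" for j
    proof -
      have "(2::real) ^ j \<le> 2 ^ J / 2" using that power_increasing[of "Suc j" J "2::real"] by simp
      moreover have "(2::real) ^ P \<le> 2 ^ (P + J)" "(2::real) ^ J \<le> 2 ^ (P + J)" by (intro power_increasing; simp)+
      moreover have "(2::real) ^ Q / 2 = 2 * 2 ^ (P + J)" "(2::real) ^ Suc P / 2 = 2 ^ P" by (simp_all add: Q_def)
      moreover have "(0::real) \<le> 2 ^ J" by simp
      ultimately show ?thesis by linarith
    qed
    define \<beta> \<gamma> where "\<beta> = C1 * B" and "\<gamma> = C1 * M"
    have bg: "\<beta> \<ge> 0" "\<gamma> \<ge> 0" using C1 bes_nonneg[OF a B] bes_nonneg[OF a M] by (auto simp: \<beta>_def \<gamma>_def)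
    have Bb: "(\<Sum>p\<le>Suc P. 2 ^ p * nb2 p b) \<le> \<beta>" unfolding \<beta>_def lessThan_Suc_atMost[symmetric] by (rule C1(2)[OF B])
    have Vb: "(\<Sum>q\<le>Q. 2 ^ q * nb2 q v) \<le> \<gamma>" unfolding \<gamma>_def lessThan_Suc_atMost[symmetric] by (rule C1(2)[OF M])
    let ?wv = "\<lambda>j. \<Sum>q\<le>Q. if j \<le> q + 2 then nb2 q v else 0"
    let ?wb = "\<lambda>j. \<Sum>p\<le>Suc P. if j \<le> p + 2 then nb2 p b else 0"
    have w0: "0 \<le> ?wv j" "0 \<le> ?wb j" for j by (rule sum_nonneg, simp add: nb2_nonneg)+
    define K where "K = \<tau> * (12 * CM\<^sup>2)"
    have K: "K \<ge> 0" using t by (simp add: K_def)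
    have main: "nb h j (v i) \<le> nb h j (f i) + K * (\<beta> * ?wv j + \<gamma> * ?wb j)" if j: "j < J" for i j
      unfolding nb_def[of h j "v i"]
    proof (rule snorm_le)
      fix x
      show "norm (blk h j (v i) x) \<le> nb h j (f i) + K * (\<beta> * ?wv j + \<gamma> * ?wb j)"
        unfolding blk_def
      proof (rule max_principle[OF fsupp_blk _ mu, where B = "\<lambda>l. ker (b l)" and \<tau> = \<tau>])
        show "Im (ker (b l) x) = 0" for l x
          by (rule fc_real_iff[OF cper_ker]) (simp add: fc_ker[OF bs] br)
        show "ker (\<lambda>k. msym h j k * v i k) x + of_real \<tau> * (\<Sum>l\<in>UNIV. ker (b l) x * ker (\<lambda>k. \<i> * of_int (k $ l) * (msym h j k * v i k)) x)
           + of_real \<mu> * ker (\<lambda>k. of_real ((norm (freq k))\<^sup>2) * (msym h j k * v i k)) x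
          = blk h j (f i) x - of_real \<tau> * (\<Sum>p\<le>Suc P. \<Sum>q\<le>Q. inter j i b v p q x)" for x
          using block_equation[where P = "Suc P" and i = i and x = x, OF bs eq P Q[OF j]] by (simp add: blk_def)
        fix x
        have "norm (blk h j (f i) x - of_real \<tau> * (\<Sum>p\<le>Suc P. \<Sum>q\<le>Q. inter j i b v p q x))
           \<le> norm (blk h j (f i) x) + \<tau> * norm (\<Sum>p\<le>Suc P. \<Sum>q\<le>Q. inter j i b v p q x)"
          using norm_triangle_ineq4[of "blk h j (f i) x" "of_real \<tau> * (\<Sum>p\<le>Suc P. \<Sum>q\<le>Q. inter j i b v p q x)"] t
          by (simp only: norm_mult norm_of_real abs_of_nonneg)
        also have "\<dots> \<le> nb h j (f i) + \<tau> * (12 * CM\<^sup>2 * (\<beta> * ?wv j + \<gamma> * ?wb j))"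
          by (intro add_mono norm_blk_le mult_left_mono inter_sum_le[OF bd vd Bb Vb] t)
        finally show "norm (blk h j (f i) x - of_real \<tau> * (\<Sum>p\<le>Suc P. \<Sum>q\<le>Q. inter j i b v p q x)) \<le> nb h j (f i) + K * (\<beta> * ?wv j + \<gamma> * ?wb j)"
          by (simp only: K_def mult.assoc)
      qed
    qed
    let ?Wv = "\<lambda>j. 2 powr (real j * s) * ?wv j" and ?Wb = "\<lambda>j. 2 powr (real j * s) * ?wb j"
    have W0: "0 \<le> ?Wv j" "0 \<le> ?Wb j" for j by (intro mult_nonneg_nonneg w0; simp)+
    have each: "lN r J (wseq s (v i)) \<le> lN r J (wseq s (f i)) + K * (\<beta> * (C2 * M) + \<gamma> * (C2 * B))" for i
    proof -
      have "lN r J (wseq s (v i)) \<le> lN r J (\<lambda>j. wseq s (f i) j + (K * \<beta> * ?Wv j + K * \<gamma> * ?Wb j))"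
      proof (rule lN_mono[OF r wseq_nonneg])
        fix j assume "j < J"
        then have "2 powr (real j * s) * nb h j (v i) \<le> 2 powr (real j * s) * (nb h j (f i) + K * (\<beta> * ?wv j + \<gamma> * ?wb j))"
          by (intro mult_left_mono main) auto
        then show "wseq s (v i) j \<le> wseq s (f i) j + (K * \<beta> * ?Wv j + K * \<gamma> * ?Wb j)"
          by (simp add: wseq_def distrib_left mult_ac)
      qed
      also have "\<dots> \<le> lN r J (wseq s (f i)) + lN r J (\<lambda>j. K * \<beta> * ?Wv j + K * \<gamma> * ?Wb j)"
        by (intro lN_add[OF r12] wseq_nonneg add_nonneg_nonneg mult_nonneg_nonneg K bg W0 w0) auto
      also have "lN r J (\<lambda>j. K * \<beta> * ?Wv j + K * \<gamma> * ?Wb j) \<le> lN r J (\<lambda>j. K * \<beta> * ?Wv j) + lN r J (\<lambda>j. K * \<gamma> * ?Wb j)"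
        by (intro lN_add[OF r12] mult_nonneg_nonneg K bg W0 w0) auto
      also have "\<dots> = K * \<beta> * lN r J ?Wv + K * \<gamma> * lN r J ?Wb"
        using K bg by (simp add: lN_cmult[OF r] del: mult.assoc)
      also have "\<dots> \<le> K * \<beta> * (C2 * M) + K * \<gamma> * (C2 * B)"
        by (intro add_mono mult_left_mono C2(2) B M mult_nonneg_nonneg K bg)
      finally show ?thesis by (simp add: algebra_simps)
    qed
    have "(\<Sum>i\<in>UNIV. lN r J (wseq s (v i))) \<le> (\<Sum>i\<in>UNIV. lN r J (wseq s (f i)) + K * (\<beta> * (C2 * M) + \<gamma> * (C2 * B)))"
      by (intro sum_mono each)
    also have "\<dots> = (\<Sum>i\<in>UNIV. lN r J (wseq s (f i))) + 2 * (K * (\<beta> * (C2 * M) + \<gamma> * (C2 * B)))"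
      by (simp add: UNIV_2)
    also have "\<dots> \<le> F + 2 * (K * (\<beta> * (C2 * M) + \<gamma> * (C2 * B)))"
      using F by (simp add: bes_def)
    also have "2 * (K * (\<beta> * (C2 * M) + \<gamma> * (C2 * B))) = C * \<tau> * B * M"
      by (simp add: K_def C_def \<beta>_def \<gamma>_def algebra_simps)
    finally show "(\<Sum>i\<in>UNIV. lN r J (wseq s (v i))) \<le> F + C * \<tau> * B * M" by simp
  qed
  moreover have "C \<ge> 1"
  proof -
    have "1 * 1 \<le> CM\<^sup>2 * C1" using CM(1) C1(1) by (intro mult_mono one_le_power) auto
    then have "1 * 1 \<le> CM\<^sup>2 * C1 * C2" using C2(1) by (intro mult_mono) auto
    then show ?thesis by (simp add: C_def)
  qed
  ultimately show ?thesis by blast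
qed

end

section \<open>Energy of the linear step\<close>

text \<open>
  The transport by a real divergence-free field is skew-symmetric: the real part of the integrand is half the divergence of
  \<open>A |U|\<^sup>2\<close>.
\<close>

lemma transport_skew:
  assumes A: "\<And>l. cper (A l)" "\<And>l. cper (A' l l)" "\<And>l. pder l (A l) (A' l l)" and div: "\<And>x. (\<Sum>l\<in>UNIV. A' l l x) = 0"
    and real: "\<And>l x. Im (A l x) = 0"
    and U: "cper U" "\<And>l. cper (U' l)" "\<And>l. pder l U (U' l)"
  shows "Re (mean (\<lambda>x. (\<Sum>l\<in>UNIV. A l x * U' l x) * cnj (U x))) = 0"
proof -
  let ?G = "\<lambda>x. (\<Sum>l\<in>UNIV. A l x * U' l x) * cnj (U x)"
  have cG: "cper ?G" by (intro cper_mult cper_sum cper_cnj A U)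
  have "mean (\<lambda>x. ?G x + cnj (?G x)) = fc (\<lambda>x. \<Sum>l\<in>UNIV. A l x * (U x * cnj (U' l x) + U' l x * cnj (U x))) 0"
    unfolding fc_def
  proof (rule mean_cong)
    fix x
    have cA: "cnj (A l x) = A l x" for l using real by (simp add: complex_eq_iff)
    show "?G x + cnj (?G x) = (\<Sum>l\<in>UNIV. A l x * (U x * cnj (U' l x) + U' l x * cnj (U x))) * cnj (ek 0 x)"
      by (simp add: UNIV_2 cA algebra_simps)
  qed
  also have "\<dots> = 0"
    by (subst fc_div_free_transport[where A' = A' and g = "\<lambda>x. U x * cnj (U x)"])
       (auto intro!: A div U cper_add cper_mult cper_cnj pder_mult pder_cnj)
  finally have "mean ?G + mean (\<lambda>x. cnj (?G x)) = 0" using mean_add[OF cG cper_cnj[OF cG]] by (simp only:)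
  then have "mean ?G + cnj (mean ?G) = 0" by (simp only: mean_cnj)
  then show ?thesis by (simp add: complex_eq_iff)
qed

lemma mean_mult_cnj_ker:
  assumes "cper g" "fsupp c" "finite K" "\<And>k. c k \<noteq> 0 \<Longrightarrow> k \<in> K"
  shows "mean (\<lambda>x. g x * cnj (ker c x)) = (\<Sum>k\<in>K. fc g k * cnj (c k))"
proof -
  have "mean (\<lambda>x. g x * cnj (ker c x)) = mean (\<lambda>x. \<Sum>k\<in>K. cnj (c k) * (g x * cnj (ek k x)))"
  proof (rule mean_cong)
    fix x show "g x * cnj (ker c x) = (\<Sum>k\<in>K. cnj (c k) * (g x * cnj (ek k x)))"
      by (subst ker_superset[OF assms(3,4)]) (auto simp: sum_distrib_left mult_ac)
  qed
  also have "\<dots> = (\<Sum>k\<in>K. cnj (c k) * mean (\<lambda>x. g x * cnj (ek k x)))"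
    by (subst mean_sum) (auto intro!: cper_mult cper_const cper_cnj cper_ek assms simp: mean_cmult)
  finally show ?thesis by (simp add: fc_def mult.commute)
qed

lemma mean_norm_sq_ker:
  assumes "finite K" "\<And>k. c k \<noteq> 0 \<Longrightarrow> k \<in> K"
  shows "mean (\<lambda>x. of_real ((norm (ker c x))\<^sup>2)) = of_real (\<Sum>k\<in>K. (norm (c k))\<^sup>2)"
proof -
  have "ker c x = (\<Sum>k\<in>K. c k * ek k x)" for x by (rule ker_superset[OF assms(1)]) (rule assms(2))
  then show ?thesis by (simp only: mean_norm_sq_trig[OF assms(1)])
qed

lemma fc_advc:
  assumes "\<And>l. fsupp (b l)" "fsupp (u i)"
  shows "fc (\<lambda>x. \<Sum>m\<in>UNIV. ker (b m) x * ker (\<lambda>k. \<i> * of_int (k $ m) * u i k) x) k = advc b u i k"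
proof -
  have "fc (\<lambda>x. \<Sum>m\<in>UNIV. ker (b m) x * ker (\<lambda>k. \<i> * of_int (k $ m) * u i k) x) k
      = (\<Sum>m\<in>UNIV. fc (\<lambda>x. ker (b m) x * ker (\<lambda>k. \<i> * of_int (k $ m) * u i k) x) k)"
    by (intro fc_sum cper_mult cper_ker)
  also have "\<dots> = advc b u i k"
    unfolding advc_def ker_def[of "b _"] by (simp add: fc_trig_mult[OF cper_ker] fc_ker assms)
  finally show ?thesis .
qed

lemma freq_sq: "(norm (freq k))\<^sup>2 = (\<Sum>i\<in>UNIV. (real_of_int (k $ i))\<^sup>2)"
  by (simp add: norm_freq UNIV_2)

lemma leray_div: "(\<Sum>i\<in>UNIV. of_int (k $ i) * leray N i k) = 0"
proof (cases "k = 0")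
  case False
  then have n: "complex_of_real ((norm (freq k))\<^sup>2) \<noteq> 0" by simp
  let ?S = "\<Sum>l\<in>UNIV. of_int (k $ l) * N l k"
  have "leray N i k = N i k - of_int (k $ i) * ?S / of_real ((norm (freq k))\<^sup>2)" for i
    by (simp add: leray_def sum_distrib_left sum_divide_distrib mult.assoc)
  then have "(\<Sum>i\<in>UNIV. of_int (k $ i) * leray N i k)
      = ?S - (\<Sum>i\<in>UNIV. of_int (k $ i) * of_int (k $ i)) * ?S / of_real ((norm (freq k))\<^sup>2)"
    by (simp add: right_diff_distrib sum_subtractf sum_distrib_right sum_divide_distrib mult.assoc)
  also have "(\<Sum>i\<in>UNIV. of_int (k $ i) * of_int (k $ i)) = complex_of_real ((norm (freq k))\<^sup>2)"
    unfolding freq_sq of_real_sum by (simp add: power2_eq_square)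
  finally show ?thesis using n by (simp only: nonzero_mult_div_cancel_left[OF n] diff_self)
qed simp

text \<open>
  The projection is symmetric, and divergence-free fields are orthogonal to gradients.
\<close>

lemma leray_dot:
  assumes "divfree u" shows "(\<Sum>i\<in>UNIV. leray N i k * cnj (u i k)) = (\<Sum>i\<in>UNIV. N i k * cnj (u i k))"
proof -
  let ?S = "(\<Sum>l\<in>UNIV. of_int (k $ l) * N l k) / of_real ((norm (freq k))\<^sup>2)"
  have "leray N i k = N i k - ?S * of_int (k $ i)" for i
    by (simp add: leray_def sum_distrib_left sum_distrib_right sum_divide_distrib mult.assoc mult.commute)
       (simp add: mult_ac)
  then have "(\<Sum>i\<in>UNIV. leray N i k * cnj (u i k)) = (\<Sum>i\<in>UNIV. N i k * cnj (u i k)) - ?S * (\<Sum>i\<in>UNIV. of_int (k $ i) * cnj (u i k))"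
    by (simp add: left_diff_distrib sum_subtractf sum_distrib_left mult.assoc)
  moreover have "(\<Sum>i\<in>UNIV. of_int (k $ i) * cnj (u i k)) = cnj (\<Sum>i\<in>UNIV. of_int (k $ i) * u i k)" by simp
  ultimately show ?thesis using assms by (simp add: divfree_def del: cnj_sum)
qed

lemma norm_leray_le: "norm (leray N i k) \<le> 2 * (norm (N 1 k) + norm (N 2 k))"
proof -
  have c: "\<bar>real_of_int (k $ i) * real_of_int (k $ l) / (norm (freq k))\<^sup>2\<bar> \<le> 1" for l
  proof (cases "k = 0")
    case False
    have "\<bar>freq k $ i\<bar> * \<bar>freq k $ l\<bar> \<le> norm (freq k) * norm (freq k)"
      by (intro mult_mono component_le_norm_cart) auto
    then show ?thesis using False by (simp add: abs_mult power2_eq_square divide_le_eq)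
  qed simp
  have "norm (leray N i k) \<le> norm (N i k) + norm (\<Sum>l\<in>UNIV. of_real (of_int (k $ i) * of_int (k $ l) / (norm (freq k))\<^sup>2) * N l k)"
    unfolding leray_def by (rule norm_triangle_ineq4)
  also have "norm (\<Sum>l\<in>UNIV. of_real (of_int (k $ i) * of_int (k $ l) / (norm (freq k))\<^sup>2) * N l k) \<le> (\<Sum>l\<in>UNIV. 1 * norm (N l k))"
    by (intro sum_norm_le) (simp only: norm_mult norm_of_real, intro mult_right_mono c, simp)
  also have "norm (N i k) \<le> norm (N 1 k) + norm (N 2 k)" using exhaust_2[of i] by auto
  finally show ?thesis by (simp add: UNIV_2)
qed

definition vsupp :: "(2 \<Rightarrow> int^2 \<Rightarrow> complex) \<Rightarrow> (int^2) set" where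
  "vsupp u = (\<Union>i. {k. u i k \<noteq> 0})"

lemma vsuppD: "k \<notin> vsupp u \<Longrightarrow> u i k = 0"
  by (auto simp: vsupp_def)

lemma finite_vsupp: "(\<And>i. fsupp (u i)) \<Longrightarrow> finite (vsupp u)"
  by (simp add: vsupp_def)

lemma advc_diff: "advc b (\<lambda>i k. u i k - v i k) i k = advc b u i k - advc b v i k"
  by (simp add: advc_def right_diff_distrib sum_subtractf)

lemma leray_diff: "leray (\<lambda>i k. M i k - N i k) i k = leray M i k - leray N i k"
  by (simp add: leray_def right_diff_distrib sum_subtractf)

lemma fsupp_advc:
  assumes "\<And>l. fsupp (b l)" "fsupp (u i)" shows "fsupp (advc b u i)"
  unfolding advc_def by (intro fsupp_sum fsupp_mult_left fsupp_shift[of "u i"] assms)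

lemma fsupp_leray: "(\<And>i. fsupp (N i)) \<Longrightarrow> fsupp (leray N i)"
  unfolding leray_def by (intro fsupp_diff fsupp_sum fsupp_mult_left)

lemma norm_sq_diff_scaled:
  "(norm (of_real a * p - of_real t * q))\<^sup>2 = a\<^sup>2 * (norm p)\<^sup>2 - 2 * a * t * Re (q * cnj p) + t\<^sup>2 * (norm (q::complex))\<^sup>2"
  unfolding cmod_power2 by (simp add: power2_eq_square algebra_simps)

lemma advc_energy:
  assumes b: "\<And>l. fsupp (b l)" and br: "\<And>l k. b l (- k) = cnj (b l k)" and bd: "divfree b"
    and u: "\<And>i. fsupp (u i)" and K: "finite K" "vsupp u \<subseteq> K"
  shows "(\<Sum>k\<in>K. Re (advc b u i k * cnj (u i k))) = 0"
proof -
  let ?G = "\<lambda>x. \<Sum>m\<in>UNIV. ker (b m) x * ker (\<lambda>k. \<i> * of_int (k $ m) * u i k) x"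
  have "Re (mean (\<lambda>x. ?G x * cnj (ker (u i) x))) = 0"
  proof (rule transport_skew[where A' = "\<lambda>l m. ker (\<lambda>k. \<i> * of_int (k $ m) * b l k)"])
    show "(\<Sum>l\<in>UNIV. ker (\<lambda>k. \<i> * of_int (k $ l) * b l k) x) = 0" for x
    proof -
      have "(\<Sum>l\<in>UNIV. ker (\<lambda>k. \<i> * of_int (k $ l) * b l k) x) = ker (\<lambda>k. \<Sum>l\<in>UNIV. \<i> * of_int (k $ l) * b l k) x"
        by (rule ker_sum[symmetric]) (rule fsupp_mult_left[OF b])
      also have "(\<lambda>k. \<Sum>l\<in>UNIV. \<i> * of_int (k $ l) * b l k) = (\<lambda>k. \<i> * (\<Sum>l\<in>UNIV. of_int (k $ l) * b l k))"
        by (simp add: sum_distrib_left mult.assoc)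
      finally show ?thesis using bd by (simp add: divfree_def)
    qed
    show "Im (ker (b l) x) = 0" for l x
      by (rule fc_real_iff[OF cper_ker]) (simp add: fc_ker[OF b] br)
  qed (auto intro: cper_ker pder_ker b u)
  also have "mean (\<lambda>x. ?G x * cnj (ker (u i) x)) = (\<Sum>k\<in>K. fc ?G k * cnj (u i k))"
    by (rule mean_mult_cnj_ker) (use K u in \<open>auto intro!: cper_sum cper_mult cper_ker simp: vsupp_def\<close>)
  also have "\<dots> = (\<Sum>k\<in>K. advc b u i k * cnj (u i k))"
    by (simp only: fc_advc[of b u i, OF b u])
  finally show ?thesis by (simp only: Re_sum)
qed

lemma advc_bound:
  assumes b: "\<And>l. fsupp (b l)" and B: "\<And>l x. norm (ker (b l) x) \<le> B" and u: "\<And>i. fsupp (u i)"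
    and K: "finite K" "vsupp u \<subseteq> K" "vsupp (advc b u) \<subseteq> K"
  shows "(\<Sum>k\<in>K. (norm (advc b u i k))\<^sup>2) \<le> 2 * B\<^sup>2 * (\<Sum>k\<in>K. (norm (freq k))\<^sup>2 * (norm (u i k))\<^sup>2)"
proof -
  let ?U = "\<lambda>m. ker (\<lambda>k. \<i> * of_int (k $ m) * u i k)"
  let ?G = "\<lambda>x. \<Sum>m\<in>UNIV. ker (b m) x * ?U m x"
  have G: "?G x = ker (advc b u i) x" for x
    by (rule fc_eqI) (auto intro!: cper_sum cper_mult cper_ker simp: fc_advc[of b u i, OF b u] fc_ker fsupp_advc[OF b u])
  have csq: "cper (\<lambda>y. (norm (f y))\<^sup>2)" if "cper f" for f :: "real^2 \<Rightarrow> complex"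
    unfolding power2_eq_square by (intro cper_mult cper_norm that)
  have "(\<Sum>k\<in>K. (norm (advc b u i k))\<^sup>2) = Re (mean (\<lambda>x. of_real ((norm (?G x))\<^sup>2)))"
    unfolding G by (subst mean_norm_sq_ker[OF K(1)]) (use K(3) in \<open>auto simp: vsupp_def\<close>)
  also have "\<dots> \<le> Re (mean (\<lambda>x. of_real ((norm (?U 1 x))\<^sup>2 * (2 * B\<^sup>2) + (norm (?U 2 x))\<^sup>2 * (2 * B\<^sup>2))))"
  proof (rule Re_mean_mono)
    show "cper (\<lambda>x. (norm (?G x))\<^sup>2)" by (intro csq cper_sum cper_mult cper_ker)
    show "cper (\<lambda>x. (norm (?U 1 x))\<^sup>2 * (2 * B\<^sup>2) + (norm (?U 2 x))\<^sup>2 * (2 * B\<^sup>2))"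
      by (intro cper_add cper_mult csq cper_ker cper_const)
    fix x
    have B0: "0 \<le> B" using order_trans[OF norm_ge_zero B] .
    have "norm (?G x) \<le> (\<Sum>m\<in>UNIV. B * norm (?U m x))"
      by (intro sum_norm_le) (simp add: norm_mult mult_right_mono B)
    then have "(norm (?G x))\<^sup>2 \<le> (B * (norm (?U 1 x) + norm (?U 2 x)))\<^sup>2"
      by (intro power_mono) (auto simp: UNIV_2 distrib_left)
    also have "\<dots> = B\<^sup>2 * (norm (?U 1 x) + norm (?U 2 x))\<^sup>2" by (rule power_mult_distrib)
    also have "\<dots> \<le> B\<^sup>2 * (2 * (norm (?U 1 x))\<^sup>2 + 2 * (norm (?U 2 x))\<^sup>2)"
      by (intro mult_left_mono) (use sum_squares_bound[of "norm (?U 1 x)" "norm (?U 2 x)"] in \<open>auto simp: power2_sum\<close>)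
    finally show "(norm (?G x))\<^sup>2 \<le> (norm (?U 1 x))\<^sup>2 * (2 * B\<^sup>2) + (norm (?U 2 x))\<^sup>2 * (2 * B\<^sup>2)"
      by (simp add: algebra_simps)
  qed
  also have "\<dots> = Re (mean (\<lambda>x. of_real ((norm (?U 1 x))\<^sup>2))) * (2 * B\<^sup>2) + Re (mean (\<lambda>x. of_real ((norm (?U 2 x))\<^sup>2))) * (2 * B\<^sup>2)"
  proof -
    have c: "cper (\<lambda>x. complex_of_real ((norm (?U m x))\<^sup>2) * of_real (2 * B\<^sup>2))" for m
      by (intro cper_mult cper_of_real csq cper_ker cper_const)
    show ?thesis unfolding of_real_add of_real_mult[of "_\<^sup>2"] mean_add[OF c c] mean_multc by simp
  qed
  also have "\<dots> = (\<Sum>k\<in>K. (real_of_int (k $ 1))\<^sup>2 * (norm (u i k))\<^sup>2) * (2 * B\<^sup>2) + (\<Sum>k\<in>K. (real_of_int (k $ 2))\<^sup>2 * (norm (u i k))\<^sup>2) * (2 * B\<^sup>2)"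
  proof -
    have "Re (mean (\<lambda>x. of_real ((norm (?U m x))\<^sup>2))) = (\<Sum>k\<in>K. (real_of_int (k $ m))\<^sup>2 * (norm (u i k))\<^sup>2)" for m
      by (subst mean_norm_sq_ker[OF K(1)]) (use K(2) in \<open>auto simp: vsupp_def norm_mult power_mult_distrib\<close>)
    then show ?thesis by (simp only:)
  qed
  finally show ?thesis
    by (simp add: freq_sq UNIV_2 distrib_right sum.distrib sum_distrib_left algebra_simps)
qed

definition energy :: "real \<Rightarrow> (int^2) set \<Rightarrow> (2 \<Rightarrow> int^2 \<Rightarrow> complex) \<Rightarrow> real" where
  "energy \<mu> K u = (\<Sum>k\<in>K. (1 + \<mu> * (norm (freq k))\<^sup>2) * (\<Sum>i\<in>UNIV. (norm (u i k))\<^sup>2))"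

text \<open>
  A damped Picard step for the homogeneous equation, preconditioned by \<open>(1 + \<mu>|k|\<^sup>2)\<^sup>-\<^sup>1\<close>.
\<close>

definition relax :: "real \<Rightarrow> real \<Rightarrow> (2 \<Rightarrow> int^2 \<Rightarrow> complex) \<Rightarrow> real \<Rightarrow> (2 \<Rightarrow> int^2 \<Rightarrow> complex) \<Rightarrow> 2 \<Rightarrow> int^2 \<Rightarrow> complex" where
  "relax \<tau> \<mu> b \<theta> u i k = of_real (1 - \<theta>) * u i k - of_real \<theta> * (of_real (\<tau> / (1 + \<mu> * (norm (freq k))\<^sup>2)) * leray (advc b u) i k)"

text \<open>
  In the energy norm the cross term of the damped step vanishes by skew-symmetry, so the step is a contraction for small
  \<open>\<theta>\<close>, however large \<open>\<tau>\<close> and \<open>b\<close> are. The undamped Picard iteration would require a small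
  \<open>\<tau> B / \<surd>\<mu>\<close>.
\<close>

lemma energy_relax:
  assumes b: "\<And>l. fsupp (b l)" and br: "\<And>l k. b l (- k) = cnj (b l k)" and bd: "divfree b"
    and B: "\<And>l x. norm (ker (b l) x) \<le> B"
    and u: "\<And>i. fsupp (u i)" "divfree u" and mu: "\<mu> > 0"
    and K: "finite K" "vsupp u \<subseteq> K" "vsupp (advc b u) \<subseteq> K"
  shows "energy \<mu> K (relax \<tau> \<mu> b \<theta> u) \<le> ((1 - \<theta>)\<^sup>2 + \<theta>\<^sup>2 * (32 * \<tau>\<^sup>2 * B\<^sup>2 / \<mu>)) * energy \<mu> K u"
proof -
  define w where "w k = 1 + \<mu> * (norm (freq k))\<^sup>2" for k
  have w: "w k \<ge> 1" "w k > 0" for k using mu by (auto simp: w_def add_pos_nonneg)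
  let ?N = "advc b u" and ?a = "leray (advc b u)"
  have pt: "w k * (norm (relax \<tau> \<mu> b \<theta> u i k))\<^sup>2 \<le> (1 - \<theta>)\<^sup>2 * (w k * (norm (u i k))\<^sup>2)
      - 2 * (1 - \<theta>) * \<theta> * \<tau> * Re (?a i k * cnj (u i k)) + \<theta>\<^sup>2 * \<tau>\<^sup>2 * (norm (?a i k))\<^sup>2" for i k
  proof -
    have "w k * (norm (relax \<tau> \<mu> b \<theta> u i k))\<^sup>2 = (1 - \<theta>)\<^sup>2 * (w k * (norm (u i k))\<^sup>2)
      - 2 * (1 - \<theta>) * \<theta> * (w k * (\<tau> / w k)) * Re (?a i k * cnj (u i k)) + \<theta>\<^sup>2 * (w k * (\<tau> / w k)\<^sup>2) * (norm (?a i k))\<^sup>2"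
    proof -
      have alg: "W * ((1 - \<theta>)\<^sup>2 * U - 2 * (1 - \<theta>) * \<theta> * (c * R) + \<theta>\<^sup>2 * (c\<^sup>2 * A))
         = (1 - \<theta>)\<^sup>2 * (W * U) - 2 * (1 - \<theta>) * \<theta> * (W * c) * R + \<theta>\<^sup>2 * (W * c\<^sup>2) * A" for W U c R A :: real
        by (simp add: algebra_simps)
      have "Re (of_real c * p * q) = c * Re (p * q)" "(norm (of_real c * p))\<^sup>2 = c\<^sup>2 * (norm p)\<^sup>2" for c and p q :: complex
        by (simp_all add: norm_mult power_mult_distrib algebra_simps)
      then show ?thesis
        unfolding relax_def norm_sq_diff_scaled w_def[symmetric] by (simp only: alg)
    qed
    also have "w k * (\<tau> / w k) = \<tau>" using w(2)[of k] by simp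
    also have "w k * (\<tau> / w k)\<^sup>2 = \<tau>\<^sup>2 / w k" using w(2)[of k] by (simp add: power2_eq_square)
    also have "\<theta>\<^sup>2 * (\<tau>\<^sup>2 / w k) * (norm (?a i k))\<^sup>2 \<le> \<theta>\<^sup>2 * \<tau>\<^sup>2 * (norm (?a i k))\<^sup>2"
      using w[of k] by (intro mult_right_mono mult_left_mono) (auto simp: divide_le_eq mult_le_cancel_left1)
    finally show ?thesis by simp
  qed
  have "energy \<mu> K (relax \<tau> \<mu> b \<theta> u) = (\<Sum>k\<in>K. \<Sum>i\<in>UNIV. w k * (norm (relax \<tau> \<mu> b \<theta> u i k))\<^sup>2)"
    unfolding energy_def w_def by (simp only: sum_distrib_left)
  also have "\<dots> \<le> (\<Sum>k\<in>K. \<Sum>i\<in>UNIV. (1 - \<theta>)\<^sup>2 * (w k * (norm (u i k))\<^sup>2)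
      - 2 * (1 - \<theta>) * \<theta> * \<tau> * Re (?a i k * cnj (u i k)) + \<theta>\<^sup>2 * \<tau>\<^sup>2 * (norm (?a i k))\<^sup>2)"
    by (intro sum_mono pt)
  also have "\<dots> = (1 - \<theta>)\<^sup>2 * energy \<mu> K u - 2 * (1 - \<theta>) * \<theta> * \<tau> * (\<Sum>k\<in>K. \<Sum>i\<in>UNIV. Re (?a i k * cnj (u i k)))
      + \<theta>\<^sup>2 * \<tau>\<^sup>2 * (\<Sum>k\<in>K. \<Sum>i\<in>UNIV. (norm (?a i k))\<^sup>2)"
    unfolding energy_def w_def[symmetric] by (simp only: sum.distrib sum_subtractf sum_distrib_left)
  also have "(\<Sum>k\<in>K. \<Sum>i\<in>UNIV. Re (?a i k * cnj (u i k))) = 0"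
  proof -
    have "(\<Sum>i\<in>UNIV. Re (?a i k * cnj (u i k))) = (\<Sum>i\<in>UNIV. Re (?N i k * cnj (u i k)))" for k
      using arg_cong[OF leray_dot[OF u(2), of ?N k], of Re] by (simp only: Re_sum)
    then have "(\<Sum>k\<in>K. \<Sum>i\<in>UNIV. Re (?a i k * cnj (u i k))) = (\<Sum>i\<in>UNIV. \<Sum>k\<in>K. Re (?N i k * cnj (u i k)))"
      by (simp only: sum.swap[of _ K])
    then show ?thesis by (simp only: advc_energy[OF b br bd u(1) K(1,2)]) simp
  qed
  also have "(\<Sum>k\<in>K. \<Sum>i\<in>UNIV. (norm (?a i k))\<^sup>2) \<le> 32 * B\<^sup>2 / \<mu> * energy \<mu> K u"
  proof -
    have "(\<Sum>k\<in>K. \<Sum>i\<in>UNIV. (norm (?a i k))\<^sup>2) \<le> (\<Sum>k\<in>K. \<Sum>i\<in>(UNIV :: 2 set). 8 * ((norm (?N 1 k))\<^sup>2 + (norm (?N 2 k))\<^sup>2))"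
    proof (intro sum_mono)
      fix k and i :: 2
      have "(norm (?a i k))\<^sup>2 \<le> (2 * (norm (?N 1 k) + norm (?N 2 k)))\<^sup>2" by (intro power_mono norm_leray_le) simp
      also have "\<dots> = 4 * (norm (?N 1 k) + norm (?N 2 k))\<^sup>2" unfolding power_mult_distrib by simp
      also have "\<dots> \<le> 8 * ((norm (?N 1 k))\<^sup>2 + (norm (?N 2 k))\<^sup>2)"
        using sum_squares_bound[of "norm (?N 1 k)" "norm (?N 2 k)"] by (simp add: power2_sum)
      finally show "(norm (?a i k))\<^sup>2 \<le> 8 * ((norm (?N 1 k))\<^sup>2 + (norm (?N 2 k))\<^sup>2)" .
    qed
    also have "\<dots> = 16 * ((\<Sum>k\<in>K. (norm (?N 1 k))\<^sup>2) + (\<Sum>k\<in>K. (norm (?N 2 k))\<^sup>2))"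
      by (simp add: sum.distrib sum_distrib_left algebra_simps)
    also have "\<dots> \<le> 16 * (2 * B\<^sup>2 * (\<Sum>k\<in>K. (norm (freq k))\<^sup>2 * (norm (u 1 k))\<^sup>2) + 2 * B\<^sup>2 * (\<Sum>k\<in>K. (norm (freq k))\<^sup>2 * (norm (u 2 k))\<^sup>2))"
      by (intro mult_left_mono add_mono advc_bound[OF b B u(1) K]) simp
    also have "\<dots> = 32 * B\<^sup>2 / \<mu> * (\<Sum>k\<in>K. (\<mu> * (norm (freq k))\<^sup>2) * (\<Sum>i\<in>UNIV. (norm (u i k))\<^sup>2))"
      using mu by (simp add: UNIV_2 sum_distrib_left sum.distrib algebra_simps)
    also have "\<dots> \<le> 32 * B\<^sup>2 / \<mu> * energy \<mu> K u"
      unfolding energy_def using mu by (intro mult_left_mono sum_mono mult_right_mono) (auto intro: sum_nonneg)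
    finally show ?thesis .
  qed
  then have "\<theta>\<^sup>2 * \<tau>\<^sup>2 * (\<Sum>k\<in>K. \<Sum>i\<in>UNIV. (norm (?a i k))\<^sup>2) \<le> \<theta>\<^sup>2 * \<tau>\<^sup>2 * (32 * B\<^sup>2 / \<mu> * energy \<mu> K u)"
    by (rule mult_left_mono) simp
  finally show ?thesis by (simp add: algebra_simps)
qed

section \<open>Solving the linear step for trigonometric data\<close>

text \<open>
  The families of coefficients of real fields.
\<close>

definition rsymm :: "(2 \<Rightarrow> int^2 \<Rightarrow> complex) \<Rightarrow> bool" where
  "rsymm c \<longleftrightarrow> (\<forall>l k. c l (- k) = cnj (c l k))"

lemma advc_rsymm:
  assumes "rsymm b" "rsymm u" shows "rsymm (advc b u)"
  unfolding rsymm_def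
proof (intro allI)
  fix i k
  have bm: "b m (- l) = cnj (b m l)" and um: "u i (- l) = cnj (u i l)" for m l using assms by (auto simp: rsymm_def)
  have "(\<Sum>l | b m l \<noteq> 0. b m l * (\<i> * of_int ((- k - l) $ m) * u i (- k - l)))
      = (\<Sum>l | b m l \<noteq> 0. cnj (b m l * (\<i> * of_int ((k - l) $ m) * u i (k - l))))" for m
  proof (rule sum.reindex_bij_witness[of _ uminus uminus])
    fix l
    have "u i (- k - (- l)) = cnj (u i (k - l))" using um[of "k - l"] by (simp add: algebra_simps)
    then show "cnj (b m (- l) * (\<i> * of_int ((k - - l) $ m) * u i (k - - l))) = b m l * (\<i> * of_int ((- k - l) $ m) * u i (- k - l))" if "l \<in> {l. b m l \<noteq> 0}"
      using um[of "k + l"] bm[of m l] by (simp add: algebra_simps)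
  qed (auto simp: bm)
  then show "advc b u i (- k) = cnj (advc b u i k)" by (simp add: advc_def)
qed

lemma leray_rsymm: "rsymm N \<Longrightarrow> rsymm (leray N)"
  by (simp add: rsymm_def leray_def)

lemma relax_diff: "relax \<tau> \<mu> b \<theta> (\<lambda>i k. u i k - v i k) i k = relax \<tau> \<mu> b \<theta> u i k - relax \<tau> \<mu> b \<theta> v i k"
proof -
  have "advc b (\<lambda>i k. u i k - v i k) = (\<lambda>i k. advc b u i k - advc b v i k)" by (intro ext) (rule advc_diff)
  moreover have "A * (x - y) - t * (c * (p - q)) = (A * x - t * (c * p)) - (A * y - t * (c * q))" for A x y t c p q :: complex
    by (simp add: algebra_simps)
  ultimately show ?thesis by (simp only: relax_def leray_diff)
qed

lemma fsupp_relax: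
  assumes "\<And>l. fsupp (b l)" "\<And>i. fsupp (u i)" shows "fsupp (relax \<tau> \<mu> b \<theta> u i)"
  unfolding relax_def by (intro fsupp_diff fsupp_mult_left fsupp_leray fsupp_advc assms)

lemma divfree_relax: assumes "divfree u" shows "divfree (relax \<tau> \<mu> b \<theta> u)"
  unfolding divfree_def
proof
  fix k
  let ?c = "of_real \<theta> * of_real (\<tau> / (1 + \<mu> * (norm (freq k))\<^sup>2)) :: complex"
  have "(\<Sum>l\<in>UNIV. of_int (k $ l) * relax \<tau> \<mu> b \<theta> u l k)
     = of_real (1 - \<theta>) * (\<Sum>l\<in>UNIV. of_int (k $ l) * u l k) - ?c * (\<Sum>l\<in>UNIV. of_int (k $ l) * leray (advc b u) l k)"
    by (simp add: relax_def UNIV_2 algebra_simps)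
  then show "(\<Sum>l\<in>UNIV. of_int (k $ l) * relax \<tau> \<mu> b \<theta> u l k) = 0"
    using assms by (simp add: leray_div divfree_def)
qed

lemma rsymm_relax: "rsymm b \<Longrightarrow> rsymm u \<Longrightarrow> rsymm (relax \<tau> \<mu> b \<theta> u)"
  using leray_rsymm[OF advc_rsymm, of b u] by (simp add: rsymm_def relax_def freq_minus)

lemma energy_superset: "finite K \<Longrightarrow> vsupp u \<subseteq> K \<Longrightarrow> energy \<mu> K u = energy \<mu> (vsupp u) u"
  unfolding energy_def by (rule sum.mono_neutral_right) (auto simp: vsuppD)

lemma norm_sq_le_energy:
  assumes "\<mu> > 0" "\<And>i. fsupp (u i)" shows "(norm (u i k))\<^sup>2 \<le> energy \<mu> (vsupp u) u"
proof (cases "k \<in> vsupp u")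
  case True
  have "(norm (u i k))\<^sup>2 \<le> (\<Sum>i\<in>UNIV. (norm (u i k))\<^sup>2)" by (rule member_le_sum) auto
  also have "\<dots> \<le> (1 + \<mu> * (norm (freq k))\<^sup>2) * (\<Sum>i\<in>UNIV. (norm (u i k))\<^sup>2)"
  proof -
    have "1 * (\<Sum>i\<in>UNIV. (norm (u i k))\<^sup>2) \<le> (1 + \<mu> * (norm (freq k))\<^sup>2) * (\<Sum>i\<in>UNIV. (norm (u i k))\<^sup>2)"
      using assms(1) by (intro mult_right_mono sum_nonneg) auto
    then show ?thesis by simp
  qed
  also have "\<dots> \<le> energy \<mu> (vsupp u) u" unfolding energy_def
    using True assms finite_vsupp[of u]
    by (intro member_le_sum[where f = "\<lambda>k. (1 + \<mu> * (norm (freq k))\<^sup>2) * (\<Sum>i\<in>UNIV. (norm (u i k))\<^sup>2)"])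
       (auto intro!: mult_nonneg_nonneg sum_nonneg)
  finally show ?thesis .
next
  case False
  then show ?thesis using assms(1) by (simp add: vsuppD energy_def sum_nonneg)
qed

text \<open>
  The damped iteration started at zero stays among trigonometric polynomials, because \<open>b\<close> and \<open>f\<close> have finitely
  many frequencies, and converges geometrically. The limit is taken coefficientwise, so no function space has to be complete.
\<close>

theorem linear_step_solvable:
  assumes b: "\<And>l. fsupp (b l)" "rsymm b" "divfree b" and f: "\<And>i. fsupp (f i)" "rsymm f" "divfree f"
    and mu: "\<mu> > 0"
  shows "\<exists>v C. step_eq \<tau> \<mu> (advc b v) f v \<and> divfree v \<and> rsymm v \<and> (\<forall>i k. norm (v i k) \<le> C)"
proof -
  obtain B where B: "\<And>l x. norm (ker (b l) x) \<le> B"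
  proof -
    obtain B1 where "\<And>x. norm (ker (b 1) x) \<le> B1" using cper_bounded[OF cper_ker] by blast
    moreover obtain B2 where "\<And>x. norm (ker (b 2) x) \<le> B2" using cper_bounded[OF cper_ker] by blast
    ultimately have "norm (ker (b l) x) \<le> max B1 B2" for l x using exhaust_2[of l] by (auto simp: le_max_iff_disj)
    then show thesis by (rule that)
  qed
  define L where "L = 32 * \<tau>\<^sup>2 * B\<^sup>2 / \<mu>"
  have L: "L \<ge> 0" using mu by (simp add: L_def)
  \<comment> \<open>The minimiser of the contraction factor \<open>(1 - \<theta>)\<^sup>2 + \<theta>\<^sup>2 L\<close>.\<close>
  define \<theta> where "\<theta> = 1 / (1 + L)"
  have th: "\<theta> > 0" using L by (simp add: \<theta>_def)
  define q where "q = (1 - \<theta>)\<^sup>2 + \<theta>\<^sup>2 * L"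
  have "q = L / (1 + L)"
  proof -
    have "1 - \<theta> = L / (1 + L)" using L by (simp add: \<theta>_def field_simps)
    then have "q = (L\<^sup>2 + L) / (1 + L)\<^sup>2" by (simp add: q_def \<theta>_def power_divide add_divide_distrib)
    also have "\<dots> = (L * (1 + L)) / ((1 + L) * (1 + L))" by (simp add: power2_eq_square algebra_simps)
    finally show ?thesis using L by simp
  qed
  then have q: "0 \<le> q" "q < 1" using L by (auto simp: divide_less_eq)
  define w where "w k = 1 + \<mu> * (norm (freq k))\<^sup>2" for k
  have w: "w k > 0" for k using mu by (simp add: w_def add_pos_nonneg)
  define T where "T u i k = relax \<tau> \<mu> b \<theta> u i k + of_real \<theta> * (f i k / of_real (w k))" for u i k
  define U where "U n = (T ^^ n) (\<lambda>i k. 0)" for n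
  have US: "U (Suc n) = T (U n)" for n by (simp add: U_def)
  have U: "(\<forall>i. fsupp (U n i)) \<and> divfree (U n) \<and> rsymm (U n)" for n
  proof (induction n)
    case 0 then show ?case by (simp add: U_def divfree_def rsymm_def)
  next
    case (Suc n)
    have "fsupp (T (U n) i)" for i
      unfolding T_def divide_inverse using Suc by (intro fsupp_add fsupp_relax fsupp_mult_left fsupp_mult_right b f) auto
    moreover have "divfree (T (U n))" unfolding divfree_def
    proof
      fix k
      have "(\<Sum>l\<in>UNIV. of_int (k $ l) * T (U n) l k) = (\<Sum>l\<in>UNIV. of_int (k $ l) * relax \<tau> \<mu> b \<theta> (U n) l k)
          + of_real \<theta> / of_real (w k) * (\<Sum>l\<in>UNIV. of_int (k $ l) * f l k)"
        by (simp add: T_def UNIV_2 algebra_simps)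
      then show "(\<Sum>l\<in>UNIV. of_int (k $ l) * T (U n) l k) = 0"
        using f(3) divfree_relax[of "U n" \<tau> \<mu> b \<theta>] Suc by (simp add: divfree_def)
    qed
    moreover have "rsymm (T (U n))"
      using rsymm_relax[OF b(2), of "U n" \<tau> \<mu> \<theta>] Suc f(2) by (simp add: rsymm_def T_def w_def)
    ultimately show ?case unfolding US by blast
  qed
  define d where "d n i k = U (Suc n) i k - U n i k" for n i k
  have dS: "d (Suc n) = relax \<tau> \<mu> b \<theta> (d n)" for n
  proof (intro ext)
    fix i k
    have TD: "T u i k - T u' i k = relax \<tau> \<mu> b \<theta> (\<lambda>i k. u i k - u' i k) i k" for u u'
      by (simp only: relax_diff T_def) simp
    show "d (Suc n) i k = relax \<tau> \<mu> b \<theta> (d n) i k" by (simp only: d_def[abs_def] US TD)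
  qed
  have d: "\<And>i. fsupp (d n i)" "divfree (d n)" for n
  proof -
    show "fsupp (d n i)" for i unfolding d_def using U by (intro fsupp_diff) auto
    show "divfree (d n)" using U[of n] U[of "Suc n"] by (simp add: divfree_def d_def right_diff_distrib sum_subtractf)
  qed
  have en: "energy \<mu> (vsupp (d n)) (d n) \<le> q ^ n * energy \<mu> (vsupp (d 0)) (d 0)" for n
  proof (induction n)
    case (Suc n)
    define K where "K = vsupp (d n) \<union> vsupp (advc b (d n)) \<union> vsupp (d (Suc n))"
    have K: "finite K" unfolding K_def using d fsupp_advc[OF b(1) d(1)] by (simp add: finite_vsupp)
    have "energy \<mu> (vsupp (d (Suc n))) (d (Suc n)) = energy \<mu> K (relax \<tau> \<mu> b \<theta> (d n))"
      by (subst energy_superset[OF K, symmetric]) (auto simp: K_def dS)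
    also have "\<dots> \<le> q * energy \<mu> K (d n)"
      unfolding q_def L_def
      by (rule energy_relax[OF b(1) _ b(3) B d(1) d(2) mu K]) (use b(2) in \<open>auto simp: K_def rsymm_def\<close>)
    also have "energy \<mu> K (d n) = energy \<mu> (vsupp (d n)) (d n)" by (rule energy_superset[OF K]) (auto simp: K_def)
    also have "q * energy \<mu> (vsupp (d n)) (d n) \<le> q * (q ^ n * energy \<mu> (vsupp (d 0)) (d 0))" by (intro mult_left_mono Suc q)
    finally show ?case by (simp add: mult_ac)
  qed simp
  define E0 where "E0 = sqrt (energy \<mu> (vsupp (d 0)) (d 0))"
  have "energy \<mu> (vsupp (d 0)) (d 0) \<ge> 0" using mu unfolding energy_def by (intro sum_nonneg mult_nonneg_nonneg) auto
  then have E0: "E0 \<ge> 0" "E0\<^sup>2 = energy \<mu> (vsupp (d 0)) (d 0)" by (auto simp: E0_def)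
  define p where "p = sqrt q"
  have p: "0 \<le> p" "p < 1" "p\<^sup>2 = q" using q by (auto simp: p_def)
  have db: "norm (d n i k) \<le> E0 * p ^ n" for n i k
  proof -
    have "(norm (d n i k))\<^sup>2 \<le> (E0 * p ^ n)\<^sup>2"
    proof -
      have "(E0 * p ^ n)\<^sup>2 = q ^ n * E0\<^sup>2"
        unfolding p(3)[symmetric] power_mult_distrib power_mult[symmetric] by (simp add: mult.commute)
      then show ?thesis
        using norm_sq_le_energy[of \<mu> "d n" i k, OF mu d(1)] en[of n] E0(2) by simp
    qed
    then show ?thesis using E0(1) p(1) by (simp add: power2_le_iff_abs_le)
  qed
  have geo: "summable (\<lambda>n. E0 * p ^ n)" using p by (intro summable_mult summable_geometric) simp
  define v where "v i k = (\<Sum>n. d n i k)" for i k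
  have sd: "summable (\<lambda>n. d n i k)" for i k by (rule summable_comparison_test'[OF geo]) (rule db)
  have lim: "(\<lambda>n. U n i k) \<longlonglongrightarrow> v i k" for i k
  proof -
    have "U n i k = (\<Sum>m<n. d m i k)" for n unfolding d_def by (subst sum_lessThan_telescope) (simp add: U_def)
    then show ?thesis using summable_LIMSEQ[OF sd] by (simp add: v_def)
  qed
  have fixp: "T v i k = v i k" for i k
  proof (rule LIMSEQ_unique)
    show "(\<lambda>n. T (U n) i k) \<longlonglongrightarrow> T v i k"
      unfolding T_def relax_def leray_def advc_def by (intro tendsto_intros lim)
    show "(\<lambda>n. T (U n) i k) \<longlonglongrightarrow> v i k" unfolding US[symmetric] by (rule LIMSEQ_Suc[OF lim])
  qed
  have "step_eq \<tau> \<mu> (advc b v) f v"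
    unfolding step_eq_def
  proof (intro allI)
    fix i k
    let ?w = "complex_of_real (w k)" and ?a = "leray (advc b v) i k"
    have wn: "?w \<noteq> 0" using w[of k] by simp
    have "of_real (1 - \<theta>) * v i k - of_real \<theta> * (of_real (\<tau> / w k) * ?a) + of_real \<theta> * (f i k / ?w) = v i k"
      using fixp[of i k] by (simp only: T_def relax_def w_def)
    then have "of_real \<theta> * (f i k / ?w - of_real (\<tau> / w k) * ?a - v i k) = 0" by (simp add: algebra_simps)
    then have "f i k / ?w - of_real (\<tau> / w k) * ?a - v i k = 0" using th by simp
    then have "?w * (f i k / ?w - of_real \<tau> / ?w * ?a - v i k) = 0" by simp
    then have "f i k - of_real \<tau> * ?a - ?w * v i k = 0" using wn by (simp add: right_diff_distrib)
    then show "of_real (1 + \<mu> * (norm (freq k))\<^sup>2) * v i k + of_real \<tau> * leray (advc b v) i k = f i k"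
      by (simp add: w_def algebra_simps)
  qed
  moreover have "divfree v" unfolding divfree_def
  proof
    fix k
    show "(\<Sum>l\<in>UNIV. of_int (k $ l) * v l k) = 0"
    proof (rule LIMSEQ_unique)
      show "(\<lambda>n. \<Sum>l\<in>UNIV. of_int (k $ l) * U n l k) \<longlonglongrightarrow> (\<Sum>l\<in>UNIV. of_int (k $ l) * v l k)"
        by (intro tendsto_intros lim)
      show "(\<lambda>n. \<Sum>l\<in>UNIV. of_int (k $ l) * U n l k) \<longlonglongrightarrow> 0" using U by (simp add: divfree_def)
    qed
  qed
  moreover have "rsymm v" unfolding rsymm_def
  proof (intro allI)
    fix l k
    have "(\<lambda>n. cnj (U n l k)) \<longlonglongrightarrow> cnj (v l k)" by (intro tendsto_cnj lim)
    then show "v l (- k) = cnj (v l k)"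
      using U lim[of l "- k"] LIMSEQ_unique by (auto simp: rsymm_def)
  qed
  moreover have "norm (v i k) \<le> (\<Sum>n. E0 * p ^ n)" for i k
    unfolding v_def by (rule norm_suminf_le[OF db geo])
  ultimately show ?thesis by blast
qed

lemma fsupp_weighted_bound:
  fixes f :: "2 \<Rightarrow> int^2 \<Rightarrow> complex"
  assumes "\<And>i. fsupp (f i)" obtains F where "F \<ge> 0" "\<And>i k. norm (f i k) * (1 + norm (freq k)) ^ m \<le> F"
proof -
  define F where "F = (\<Sum>i\<in>UNIV. \<Sum>k | f i k \<noteq> 0. norm (f i k) * (1 + norm (freq k)) ^ m)"
  have t: "0 \<le> norm (f i k) * (1 + norm (freq k)) ^ m" for i k by simp
  have "norm (f i k) * (1 + norm (freq k)) ^ m \<le> F" for i k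
  proof (cases "f i k = 0")
    case False
    have "norm (f i k) * (1 + norm (freq k)) ^ m \<le> (\<Sum>k | f i k \<noteq> 0. norm (f i k) * (1 + norm (freq k)) ^ m)"
      using False assms by (intro member_le_sum[where f = "\<lambda>k. norm (f i k) * (1 + norm (freq k)) ^ m"]) auto
    also have "\<dots> \<le> F" unfolding F_def
      by (rule member_le_sum[where f = "\<lambda>i. \<Sum>k | f i k \<noteq> 0. norm (f i k) * (1 + norm (freq k)) ^ m"]) (auto intro: sum_nonneg)
    finally show ?thesis .
  qed (use t in \<open>auto simp: F_def intro!: sum_nonneg\<close>)
  moreover have "F \<ge> 0" unfolding F_def by (intro sum_nonneg t)
  ultimately show thesis by (rule that[rotated])
qed

text \<open>
  Bootstrapping: the transport term loses one power of \<open>|k|\<close> and the elliptic operator gains two, so each round improves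
  the decay by one power. The bounds depend on \<open>\<mu>\<close> and serve only to make the norms finite.
\<close>

theorem elliptic_decay:
  assumes b: "\<And>l. fsupp (b l)" and f: "\<And>i. fsupp (f i)" and mu: "\<mu> > 0" and t: "\<tau> \<ge> 0"
    and eq: "step_eq \<tau> \<mu> (advc b v) f v" and v: "\<And>i k. norm (v i k) \<le> C0"
  shows "\<exists>C\<ge>0. \<forall>i k. norm (v i k) * (1 + norm (freq k)) ^ m \<le> C"
proof (induction m)
  case 0 then show ?case using v by (intro exI[of _ "max 0 C0"]) (auto simp: le_max_iff_disj)
next
  case (Suc m)
  then obtain C where C: "C \<ge> 0" "\<And>i k. norm (v i k) * (1 + norm (freq k)) ^ m \<le> C" by blast
  obtain F where F: "F \<ge> 0" "\<And>i k. norm (f i k) * (1 + norm (freq k)) ^ m \<le> F"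
    by (rule fsupp_weighted_bound[of f m, OF f]) blast
  let ?g = "\<lambda>k. 1 + norm (freq k)"
  have g1: "1 \<le> ?g k" for k by simp
  define D where "D = (\<Sum>j\<in>UNIV. \<Sum>l | b j l \<noteq> 0. norm (b j l) * ?g l ^ Suc m)"
  have D0: "D \<ge> 0" unfolding D_def by (intro sum_nonneg) auto
  have adv: "norm (advc b v i k) * ?g k ^ m \<le> D * C * ?g k" for i k
  proof -
    have each: "norm (b j l * (\<i> * of_int ((k - l) $ j) * v i (k - l))) * ?g k ^ m \<le> norm (b j l) * ?g l ^ Suc m * (C * ?g k)" for j l
    proof -
      have sub: "1 + x \<le> (1 + y) * (1 + z)" if "x \<le> y + z" "0 \<le> y" "0 \<le> z" for x y z :: real
      proof -
        have "(1 + y) * (1 + z) = 1 + y + z + y * z" by (simp add: algebra_simps)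
        then show ?thesis using that(1) mult_nonneg_nonneg[OF that(2,3)] by linarith
      qed
      have tri1: "?g k \<le> ?g l * ?g (k - l)"
        using norm_triangle_ineq[of "freq l" "freq (k - l)"] by (intro sub) (simp_all add: freq_diff)
      have tri2: "?g (k - l) \<le> ?g l * ?g k"
        using norm_triangle_ineq4[of "freq k" "freq l"] by (intro sub) (simp_all add: freq_diff add.commute)
      have "\<bar>real_of_int ((k - l) $ j)\<bar> \<le> ?g (k - l)"
        using component_le_norm_cart[of "freq (k - l)" j] by simp
      then have "norm (b j l) * (\<bar>real_of_int ((k - l) $ j)\<bar> * norm (v i (k - l))) * ?g k ^ m
         \<le> norm (b j l) * (?g (k - l) * norm (v i (k - l))) * (?g l * ?g (k - l)) ^ m"
      proof -
        assume le: "\<bar>real_of_int ((k - l) $ j)\<bar> \<le> ?g (k - l)"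
        have "\<bar>real_of_int ((k - l) $ j)\<bar> * norm (v i (k - l)) \<le> ?g (k - l) * norm (v i (k - l))"
          by (rule mult_right_mono[OF le norm_ge_zero])
        then have 1: "norm (b j l) * (\<bar>real_of_int ((k - l) $ j)\<bar> * norm (v i (k - l))) \<le> norm (b j l) * (?g (k - l) * norm (v i (k - l)))"
          by (rule mult_left_mono[OF _ norm_ge_zero])
        have 2: "?g k ^ m \<le> (?g l * ?g (k - l)) ^ m" by (rule power_mono[OF tri1]) simp
        show ?thesis by (rule mult_mono[OF 1 2]) simp_all
      qed
      moreover have "norm (b j l * (\<i> * of_int ((k - l) $ j) * v i (k - l))) = norm (b j l) * (\<bar>real_of_int ((k - l) $ j)\<bar> * norm (v i (k - l)))"
        by (simp only: norm_mult norm_ii mult_1_left norm_of_int)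
      ultimately have "norm (b j l * (\<i> * of_int ((k - l) $ j) * v i (k - l))) * ?g k ^ m
         \<le> norm (b j l) * (?g (k - l) * norm (v i (k - l))) * (?g l * ?g (k - l)) ^ m"
        by (simp only:)
      also have "\<dots> = norm (b j l) * ?g l ^ m * (?g (k - l) * (norm (v i (k - l)) * ?g (k - l) ^ m))"
        by (simp only: power_mult_distrib mult_ac)
      also have "\<dots> \<le> norm (b j l) * ?g l ^ m * ((?g l * ?g k) * C)"
        using C tri2 by (intro mult_left_mono mult_mono) auto
      finally show ?thesis by (simp add: mult_ac)
    qed
    have "norm (advc b v i k) \<le> (\<Sum>j\<in>UNIV. \<Sum>l | b j l \<noteq> 0. norm (b j l * (\<i> * of_int ((k - l) $ j) * v i (k - l))))"
      unfolding advc_def by (intro sum_norm_le order_refl)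
    then have "norm (advc b v i k) * ?g k ^ m \<le> (\<Sum>j\<in>UNIV. \<Sum>l | b j l \<noteq> 0. norm (b j l * (\<i> * of_int ((k - l) $ j) * v i (k - l)))) * ?g k ^ m"
      by (rule mult_right_mono) simp
    also have "\<dots> \<le> (\<Sum>j\<in>UNIV. \<Sum>l | b j l \<noteq> 0. norm (b j l) * ?g l ^ Suc m * (C * ?g k))"
      unfolding sum_distrib_right by (intro sum_mono each)
    also have "\<dots> = D * C * ?g k" unfolding D_def sum_distrib_right by (simp only: mult.assoc)
    finally show ?thesis .
  qed
  define c where "c = min 1 \<mu> / 2"
  have c: "c > 0" using mu by (simp add: c_def)
  have ell: "c * (?g k)\<^sup>2 \<le> 1 + \<mu> * (norm (freq k))\<^sup>2" for k
  proof -
    have "(?g k)\<^sup>2 \<le> 2 + 2 * (norm (freq k))\<^sup>2" using sum_squares_bound[of 1 "norm (freq k)"] by (simp add: power2_sum)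
    then have "c * (?g k)\<^sup>2 \<le> c * (2 + 2 * (norm (freq k))\<^sup>2)" using c by (intro mult_left_mono) auto
    also have "\<dots> = min 1 \<mu> * 1 + min 1 \<mu> * (norm (freq k))\<^sup>2" by (simp add: c_def algebra_simps)
    also have "\<dots> \<le> 1 * 1 + \<mu> * (norm (freq k))\<^sup>2" by (intro add_mono mult_right_mono) auto
    finally show ?thesis by simp
  qed
  have "norm (v i k) * ?g k ^ Suc m \<le> (F + \<tau> * (4 * (D * C))) / c" for i k
  proof -
    have "c * (?g k)\<^sup>2 * norm (v i k) \<le> (1 + \<mu> * (norm (freq k))\<^sup>2) * norm (v i k)" by (intro mult_right_mono ell) simp
    also have "\<dots> = norm (of_real (1 + \<mu> * (norm (freq k))\<^sup>2) * v i k)"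
      using mu by (simp only: norm_mult norm_of_real) (simp add: abs_of_nonneg add_nonneg_nonneg)
    also have "of_real (1 + \<mu> * (norm (freq k))\<^sup>2) * v i k = f i k - of_real \<tau> * leray (advc b v) i k"
      using eq[unfolded step_eq_def, rule_format, of k i] by (simp add: algebra_simps)
    also have "norm \<dots> \<le> norm (f i k) + \<tau> * (2 * (norm (advc b v 1 k) + norm (advc b v 2 k)))"
      using norm_triangle_ineq4[of "f i k" "of_real \<tau> * leray (advc b v) i k"] mult_left_mono[OF norm_leray_le[of "advc b v" i k] t] t
      by (simp add: norm_mult)
    finally have "c * (?g k)\<^sup>2 * norm (v i k) * ?g k ^ m \<le> (norm (f i k) + \<tau> * (2 * (norm (advc b v 1 k) + norm (advc b v 2 k)))) * ?g k ^ m"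
      by (rule mult_right_mono) simp
    also have "\<dots> = norm (f i k) * ?g k ^ m + \<tau> * (2 * (norm (advc b v 1 k) * ?g k ^ m + norm (advc b v 2 k) * ?g k ^ m))"
      by (simp only: distrib_right distrib_left mult.assoc)
    also have "\<dots> \<le> F + \<tau> * (2 * (D * C * ?g k + D * C * ?g k))"
      by (intro add_mono mult_left_mono F adv t) auto
    also have "\<dots> \<le> F * ?g k + \<tau> * (4 * (D * C)) * ?g k"
      using F(1) by (simp add: algebra_simps)
    finally have "(c * (norm (v i k) * ?g k ^ Suc m)) * ?g k \<le> (F + \<tau> * (4 * (D * C))) * ?g k"
      by (simp add: power2_eq_square algebra_simps)
    then have "c * (norm (v i k) * ?g k ^ Suc m) \<le> F + \<tau> * (4 * (D * C))"
    proof (rule mult_right_le_imp_le)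
      show "0 < ?g k" using g1[of k] by linarith
    qed
    then show ?thesis using c by (simp add: pos_le_divide_eq mult.commute)
  qed
  moreover have "(F + \<tau> * (4 * (D * C))) / c \<ge> 0" using F D0 C t c by simp
  ultimately show ?case by blast
qed

context lp_cutoff
begin

lemma lN_le_sum: "r = 1 \<or> r = 2 \<Longrightarrow> (\<And>j. 0 \<le> x j) \<Longrightarrow> lN r J x \<le> (\<Sum>j<J. x j)"
  using L2_set_le_sum[of "{..<J}" x] by (auto simp: lN_def L2_set_def sqrt_def)

lemma nb_le_sum: "nb h j c \<le> (\<Sum>k | msym h j k \<noteq> 0. norm (c k))"
  unfolding nb_def
proof (rule snorm_le)
  fix x
  have "blk h j c x = (\<Sum>k | msym h j k \<noteq> 0. (msym h j k * c k) * ek k x)"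
    unfolding blk_def by (rule ker_superset) auto
  also have "norm \<dots> \<le> (\<Sum>k | msym h j k \<noteq> 0. norm (c k))"
    by (intro sum_norm_le) (simp add: norm_mult mult_left_le_one_le norm_msym_le)
  finally show "norm (blk h j c x) \<le> (\<Sum>k | msym h j k \<noteq> 0. norm (c k))" .
qed

theorem decay_imp_bes:
  assumes a: "adm r s" and dec: "\<And>m. \<exists>C\<ge>0. \<forall>i k. norm (c i k) * (1 + norm (freq k)) ^ m \<le> C"
  shows "\<exists>M. bes r s c M"
proof -
  obtain m :: nat where m: "s + 3 \<le> real m" using real_arch_simple by blast
  obtain C where C: "C \<ge> 0" "\<And>i k. norm (c i k) * (1 + norm (freq k)) ^ m \<le> C" using dec by blast
  define A where "A = 9 * C * 4 ^ m"
  have nb: "wseq s (c i) j \<le> A * (1 / 2) ^ j" for i j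
  proof -
    have ck: "norm (c i k) \<le> C * 4 ^ m / 2 ^ (j * m)" if "msym h j k \<noteq> 0" for k
    proof -
      have "2 ^ j / 4 \<le> 1 + norm (freq k)"
        using msym_nonzeroD(2)[OF that] by (cases "j = 0") auto
      then have "(2 ^ j / 4) ^ m \<le> (1 + norm (freq k)) ^ m" by (intro power_mono) auto
      then have "norm (c i k) * (2 ^ j / 4) ^ m \<le> norm (c i k) * (1 + norm (freq k)) ^ m" by (intro mult_left_mono) auto
      also have "\<dots> \<le> C" by (rule C)
      finally show ?thesis by (simp add: power_divide power_mult field_simps)
    qed
    have card: "real (card {k. msym h j k \<noteq> 0}) \<le> 9 * 4 ^ j"
    proof -
      have "\<bar>real_of_int (k $ i)\<bar> \<le> norm (freq k)" for k i
        using component_le_norm_cart[of "freq k" i] by simp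
      moreover have "norm (freq k) \<le> 2 ^ j" if "msym h j k \<noteq> 0" for k using msym_nonzeroD(1)[OF that] by simp
      ultimately have "{k. msym h j k \<noteq> 0} \<subseteq> cube (2 ^ j)"
        unfolding cube_def by (blast intro: order_trans)
      then have "real (card {k. msym h j k \<noteq> 0}) \<le> real (card (cube (2 ^ j)))" by (simp add: card_mono)
      also have "\<dots> \<le> (2 * 2 ^ j + 1)\<^sup>2" by (rule card_cube_le) simp
      also have "\<dots> \<le> (3 * 2 ^ j)\<^sup>2" by (intro power_mono) auto
      also have "\<dots> = 9 * 4 ^ j" by (simp add: power_mult_distrib power2_eq_square power_mult_distrib[symmetric])
      finally show ?thesis .
    qed
    have "nb h j (c i) \<le> (\<Sum>k | msym h j k \<noteq> 0. C * 4 ^ m / 2 ^ (j * m))"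
      by (rule order_trans[OF nb_le_sum sum_mono]) (use ck in auto)
    also have "\<dots> = real (card {k. msym h j k \<noteq> 0}) * (C * 4 ^ m / 2 ^ (j * m))" by simp
    also have "\<dots> \<le> (9 * 4 ^ j) * (C * 4 ^ m / 2 ^ (j * m))" using C(1) by (intro mult_right_mono card) auto
    finally have "2 powr (real j * s) * nb h j (c i) \<le> 2 powr (real j * s) * ((9 * 4 ^ j) * (C * 4 ^ m / 2 ^ (j * m)))"
      by (intro mult_left_mono) auto
    also have "\<dots> = A * (2 powr (real j * s) * 4 ^ j / 2 ^ (j * m))" by (simp add: A_def)
    also have "2 powr (real j * s) * 4 ^ j / 2 ^ (j * m) = 2 powr (real j * (s + 2 - real m))"
    proof -
      have "(4::real) ^ j = 2 powr (real j * 2)" by (simp add: powr_powr[symmetric] powr_realpow[symmetric] mult.commute[of _ 2])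
      moreover have "(2::real) ^ (j * m) = 2 powr (real j * real m)" by (simp add: powr_realpow[symmetric])
      ultimately show ?thesis by (simp add: powr_add[symmetric] powr_diff[symmetric] algebra_simps)
    qed
    also have "A * 2 powr (real j * (s + 2 - real m)) \<le> A * 2 powr (- real j)"
    proof (intro mult_left_mono powr_mono)
      have "real j * (s + 2 - real m) \<le> real j * (-1)" using m by (intro mult_left_mono) auto
      then show "real j * (s + 2 - real m) \<le> - real j" by simp
    qed (use C in \<open>auto simp: A_def\<close>)
    also have "2 powr (- real j) = (1 / 2) ^ j" by (simp add: powr_minus powr_realpow power_one_over inverse_eq_divide)
    finally show ?thesis by (simp add: wseq_def)
  qed
  have A0: "A \<ge> 0" using C by (simp add: A_def)
  have "(\<Sum>i\<in>UNIV. lN r J (wseq s (c i))) \<le> 2 * (A * 2)" for J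
  proof -
    have "lN r J (wseq s (c i)) \<le> A * 2" for i
    proof -
      have "lN r J (wseq s (c i)) \<le> (\<Sum>j<J. wseq s (c i) j)" by (rule lN_le_sum[OF adm_pos(3)[OF a] wseq_nonneg])
      also have "\<dots> \<le> (\<Sum>j<J. A * (1 / 2) ^ j)" by (intro sum_mono nb)
      also have "\<dots> \<le> A * 2"
        unfolding sum_distrib_left[symmetric] using A0 by (intro mult_left_mono) (auto simp: sum_gp_strict)
      finally show ?thesis .
    qed
    then have "(\<Sum>i\<in>UNIV. lN r J (wseq s (c i))) \<le> (\<Sum>i\<in>(UNIV :: 2 set). A * 2)" by (intro sum_mono)
    then show ?thesis by simp
  qed
  then show ?thesis unfolding bes_def by blast
qed

end

section \<open>Fields with given coefficients and passage to the limit\<close>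

text \<open>
  Uniform convergence on the plane with a weak inequality, which passes to limits more easily.
\<close>

definition ulim :: "(nat \<Rightarrow> real^2 \<Rightarrow> complex) \<Rightarrow> (real^2 \<Rightarrow> complex) \<Rightarrow> bool" where
  "ulim F f \<longleftrightarrow> (\<forall>e>0. \<exists>N. \<forall>n\<ge>N. \<forall>x. norm (F n x - f x) \<le> e)"

lemma ulimD: "ulim F f \<Longrightarrow> e > 0 \<Longrightarrow> \<exists>N. \<forall>n\<ge>N. \<forall>x. norm (F n x - f x) \<le> e"
  by (simp add: ulim_def)

lemma ulimI_bound:
  assumes "\<And>n x. norm (F n x - f x) \<le> a n" "a \<longlonglongrightarrow> (0::real)" shows "ulim F f"
  unfolding ulim_def
proof (intro allI impI)
  fix e :: real assume "e > 0"
  then obtain N where "\<forall>n\<ge>N. norm (a n - 0) < e" using LIMSEQ_D[OF assms(2)] by blast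
  then show "\<exists>N. \<forall>n\<ge>N. \<forall>x. norm (F n x - f x) \<le> e"
    using assms(1) by (metis abs_le_D1 diff_zero less_imp_le order_trans real_norm_def)
qed

lemma ulim_pointwise: "ulim F f \<Longrightarrow> (\<lambda>n. F n x) \<longlonglongrightarrow> f x"
  unfolding ulim_def
proof (rule LIMSEQ_I)
  fix r :: real assume u: "\<forall>e>0. \<exists>N. \<forall>n\<ge>N. \<forall>x. norm (F n x - f x) \<le> e" and "r > 0"
  then obtain N where "\<forall>n\<ge>N. \<forall>x. norm (F n x - f x) \<le> r / 2" by (meson half_gt_zero)
  then have "\<forall>n\<ge>N. norm (F n x - f x) < r" using \<open>r > 0\<close> by (metis field_sum_of_halves less_add_same_cancel1 half_gt_zero order_le_less_trans)
  then show "\<exists>no. \<forall>n\<ge>no. norm (F n x - f x) < r" by blast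
qed

lemma cper_ulim:
  assumes "ulim F f" "\<And>n. cper (F n)" shows "cper f"
proof (rule cperI)
  have "uniform_limit UNIV F f sequentially"
    unfolding uniform_limit_sequentially_iff dist_norm
  proof (intro allI impI)
    fix e :: real assume "e > 0"
    then obtain N where "\<forall>n\<ge>N. \<forall>x. norm (F n x - f x) \<le> e / 2" using ulimD[OF assms(1), of "e/2"] by auto
    then show "\<exists>N. \<forall>n\<ge>N. \<forall>x\<in>UNIV. norm (F n x - f x) < e"
      using \<open>e > 0\<close> by (intro exI[of _ N]) (metis field_sum_of_halves half_gt_zero less_add_same_cancel1 order_le_less_trans)
  qed
  then show "continuous_on UNIV f"
    by (rule uniform_limit_theorem[rotated]) (use assms in \<open>auto simp: cper_def\<close>)
  show "periodic f" unfolding periodic_def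
  proof (intro allI)
    fix x i
    have "(\<lambda>n. F n (x + (2 * pi) *\<^sub>R axis i 1)) \<longlonglongrightarrow> f x"
      using ulim_pointwise[OF assms(1), of x] assms(2) by (simp add: cper_def periodic_def)
    then show "f (x + (2 * pi) *\<^sub>R axis i 1) = f x"
      using ulim_pointwise[OF assms(1)] LIMSEQ_unique by blast
  qed
qed

lemma mean_ulim:
  assumes "ulim F f" "\<And>n. cper (F n)" shows "(\<lambda>n. mean (F n)) \<longlonglongrightarrow> mean f"
proof (rule LIMSEQ_I)
  fix r :: real assume r: "r > 0"
  obtain N where N: "\<And>n x. n \<ge> N \<Longrightarrow> norm (F n x - f x) \<le> r / 2" using ulimD[OF assms(1), of "r / 2"] r by auto
  have c: "cper f" by (rule cper_ulim[OF assms])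
  have "norm (mean (F n) - mean f) < r" if "n \<ge> N" for n
  proof -
    have "norm (mean (\<lambda>x. F n x - f x)) \<le> r / 2"
      by (rule norm_mean_le_const[OF cper_diff[OF assms(2) c]]) (rule N[OF that])
    then show ?thesis using r by (simp add: mean_diff[OF assms(2) c])
  qed
  then show "\<exists>no. \<forall>n\<ge>no. norm (mean (F n) - mean f) < r" by blast
qed

lemma ulim_mult:
  assumes f: "ulim F f" "\<And>n. cper (F n)" and g: "ulim G g" "\<And>n. cper (G n)"
  shows "ulim (\<lambda>n x. F n x * G n x) (\<lambda>x. f x * g x)"
  unfolding ulim_def
proof (intro allI impI)
  fix e :: real assume e: "e > 0"
  obtain A where A: "A \<ge> 0" "\<And>x. norm (f x) \<le> A" using cper_bounded[OF cper_ulim[OF f]] by blast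
  obtain B where B: "B \<ge> 0" "\<And>x. norm (g x) \<le> B" using cper_bounded[OF cper_ulim[OF g]] by blast
  define d where "d = min 1 (e / (A + B + 1))"
  have AB: "A + B + 1 > 0" using A B by simp
  have "d \<le> e / (A + B + 1)" by (simp add: d_def)
  then have d3: "d * (A + B + 1) \<le> e" using AB by (simp only: pos_le_divide_eq)
  have d: "d > 0" "d \<le> 1" using e AB by (auto simp: d_def)
  obtain N1 where N1: "\<And>n x. n \<ge> N1 \<Longrightarrow> norm (F n x - f x) \<le> d" using ulimD[OF f(1) d(1)] by blast
  obtain N2 where N2: "\<And>n x. n \<ge> N2 \<Longrightarrow> norm (G n x - g x) \<le> d" using ulimD[OF g(1) d(1)] by blast
  have "norm (F n x * G n x - f x * g x) \<le> e" if n: "n \<ge> max N1 N2" for n x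
  proof -
    have "F n x * G n x - f x * g x = (F n x - f x) * (G n x - g x) + (F n x - f x) * g x + f x * (G n x - g x)"
      by (simp add: algebra_simps)
    also have "norm \<dots> \<le> norm (F n x - f x) * norm (G n x - g x) + norm (F n x - f x) * norm (g x) + norm (f x) * norm (G n x - g x)"
      unfolding norm_mult[symmetric] by (intro norm_triangle_mono order_refl)
    also have "\<dots> \<le> d * 1 + d * B + A * d"
      using N1[of n x] N2[of n x] n d A B by (intro add_mono mult_mono) auto
    also have "\<dots> \<le> e" using d3 by (simp add: algebra_simps)
    finally show ?thesis .
  qed
  then show "\<exists>N. \<forall>n\<ge>N. \<forall>x. norm (F n x * G n x - f x * g x) \<le> e" by blast
qed

lemma ulim_const: "ulim (\<lambda>n. f) f"
  by (simp add: ulim_def)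

lemma fc_ulim:
  assumes "ulim F f" "\<And>n. cper (F n)" shows "(\<lambda>n. fc (F n) k) \<longlonglongrightarrow> fc f k"
  unfolding fc_def
  by (rule mean_ulim[OF ulim_mult[OF assms ulim_const]]) (intro cper_mult cper_cnj cper_ek assms)+

lemma ulim_fejer: "cper f \<Longrightarrow> ulim (\<lambda>n. fejer n f) f"
  unfolding ulim_def using fejer_uniform by blast

text \<open>
  Termwise differentiation, through the theorem on uniformly convergent derivatives along a line.
\<close>

lemma pder_ulim:
  assumes F: "ulim F f" and G: "ulim G g" and d: "\<And>n. pder i (F n) (G n)" shows "pder i f g"
  unfolding pder_def
proof
  fix x :: "real^2"
  let ?e = "\<lambda>t. x + t *\<^sub>R axis i 1"
  have "\<exists>h. \<forall>t\<in>UNIV. (\<lambda>n. F n (?e t)) \<longlonglongrightarrow> h t \<and> (h has_derivative (\<lambda>u. u *\<^sub>R g (?e t))) (at t within UNIV)"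
  proof (rule has_derivative_sequence[where f' = "\<lambda>n t u. u *\<^sub>R G n (?e t)" and ?x0.0 = 0 and l = "f (?e 0)"])
    show "((\<lambda>t. F n (?e t)) has_derivative (\<lambda>u. u *\<^sub>R G n (?e t))) (at t within UNIV)" for n t
      using pder_at[OF d, of n x t UNIV] by (simp add: has_vector_derivative_def)
    fix e :: real assume "e > 0"
    then obtain N where N: "\<And>n x. n \<ge> N \<Longrightarrow> norm (G n x - g x) \<le> e" using ulimD[OF G] by blast
    show "\<forall>\<^sub>F n in sequentially. \<forall>t\<in>UNIV. \<forall>u. norm (u *\<^sub>R G n (?e t) - u *\<^sub>R g (?e t)) \<le> e * norm u"
      unfolding eventually_sequentially
    proof (intro exI[of _ N] allI impI ballI)
      fix n t u assume "n \<ge> N"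
      have "norm (u *\<^sub>R G n (?e t) - u *\<^sub>R g (?e t)) = \<bar>u\<bar> * norm (G n (?e t) - g (?e t))"
        by (simp add: scaleR_diff_right[symmetric])
      also have "\<dots> \<le> \<bar>u\<bar> * e" by (intro mult_left_mono N \<open>n \<ge> N\<close>) simp
      finally show "norm (u *\<^sub>R G n (?e t) - u *\<^sub>R g (?e t)) \<le> e * norm u" by (simp add: mult.commute)
    qed
  qed (auto intro: ulim_pointwise[OF F])
  then obtain h where h: "\<And>t. (\<lambda>n. F n (?e t)) \<longlonglongrightarrow> h t" "\<And>t. (h has_derivative (\<lambda>u. u *\<^sub>R g (?e t))) (at t)"
    by auto
  have "h = (\<lambda>t. f (?e t))" using LIMSEQ_unique[OF h(1) ulim_pointwise[OF F]] by auto
  then show "((\<lambda>t. f (?e t)) has_vector_derivative g x) (at 0)"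
    using h(2)[of 0] by (simp add: has_vector_derivative_def)
qed

text \<open>
  Cantor's diagonal argument.
\<close>

lemma countable_bounded_subsequence:
  fixes f :: "nat \<Rightarrow> 'i::countable \<Rightarrow> complex"
  assumes M: "\<And>n i. norm (f n i) \<le> M"
  shows "\<exists>\<sigma> g. strict_mono \<sigma> \<and> (\<forall>i. (\<lambda>n. f (\<sigma> n) i) \<longlonglongrightarrow> g i)"
proof -
  interpret subseqs "\<lambda>m s. convergent (\<lambda>n. f (s n) (from_nat m))"
  proof
    fix m and s :: "nat \<Rightarrow> nat"
    have "bounded (range (\<lambda>n. f (s n) (from_nat m)))" using M by (auto simp: bounded_iff)
    then obtain l r where "strict_mono r" "((\<lambda>n. f (s n) (from_nat m)) \<circ> r) \<longlonglongrightarrow> l"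
      using bounded_imp_convergent_subsequence by blast
    then show "\<exists>r. strict_mono r \<and> convergent (\<lambda>n. f ((s \<circ> r) n) (from_nat m))"
      by (auto simp: convergent_def o_def)
  qed
  have "convergent (\<lambda>n. f (diagseq n) i)" for i
  proof -
    have "convergent (\<lambda>n. f ((diagseq \<circ> (+) (Suc (to_nat i))) n) (from_nat (to_nat i)))"
    proof (rule diagseq_holds)
      fix r s :: "nat \<Rightarrow> nat" and n
      assume r: "strict_mono r" and c: "convergent (\<lambda>m. f (s m) (from_nat n))"
      from c obtain L where "(\<lambda>m. f (s m) (from_nat n)) \<longlonglongrightarrow> L" by (auto simp: convergent_def)
      from LIMSEQ_subseq_LIMSEQ[OF this r] show "convergent (\<lambda>m. f ((s \<circ> r) m) (from_nat n))"
        by (auto simp: convergent_def o_def)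
    qed
    then have "convergent (\<lambda>n. f (diagseq (n + Suc (to_nat i))) i)" by (simp add: o_def add.commute)
    then show ?thesis using convergent_ignore_initial_segment[of "\<lambda>n. f (diagseq n) i"] by blast
  qed
  then have "\<forall>i. \<exists>l. (\<lambda>n. f (diagseq n) i) \<longlonglongrightarrow> l" by (simp add: convergent_def)
  then obtain g where "\<forall>i. (\<lambda>n. f (diagseq n) i) \<longlonglongrightarrow> g i" by metis
  then show ?thesis using subseq_diagseq by blast
qed

context lp_cutoff
begin

text \<open>
  The field with given coefficients, as the sum of its blocks. Under a Besov bound this sum converges uniformly, while
  the Fourier series need not converge absolutely.
\<close>

definition fld :: "(int^2 \<Rightarrow> complex) \<Rightarrow> real^2 \<Rightarrow> complex" where
  "fld c x = (\<Sum>j. blk h j c x)"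

definition dfld :: "2 \<Rightarrow> (int^2 \<Rightarrow> complex) \<Rightarrow> real^2 \<Rightarrow> complex" where
  "dfld l c x = (\<Sum>j. dblk l j c x)"

lemma ulim_series:
  fixes F :: "nat \<Rightarrow> real^2 \<Rightarrow> complex"
  assumes b: "\<And>j x. norm (F j x) \<le> a j" and s: "summable a"
  shows "ulim (\<lambda>J x. \<Sum>j\<le>J. F j x) (\<lambda>x. \<Sum>j. F j x)"
    and "norm ((\<Sum>j\<le>J. F j x) - (\<Sum>j. F j x)) \<le> (\<Sum>j. a (j + Suc J))"
proof -
  have sF: "summable (\<lambda>j. F j x)" for x by (rule summable_comparison_test'[OF s]) (rule b)
  have bd: "norm ((\<Sum>j\<le>J. F j x) - (\<Sum>j. F j x)) \<le> (\<Sum>j. a (j + Suc J))" for J x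
  proof -
    have "(\<Sum>j. F j x) = (\<Sum>j. F (j + Suc J) x) + (\<Sum>j<Suc J. F j x)"
      by (rule suminf_split_initial_segment[OF sF])
    then have "(\<Sum>j\<le>J. F j x) - (\<Sum>j. F j x) = - (\<Sum>j. F (j + Suc J) x)" by (simp add: lessThan_Suc_atMost del: sum.lessThan_Suc sum.atMost_Suc)
    also have "norm \<dots> \<le> (\<Sum>j. a (j + Suc J))"
      unfolding norm_minus_cancel by (rule norm_suminf_le[OF b]) (rule summable_ignore_initial_segment[OF s])
    finally show ?thesis .
  qed
  then show "norm ((\<Sum>j\<le>J. F j x) - (\<Sum>j. F j x)) \<le> (\<Sum>j. a (j + Suc J))" .
  have "(\<lambda>J. \<Sum>j. a (j + J)) \<longlonglongrightarrow> 0"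
    using suminf_exist_split2[OF s] by simp
  then have "(\<lambda>J. \<Sum>j. a (j + Suc J)) \<longlonglongrightarrow> 0" by (rule LIMSEQ_Suc)
  then show "ulim (\<lambda>J x. \<Sum>j\<le>J. F j x) (\<lambda>x. \<Sum>j. F j x)" by (rule ulimI_bound[OF bd])
qed

lemma ulim_fld: "summable (\<lambda>j. nb h j c) \<Longrightarrow> ulim (\<lambda>J x. \<Sum>j\<le>J. blk h j c x) (fld c)"
  unfolding fld_def[abs_def] by (rule ulim_series(1)[OF norm_blk_le])

lemma cper_fld: "summable (\<lambda>j. nb h j c) \<Longrightarrow> cper (fld c)"
  by (rule cper_ulim[OF ulim_fld]) (auto intro!: cper_sum cper_blk)

lemma fc_fld: assumes "summable (\<lambda>j. nb h j c)" shows "fc (fld c) k = c k"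
proof (rule LIMSEQ_unique)
  show "(\<lambda>J. fc (\<lambda>x. \<Sum>j\<le>J. blk h j c x) k) \<longlonglongrightarrow> fc (fld c) k"
    by (rule fc_ulim[OF ulim_fld[OF assms]]) (intro cper_sum cper_blk)
  obtain J0 where J0: "2 * norm (freq k) < 2 ^ J0" using real_arch_pow[of 2] by auto
  have "fc (\<lambda>x. \<Sum>j\<le>J. blk h j c x) k = c k" if "J \<ge> J0" for J
  proof -
    have "(2::real) ^ J0 \<le> 2 ^ J" using that by (intro power_increasing) auto
    then have "ssym h J k = 1" using J0 by (intro ssym_one) linarith
    then show ?thesis unfolding sum_blk by (simp add: fc_ker)
  qed
  then show "(\<lambda>J. fc (\<lambda>x. \<Sum>j\<le>J. blk h j c x) k) \<longlonglongrightarrow> c k"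
    by (intro tendsto_eventually eventually_sequentiallyI[of J0]) auto
qed

lemma summable_nb_if_C1: assumes "summable (\<lambda>j. 2 ^ j * nb h j c)" shows "summable (\<lambda>j. nb h j c)"
proof (rule summable_comparison_test'[OF assms])
  fix j :: nat
  have "1 * nb h j c \<le> 2 ^ j * nb h j c" by (intro mult_right_mono nb_nonneg) simp
  then show "norm (nb h j c) \<le> 2 ^ j * nb h j c" using nb_nonneg[of j c] by simp
qed

lemma ulim_dfld: "summable (\<lambda>j. 2 ^ j * nb h j c) \<Longrightarrow> ulim (\<lambda>J x. \<Sum>j\<le>J. dblk l j c x) (dfld l c)"
proof -
  assume "summable (\<lambda>j. 2 ^ j * nb h j c)"
  then have "summable (\<lambda>j. CM * 2 ^ j * nb h j c)" using summable_mult[of _ CM] by (simp add: mult.assoc)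
  from ulim_series(1)[OF norm_dblk_le this] show ?thesis by (simp add: dfld_def[abs_def])
qed

lemma cper_dfld: "summable (\<lambda>j. 2 ^ j * nb h j c) \<Longrightarrow> cper (dfld l c)"
  by (rule cper_ulim[OF ulim_dfld]) (auto intro!: cper_sum cper_dblk)

lemma pder_fld: "summable (\<lambda>j. 2 ^ j * nb h j c) \<Longrightarrow> pder l (fld c) (dfld l c)"
  by (rule pder_ulim[OF ulim_fld[OF summable_nb_if_C1] ulim_dfld]) (auto intro!: pder_sum pder_blk)

lemma fld_real:
  assumes "summable (\<lambda>j. nb h j c)" "\<And>k. c (- k) = cnj (c k)" shows "Im (fld c x) = 0"
  by (rule fc_real_iff[OF cper_fld[OF assms(1)]]) (simp add: fc_fld assms)

lemma norm_coeff_le: assumes "summable (\<lambda>j. nb h j c)" shows "norm (c k) \<le> (\<Sum>j. nb h j c)"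
proof -
  have "norm (fld c x) \<le> (\<Sum>j. nb h j c)" for x
    unfolding fld_def by (rule norm_suminf_le[OF norm_blk_le assms])
  from norm_fc_le[OF cper_fld[OF assms] this, of k] show ?thesis by (simp add: fc_fld assms)
qed

lemma bes_summable_C1:
  assumes a: "adm r s" and c: "bes r s c M" shows "summable (\<lambda>j. 2 ^ j * nb h j (c i))"
proof -
  obtain C where C: "\<And>J. (\<Sum>j<J. 2 ^ j * nb2 j c) \<le> C * M" using bes_C1_embedding[OF a] c by blast
  show ?thesis
  proof (rule bounded_imp_summable)
    show "0 \<le> 2 ^ j * nb h j (c i)" for j by (intro mult_nonneg_nonneg nb_nonneg) simp
    fix J
    have "(\<Sum>j\<le>J. 2 ^ j * nb h j (c i)) \<le> (\<Sum>j<Suc J. 2 ^ j * nb2 j c)"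
      unfolding lessThan_Suc_atMost by (intro sum_mono mult_left_mono nb_le_nb2) simp
    then show "(\<Sum>j\<le>J. 2 ^ j * nb h j (c i)) \<le> C * M" using C[of "Suc J"] by linarith
  qed
qed

lemma bes_summable: "adm r s \<Longrightarrow> bes r s c M \<Longrightarrow> summable (\<lambda>j. nb h j (c i))"
  by (rule summable_nb_if_C1) (rule bes_summable_C1)

lemma nb_diff_le: "\<bar>nb h j c - nb h j d\<bar> \<le> (\<Sum>k | msym h j k \<noteq> 0. norm (c k - d k))"
proof -
  have le: "nb h j c \<le> nb h j d + (\<Sum>k | msym h j k \<noteq> 0. norm (c k - d k))" for c d
    unfolding nb_def[of h j c]
  proof (rule snorm_le)
    fix x
    have "(\<lambda>k. msym h j k * (c k - d k)) = (\<lambda>k. msym h j k * c k - msym h j k * d k)" by (simp add: right_diff_distrib)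
    then have "blk h j c x = blk h j d x + blk h j (\<lambda>k. c k - d k) x"
      unfolding blk_def by (simp add: ker_diff)
    then have "norm (blk h j c x) \<le> norm (blk h j d x) + norm (blk h j (\<lambda>k. c k - d k) x)" by (simp add: norm_triangle_ineq)
    also have "\<dots> \<le> nb h j d + nb h j (\<lambda>k. c k - d k)" by (intro add_mono norm_blk_le)
    also have "nb h j (\<lambda>k. c k - d k) \<le> (\<Sum>k | msym h j k \<noteq> 0. norm (c k - d k))" by (rule nb_le_sum)
    finally show "norm (blk h j c x) \<le> nb h j d + (\<Sum>k | msym h j k \<noteq> 0. norm (c k - d k))" by simp
  qed
  show ?thesis using le[of c d] le[of d c] by (simp add: norm_minus_commute abs_le_iff)
qed

lemma nb_tendsto:
  assumes "\<And>k. (\<lambda>n. c n k) \<longlonglongrightarrow> d k" shows "(\<lambda>n. nb h j (c n)) \<longlonglongrightarrow> nb h j d"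
proof (rule LIM_zero_cancel, rule tendsto_rabs_zero_cancel, rule tendsto_sandwich[where f = "\<lambda>_. 0"])
  show "(\<lambda>n. \<Sum>k | msym h j k \<noteq> 0. norm (c n k - d k)) \<longlonglongrightarrow> 0"
    by (rule tendsto_null_sum) (intro tendsto_norm_zero LIM_zero assms)
  show "\<forall>\<^sub>F n in sequentially. \<bar>nb h j (c n) - nb h j d\<bar> \<le> (\<Sum>k | msym h j k \<noteq> 0. norm (c n k - d k))"
    by (rule always_eventually) (rule allI, rule nb_diff_le)
qed auto

text \<open>
  Fatou: a block depends on finitely many coefficients, so truncated norms are continuous.
\<close>

lemma bes_limit:
  assumes a: "adm r s" and l: "\<And>i k. (\<lambda>n. c n i k) \<longlonglongrightarrow> d i k" and b: "\<And>n. bes r s (c n) M"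
  shows "bes r s d M"
  unfolding bes_def
proof
  fix J
  have "(\<lambda>n. \<Sum>i\<in>UNIV. lN r J (wseq s (c n i))) \<longlonglongrightarrow> (\<Sum>i\<in>UNIV. lN r J (wseq s (d i)))"
    unfolding wseq_def by (intro tendsto_sum lN_tendsto adm_pos(1)[OF a] tendsto_mult tendsto_const nb_tendsto l)
  then show "(\<Sum>i\<in>UNIV. lN r J (wseq s (d i))) \<le> M"
    by (rule LIMSEQ_le_const2) (use b in \<open>auto simp: bes_def\<close>)
qed

text \<open>
  Compactness: under a common Besov bound the tails of the block sums are uniformly small, and each block converges
  because its finitely many coefficients do.
\<close>

lemma ulim_fld_bes:
  assumes a: "adm r s" and l: "\<And>i k. (\<lambda>n. c n i k) \<longlonglongrightarrow> d i k" and b: "\<And>n. bes r s (c n) M"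
  shows "ulim (\<lambda>n. fld (c n i)) (fld (d i))"
  unfolding ulim_def
proof (intro allI impI)
  fix e :: real assume e: "e > 0"
  have d: "bes r s d M" by (rule bes_limit[OF a l b])
  obtain C where C: "C \<ge> 1" "\<And>c M J. bes r s c M \<Longrightarrow> (\<Sum>j<J. 2 ^ j * nb2 j c) \<le> C * M" using bes_C1_embedding[OF a] by blast
  have M: "M \<ge> 0" by (rule bes_nonneg[OF a d])
  have tail: "norm (fld (c i) x - (\<Sum>j\<le>J. blk h j (c i) x)) \<le> C * M / 2 ^ J" if c: "bes r s c M" for c x J
  proof -
    note s1 = bes_summable_C1[OF a c, of i] and s0 = bes_summable[OF a c, of i]
    have "norm (fld (c i) x - (\<Sum>j\<le>J. blk h j (c i) x)) \<le> (\<Sum>j. nb h (j + Suc J) (c i))"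
      using ulim_series(2)[where J = J and x = x, OF norm_blk_le s0] by (simp add: fld_def norm_minus_commute)
    also have "\<dots> \<le> (\<Sum>j. 2 ^ (j + Suc J) * nb h (j + Suc J) (c i) / 2 ^ J)"
    proof (rule suminf_le)
      fix j
      have "1 * nb h (j + Suc J) (c i) \<le> 2 ^ Suc j * nb h (j + Suc J) (c i)" by (intro mult_right_mono nb_nonneg one_le_power) simp
      then show "nb h (j + Suc J) (c i) \<le> 2 ^ (j + Suc J) * nb h (j + Suc J) (c i) / 2 ^ J" by (simp add: power_add)
      show "summable (\<lambda>j. nb h (j + Suc J) (c i))" by (rule summable_ignore_initial_segment[OF s0])
      show "summable (\<lambda>j. 2 ^ (j + Suc J) * nb h (j + Suc J) (c i) / 2 ^ J)"
        by (rule summable_divide[OF summable_ignore_initial_segment[OF s1]])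
    qed
    also have "\<dots> = (\<Sum>j. 2 ^ (j + Suc J) * nb h (j + Suc J) (c i)) / 2 ^ J"
      by (rule suminf_divide[OF summable_ignore_initial_segment[OF s1]])
    also have "(\<Sum>j. 2 ^ (j + Suc J) * nb h (j + Suc J) (c i)) \<le> C * M"
    proof (rule suminf_le_const[OF summable_ignore_initial_segment[OF s1]])
      fix n
      have "(\<Sum>j<n. 2 ^ (j + Suc J) * nb h (j + Suc J) (c i)) = (\<Sum>j\<in>{Suc J..<n + Suc J}. 2 ^ j * nb h j (c i))"
        using sum.shift_bounds_nat_ivl[of "\<lambda>j. 2 ^ j * nb h j (c i)" 0 "Suc J" n] by (simp add: lessThan_atLeast0)
      also have "\<dots> \<le> (\<Sum>j<n + Suc J. 2 ^ j * nb2 j c)"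
        by (rule order_trans[OF sum_mono sum_mono2]) (auto intro!: mult_left_mono nb_le_nb2 mult_nonneg_nonneg nb2_nonneg)
      also have "\<dots> \<le> C * M" by (rule C(2)[OF c])
      finally show "(\<Sum>j<n. 2 ^ (j + Suc J) * nb h (j + Suc J) (c i)) \<le> C * M" .
    qed
    finally show ?thesis by (simp add: divide_right_mono)
  qed
  obtain J where "3 * C * M / e < 2 ^ J" using real_arch_pow[of 2 "3 * C * M / e"] by auto
  then have J: "C * M / 2 ^ J \<le> e / 3" using e by (simp add: field_simps)
  have "(\<lambda>n. \<Sum>j\<le>J. \<Sum>k | msym h j k \<noteq> 0. norm (c n i k - d i k)) \<longlonglongrightarrow> 0"
    by (intro tendsto_null_sum tendsto_norm_zero LIM_zero l)
  from order_tendstoD(2)[OF this, of "e / 3"] e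
  obtain N where N: "\<And>n. n \<ge> N \<Longrightarrow> (\<Sum>j\<le>J. \<Sum>k | msym h j k \<noteq> 0. norm (c n i k - d i k)) < e / 3"
    by (auto simp: eventually_sequentially)
  have "norm (fld (c n i) x - fld (d i) x) \<le> e" if n: "n \<ge> N" for n x
  proof -
    have "norm (blk h j (c n i) x - blk h j (d i) x) \<le> (\<Sum>k | msym h j k \<noteq> 0. norm (c n i k - d i k))" for j
    proof -
      have "blk h j (c n i) x - blk h j (d i) x = blk h j (\<lambda>k. c n i k - d i k) x"
        unfolding blk_def right_diff_distrib by (simp add: ker_diff)
      then show ?thesis using order_trans[OF norm_blk_le nb_le_sum] by metis
    qed
    then have "norm (\<Sum>j\<le>J. blk h j (c n i) x - blk h j (d i) x) \<le> (\<Sum>j\<le>J. \<Sum>k | msym h j k \<noteq> 0. norm (c n i k - d i k))"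
      by (intro sum_norm_le)
    then have mid: "norm ((\<Sum>j\<le>J. blk h j (c n i) x) - (\<Sum>j\<le>J. blk h j (d i) x)) \<le> e / 3"
      using N[OF n] by (simp add: sum_subtractf)
    have t1: "norm (fld (c n i) x - (\<Sum>j\<le>J. blk h j (c n i) x)) \<le> e / 3" using tail[OF b, of n x J] J by linarith
    have t2: "norm ((\<Sum>j\<le>J. blk h j (d i) x) - fld (d i) x) \<le> e / 3"
    proof -
      have "norm (fld (d i) x - (\<Sum>j\<le>J. blk h j (d i) x)) \<le> e / 3" using tail[OF d, of x J] J by linarith
      then show ?thesis by (simp only: norm_minus_commute)
    qed
    have "fld (c n i) x - fld (d i) x = (fld (c n i) x - (\<Sum>j\<le>J. blk h j (c n i) x)) + ((\<Sum>j\<le>J. blk h j (c n i) x) - (\<Sum>j\<le>J. blk h j (d i) x))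
       + ((\<Sum>j\<le>J. blk h j (d i) x) - fld (d i) x)" by simp
    also have "norm \<dots> \<le> e / 3 + e / 3 + e / 3" by (intro norm_triangle_mono t1 t2 mid)
    finally show ?thesis by simp
  qed
  then show "\<exists>N. \<forall>n\<ge>N. \<forall>x. norm (fld (c n i) x - fld (d i) x) \<le> e" by blast
qed

end

section \<open>One step of the scheme in a Besov class\<close>

text \<open>
  Fourier coefficients of \<open>div (b v\<^sub>i)\<close>. In this form the nonlinear term is continuous under uniform convergence,
  without derivatives of \<open>v\<close>.
\<close>

definition divc :: "(2 \<Rightarrow> real^2 \<Rightarrow> complex) \<Rightarrow> (2 \<Rightarrow> real^2 \<Rightarrow> complex) \<Rightarrow> 2 \<Rightarrow> int^2 \<Rightarrow> complex" where
  "divc b v i k = (\<Sum>m\<in>UNIV. \<i> * of_int (k $ m) * fc (\<lambda>x. b m x * v i x) k)"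

context lp_cutoff
begin

text \<open>
  Fejer means of a family. They are trigonometric polynomials and increase none of the block norms, because the Fejer
  kernel is positive of mean one.
\<close>

definition fejc :: "nat \<Rightarrow> (2 \<Rightarrow> int^2 \<Rightarrow> complex) \<Rightarrow> 2 \<Rightarrow> int^2 \<Rightarrow> complex" where
  "fejc n c l k = of_real (fejer_weight n k) * c l k"

lemma fsupp_fejc: "fsupp (fejc n c l)"
  unfolding fejc_def by (rule finite_subset[OF _ finite_sq_diffs[of n]]) (auto intro: ccontr simp: fejer_weight_outside)

lemma nb_fejc_le: "nb h j (fejc n c l) \<le> nb h j (c l)"
  unfolding nb_def[of h j "fejc n c l"]
proof (rule snorm_le)
  fix x
  have "blk h j (fejc n c l) x = ker (\<lambda>k. of_real (fejer_weight n k) * (msym h j k * c l k)) x"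
    unfolding blk_def fejc_def by (simp only: mult.left_commute)
  also have "\<dots> = fejer n (blk h j (c l)) x"
    unfolding fejer_def fc_blk
    by (rule ker_superset) (auto intro: ccontr simp: fejer_weight_outside)
  also have "norm \<dots> \<le> nb h j (c l)" by (rule norm_fejer_le[OF cper_blk norm_blk_le])
  finally show "norm (blk h j (fejc n c l) x) \<le> nb h j (c l)" .
qed

lemma bes_fejc: "adm r s \<Longrightarrow> bes r s c M \<Longrightarrow> bes r s (fejc n c) M"
proof -
  assume a: "adm r s" and b: "bes r s c M"
  have "lN r J (wseq s (fejc n c i)) \<le> lN r J (wseq s (c i))" for J i
    by (rule lN_mono[OF adm_pos(1)[OF a] wseq_nonneg]) (auto simp: wseq_def intro!: mult_left_mono nb_fejc_le)
  then show ?thesis using b unfolding bes_def by (meson order_trans sum_mono)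
qed

lemma divfree_fejc: "divfree c \<Longrightarrow> divfree (fejc n c)"
proof -
  assume "divfree c"
  moreover have "(\<Sum>l\<in>UNIV. of_int (k $ l) * fejc n c l k) = of_real (fejer_weight n k) * (\<Sum>l\<in>UNIV. of_int (k $ l) * c l k)" for k
    by (simp add: fejc_def sum_distrib_left mult_ac)
  ultimately show ?thesis by (simp add: divfree_def)
qed

lemma rsymm_fejc: "rsymm c \<Longrightarrow> rsymm (fejc n c)"
  by (simp add: rsymm_def fejc_def fejer_weight_uminus)

lemma ker_fejc: "summable (\<lambda>j. nb h j (c l)) \<Longrightarrow> ker (fejc n c l) x = fejer n (fld (c l)) x"
  unfolding fejer_def
  by (subst ker_superset[of "sq_diffs n"]) (auto intro: ccontr simp: fejc_def fejer_weight_outside fc_fld)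

lemma advc_eq_divc:
  assumes b: "\<And>l. fsupp (b l)" "divfree b" and v: "summable (\<lambda>j. nb h j (v i))"
  shows "advc b v i k = divc (\<lambda>m. ker (b m)) (\<lambda>i. fld (v i)) i k"
proof -
  define L where "L = vsupp b"
  have L: "finite L" unfolding L_def by (rule finite_vsupp[OF b(1)])
  have toL: "(\<Sum>l | b m l \<noteq> 0. b m l * g l) = (\<Sum>l\<in>L. b m l * g l)" for m and g :: "int^2 \<Rightarrow> complex"
    by (rule sum.mono_neutral_left[OF L]) (auto simp: L_def vsupp_def)
  have "advc b v i k = (\<Sum>m\<in>UNIV. \<Sum>l\<in>L. b m l * (\<i> * of_int ((k - l) $ m) * v i (k - l)))"
    unfolding advc_def toL ..
  also have "\<dots> = (\<Sum>m\<in>UNIV. \<Sum>l\<in>L. \<i> * of_int (k $ m) * (b m l * v i (k - l)))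
      - (\<Sum>m\<in>UNIV. \<Sum>l\<in>L. \<i> * v i (k - l) * (of_int (l $ m) * b m l))"
    by (simp add: sum_subtractf[symmetric] algebra_simps)
  also have "(\<Sum>m\<in>UNIV. \<Sum>l\<in>L. \<i> * v i (k - l) * (of_int (l $ m) * b m l)) = (\<Sum>l\<in>L. \<i> * v i (k - l) * (\<Sum>m\<in>UNIV. of_int (l $ m) * b m l))"
    unfolding sum_distrib_left by (rule sum.swap)
  also have "\<dots> = 0" using b(2) by (simp add: divfree_def)
  also have "(\<Sum>m\<in>UNIV. \<Sum>l\<in>L. \<i> * of_int (k $ m) * (b m l * v i (k - l))) = divc (\<lambda>m. ker (b m)) (\<lambda>i. fld (v i)) i k"
  proof -
    have "fc (\<lambda>x. ker (b m) x * fld (v i) x) k = (\<Sum>l\<in>L. b m l * v i (k - l))" for m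
    proof -
      have "fc (\<lambda>x. ker (b m) x * fld (v i) x) k = (\<Sum>l | b m l \<noteq> 0. b m l * fc (fld (v i)) (k - l))"
        unfolding ker_def by (rule fc_trig_mult[OF cper_fld[OF v]])
      then show ?thesis by (simp only: fc_fld[OF v] toL)
    qed
    then show ?thesis by (simp only: divc_def sum_distrib_left)
  qed
  finally show ?thesis by simp
qed

text \<open>
  Absorbing the unknown norm on the right is legitimate because it is finite; applied to the least bound.
\<close>

lemma bes_absorb:
  assumes a: "adm r s" and b: "bes r s v M0" and q: "0 \<le> q" "q < 1"
    and imp: "\<And>M. bes r s v M \<Longrightarrow> bes r s v (B + q * M)"
  shows "bes r s v (B / (1 - q))"
proof -
  let ?S = "\<lambda>J. \<Sum>i\<in>UNIV. lN r J (wseq s (v i))"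
  define M where "M = (SUP J. ?S J)"
  have bd: "bdd_above (range ?S)" using b by (auto simp: bes_def intro!: bdd_aboveI2)
  have "bes r s v M" unfolding bes_def M_def by (auto intro!: cSUP_upper bd)
  from imp[OF this] have "?S J \<le> B + q * M" for J unfolding bes_def by blast
  then have "(SUP J. ?S J) \<le> B + q * M" by (intro cSUP_least) auto
  then have "M \<le> B + q * M" by (simp only: M_def[symmetric])
  then have "M * (1 - q) \<le> B" by (simp add: algebra_simps)
  then have "M \<le> B / (1 - q)" using q by (simp add: pos_le_divide_eq)
  then show ?thesis using \<open>bes r s v M\<close> unfolding bes_def by (meson order_trans)
qed

text \<open>
  The data are replaced by Fejer means and the viscosity is increased by \<open>1/(n+1)\<close>, which makes the step solvable. The
  a priori estimate is uniform in \<open>n\<close>, so a subsequence of the coefficients converges, and the equation passes to the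
  limit in divergence form. The added viscosity is what allows \<open>\<mu> = 0\<close>.
\<close>

theorem step_solution:
  assumes a: "adm r s"
  shows "\<exists>C\<ge>1. \<forall>b \<tau> \<mu> B. \<tau> \<ge> 0 \<longrightarrow> \<mu> \<ge> 0 \<longrightarrow> rsymm b \<longrightarrow> divfree b \<longrightarrow> bes r s b B \<longrightarrow> C * \<tau> * B \<le> 1 / 2 \<longrightarrow>
     (\<exists>v. rsymm v \<and> divfree v \<and> bes r s v (B / (1 - C * \<tau> * B)) \<and>
          step_eq \<tau> \<mu> (divc (\<lambda>m. fld (b m)) (\<lambda>i. fld (v i))) b v)"
proof -
  obtain C where C: "C \<ge> 1" and ap: "\<And>b v f \<tau> \<mu> F B M. \<tau> \<ge> 0 \<Longrightarrow> \<mu> \<ge> 0 \<Longrightarrow> (\<forall>l. fsupp (b l)) \<Longrightarrow> (\<forall>l k. b l (- k) = cnj (b l k)) \<Longrightarrow>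
     divfree b \<Longrightarrow> divfree v \<Longrightarrow> step_eq \<tau> \<mu> (advc b v) f v \<Longrightarrow> bes r s f F \<Longrightarrow> bes r s b B \<Longrightarrow> bes r s v M \<Longrightarrow>
     bes r s v (F + C * \<tau> * B * M)"
    using a_priori_estimate[OF a] by blast
  have "\<exists>v. rsymm v \<and> divfree v \<and> bes r s v (B / (1 - C * \<tau> * B)) \<and> step_eq \<tau> \<mu> (divc (\<lambda>m. fld (b m)) (\<lambda>i. fld (v i))) b v"
    if t: "\<tau> \<ge> 0" and mu: "\<mu> \<ge> 0" and rb: "rsymm b" and db: "divfree b" and bB: "bes r s b B" and small: "C * \<tau> * B \<le> 1 / 2" for b \<tau> \<mu> B
  proof -
    define q where "q = C * \<tau> * B"
    have B0: "B \<ge> 0" by (rule bes_nonneg[OF a bB])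
    have q: "0 \<le> q" "q < 1" using C t B0 small by (auto simp: q_def)
    define M where "M = B / (1 - q)"
    define bn where "bn n = fejc n b" for n
    define \<mu>n where "\<mu>n n = \<mu> + 1 / real (Suc n)" for n
    have mun: "\<mu>n n > 0" for n using mu by (simp add: \<mu>n_def add_nonneg_pos)
    have bfin: "fsupp (bn n l)" and bnr: "rsymm (bn n)" and bnd: "divfree (bn n)" and bnB: "bes r s (bn n) B" for n l
      unfolding bn_def by (rule fsupp_fejc rsymm_fejc[OF rb] divfree_fejc[OF db] bes_fejc[OF a bB])+
    have "\<exists>v. step_eq \<tau> (\<mu>n n) (advc (bn n) v) (bn n) v \<and> divfree v \<and> rsymm v \<and> bes r s v M" for n
    proof -
      obtain v C0 where v: "step_eq \<tau> (\<mu>n n) (advc (bn n) v) (bn n) v" "divfree v" "rsymm v" "\<And>i k. norm (v i k) \<le> C0"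
        using linear_step_solvable[OF bfin bnr bnd bfin bnr bnd mun] by blast
      obtain M0 where M0: "bes r s v M0"
        using decay_imp_bes[OF a elliptic_decay[OF bfin bfin mun t v(1) v(4)]] by blast
      have "bes r s v (B + q * M')" if "bes r s v M'" for M'
        unfolding q_def
        by (rule ap[OF t less_imp_le[OF mun] _ _ bnd v(2) v(1) bnB bnB that]) (use bfin bnr in \<open>auto simp: rsymm_def\<close>)
      from bes_absorb[OF a M0 q this] have "bes r s v M" by (simp add: M_def)
      then show ?thesis using v by blast
    qed
    then obtain v where v: "\<And>n. step_eq \<tau> (\<mu>n n) (advc (bn n) (v n)) (bn n) (v n)" "\<And>n. divfree (v n)" "\<And>n. rsymm (v n)" "\<And>n. bes r s (v n) M"
      by metis
    obtain C1 where C1: "\<And>c M J. bes r s c M \<Longrightarrow> (\<Sum>j<J. 2 ^ j * nb2 j c) \<le> C1 * M" using bes_C1_embedding[OF a] by blast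
    have bound: "norm (v n i k) \<le> C1 * M" for n i k
    proof -
      have sm: "summable (\<lambda>j. nb h j (v n i))" by (rule bes_summable[OF a v(4)])
      have "(\<Sum>j. nb h j (v n i)) \<le> C1 * M"
      proof (rule suminf_le_const[OF sm])
        fix J
        have "(\<Sum>j<J. nb h j (v n i)) \<le> (\<Sum>j<J. 2 ^ j * nb2 j (v n))"
        proof (rule sum_mono)
          fix j :: nat
          have "1 * nb h j (v n i) \<le> 2 ^ j * nb2 j (v n)" by (intro mult_mono nb_le_nb2 nb_nonneg) auto
          then show "nb h j (v n i) \<le> 2 ^ j * nb2 j (v n)" by simp
        qed
        also have "\<dots> \<le> C1 * M" by (rule C1[OF v(4)])
        finally show "(\<Sum>j<J. nb h j (v n i)) \<le> C1 * M" .
      qed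
      then show ?thesis using norm_coeff_le[OF sm, of k] by linarith
    qed
    \<comment> \<open>The two components are merged into one countable family for the diagonal argument.\<close>
    define cf where "cf n p = v n (if fst p = (0::int) then 1 else 2) (snd p)" for n and p :: "int \<times> (int^2)"
    have "norm (cf n p) \<le> C1 * M" for n p unfolding cf_def by (rule bound)
    from countable_bounded_subsequence[of cf "C1 * M", OF this]
    obtain \<sigma> g where sg: "strict_mono \<sigma>" "\<And>p. (\<lambda>n. cf (\<sigma> n) p) \<longlonglongrightarrow> g p" by blast
    define w where "w i k = g (if i = 1 then 0 else 1, k)" for i :: 2 and k
    have lim: "(\<lambda>n. v (\<sigma> n) i k) \<longlonglongrightarrow> w i k" for i k
      using sg(2)[of "(if i = 1 then 0 else 1, k)"] exhaust_2[of i] by (auto simp: cf_def w_def)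
    have wM: "bes r s w M" by (rule bes_limit[OF a lim v(4)])
    have bsm: "summable (\<lambda>j. nb h j (b l))" for l by (rule bes_summable[OF a bB])
    have vsm: "summable (\<lambda>j. nb h j (v n i))" for n i by (rule bes_summable[OF a v(4)])
    have sub: "(\<lambda>n. F (\<sigma> n)) \<longlonglongrightarrow> L" if "F \<longlonglongrightarrow> L" for F :: "nat \<Rightarrow> complex" and L
      using LIMSEQ_subseq_LIMSEQ[OF that sg(1)] by (simp add: o_def)
    have ub: "ulim (\<lambda>n. ker (bn (\<sigma> n) m)) (fld (b m))" for m
      unfolding ulim_def
    proof (intro allI impI)
      fix e :: real assume "e > 0"
      then obtain N where "\<forall>n\<ge>N. \<forall>x. norm (fejer n (fld (b m)) x - fld (b m) x) \<le> e"
        using ulimD[OF ulim_fejer[OF cper_fld[OF bsm]]] by blast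
      then show "\<exists>N. \<forall>n\<ge>N. \<forall>x. norm (ker (bn (\<sigma> n) m) x - fld (b m) x) \<le> e"
        unfolding bn_def ker_fejc[OF bsm] using seq_suble[OF sg(1)] by (meson order_trans)
    qed
    have uv: "ulim (\<lambda>n. fld (v (\<sigma> n) i)) (fld (w i))" for i by (rule ulim_fld_bes[OF a lim v(4)])
    have dl: "(\<lambda>n. advc (bn (\<sigma> n)) (v (\<sigma> n)) i k) \<longlonglongrightarrow> divc (\<lambda>m. fld (b m)) (\<lambda>i. fld (w i)) i k" for i k
      unfolding advc_eq_divc[OF bfin bnd vsm] divc_def
      by (intro tendsto_intros fc_ulim[OF ulim_mult[OF ub cper_ker uv cper_fld[OF vsm]]] cper_mult cper_ker cper_fld[OF vsm])
    have "step_eq \<tau> \<mu> (divc (\<lambda>m. fld (b m)) (\<lambda>i. fld (w i))) b w"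
      unfolding step_eq_def
    proof (intro allI)
      fix i k
      have "(\<lambda>n. 1 / real (Suc n)) \<longlonglongrightarrow> 0" by (rule LIMSEQ_Suc[OF lim_1_over_n])
      then have "(\<lambda>n. 1 / real (Suc (\<sigma> n))) \<longlonglongrightarrow> 0"
        using LIMSEQ_subseq_LIMSEQ[OF _ sg(1)] by (force simp: o_def)
      then have "(\<lambda>n. \<mu> + 1 / real (Suc (\<sigma> n))) \<longlonglongrightarrow> \<mu> + 0" by (intro tendsto_add tendsto_const)
      then have m: "(\<lambda>n. \<mu>n (\<sigma> n)) \<longlonglongrightarrow> \<mu>" by (simp add: \<mu>n_def)
      have "(\<lambda>n. bn n i k) \<longlonglongrightarrow> b i k"
      proof -
        have "(\<lambda>n. fc (fejer n (fld (b i))) k) \<longlonglongrightarrow> fc (fld (b i)) k"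
          by (rule fc_ulim[OF ulim_fejer[OF cper_fld[OF bsm]] cper_fejer])
        then show ?thesis by (simp add: fc_fejer fc_fld[OF bsm] bn_def fejc_def)
      qed
      then have 1: "(\<lambda>n. bn (\<sigma> n) i k) \<longlonglongrightarrow> b i k" by (rule sub)
      have "(\<lambda>n. of_real (1 + \<mu>n (\<sigma> n) * (norm (freq k))\<^sup>2) * v (\<sigma> n) i k + of_real \<tau> * leray (advc (bn (\<sigma> n)) (v (\<sigma> n))) i k)
         \<longlonglongrightarrow> of_real (1 + \<mu> * (norm (freq k))\<^sup>2) * w i k + of_real \<tau> * leray (divc (\<lambda>m. fld (b m)) (\<lambda>i. fld (w i))) i k"
        unfolding leray_def by (intro tendsto_intros m lim dl)
      moreover have "of_real (1 + \<mu>n (\<sigma> n) * (norm (freq k))\<^sup>2) * v (\<sigma> n) i k + of_real \<tau> * leray (advc (bn (\<sigma> n)) (v (\<sigma> n))) i k = bn (\<sigma> n) i k" for n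
        using v(1) unfolding step_eq_def by blast
      ultimately show "of_real (1 + \<mu> * (norm (freq k))\<^sup>2) * w i k + of_real \<tau> * leray (divc (\<lambda>m. fld (b m)) (\<lambda>i. fld (w i))) i k = b i k"
        using LIMSEQ_unique[OF _ 1] by simp
    qed
    moreover have "divfree w" unfolding divfree_def
    proof
      fix k
      have "(\<lambda>n. \<Sum>l\<in>UNIV. of_int (k $ l) * v (\<sigma> n) l k) \<longlonglongrightarrow> (\<Sum>l\<in>UNIV. of_int (k $ l) * w l k)"
        by (intro tendsto_intros lim)
      moreover have "(\<Sum>l\<in>UNIV. of_int (k $ l) * v (\<sigma> n) l k) = 0" for n using v(2) by (simp add: divfree_def)
      ultimately show "(\<Sum>l\<in>UNIV. of_int (k $ l) * w l k) = 0" using LIMSEQ_unique[OF _ tendsto_const] by simp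
    qed
    moreover have "rsymm w" unfolding rsymm_def
    proof (intro allI)
      fix l k
      have "(\<lambda>n. cnj (v (\<sigma> n) l k)) \<longlonglongrightarrow> cnj (w l k)" by (intro tendsto_cnj lim)
      moreover have "cnj (v (\<sigma> n) l k) = v (\<sigma> n) l (- k)" for n using v(3) by (simp add: rsymm_def)
      ultimately show "w l (- k) = cnj (w l k)" using LIMSEQ_unique[OF lim[of l "- k"]] by simp
    qed
    ultimately show ?thesis using wM by (auto simp: M_def q_def)
  qed
  then show ?thesis using C by blast
qed

end

section \<open>Periodic distributions\<close>

subsection \<open>Test functions\<close>

abbreviation cx :: "(real^2 \<Rightarrow> real) \<Rightarrow> real^2 \<Rightarrow> complex" where
  "cx f \<equiv> (\<lambda>x. complex_of_real (f x))"

lemma pds_Nil [simp]: "pds [] f = f" and pds_Cons [simp]: "pds (i # is) f = pd i (pds is f)"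
  by (simp_all add: pds_def)

lemma pds_snoc: "pds (is @ [i]) f = pds is (pd i f)"
  by (simp add: pds_def)

lemma differentiable_imp_real_derivative:
  assumes "f differentiable_on UNIV"
  shows "((\<lambda>t. f (x + t *\<^sub>R axis i 1)) has_real_derivative pd i f x) (at 0)"
proof -
  have "f differentiable (at (x + 0 *\<^sub>R axis i 1))" using assms by (simp add: differentiable_on_def)
  moreover have "(\<lambda>t. x + t *\<^sub>R axis i 1) differentiable (at (0::real))"
    by (intro differentiable_add differentiable_const differentiable_scaleR differentiable_ident)
  ultimately have "(f \<circ> (\<lambda>t. x + t *\<^sub>R axis i 1)) differentiable (at 0)"
    by (intro differentiable_chain_at) simp_all
  then show ?thesis by (simp add: pd_def o_def DERIV_deriv_iff_real_differentiable)
qed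

lemma pder_cx: "f differentiable_on UNIV \<Longrightarrow> pder i (cx f) (cx (pd i f))"
  by (rule pder_of_real) (rule differentiable_imp_real_derivative)

lemma pd_eqI:
  assumes "\<And>x. ((\<lambda>t. f (x + t *\<^sub>R axis i 1)) has_real_derivative g x) (at 0)" shows "pd i f = g"
  using assms by (auto simp: pd_def DERIV_imp_deriv)

lemma periodic_pd: "periodic f \<Longrightarrow> periodic (pd i f)"
proof -
  assume p: "periodic f"
  have "f (x + (2 * pi) *\<^sub>R axis j 1 + t *\<^sub>R axis i 1) = f (x + t *\<^sub>R axis i 1)" for x t j
    using p[unfolded periodic_def, rule_format, of "x + t *\<^sub>R axis i 1" j] by (simp add: add_ac)
  then show ?thesis by (simp add: periodic_def pd_def)
qed

lemma test_pd: "f \<in> test_functions \<Longrightarrow> pd i f \<in> test_functions"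
  unfolding test_functions_def
proof (intro CollectI conjI allI; elim CollectE conjE)
  assume "periodic f" then show "periodic (pd i f)" by (rule periodic_pd)
next
  fix "is" assume "\<forall>is. pds is f differentiable_on UNIV"
  then show "pds is (pd i f) differentiable_on UNIV" unfolding pds_snoc[symmetric] by blast
qed

lemma test_pds: "f \<in> test_functions \<Longrightarrow> pds is f \<in> test_functions"
  by (induction "is") (auto intro: test_pd)

lemma test_differentiable: "f \<in> test_functions \<Longrightarrow> f differentiable_on UNIV"
  unfolding test_functions_def by (auto dest: spec[of _ "[]"])

lemma test_cper: "f \<in> test_functions \<Longrightarrow> cper f"
  using test_differentiable[of f] by (auto simp: cper_def test_functions_def intro: differentiable_imp_continuous_on)

lemma test_pder: "f \<in> test_functions \<Longrightarrow> pder i (cx f) (cx (pd i f))"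
  by (rule pder_cx) (rule test_differentiable)

lemma pd_lincomb:
  assumes "f \<in> test_functions" "g \<in> test_functions"
  shows "pd i (\<lambda>x. a * f x + b * g x) = (\<lambda>x. a * pd i f x + b * pd i g x)"
  by (rule pd_eqI, intro DERIV_add DERIV_cmult differentiable_imp_real_derivative test_differentiable assms)

lemma pds_lincomb:
  assumes "f \<in> test_functions" "g \<in> test_functions"
  shows "pds is (\<lambda>x. a * f x + b * g x) = (\<lambda>x. a * pds is f x + b * pds is g x)"
  by (induction "is") (simp_all add: pd_lincomb test_pds assms)

lemma test_lincomb:
  assumes "f \<in> test_functions" "g \<in> test_functions" shows "(\<lambda>x. a * f x + b * g x) \<in> test_functions"
proof -
  have "periodic (\<lambda>x. a * f x + b * g x)" using assms by (simp add: test_functions_def periodic_def)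
  moreover have "pds is (\<lambda>x. a * f x + b * g x) differentiable_on UNIV" for "is"
    unfolding pds_lincomb[OF assms]
    by (intro derivative_intros differentiable_on_mult differentiable_on_const test_differentiable test_pds assms)
  ultimately show ?thesis by (simp add: test_functions_def)
qed

lemma test_cmult: "f \<in> test_functions \<Longrightarrow> (\<lambda>x. c * f x) \<in> test_functions"
  using test_lincomb[of f f c 0] by simp

lemma pd_cmult: "f \<in> test_functions \<Longrightarrow> pd i (\<lambda>x. c * f x) = (\<lambda>x. c * pd i f x)"
  using pd_lincomb[of f f i c 0] by simp

lemma ek_has_derivative: "(ek k has_derivative (\<lambda>u. \<Sum>l\<in>UNIV. (u $ l) *\<^sub>R (\<i> * of_int (k $ l) * ek k x))) (at x)"
proof -
  have "((\<lambda>x. cis (freq k \<bullet> x)) has_derivative (\<lambda>t. (freq k \<bullet> t) *\<^sub>R (\<i> * cis (freq k \<bullet> x)))) (at x)"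
    by (intro has_derivative_cis derivative_intros)
  then show ?thesis
    unfolding ek_def[abs_def] by (simp add: inner_real2 UNIV_2 scaleR_conv_of_real algebra_simps)
qed

lemma ker_has_derivative:
  assumes "fsupp c"
  shows "(ker c has_derivative (\<lambda>u. \<Sum>l\<in>UNIV. (u $ l) *\<^sub>R ker (\<lambda>k. \<i> * of_int (k $ l) * c k) x)) (at x)"
proof -
  let ?K = "{k. c k \<noteq> 0}"
  have "((\<lambda>x. \<Sum>k\<in>?K. c k * ek k x) has_derivative (\<lambda>u. \<Sum>k\<in>?K. c k * (\<Sum>l\<in>UNIV. (u $ l) *\<^sub>R (\<i> * of_int (k $ l) * ek k x)))) (at x)"
    by (intro has_derivative_sum has_derivative_mult_right ek_has_derivative)
  moreover have "ker (\<lambda>k. \<i> * of_int (k $ l) * c k) x = (\<Sum>k\<in>?K. (\<i> * of_int (k $ l) * c k) * ek k x)" for l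
    by (rule ker_superset[OF assms]) auto
  then have "(\<Sum>k\<in>?K. c k * (\<Sum>l\<in>UNIV. (u $ l) *\<^sub>R (\<i> * of_int (k $ l) * ek k x))) = (\<Sum>l\<in>UNIV. (u $ l) *\<^sub>R ker (\<lambda>k. \<i> * of_int (k $ l) * c k) x)" for u
    by (simp add: UNIV_2 scaleR_sum_right sum_distrib_left sum.distrib scaleR_conv_of_real algebra_simps)
  ultimately show ?thesis by (simp add: ker_def[of c, abs_def])
qed

text \<open>
  The real parts of trigonometric polynomials. They are dense among the test functions, and distributions act on them
  through their Fourier coefficients.
\<close>

definition rtrig :: "(int^2 \<Rightarrow> complex) \<Rightarrow> real^2 \<Rightarrow> real" where
  "rtrig c x = Re (ker c x)"

lemma rtrig_differentiable: "fsupp c \<Longrightarrow> rtrig c differentiable_on UNIV"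
  unfolding rtrig_def[abs_def] differentiable_on_def
  using bounded_linear.has_derivative[OF bounded_linear_Re ker_has_derivative] differentiableI by blast

lemma pd_rtrig: "fsupp c \<Longrightarrow> pd i (rtrig c) = rtrig (\<lambda>k. \<i> * of_int (k $ i) * c k)"
proof (rule pd_eqI)
  fix x assume c: "fsupp c"
  from bounded_linear.has_vector_derivative[OF bounded_linear_Re pder_at[OF pder_ker[OF c], of x i 0 UNIV]]
  show "((\<lambda>t. rtrig c (x + t *\<^sub>R axis i 1)) has_real_derivative rtrig (\<lambda>k. \<i> * of_int (k $ i) * c k) x) (at 0)"
    by (simp add: rtrig_def has_real_derivative_iff_has_vector_derivative)
qed

lemma pds_rtrig: "fsupp c \<Longrightarrow> \<exists>d. fsupp d \<and> pds is (rtrig c) = rtrig d"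
proof (induction "is")
  case (Cons i "is")
  then obtain d where d: "fsupp d" "pds is (rtrig c) = rtrig d" by blast
  have "pds (i # is) (rtrig c) = rtrig (\<lambda>k. \<i> * of_int (k $ i) * d k)" using pd_rtrig[OF d(1), of i] d(2) by simp
  then show ?case by (intro exI[of _ "\<lambda>k. \<i> * of_int (k $ i) * d k"]) (simp add: fsupp_mult_left[OF d(1), of "\<lambda>k. \<i> * of_int (k $ i)", simplified])
qed auto

lemma test_rtrig: "fsupp c \<Longrightarrow> rtrig c \<in> test_functions"
proof -
  assume c: "fsupp c"
  have "periodic (rtrig c)" using cper_ker[of c] by (simp add: cper_def periodic_def rtrig_def)
  moreover have "pds is (rtrig c) differentiable_on UNIV" for "is"
    using pds_rtrig[OF c] rtrig_differentiable by metis
  ultimately show ?thesis by (simp add: test_functions_def)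
qed

definition cosk :: "int^2 \<Rightarrow> real^2 \<Rightarrow> real" where "cosk k x = cos (freq k \<bullet> x)"
definition sink :: "int^2 \<Rightarrow> real^2 \<Rightarrow> real" where "sink k x = sin (freq k \<bullet> x)"

lemma ker_single: "ker (\<lambda>l. if l = k then c else 0) x = c * ek k x"
  by (subst ker_superset[of "{k}"]) (auto split: if_splits)

lemma test_cosk: "cosk k \<in> test_functions" and test_sink: "sink k \<in> test_functions"
proof -
  have "cosk k = rtrig (\<lambda>l. if l = k then 1 else 0)" "sink k = rtrig (\<lambda>l. if l = k then - \<i> else 0)"
    by (auto simp: cosk_def sink_def rtrig_def ker_single ek_def)
  moreover have "fsupp (\<lambda>l. if l = k then c else 0)" for c by (rule finite_subset[of _ "{k}"]) auto
  ultimately show "cosk k \<in> test_functions" "sink k \<in> test_functions" by (simp_all add: test_rtrig)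
qed

lemma ek_cos_sin: "ek k x = of_real (cosk k x) + \<i> * of_real (sink k x)"
  by (simp add: ek_def cosk_def sink_def complex_eq_iff)

lemma pd_cosk: "pd i (cosk k) = (\<lambda>x. (- of_int (k $ i)) * sink k x)" and pd_sink: "pd i (sink k) = (\<lambda>x. of_int (k $ i) * cosk k x)"
proof -
  have d: "((\<lambda>t. freq k \<bullet> (x + t *\<^sub>R axis i 1)) has_real_derivative of_int (k $ i)) (at 0)" for x
    by (auto intro!: derivative_eq_intros simp: inner_add_right inner_axis)
  show "pd i (cosk k) = (\<lambda>x. (- of_int (k $ i)) * sink k x)"
    unfolding cosk_def[abs_def] sink_def by (rule pd_eqI) (rule DERIV_cong[OF DERIV_fun_cos[OF d]], simp)
  show "pd i (sink k) = (\<lambda>x. of_int (k $ i) * cosk k x)"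
    unfolding sink_def[abs_def] cosk_def by (rule pd_eqI) (rule DERIV_cong[OF DERIV_fun_sin[OF d]], simp)
qed

subsection \<open>Periodic distributions and their Fourier coefficients\<close>

lemma finite_short_lists: "finite {is :: 2 list. length is \<le> N}"
  using finite_lists_length_le[of "UNIV :: 2 set" N] by simp

lemma test_bdd: "f \<in> test_functions \<Longrightarrow> bdd_above (range (\<lambda>x. \<bar>pds is f x\<bar>))"
proof -
  assume "f \<in> test_functions"
  then have "cper (pds is f)" by (intro test_cper test_pds)
  then obtain B where "\<And>x. norm (pds is f x) \<le> B" using cper_bounded by blast
  then show ?thesis by (intro bdd_aboveI2[of _ _ B]) auto
qed

lemma SUP_pds_nonneg: "f \<in> test_functions \<Longrightarrow> 0 \<le> (SUP x. \<bar>pds is f x\<bar>)"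
  using cSUP_upper[OF UNIV_I test_bdd[of f "is"], of 0] by (meson abs_ge_zero order_trans)

lemma distr_bound_nonneg:
  assumes "F \<in> periodic_distr"
  obtains C N where "C \<ge> 0" "\<And>f. f \<in> test_functions \<Longrightarrow> \<bar>F f\<bar> \<le> C * (\<Sum>is\<in>{is. length is \<le> N}. SUP x. \<bar>pds is f x\<bar>)"
proof -
  obtain C N where C: "\<And>f. f \<in> test_functions \<Longrightarrow> \<bar>F f\<bar> \<le> C * (\<Sum>is\<in>{is. length is \<le> N}. SUP x. \<bar>pds is f x\<bar>)"
    using assms unfolding periodic_distr_def by blast
  show thesis
  proof (rule that[of "max C 0" N])
    fix f :: "real^2 \<Rightarrow> real" assume f: "f \<in> test_functions"
    have "C * (\<Sum>is\<in>{is. length is \<le> N}. SUP x. \<bar>pds is f x\<bar>) \<le> max C 0 * (\<Sum>is\<in>{is. length is \<le> N}. SUP x. \<bar>pds is f x\<bar>)"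
      by (intro mult_right_mono sum_nonneg SUP_pds_nonneg[OF f]) auto
    then show "\<bar>F f\<bar> \<le> max C 0 * (\<Sum>is\<in>{is. length is \<le> N}. SUP x. \<bar>pds is f x\<bar>)" using C[OF f] by linarith
  qed simp
qed

lemma distr_lincomb:
  assumes "F \<in> periodic_distr" "f \<in> test_functions" "g \<in> test_functions"
  shows "F (\<lambda>x. a * f x + b * g x) = a * F f + b * F g"
proof -
  have add: "F (\<lambda>x. f x + g x) = F f + F g" if "f \<in> test_functions" "g \<in> test_functions" for f g
    using assms(1) that unfolding periodic_distr_def by blast
  have cm: "F (\<lambda>x. c * f x) = c * F f" if "f \<in> test_functions" for c f
    using assms(1) that unfolding periodic_distr_def by blast
  show ?thesis using add[OF test_cmult[OF assms(2)] test_cmult[OF assms(3)]] assms by (simp add: cm)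
qed

lemma distr_cmult: "F \<in> periodic_distr \<Longrightarrow> f \<in> test_functions \<Longrightarrow> F (\<lambda>x. c * f x) = c * F f"
  unfolding periodic_distr_def by blast

text \<open>
  The bound in the definition of a distribution involves finitely many derivatives, so uniform convergence of all of them
  suffices.
\<close>

lemma distr_continuous:
  assumes F: "F \<in> periodic_distr" and f: "f \<in> test_functions" and g: "\<And>n. g n \<in> test_functions"
    and l: "\<And>is e. e > 0 \<Longrightarrow> \<exists>N. \<forall>n\<ge>N. \<forall>x. \<bar>pds is (g n) x - pds is f x\<bar> \<le> e"
  shows "(\<lambda>n. F (g n)) \<longlonglongrightarrow> F f"
proof -
  obtain C N where C: "C \<ge> 0" "\<And>f. f \<in> test_functions \<Longrightarrow> \<bar>F f\<bar> \<le> C * (\<Sum>is\<in>{is. length is \<le> N}. SUP x. \<bar>pds is f x\<bar>)"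
    using distr_bound_nonneg[OF F] by blast
  define d where "d n x = 1 * g n x + (-1) * f x" for n x
  have d: "d n \<in> test_functions" for n unfolding d_def[abs_def] by (rule test_lincomb[OF g f])
  have pd: "pds is (d n) x = pds is (g n) x - pds is f x" for "is" n x
    unfolding d_def[abs_def] by (simp only: pds_lincomb[OF g f])
  have S: "(\<lambda>n. SUP x. \<bar>pds is (d n) x\<bar>) \<longlonglongrightarrow> 0" for "is"
  proof (rule LIMSEQ_I)
    fix r :: real assume r: "r > 0"
    then obtain N where N: "\<And>n x. n \<ge> N \<Longrightarrow> \<bar>pds is (g n) x - pds is f x\<bar> \<le> r / 2" using l[of "r/2" "is"] by auto
    have "norm ((SUP x. \<bar>pds is (d n) x\<bar>) - 0) < r" if "n \<ge> N" for n
    proof -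
      have "(SUP x. \<bar>pds is (d n) x\<bar>) \<le> r / 2" by (rule cSUP_least) (simp_all only: pd N[OF that] UNIV_not_empty not_False_eq_True)
      then show ?thesis using SUP_pds_nonneg[OF d, of "is" n] r by simp
    qed
    then show "\<exists>no. \<forall>n\<ge>no. norm ((SUP x. \<bar>pds is (d n) x\<bar>) - 0) < r" by blast
  qed
  have "(\<lambda>n. C * (\<Sum>is\<in>{is. length is \<le> N}. SUP x. \<bar>pds is (d n) x\<bar>)) \<longlonglongrightarrow> C * (\<Sum>is\<in>{is::2 list. length is \<le> N}. 0)"
    by (intro tendsto_intros S)
  then have "(\<lambda>n. C * (\<Sum>is\<in>{is. length is \<le> N}. SUP x. \<bar>pds is (d n) x\<bar>)) \<longlonglongrightarrow> 0" by simp
  then have "(\<lambda>n. F (d n)) \<longlonglongrightarrow> 0"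
    by (rule Lim_null_comparison[rotated]) (auto intro!: always_eventually C(2)[OF d])
  moreover have "F (d n) = F (g n) - F f" for n
    unfolding d_def[abs_def] by (simp only: distr_lincomb[OF F g f])
  ultimately show ?thesis by (simp add: LIM_zero_cancel)
qed

text \<open>
  Fejer means commute with derivatives, hence approximate a test function together with all of them.
\<close>

lemma test_fejer:
  assumes f: "f \<in> test_functions"
  shows "\<exists>c. \<forall>n. fsupp (c n) \<and> (\<forall>k. c n k = of_real (fejer_weight n k) * fc (cx f) k) \<and>
     (\<forall>is e. e > 0 \<longrightarrow> (\<exists>N. \<forall>n\<ge>N. \<forall>x. \<bar>pds is (rtrig (c n)) x - pds is f x\<bar> \<le> e))"
proof -
  define c where "c n k = of_real (fejer_weight n k) * fc (cx f) k" for n k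
  have fs: "fsupp (\<lambda>k. of_real (fejer_weight n k) * a k)" for n and a :: "int^2 \<Rightarrow> complex"
    by (rule finite_subset[OF _ finite_sq_diffs[of n]]) (auto intro: ccontr simp: fejer_weight_outside)
  have main: "pds is (rtrig (c n)) = rtrig (\<lambda>k. of_real (fejer_weight n k) * fc (cx (pds is f)) k)" for "is" n
  proof (induction "is")
    case Nil then show ?case by (simp add: c_def[abs_def])
  next
    case (Cons i "is")
    let ?g = "pds is f"
    have g: "?g \<in> test_functions" by (rule test_pds[OF f])
    have "fc (cx (pd i ?g)) k = \<i> * of_int (k $ i) * fc (cx ?g) k" for k
      by (rule fc_pder) (auto intro!: cper_of_real test_cper g test_pd test_pder)
    then have "(\<lambda>k. \<i> * of_int (k $ i) * (of_real (fejer_weight n k) * fc (cx ?g) k)) = (\<lambda>k. of_real (fejer_weight n k) * fc (cx (pd i ?g)) k)"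
      by (simp add: mult_ac)
    then show ?case using Cons pd_rtrig[OF fs, of i n] by simp
  qed
  have ker_fejer: "ker (\<lambda>k. of_real (fejer_weight n k) * fc g k) x = fejer n g x" for n g x
    unfolding fejer_def by (rule ker_superset) (auto intro: ccontr simp: fejer_weight_outside)
  have "\<exists>N. \<forall>n\<ge>N. \<forall>x. \<bar>pds is (rtrig (c n)) x - pds is f x\<bar> \<le> e" if "e > 0" for "is" e
  proof -
    obtain N where N: "\<And>n x. n \<ge> N \<Longrightarrow> norm (fejer n (cx (pds is f)) x - cx (pds is f) x) \<le> e"
      using fejer_uniform[OF cper_of_real[OF test_cper[OF test_pds[OF f]]] \<open>e > 0\<close>] by blast
    have "\<bar>pds is (rtrig (c n)) x - pds is f x\<bar> \<le> e" if "n \<ge> N" for n x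
      using N[OF that, of x] abs_Re_le_cmod[of "fejer n (cx (pds is f)) x - cx (pds is f) x"]
      unfolding main rtrig_def ker_fejer by simp
    then show ?thesis by blast
  qed
  then show ?thesis using fs by (intro exI[of _ c]) (auto simp: c_def[abs_def])
qed

lemma distr_rtrig:
  assumes F: "F \<in> periodic_distr" and c: "fsupp c"
  shows "F (rtrig c) = (\<Sum>k | c k \<noteq> 0. Re (c k) * F (cosk k) - Im (c k) * F (sink k))"
proof -
  have *: "(\<lambda>x. \<Sum>k\<in>K. Re (c k) * cosk k x + (- Im (c k)) * sink k x) \<in> test_functions \<and>
        F (\<lambda>x. \<Sum>k\<in>K. Re (c k) * cosk k x + (- Im (c k)) * sink k x) = (\<Sum>k\<in>K. Re (c k) * F (cosk k) - Im (c k) * F (sink k))"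
    if "finite K" for K
    using that
  proof induction
    case empty
    have "(\<lambda>x. 0 * cosk 0 x) \<in> test_functions" "F (\<lambda>x. 0 * cosk 0 x) = 0 * F (cosk 0)"
      by (intro test_cmult test_cosk distr_cmult[OF F])+
    then show ?case by simp
  next
    case (insert k K)
    let ?S = "\<lambda>x. \<Sum>k\<in>K. Re (c k) * cosk k x + (- Im (c k)) * sink k x"
    let ?T = "\<lambda>x. Re (c k) * cosk k x + (- Im (c k)) * sink k x"
    have T: "?T \<in> test_functions" by (rule test_lincomb[OF test_cosk test_sink])
    have eq: "(\<lambda>x. \<Sum>k\<in>insert k K. Re (c k) * cosk k x + (- Im (c k)) * sink k x) = (\<lambda>x. 1 * ?T x + 1 * ?S x)"
      using insert by simp
    show ?case unfolding eq
      using test_lincomb[OF T, of ?S 1 1] distr_lincomb[OF F T, of ?S 1 1] distr_lincomb[OF F test_cosk test_sink, of "Re (c k)" k "- Im (c k)" k] insert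
      by simp
  qed
  have "rtrig c = (\<lambda>x. \<Sum>k | c k \<noteq> 0. Re (c k) * cosk k x + (- Im (c k)) * sink k x)"
    by (auto simp: rtrig_def ker_def ek_cos_sin)
  then show ?thesis using *[OF c] by simp
qed

lemma fourier_eq: "fourier F k = (of_real (F (cosk k)) - \<i> * of_real (F (sink k))) / of_real ((2 * pi)\<^sup>2)"
  by (simp add: fourier_def cosk_def[abs_def] sink_def[abs_def] complex_eq_iff Complex_eq)

lemma fourier_inject: "fourier F k = fourier G k \<longleftrightarrow> F (cosk k) = G (cosk k) \<and> F (sink k) = G (sink k)"
  unfolding fourier_eq by (auto simp: complex_eq_iff)

text \<open>
  A distribution is determined by its Fourier coefficients: test functions are limits of trigonometric polynomials in the
  topology of test functions. All identities between distributions are proved by comparing coefficients.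
\<close>

theorem distr_eqI:
  assumes F: "F \<in> periodic_distr" and G: "G \<in> periodic_distr" and eq: "\<And>k. fourier F k = fourier G k"
  shows "F \<simeq>\<^sub>D G"
  unfolding distr_eq_def
proof
  fix f assume f: "f \<in> test_functions"
  obtain c :: "nat \<Rightarrow> int^2 \<Rightarrow> complex" where c: "\<And>n. fsupp (c n)" "\<And>is e. e > 0 \<Longrightarrow> (\<exists>N. \<forall>n\<ge>N. \<forall>x. \<bar>pds is (rtrig (c n)) x - pds is f x\<bar> \<le> e)"
  proof -
    assume th: "\<And>c :: nat \<Rightarrow> int^2 \<Rightarrow> complex. (\<And>n. fsupp (c n)) \<Longrightarrow> (\<And>is e. e > 0 \<Longrightarrow> (\<exists>N. \<forall>n\<ge>N. \<forall>x. \<bar>pds is (rtrig (c n)) x - pds is f x\<bar> \<le> e)) \<Longrightarrow> thesis"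
    from test_fejer[OF f] obtain c where c: "\<forall>n. fsupp (c n) \<and> (\<forall>k. c n k = of_real (fejer_weight n k) * fc (cx f) k) \<and>
      (\<forall>is e. e > 0 \<longrightarrow> (\<exists>N. \<forall>n\<ge>N. \<forall>x. \<bar>pds is (rtrig (c n)) x - pds is f x\<bar> \<le> e))" by (elim exE)
    have a: "fsupp (c n)" for n using c[rule_format, of n] by (elim conjE)
    have b: "\<exists>N. \<forall>n\<ge>N. \<forall>x. \<bar>pds is (rtrig (c n)) x - pds is f x\<bar> \<le> e" if "e > 0" for "is" e
      using c[THEN spec, of 0] that by (elim conjE) (elim allE impE, assumption+)
    show thesis by (rule th[of c], rule a, erule b)
  qed
  have "F (rtrig (c n)) = G (rtrig (c n))" for n
    using eq by (simp add: distr_rtrig[OF F c(1)] distr_rtrig[OF G c(1)] fourier_inject)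
  then show "F f = G f"
    using LIMSEQ_unique[OF distr_continuous[OF F f test_rtrig[OF c(1)] c(2)]] distr_continuous[OF G f test_rtrig[OF c(1)] c(2)]
    by simp
qed

lemma distr_eqD: "F \<simeq>\<^sub>D G \<Longrightarrow> fourier F k = fourier G k"
  by (simp add: fourier_inject distr_eq_def test_cosk test_sink)

subsection \<open>Operations on distributions\<close>

lemma periodic_distrI:
  assumes "\<And>f g. f \<in> test_functions \<Longrightarrow> g \<in> test_functions \<Longrightarrow> F (\<lambda>x. f x + g x) = F f + F g"
    "\<And>c f. f \<in> test_functions \<Longrightarrow> F (\<lambda>x. c * f x) = c * F f"
    "\<And>f. f \<in> test_functions \<Longrightarrow> \<bar>F f\<bar> \<le> C * (\<Sum>is\<in>{is. length is \<le> N}. SUP x. \<bar>pds is f x\<bar>)"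
  shows "F \<in> periodic_distr"
  unfolding periodic_distr_def using assms by blast

lemma distr_lincomb_mem:
  assumes F: "F \<in> periodic_distr" and G: "G \<in> periodic_distr" shows "(\<lambda>f. a * F f + b * G f) \<in> periodic_distr"
proof -
  obtain C1 N1 where C1: "C1 \<ge> 0" "\<And>f. f \<in> test_functions \<Longrightarrow> \<bar>F f\<bar> \<le> C1 * (\<Sum>is\<in>{is. length is \<le> N1}. SUP x. \<bar>pds is f x\<bar>)"
    using distr_bound_nonneg[OF F] by blast
  obtain C2 N2 where C2: "C2 \<ge> 0" "\<And>f. f \<in> test_functions \<Longrightarrow> \<bar>G f\<bar> \<le> C2 * (\<Sum>is\<in>{is. length is \<le> N2}. SUP x. \<bar>pds is f x\<bar>)"
    using distr_bound_nonneg[OF G] by blast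
  show ?thesis
  proof (rule periodic_distrI[where C = "\<bar>a\<bar> * C1 + \<bar>b\<bar> * C2" and N = "max N1 N2"])
    fix f g :: "real^2 \<Rightarrow> real" assume "f \<in> test_functions" "g \<in> test_functions"
    then show "a * F (\<lambda>x. f x + g x) + b * G (\<lambda>x. f x + g x) = a * F f + b * G f + (a * F g + b * G g)"
      using distr_lincomb[OF F, of f g 1 1] distr_lincomb[OF G, of f g 1 1] by (simp add: algebra_simps)
  next
    fix c and f :: "real^2 \<Rightarrow> real" assume f: "f \<in> test_functions"
    then show "a * F (\<lambda>x. c * f x) + b * G (\<lambda>x. c * f x) = c * (a * F f + b * G f)"
      by (simp add: distr_cmult[OF F] distr_cmult[OF G] algebra_simps)
    let ?S = "\<lambda>N. \<Sum>is\<in>{is. length is \<le> N}. SUP x. \<bar>pds is f x\<bar>"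
    have m: "?S N \<le> ?S (max N1 N2)" if "N \<le> max N1 N2" for N
      using that by (intro sum_mono2 finite_short_lists SUP_pds_nonneg[OF f]) auto
    have "\<bar>F f\<bar> \<le> C1 * ?S (max N1 N2)" using C1(2)[OF f] mult_left_mono[OF m[of N1] C1(1)] by linarith
    moreover have "\<bar>G f\<bar> \<le> C2 * ?S (max N1 N2)" using C2(2)[OF f] mult_left_mono[OF m[of N2] C2(1)] by linarith
    ultimately have "\<bar>a\<bar> * \<bar>F f\<bar> + \<bar>b\<bar> * \<bar>G f\<bar> \<le> \<bar>a\<bar> * (C1 * ?S (max N1 N2)) + \<bar>b\<bar> * (C2 * ?S (max N1 N2))"
      by (intro add_mono mult_left_mono) auto
    then show "\<bar>a * F f + b * G f\<bar> \<le> (\<bar>a\<bar> * C1 + \<bar>b\<bar> * C2) * ?S (max N1 N2)"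
      using abs_triangle_ineq[of "a * F f" "b * G f"] by (simp add: abs_mult algebra_simps)
  qed
qed

lemma distr_zero_mem: "zero_distr \<in> periodic_distr"
  by (rule periodic_distrI[where C = 0 and N = 0]) (auto simp: zero_distr_def)

lemma distr_dpd_mem: assumes F: "F \<in> periodic_distr" shows "dpd i F \<in> periodic_distr"
proof -
  obtain C N where C: "C \<ge> 0" "\<And>f. f \<in> test_functions \<Longrightarrow> \<bar>F f\<bar> \<le> C * (\<Sum>is\<in>{is. length is \<le> N}. SUP x. \<bar>pds is f x\<bar>)"
    using distr_bound_nonneg[OF F] by blast
  show ?thesis
  proof (rule periodic_distrI[where C = C and N = "Suc N"])
    fix f g :: "real^2 \<Rightarrow> real" assume "f \<in> test_functions" "g \<in> test_functions"
    then show "dpd i F (\<lambda>x. f x + g x) = dpd i F f + dpd i F g"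
      using pd_lincomb[of f g i 1 1] distr_lincomb[OF F test_pd test_pd, of f g 1 i 1 i] by (simp add: dpd_def)
  next
    fix c and f :: "real^2 \<Rightarrow> real" assume f: "f \<in> test_functions"
    then show "dpd i F (\<lambda>x. c * f x) = c * dpd i F f"
      by (simp add: dpd_def pd_cmult distr_cmult[OF F test_pd])
    have "\<bar>dpd i F f\<bar> \<le> C * (\<Sum>is\<in>{is. length is \<le> N}. SUP x. \<bar>pds (is @ [i]) f x\<bar>)"
      using C(2)[OF test_pd[OF f], of i] by (simp add: dpd_def pds_snoc)
    also have "(\<Sum>is\<in>{is. length is \<le> N}. SUP x. \<bar>pds (is @ [i]) f x\<bar>) = (\<Sum>js\<in>(\<lambda>is. is @ [i]) ` {is. length is \<le> N}. SUP x. \<bar>pds js f x\<bar>)"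
      by (subst sum.reindex) (auto simp: inj_on_def)
    also have "\<dots> \<le> (\<Sum>is\<in>{is. length is \<le> Suc N}. SUP x. \<bar>pds is f x\<bar>)"
      by (intro sum_mono2 finite_short_lists SUP_pds_nonneg[OF f]) auto
    finally show "\<bar>dpd i F f\<bar> \<le> C * (\<Sum>is\<in>{is. length is \<le> Suc N}. SUP x. \<bar>pds is f x\<bar>)"
      using C(1) by (simp add: mult_left_mono)
  qed
qed

lemma distr_of_eq: "complex_of_real (distr_of u f) = of_real ((2 * pi)\<^sup>2) * mean (cx (\<lambda>x. u x * f x))"
  by (simp only: distr_of_def mean_of_real) simp

lemma distr_of_mem: assumes u: "cper u" shows "distr_of u \<in> periodic_distr"
proof -
  obtain B where B: "B \<ge> 0" "\<And>x. norm (u x) \<le> B" using cper_bounded[OF u] by blast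
  show ?thesis
  proof (rule periodic_distrI[where C = "(2 * pi)\<^sup>2 * B" and N = 0])
    fix f g :: "real^2 \<Rightarrow> real" assume f: "f \<in> test_functions" "g \<in> test_functions"
    then show "distr_of u (\<lambda>x. f x + g x) = distr_of u f + distr_of u g"
      by (simp add: distr_of_def distrib_left integrable_torus cper_mult u test_cper)
  next
    fix c and f :: "real^2 \<Rightarrow> real" assume f: "f \<in> test_functions"
    show "distr_of u (\<lambda>x. c * f x) = c * distr_of u f"
      by (simp add: distr_of_def mult.left_commute)
    have le: "\<bar>f x\<bar> \<le> (SUP x. \<bar>f x\<bar>)" for x using cSUP_upper[OF UNIV_I test_bdd[OF f, of "[]"], of x] by simp
    have "norm (mean (cx (\<lambda>x. u x * f x))) \<le> B * (SUP x. \<bar>f x\<bar>)"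
    proof (rule norm_mean_le_const)
      show "cper (cx (\<lambda>x. u x * f x))" by (intro cper_of_real cper_mult u test_cper[OF f])
      fix x show "norm (cx (\<lambda>x. u x * f x) x) \<le> B * (SUP x. \<bar>f x\<bar>)"
        unfolding norm_of_real abs_mult using B le by (intro mult_mono) auto
    qed
    then have "(2 * pi)\<^sup>2 * norm (mean (cx (\<lambda>x. u x * f x))) \<le> (2 * pi)\<^sup>2 * (B * (SUP x. \<bar>f x\<bar>))"
      by (rule mult_left_mono) simp
    moreover have "\<bar>distr_of u f\<bar> = (2 * pi)\<^sup>2 * norm (mean (cx (\<lambda>x. u x * f x)))"
      using arg_cong[OF distr_of_eq[of u f], of norm] by (simp only: norm_mult norm_of_real) simp
    ultimately show "\<bar>distr_of u f\<bar> \<le> (2 * pi)\<^sup>2 * B * (\<Sum>is\<in>{is. length is \<le> 0}. SUP x. \<bar>pds is f x\<bar>)" by simp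
  qed
qed

lemma fourier_distr_of: assumes u: "cper u" shows "fourier (distr_of u) k = fc (cx u) k"
proof -
  have c: "cper (cx (\<lambda>x. u x * cosk k x))" "cper (\<lambda>x. \<i> * cx (\<lambda>x. u x * sink k x) x)"
    by (intro cper_of_real cper_mult cper_const u test_cper test_cosk test_sink)+
  have "fourier (distr_of u) k = mean (cx (\<lambda>x. u x * cosk k x)) - \<i> * mean (cx (\<lambda>x. u x * sink k x))"
    unfolding fourier_eq distr_of_eq by (simp add: diff_divide_distrib)
  also have "\<dots> = mean (\<lambda>x. cx (\<lambda>x. u x * cosk k x) x - \<i> * cx (\<lambda>x. u x * sink k x) x)"
    unfolding mean_diff[OF c] mean_cmult ..
  also have "\<dots> = fc (cx u) k"
    unfolding fc_def by (rule mean_cong) (simp add: ek_cos_sin algebra_simps)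
  finally show ?thesis .
qed

lemma fourier_lincomb: "fourier (\<lambda>f. a * F f + b * G f) k = of_real a * fourier F k + of_real b * fourier G k"
  by (simp add: fourier_eq add_divide_distrib diff_divide_distrib algebra_simps)

lemma fourier_dpd:
  assumes F: "F \<in> periodic_distr" shows "fourier (dpd i F) k = \<i> * of_int (k $ i) * fourier F k"
proof -
  have "dpd i F (cosk k) = of_int (k $ i) * F (sink k)" "dpd i F (sink k) = - of_int (k $ i) * F (cosk k)"
    unfolding dpd_def pd_cosk pd_sink by (simp_all only: distr_cmult[OF F] test_cosk test_sink)
  then show ?thesis by (simp add: fourier_eq algebra_simps)
qed

lemma fourier_zero: "fourier zero_distr k = 0"
  by (simp add: fourier_eq zero_distr_def)

lemma ddiv_eq: "ddiv v = (\<lambda>f. 1 * dpd 1 (v $ 1) f + 1 * dpd 2 (v $ 2) f)"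
  by (auto simp: ddiv_def UNIV_2)

lemma dlaplacian_eq: "dlaplacian F = (\<lambda>f. 1 * dpd 1 (dpd 1 F) f + 1 * dpd 2 (dpd 2 F) f)"
  by (auto simp: dlaplacian_def UNIV_2)

lemma ddiv_mem: "(\<And>i. v $ i \<in> periodic_distr) \<Longrightarrow> ddiv v \<in> periodic_distr"
  unfolding ddiv_eq by (intro distr_lincomb_mem distr_dpd_mem)

lemma dlaplacian_mem: "F \<in> periodic_distr \<Longrightarrow> dlaplacian F \<in> periodic_distr"
  unfolding dlaplacian_eq by (intro distr_lincomb_mem distr_dpd_mem)

lemma fourier_ddiv: "(\<And>i. v $ i \<in> periodic_distr) \<Longrightarrow> fourier (ddiv v) k = \<i> * (\<Sum>l\<in>UNIV. of_int (k $ l) * fourier (v $ l) k)"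
  unfolding ddiv_eq fourier_lincomb by (simp add: fourier_dpd UNIV_2 algebra_simps)

lemma fourier_dlaplacian: "F \<in> periodic_distr \<Longrightarrow> fourier (dlaplacian F) k = - of_real ((norm (freq k))\<^sup>2) * fourier F k"
  unfolding dlaplacian_eq fourier_lincomb freq_sq
  by (simp add: fourier_dpd distr_dpd_mem UNIV_2 power2_eq_square algebra_simps)

section \<open>One step of the scheme, seen from its Fourier coefficients\<close>

subsection \<open>Continuously differentiable fields\<close>

abbreviation cof :: "(real^2 \<Rightarrow> real^2) \<Rightarrow> 2 \<Rightarrow> int^2 \<Rightarrow> complex" where
  "cof v i \<equiv> fc (cx (\<lambda>x. v x $ i))"

lemma c1_component_differentiable: "c1_field v \<Longrightarrow> (\<lambda>x. v x $ i) differentiable_on UNIV"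
  unfolding c1_field_def differentiable_on_def differentiable_def
  using bounded_linear.has_derivative[OF bounded_linear_vec_nth] by blast

lemma c1_cper: "c1_field v \<Longrightarrow> cper (\<lambda>x. v x $ i)"
  using c1_component_differentiable[of v i]
  by (auto simp: cper_def c1_field_def periodic_def intro: differentiable_imp_continuous_on)

lemma c1_cper_pd: "c1_field v \<Longrightarrow> cper (pd j (\<lambda>x. v x $ i))"
  using periodic_pd[of "\<lambda>x. v x $ i" j] c1_cper[of v i] by (auto simp: cper_def c1_field_def)

lemma c1_pder: "c1_field v \<Longrightarrow> pder j (cx (\<lambda>x. v x $ i)) (cx (pd j (\<lambda>x. v x $ i)))"
  by (rule pder_cx) (rule c1_component_differentiable)

lemma fc_pd: "c1_field v \<Longrightarrow> fc (cx (pd j (\<lambda>x. v x $ i))) k = \<i> * of_int (k $ j) * cof v i k"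
  by (rule fc_pder[OF cper_of_real[OF c1_cper] cper_of_real[OF c1_cper_pd] c1_pder])

lemma divfree_pointwise:
  assumes v: "c1_field v" and d: "divfree (cof v)"
  shows "(\<Sum>l\<in>UNIV. cx (pd l (\<lambda>x. v x $ l)) x) = 0"
proof (rule fc_eqI[where g = "\<lambda>x. 0"])
  show "cper (\<lambda>x. \<Sum>l\<in>UNIV. cx (pd l (\<lambda>x. v x $ l)) x)" by (intro cper_sum cper_of_real c1_cper_pd v)
  show "cper (\<lambda>x::real^2. 0 :: complex)" by (rule cper_const)
  fix k
  have "fc (\<lambda>x. \<Sum>l\<in>UNIV. cx (pd l (\<lambda>x. v x $ l)) x) k = (\<Sum>l\<in>UNIV. fc (cx (pd l (\<lambda>x. v x $ l))) k)"
    by (rule fc_sum) (rule cper_of_real[OF c1_cper_pd[OF v]])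
  also have "\<dots> = \<i> * (\<Sum>l\<in>UNIV. of_int (k $ l) * cof v l k)"
    by (simp add: fc_pd[OF v] sum_distrib_left mult.assoc)
  finally show "fc (\<lambda>x. \<Sum>l\<in>UNIV. cx (pd l (\<lambda>x. v x $ l)) x) k = fc (\<lambda>x. 0) k"
    using d by (simp add: divfree_def)
qed

lemma cx_advect: "cx (\<lambda>x. advect u v x $ i) = (\<lambda>x. \<Sum>l\<in>UNIV. cx (\<lambda>x. u x $ l) x * cx (pd l (\<lambda>x. v x $ i)) x)"
  by (simp add: advect_def)

lemma cper_advect: "c1_field u \<Longrightarrow> c1_field v \<Longrightarrow> cper (\<lambda>x. advect u v x $ i)"
  by (simp add: advect_def) (intro cper_sum cper_mult c1_cper c1_cper_pd)

text \<open>
  For divergence-free \<open>u\<close> the classical product is the divergence form used in the construction.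
\<close>

lemma cof_advect:
  assumes u: "c1_field u" "divfree (cof u)" and v: "c1_field v"
  shows "cof (advect u v) i k = divc (\<lambda>m. cx (\<lambda>x. u x $ m)) (\<lambda>i. cx (\<lambda>x. v x $ i)) i k"
  unfolding cx_advect divc_def
  by (rule fc_div_free_transport[where A' = "\<lambda>i l. cx (pd i (\<lambda>x. u x $ l))"])
    (intro cper_of_real c1_cper c1_cper_pd c1_pder u(1) v divfree_pointwise[OF u])+

subsection \<open>The equation for the coefficients\<close>

lemma fourier_field: "c1_field v \<Longrightarrow> fourier (distr_field_of v $ i) k = cof v i k"
  by (simp add: distr_field_of_def fourier_distr_of c1_cper)

lemma field_mem: "c1_field v \<Longrightarrow> distr_field_of v $ i \<in> periodic_distr"
  by (simp add: distr_field_of_def distr_of_mem c1_cper)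

text \<open>
  Solving the Poisson equation of the pressure at each frequency gives the symbol of the projection. At \<open>k = 0\<close>
  the pressure gradient vanishes.
\<close>

lemma fourier_leray_projection:
  assumes l: "is_leray_projection V w" and V: "\<And>i. V $ i \<in> periodic_distr"
  shows "fourier (w $ i) k = leray (\<lambda>i. fourier (V $ i)) i k"
proof -
  obtain q where q: "q \<in> periodic_distr" "dlaplacian q \<simeq>\<^sub>D ddiv V" "\<And>i. w $ i \<simeq>\<^sub>D (\<lambda>f. (V $ i) f - dpd i q f)"
    using l unfolding is_leray_projection_def by blast
  have w: "fourier (w $ i) k = fourier (V $ i) k - \<i> * of_int (k $ i) * fourier q k"
    using distr_eqD[OF q(3)[of i], of k] fourier_lincomb[of 1 "V $ i" "-1" "dpd i q" k] by (simp add: fourier_dpd q(1))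
  have e: "- of_real ((norm (freq k))\<^sup>2) * fourier q k = \<i> * (\<Sum>l\<in>UNIV. of_int (k $ l) * fourier (V $ l) k)"
    using distr_eqD[OF q(2), of k] by (simp only: fourier_dlaplacian[OF q(1)] fourier_ddiv[OF V])
  show ?thesis
  proof (cases "k = 0")
    case False
    then have n: "complex_of_real ((norm (freq k))\<^sup>2) \<noteq> 0" by simp
    have "fourier q k = - \<i> * (\<Sum>l\<in>UNIV. of_int (k $ l) * fourier (V $ l) k) / of_real ((norm (freq k))\<^sup>2)"
      unfolding mult_minus_left e[symmetric] using n by (simp del: of_real_power)
    then show ?thesis unfolding w leray_def
      by (simp add: sum_distrib_left sum_divide_distrib mult_ac)
  next
    case True then show ?thesis unfolding w leray_def by simp
  qed
qed

lemma scheme_step_coefficients: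
  assumes \<tau>: "\<tau> > 0" and u: "c1_field u" "divfree (cof u)" and v: "c1_field v"
    and div: "ddiv (distr_field_of v) \<simeq>\<^sub>D zero_distr"
    and w: "is_leray_projection (distr_field_of (advect u v)) w"
    and eq: "\<And>i. (\<lambda>f. ((distr_field_of v $ i) f - (distr_field_of u $ i) f) / \<tau> + (w $ i) f) \<simeq>\<^sub>D (\<lambda>f. \<nu> * dlaplacian (distr_field_of v $ i) f)"
  shows "divfree (cof v)" and "step_eq \<tau> (\<tau> * \<nu>) (divc (\<lambda>m. cx (\<lambda>x. u x $ m)) (\<lambda>i. cx (\<lambda>x. v x $ i))) (cof u) (cof v)"
proof -
  show "divfree (cof v)"
    unfolding divfree_def
  proof
    fix k show "(\<Sum>l\<in>UNIV. of_int (k $ l) * cof v l k) = 0"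
      using distr_eqD[OF div, of k] by (simp add: fourier_ddiv field_mem v fourier_field fourier_zero)
  qed
  let ?N = "divc (\<lambda>m. cx (\<lambda>x. u x $ m)) (\<lambda>i. cx (\<lambda>x. v x $ i))"
  have fa: "fourier (distr_field_of (advect u v) $ i) = ?N i" for i
    by (rule ext) (simp add: distr_field_of_def fourier_distr_of cper_advect u v cof_advect[OF u v])
  have ma: "distr_field_of (advect u v) $ i \<in> periodic_distr" for i
    by (simp add: distr_field_of_def distr_of_mem cper_advect u v)
  have W: "fourier (w $ i) k = leray ?N i k" for i k
    using fourier_leray_projection[OF w ma, of i k] by (simp only: fa)
  show "step_eq \<tau> (\<tau> * \<nu>) ?N (cof u) (cof v)"
    unfolding step_eq_def
  proof (intro allI)
    fix i k
    let ?V = "distr_field_of v $ i" and ?U = "distr_field_of u $ i"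
    have L: "(\<lambda>f. (?V f - ?U f) / \<tau> + (w $ i) f) = (\<lambda>f. (1 / \<tau>) * ?V f + 1 * ((\<lambda>f. (- 1 / \<tau>) * ?U f + 1 * (w $ i) f) f))"
      by (rule ext) (simp add: diff_divide_distrib)
    have "fourier (\<lambda>f. (?V f - ?U f) / \<tau> + (w $ i) f) k = of_real (1/\<tau>) * cof v i k + (of_real (- 1 / \<tau>) * cof u i k + leray ?N i k)"
      unfolding L fourier_lincomb by (simp only: fourier_field u v W of_real_1 mult_1)
    moreover have "fourier (\<lambda>f. \<nu> * dlaplacian ?V f) k = of_real \<nu> * (- of_real ((norm (freq k))\<^sup>2) * cof v i k)"
      using fourier_lincomb[of \<nu> "dlaplacian ?V" 0 "dlaplacian ?V" k]
      by (simp only: fourier_dlaplacian field_mem fourier_field v) simp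
    ultimately have "of_real (1/\<tau>) * cof v i k + (of_real (- 1 / \<tau>) * cof u i k + leray ?N i k) = of_real \<nu> * (- of_real ((norm (freq k))\<^sup>2) * cof v i k)"
      using distr_eqD[OF eq[of i], of k] by (simp only:)
    then have "of_real \<tau> * (of_real (1/\<tau>) * cof v i k + (of_real (- 1 / \<tau>) * cof u i k + leray ?N i k)) = of_real \<tau> * (of_real \<nu> * (- of_real ((norm (freq k))\<^sup>2) * cof v i k))"
      by (simp only:)
    then show "of_real (1 + \<tau> * \<nu> * (norm (freq k))\<^sup>2) * cof v i k + of_real \<tau> * leray ?N i k = cof u i k"
      using \<tau> by (simp add: algebra_simps)
  qed
qed

text \<open>
  The converse direction has to exhibit a pressure. Its coefficients are those of the inverse
  Laplacian of the divergence of a continuous field, so they gain one derivative, their blocks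
  decay like \<open>2\<^sup>-\<^sup>j\<close>, and the pressure is itself a continuous function.
\<close>

context lp_cutoff
begin

lemma pressure_exists:
  assumes G: "\<And>i. cper (G i)"
  shows "\<exists>q\<in>periodic_distr. \<forall>k. fourier q k = - \<i> * (\<Sum>l\<in>UNIV. of_real (of_int (k $ l) / (norm (freq k))\<^sup>2) * fc (cx (G l)) k)"
proof -
  define qc where "qc k = - \<i> * (\<Sum>l\<in>UNIV. of_real (of_int (k $ l) / (norm (freq k))\<^sup>2) * fc (cx (G l)) k)" for k :: "int^2"
  have cG: "cper (cx (G l))" for l by (rule cper_of_real[OF G])
  define B where "B l = snorm (cx (G l))" for l
  have "norm (blk h j qc x) \<le> (\<Sum>l\<in>UNIV. CM / 2 ^ j * B l)" for j x
  proof -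
    have eq: "(\<lambda>k. msym h j k * qc k) = (\<lambda>k. - \<i> * (\<Sum>l\<in>UNIV. isym h j l k * fc (cx (G l)) k))"
      by (auto simp: qc_def isym_def sum_distrib_left mult_ac)
    have "blk h j qc x = - \<i> * (\<Sum>l\<in>UNIV. Op (isym h j l) (cx (G l)) x)"
      unfolding blk_def Op_def eq ker_cmult by (simp add: ker_sum)
    then have "norm (blk h j qc x) = norm (\<Sum>l\<in>UNIV. Op (isym h j l) (cx (G l)) x)" by (simp add: norm_mult)
    also have "\<dots> \<le> (\<Sum>l\<in>UNIV. CM / 2 ^ j * B l)"
    proof (rule sum_norm_le)
      fix l :: 2
      have "norm (Op (isym h j l) (cx (G l)) x) \<le> Mn (isym h j l) * B l"
        unfolding B_def by (rule norm_Op_le[OF fsupp_isym cG le_snorm[OF cG]])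
      also have "\<dots> \<le> CM / 2 ^ j * B l"
        unfolding B_def by (rule mult_right_mono[OF CM(6) snorm_nonneg[OF cG]])
      finally show "norm (Op (isym h j l) (cx (G l)) x) \<le> CM / 2 ^ j * B l" .
    qed
    finally show ?thesis .
  qed
  then have a1: "nb h j qc \<le> (\<Sum>l\<in>UNIV. CM / 2 ^ j * B l)" for j unfolding nb_def by (rule snorm_le)
  have a2: "(\<Sum>l\<in>UNIV. CM / 2 ^ j * B l) = (CM * (\<Sum>l\<in>UNIV. B l)) * (1/2) ^ j" for j
    by (simp add: sum_distrib_left power_one_over field_simps)
  have "summable (\<lambda>j. (CM * (\<Sum>l\<in>UNIV. B l)) * (1/2) ^ j)"
    by (intro summable_mult summable_geometric) simp
  then have S: "summable (\<lambda>j. nb h j qc)"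
  proof (rule summable_comparison_test'[where N = 0])
    fix j show "norm (nb h j qc) \<le> (CM * (\<Sum>l\<in>UNIV. B l)) * (1/2) ^ j"
      unfolding real_norm_def abs_of_nonneg[OF nb_nonneg] a2[symmetric] by (rule a1)
  qed
  have sym: "qc (- k) = cnj (qc k)" for k
  proof -
    have "fc (cx (G l)) (- k) = cnj (fc (cx (G l)) k)" for l by (rule fc_real) simp
    then show ?thesis unfolding qc_def by (simp add: sum_negf)
  qed
  have "cx (\<lambda>x. Re (fld qc x)) = fld qc"
    using fld_real[OF S sym] by (auto simp: complex_eq_iff)
  moreover have "cper (\<lambda>x. Re (fld qc x))" by (rule cper_Re[OF cper_fld[OF S]])
  ultimately have "distr_of (\<lambda>x. Re (fld qc x)) \<in> periodic_distr \<and> (\<forall>k. fourier (distr_of (\<lambda>x. Re (fld qc x))) k = qc k)"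
    by (simp add: distr_of_mem fourier_distr_of fc_fld[OF S])
  then show ?thesis unfolding qc_def[symmetric] by blast
qed

lemma coefficients_scheme_step:
  assumes \<tau>: "\<tau> > 0" and u: "c1_field u" "divfree (cof u)" and v: "c1_field v" "divfree (cof v)"
    and eq: "step_eq \<tau> (\<tau> * \<nu>) (divc (\<lambda>m. cx (\<lambda>x. u x $ m)) (\<lambda>i. cx (\<lambda>x. v x $ i))) (cof u) (cof v)"
  shows "ddiv (distr_field_of v) \<simeq>\<^sub>D zero_distr"
    and "\<exists>w. is_leray_projection (distr_field_of (advect u v)) w \<and>
      (\<forall>i. (\<lambda>f. ((distr_field_of v $ i) f - (distr_field_of u $ i) f) / \<tau> + (w $ i) f) \<simeq>\<^sub>D (\<lambda>f. \<nu> * dlaplacian (distr_field_of v $ i) f))"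
proof -
  show "ddiv (distr_field_of v) \<simeq>\<^sub>D zero_distr"
  proof (rule distr_eqI[OF ddiv_mem distr_zero_mem])
    show "distr_field_of v $ i \<in> periodic_distr" for i by (rule field_mem[OF v(1)])
    show "fourier (ddiv (distr_field_of v)) k = fourier zero_distr k" for k
      using v(2) by (simp add: fourier_ddiv field_mem v(1) fourier_field fourier_zero divfree_def)
  qed
  let ?N = "divc (\<lambda>m. cx (\<lambda>x. u x $ m)) (\<lambda>i. cx (\<lambda>x. v x $ i))"
  let ?G = "distr_field_of (advect u v)"
  have fa: "fourier (?G $ i) = ?N i" for i
    by (rule ext) (simp add: distr_field_of_def fourier_distr_of cper_advect u v cof_advect[OF u v(1)])
  have ma: "?G $ i \<in> periodic_distr" for i
    by (simp add: distr_field_of_def distr_of_mem cper_advect u v)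
  have fcN: "fc (cx (\<lambda>x. advect u v x $ i)) k = ?N i k" for i k by (rule cof_advect[OF u v(1)])
  obtain q where q: "q \<in> periodic_distr" "\<And>k. fourier q k = - \<i> * (\<Sum>l\<in>UNIV. of_real (of_int (k $ l) / (norm (freq k))\<^sup>2) * ?N l k)"
    using pressure_exists[of "\<lambda>i x. advect u v x $ i"] cper_advect[OF u(1) v(1)] unfolding fcN by blast
  define w :: "distr^2" where "w = (\<chi> i. (\<lambda>f. 1 * (?G $ i) f + (- 1) * dpd i q f))"
  have mw: "w $ i \<in> periodic_distr" for i
    unfolding w_def vec_lambda_beta by (intro distr_lincomb_mem distr_dpd_mem ma q(1))
  have "dlaplacian q \<simeq>\<^sub>D ddiv ?G"
  proof (rule distr_eqI[OF dlaplacian_mem[OF q(1)] ddiv_mem[OF ma]])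
    fix k show "fourier (dlaplacian q) k = fourier (ddiv ?G) k"
    proof (cases "k = 0")
      case False
      then have n: "complex_of_real ((norm (freq k))\<^sup>2) \<noteq> 0" by simp
      have "(\<Sum>l\<in>UNIV. of_real (of_int (k $ l) / (norm (freq k))\<^sup>2) * ?N l k) = (\<Sum>l\<in>UNIV. of_int (k $ l) * ?N l k) / of_real ((norm (freq k))\<^sup>2)"
        by (simp add: sum_divide_distrib)
      then show ?thesis
        using n by (simp add: fourier_dlaplacian[OF q(1)] fourier_ddiv[OF ma] q(2) fa field_simps del: of_real_power)
    qed (simp add: fourier_dlaplacian[OF q(1)] fourier_ddiv[OF ma])
  qed
  then have lp: "is_leray_projection ?G w"
    unfolding is_leray_projection_def using q(1) by (intro bexI[of _ q]) (auto simp: w_def distr_eq_def)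
  have W: "fourier (w $ i) k = leray ?N i k" for i k
    using fourier_leray_projection[OF lp ma, of i k] by (simp only: fa)
  have "(\<lambda>f. ((distr_field_of v $ i) f - (distr_field_of u $ i) f) / \<tau> + (w $ i) f) \<simeq>\<^sub>D (\<lambda>f. \<nu> * dlaplacian (distr_field_of v $ i) f)" for i
  proof -
    let ?V = "distr_field_of v $ i" and ?U = "distr_field_of u $ i"
    have L: "(\<lambda>f. (?V f - ?U f) / \<tau> + (w $ i) f) = (\<lambda>f. (1 / \<tau>) * ?V f + 1 * ((\<lambda>f. (- 1 / \<tau>) * ?U f + 1 * (w $ i) f) f))"
      by (rule ext) (simp add: diff_divide_distrib)
    have R: "(\<lambda>f. \<nu> * dlaplacian ?V f) = (\<lambda>f. \<nu> * dlaplacian ?V f + 0 * dlaplacian ?V f)" by simp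
    show ?thesis unfolding L R
    proof (rule distr_eqI)
      show "(\<lambda>f. (1 / \<tau>) * ?V f + 1 * ((\<lambda>f. (- 1 / \<tau>) * ?U f + 1 * (w $ i) f) f)) \<in> periodic_distr"
        by (intro distr_lincomb_mem field_mem u v mw)
      show "(\<lambda>f. \<nu> * dlaplacian ?V f + 0 * dlaplacian ?V f) \<in> periodic_distr"
        by (intro distr_lincomb_mem dlaplacian_mem field_mem v)
      fix k
      have "of_real (1 + \<tau> * \<nu> * (norm (freq k))\<^sup>2) * cof v i k + of_real \<tau> * leray ?N i k = cof u i k"
        using eq by (simp only: step_eq_def)
      then have "of_real (1/\<tau>) * cof v i k + (of_real (- 1 / \<tau>) * cof u i k + leray ?N i k) = of_real \<nu> * (- of_real ((norm (freq k))\<^sup>2) * cof v i k)"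
        using \<tau> by (simp add: field_simps)
      then show "fourier (\<lambda>f. (1 / \<tau>) * ?V f + 1 * ((\<lambda>f. (- 1 / \<tau>) * ?U f + 1 * (w $ i) f) f)) k = fourier (\<lambda>f. \<nu> * dlaplacian ?V f + 0 * dlaplacian ?V f) k"
        unfolding fourier_lincomb by (simp only: fourier_field u v W of_real_1 mult_1 fourier_dlaplacian field_mem of_real_0 mult_zero_left add_0_right)
    qed
  qed
  then show "\<exists>w. is_leray_projection ?G w \<and>
      (\<forall>i. (\<lambda>f. ((distr_field_of v $ i) f - (distr_field_of u $ i) f) / \<tau> + (w $ i) f) \<simeq>\<^sub>D (\<lambda>f. \<nu> * dlaplacian (distr_field_of v $ i) f))"
    using lp by blast
qed

subsection \<open>Fields with prescribed coefficients\<close>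

definition vfld :: "(2 \<Rightarrow> int^2 \<Rightarrow> complex) \<Rightarrow> real^2 \<Rightarrow> real^2" where
  "vfld w x = (\<chi> i. Re (fld (w i) x))"

text \<open>
  Total differentiability, from the uniform convergence of the differentials of the partial sums.
\<close>

lemma fld_has_derivative:
  assumes s: "summable (\<lambda>j. 2 ^ j * nb h j c)"
  shows "(fld c has_derivative (\<lambda>u. \<Sum>l\<in>UNIV. (u $ l) *\<^sub>R dfld l c x)) (at x)"
proof -
  have "\<exists>g. \<forall>x\<in>UNIV. (\<lambda>J. \<Sum>j\<le>J. blk h j c x) \<longlonglongrightarrow> g x \<and> (g has_derivative (\<lambda>u. \<Sum>l\<in>UNIV. (u $ l) *\<^sub>R dfld l c x)) (at x within UNIV)"
  proof (rule has_derivative_sequence[where f' = "\<lambda>J x u. \<Sum>l\<in>UNIV. (u $ l) *\<^sub>R (\<Sum>j\<le>J. dblk l j c x)"])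
    show "convex (UNIV :: (real^2) set)" by simp
    fix J and x :: "real^2"
    have "((\<lambda>x. \<Sum>j\<le>J. blk h j c x) has_derivative (\<lambda>u. \<Sum>j\<le>J. \<Sum>l\<in>UNIV. (u $ l) *\<^sub>R dblk l j c x)) (at x)"
      unfolding blk_def dblk_def by (intro has_derivative_sum ker_has_derivative) simp
    then show "((\<lambda>x. \<Sum>j\<le>J. blk h j c x) has_derivative (\<lambda>u. \<Sum>l\<in>UNIV. (u $ l) *\<^sub>R (\<Sum>j\<le>J. dblk l j c x))) (at x within UNIV)"
      by (simp add: scaleR_sum_right) (subst sum.swap, simp)
  next
    fix e :: real assume e: "e > 0"
    have "\<exists>N. \<forall>n\<ge>N. \<forall>x. norm ((\<Sum>j\<le>n. dblk l j c x) - dfld l c x) \<le> e / 2" for l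
      using ulimD[OF ulim_dfld[OF s, of l], of "e / 2"] e by simp
    then obtain N where N: "\<And>l n x. n \<ge> N l \<Longrightarrow> norm ((\<Sum>j\<le>n. dblk l j c x) - dfld l c x) \<le> e / 2" by metis
    have "norm ((\<Sum>l\<in>UNIV. (u $ l) *\<^sub>R (\<Sum>j\<le>n. dblk l j c x)) - (\<Sum>l\<in>UNIV. (u $ l) *\<^sub>R dfld l c x)) \<le> e * norm u"
      if n: "n \<ge> max (N 1) (N 2)" for n x and u :: "real^2"
    proof -
      have "(\<Sum>l\<in>UNIV. (u $ l) *\<^sub>R (\<Sum>j\<le>n. dblk l j c x)) - (\<Sum>l\<in>UNIV. (u $ l) *\<^sub>R dfld l c x) = (\<Sum>l\<in>UNIV. (u $ l) *\<^sub>R ((\<Sum>j\<le>n. dblk l j c x) - dfld l c x))"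
        by (simp only: scaleR_diff_right sum_subtractf)
      also have "norm \<dots> \<le> (\<Sum>l\<in>(UNIV :: 2 set). norm u * (e / 2))"
      proof (rule sum_norm_le)
        fix l :: 2
        have "n \<ge> N l" using n exhaust_2[of l] by auto
        then show "norm ((u $ l) *\<^sub>R ((\<Sum>j\<le>n. dblk l j c x) - dfld l c x)) \<le> norm u * (e / 2)"
          unfolding norm_scaleR by (intro mult_mono N) (auto simp: component_le_norm_cart)
      qed
      finally show ?thesis by (simp add: UNIV_2 mult.commute)
    qed
    then show "\<forall>\<^sub>F n in sequentially. \<forall>x\<in>UNIV. \<forall>u. norm ((\<Sum>l\<in>UNIV. (u $ l) *\<^sub>R (\<Sum>j\<le>n. dblk l j c x)) - (\<Sum>l\<in>UNIV. (u $ l) *\<^sub>R dfld l c x)) \<le> e * norm u"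
      unfolding eventually_sequentially by blast
  next
    show "(\<lambda>J. \<Sum>j\<le>J. blk h j c 0) \<longlonglongrightarrow> fld c 0" by (rule ulim_pointwise[OF ulim_fld[OF summable_nb_if_C1[OF s]]])
  qed simp
  then obtain g where g: "\<And>x. (\<lambda>J. \<Sum>j\<le>J. blk h j c x) \<longlonglongrightarrow> g x" "\<And>x. (g has_derivative (\<lambda>u. \<Sum>l\<in>UNIV. (u $ l) *\<^sub>R dfld l c x)) (at x)" by auto
  have "g = fld c" using LIMSEQ_unique[OF g(1) ulim_pointwise[OF ulim_fld[OF summable_nb_if_C1[OF s]]]] by auto
  then show ?thesis using g(2) by simp
qed

lemma vfld:
  assumes w: "rsymm w" and s: "\<And>i. summable (\<lambda>j. 2 ^ j * nb h j (w i))"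
  shows cx_vfld: "cx (\<lambda>x. vfld w x $ i) = fld (w i)" and cof_vfld: "cof (vfld w) i = w i" and c1_vfld: "c1_field (vfld w)"
proof -
  note s0 = summable_nb_if_C1[OF s]
  show *: "cx (\<lambda>x. vfld w x $ i) = fld (w i)" for i
    using fld_real[OF s0, of i] w by (auto simp: vfld_def rsymm_def complex_eq_iff)
  show "cof (vfld w) i = w i" unfolding * by (rule ext) (rule fc_fld[OF s0])
  have "periodic (vfld w)" using cper_fld[OF s0] by (simp add: cper_def periodic_def vfld_def vec_eq_iff)
  moreover have "vfld w differentiable (at x)" for x
  proof -
    have "((\<lambda>x. Re (fld (w i) x)) has_derivative (\<lambda>u. Re (\<Sum>l\<in>UNIV. (u $ l) *\<^sub>R dfld l (w i) x))) (at x)" for i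
      by (rule bounded_linear.has_derivative[OF bounded_linear_Re fld_has_derivative[OF s]])
    then have "((\<lambda>x. \<chi> i. Re (fld (w i) x)) has_derivative (\<lambda>u. \<chi> i. Re (\<Sum>l\<in>UNIV. (u $ l) *\<^sub>R dfld l (w i) x))) (at x)"
      by (subst has_derivative_componentwise_within) (auto simp: Basis_vec_def inner_axis)
    then show ?thesis unfolding vfld_def[abs_def] by (rule differentiableI)
  qed
  moreover have "pd j (\<lambda>x. vfld w x $ i) = (\<lambda>x. Re (dfld j (w i) x))" for i j
  proof (rule pd_eqI)
    fix x
    from bounded_linear.has_vector_derivative[OF bounded_linear_Re pder_fld[OF s[of i], of j, unfolded pder_def, rule_format, of x]]
    show "((\<lambda>t. vfld w (x + t *\<^sub>R axis j 1) $ i) has_real_derivative Re (dfld j (w i) x)) (at 0)"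
      by (simp add: vfld_def has_real_derivative_iff_has_vector_derivative)
  qed
  moreover have "continuous_on UNIV (\<lambda>x. Re (dfld j (w i) x))" for i j
    using cper_Re[OF cper_dfld[OF s]] by (simp add: cper_def)
  ultimately show "c1_field (vfld w)" by (simp add: c1_field_def differentiable_on_def)
qed

end

subsection \<open>Uniqueness of a step among continuously differentiable fields\<close>

text \<open>
  The energy estimate for the difference of two solutions. The identity is tested at each frequency and summed with the Fejer
  weights, so it holds for fields that are merely continuously differentiable, and the transport term drops out in the limit.
\<close>

lemma step_unique:
  assumes \<tau>: "\<tau> > 0" and \<mu>: "\<mu> \<ge> 0" and u: "c1_field u" "divfree (cof u)"
    and v: "c1_field v" "divfree (cof v)" "step_eq \<tau> \<mu> (divc (\<lambda>m. cx (\<lambda>x. u x $ m)) (\<lambda>i. cx (\<lambda>x. v x $ i))) (cof u) (cof v)"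
    and v': "c1_field v'" "divfree (cof v')" "step_eq \<tau> \<mu> (divc (\<lambda>m. cx (\<lambda>x. u x $ m)) (\<lambda>i. cx (\<lambda>x. v' x $ i))) (cof u) (cof v')"
  shows "v = v'"
proof -
  define d where "d i x = cx (\<lambda>x. v x $ i) x - cx (\<lambda>x. v' x $ i) x" for i x
  define d' where "d' l i x = cx (pd l (\<lambda>x. v x $ i)) x - cx (pd l (\<lambda>x. v' x $ i)) x" for l i x
  define G where "G i x = (\<Sum>l\<in>UNIV. cx (\<lambda>x. u x $ l) x * d' l i x)" for i x
  let ?N = "\<lambda>v. divc (\<lambda>m. cx (\<lambda>x. u x $ m)) (\<lambda>i. cx (\<lambda>x. v x $ i))"
  have cd: "cper (d i)" "cper (d' l i)" "pder l (d i) (d' l i)" for l i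
    unfolding d_def[abs_def] d'_def[abs_def]
    by (intro cper_diff pder_diff cper_of_real c1_cper c1_cper_pd c1_pder v v')+
  have cG: "cper (G i)" for i
    unfolding G_def[abs_def] by (intro cper_sum cper_mult cper_of_real c1_cper u cd)
  have fd: "fc (d i) k = cof v i k - cof v' i k" for i k
    unfolding d_def[abs_def] by (intro fc_diff cper_of_real c1_cper v v')
  have fG: "fc (G i) k = ?N v i k - ?N v' i k" for i k
  proof -
    have "G i = (\<lambda>x. cx (\<lambda>x. advect u v x $ i) x - cx (\<lambda>x. advect u v' x $ i) x)"
      by (rule ext) (simp add: advect_def G_def d'_def UNIV_2 algebra_simps)
    then have "fc (G i) k = fc (\<lambda>x. cx (\<lambda>x. advect u v x $ i) x - cx (\<lambda>x. advect u v' x $ i) x) k" by simp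
    also have "\<dots> = cof (advect u v) i k - cof (advect u v') i k"
      by (intro fc_diff cper_of_real cper_advect u v v')
    finally have "fc (G i) k = cof (advect u v) i k - cof (advect u v') i k" .
    then show ?thesis by (simp only: cof_advect[OF u v(1)] cof_advect[OF u v'(1)])
  qed
  have dd: "divfree (\<lambda>i. fc (d i))"
    using v(2) v'(2) unfolding divfree_def by (simp add: fd right_diff_distrib sum_subtractf)
  \<comment> \<open>The equation of the difference, tested with the difference itself; the viscous term has a sign.\<close>
  have le: "Re (\<Sum>i\<in>UNIV. fc (d i) k * cnj (fc (d i) k)) + \<tau> * Re (\<Sum>i\<in>UNIV. fc (G i) k * cnj (fc (d i) k)) \<le> 0" for k
  proof -
    have lG: "leray (\<lambda>i. fc (G i)) i k = leray (?N v) i k - leray (?N v') i k" for i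
      by (simp add: leray_def fG UNIV_2 algebra_simps)
    have "of_real (1 + \<mu> * (norm (freq k))\<^sup>2) * fc (d i) k + of_real \<tau> * leray (\<lambda>i. fc (G i)) i k
      = (of_real (1 + \<mu> * (norm (freq k))\<^sup>2) * cof v i k + of_real \<tau> * leray (?N v) i k) - (of_real (1 + \<mu> * (norm (freq k))\<^sup>2) * cof v' i k + of_real \<tau> * leray (?N v') i k)" for i
      unfolding lG fd by (simp only: right_diff_distrib) (simp only: algebra_simps)
    also have "\<dots> i = cof u i k - cof u i k" for i
      using v(3) v'(3) by (simp only: step_eq_def)
    finally have "of_real (1 + \<mu> * (norm (freq k))\<^sup>2) * fc (d i) k + of_real \<tau> * leray (\<lambda>i. fc (G i)) i k = 0" for i by simp
    then have "(\<Sum>i\<in>UNIV. (of_real (1 + \<mu> * (norm (freq k))\<^sup>2) * fc (d i) k + of_real \<tau> * leray (\<lambda>i. fc (G i)) i k) * cnj (fc (d i) k)) = 0"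
      by (simp only: mult_zero_left sum.neutral_const)
    then have "of_real (1 + \<mu> * (norm (freq k))\<^sup>2) * (\<Sum>i\<in>UNIV. fc (d i) k * cnj (fc (d i) k)) + of_real \<tau> * (\<Sum>i\<in>UNIV. leray (\<lambda>i. fc (G i)) i k * cnj (fc (d i) k)) = 0"
      by (simp only: distrib_right sum.distrib sum_distrib_left mult.assoc)
    then have "of_real (1 + \<mu> * (norm (freq k))\<^sup>2) * (\<Sum>i\<in>UNIV. fc (d i) k * cnj (fc (d i) k)) + of_real \<tau> * (\<Sum>i\<in>UNIV. fc (G i) k * cnj (fc (d i) k)) = 0"
      by (simp only: leray_dot[OF dd])
    from arg_cong[OF this, of Re]
    have "(1 + \<mu> * (norm (freq k))\<^sup>2) * Re (\<Sum>i\<in>UNIV. fc (d i) k * cnj (fc (d i) k)) + \<tau> * Re (\<Sum>i\<in>UNIV. fc (G i) k * cnj (fc (d i) k)) = 0"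
      by (simp only: plus_complex.simps Re_complex_of_real times_complex.simps Im_complex_of_real mult_zero_left diff_zero zero_complex.simps)
    moreover have "0 \<le> Re (\<Sum>i\<in>UNIV. fc (d i) k * cnj (fc (d i) k))"
      by (simp only: complex_norm_square[symmetric] Re_sum) (intro sum_nonneg, simp)
    then have "0 \<le> (\<mu> * (norm (freq k))\<^sup>2) * Re (\<Sum>i\<in>UNIV. fc (d i) k * cnj (fc (d i) k))" using \<mu> by simp
    ultimately show ?thesis by (simp add: distrib_right)
  qed
  let ?M = "\<lambda>f g. mean (\<lambda>x. f x * cnj (g x))"
  let ?S = "\<lambda>n f g. \<Sum>k\<in>sq_diffs n. of_real (fejer_weight n k) * (fc f k * cnj (fc g k))"
  have lim: "(\<lambda>n. Re (\<Sum>i\<in>UNIV. ?S n (d i) (d i)) + \<tau> * Re (\<Sum>i\<in>UNIV. ?S n (G i) (d i))) \<longlonglongrightarrow>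
     Re (\<Sum>i\<in>UNIV. ?M (d i) (d i)) + \<tau> * Re (\<Sum>i\<in>UNIV. ?M (G i) (d i))"
    by (intro tendsto_intros fejer_mean_limit cd cG)
  have le0: "Re (\<Sum>i\<in>UNIV. ?S n (d i) (d i)) + \<tau> * Re (\<Sum>i\<in>UNIV. ?S n (G i) (d i)) \<le> 0" for n
  proof -
    have "Re (\<Sum>i\<in>UNIV. ?S n (d i) (d i)) + \<tau> * Re (\<Sum>i\<in>UNIV. ?S n (G i) (d i)) =
      (\<Sum>k\<in>sq_diffs n. fejer_weight n k * (Re (\<Sum>i\<in>UNIV. fc (d i) k * cnj (fc (d i) k)) + \<tau> * Re (\<Sum>i\<in>UNIV. fc (G i) k * cnj (fc (d i) k))))"
      by (simp add: UNIV_2 sum_distrib_left sum.distrib[symmetric] algebra_simps)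
    also have "\<dots> \<le> 0" by (intro sum_nonpos mult_nonneg_nonpos le fejer_weight_nonneg)
    finally show ?thesis .
  qed
  have "Re (\<Sum>i\<in>UNIV. ?M (d i) (d i)) + \<tau> * Re (\<Sum>i\<in>UNIV. ?M (G i) (d i)) \<le> 0"
    by (rule LIMSEQ_le_const2[OF lim]) (use le0 in blast)
  moreover have "Re (?M (G i) (d i)) = 0" for i
    unfolding G_def
    by (rule transport_skew[where A' = "\<lambda>i l. cx (pd i (\<lambda>x. u x $ l))"])
      (simp_all add: cper_of_real c1_cper c1_cper_pd c1_pder u cd divfree_pointwise[OF u, simplified])
  moreover have M: "?M (d i) (d i) = mean (\<lambda>x. of_real ((norm (d i x))\<^sup>2))" for i
    by (simp only: complex_norm_square)
  moreover have nn: "0 \<le> Re (?M (d i) (d i))" for i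
  proof -
    have "cper (\<lambda>x. (norm (d i x))\<^sup>2)" unfolding power2_eq_square by (intro cper_mult cper_norm cd)
    then show ?thesis unfolding M by (rule Re_mean_nonneg) simp
  qed
  ultimately have "(\<Sum>i\<in>UNIV. Re (?M (d i) (d i))) \<le> 0" by simp
  then have "Re (?M (d i) (d i)) = 0" for i
    using nn sum_nonneg_eq_0_iff[of "UNIV :: 2 set" "\<lambda>i. Re (?M (d i) (d i))"] by (simp add: order_antisym sum_nonneg)
  moreover have "Im (?M (d i) (d i)) = 0" for i unfolding M mean_of_real by simp
  ultimately have "?M (d i) (d i) = 0" for i by (simp add: complex_eq_iff)
  then have "d i x = 0" for i x by (rule mean_norm_sq_eq_0[OF cd(1)])
  then have "v x $ i = v' x $ i" for x i by (simp add: d_def of_real_diff[symmetric] del: of_real_diff)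
  then show ?thesis by (auto simp: vec_eq_iff)
qed

section \<open>Besov norms of distributions and of coefficient families\<close>

text \<open>
  A continuous function that is bounded almost everywhere is bounded everywhere: its excess over the bound has mean square
  zero, and a continuous function with that property vanishes.
\<close>

lemma esssup_torus:
  assumes f: "cper f" shows "esssup torus (\<lambda>x. ennreal (norm (f x))) = ennreal (snorm f)"
proof (rule antisym)
  have m: "(\<lambda>x. ennreal (norm (f x))) \<in> borel_measurable torus"
    by (intro measurable_compose[OF _ measurable_ennreal] borel_measurable_integrable integrable_torus cper_norm f)
  show "esssup torus (\<lambda>x. ennreal (norm (f x))) \<le> ennreal (snorm f)"
    by (rule esssup_I[OF m]) (intro always_eventually allI ennreal_leI le_snorm f)
  show "ennreal (snorm f) \<le> esssup torus (\<lambda>x. ennreal (norm (f x)))"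
  proof (cases "esssup torus (\<lambda>x. ennreal (norm (f x)))")
    case (real e)
    define g where "g x = max (norm (f x) - e) 0" for x
    have cg: "cper g" unfolding g_def[abs_def]
      by (rule cper_comp1[OF _ f]) (intro continuous_intros)
    have "AE x in torus. ennreal (norm (f x)) \<le> ennreal e"
      using esssup_AE[of "\<lambda>x. ennreal (norm (f x))" torus] by (simp only: real)
    then have "AE x in torus. g x * g x = 0"
      by (rule AE_mp) (auto simp: g_def real(1))
    then have "(LINT x|torus. g x * g x) = 0" by (rule integral_eq_zero_AE)
    then have "mean (\<lambda>x. cx g x * cnj (cx g x)) = 0"
      using mean_of_real[of "\<lambda>x. g x * g x"] by (simp only: complex_cnj_complex_of_real of_real_mult[symmetric]) simp
    then have g0: "cx g x = 0" for x by (rule mean_norm_sq_eq_0[OF cper_of_real[OF cg]])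
    have "norm (f x) \<le> e" for x using g0[of x] by (simp add: g_def max_def split: if_splits)
    then have "snorm f \<le> e" by (rule snorm_le)
    then show ?thesis using real by (simp add: ennreal_leI)
  qed simp
qed

lemma epow_mono: "x \<le> y \<Longrightarrow> a > 0 \<Longrightarrow> epow x a \<le> epow y a"
  by (auto simp: epow_def top_unique less_top intro!: ennreal_leI powr_mono2 enn2real_mono)

lemma epow_ennreal: "x \<ge> 0 \<Longrightarrow> epow (ennreal x) a = ennreal (x powr a)"
  by (simp add: epow_def)

lemma epow_power: "x \<ge> 0 \<Longrightarrow> r > 0 \<Longrightarrow> epow (ennreal x) (real r) = ennreal (x ^ r)"
  by (simp add: epow_ennreal powr_realpow')

lemma epow_root: "x \<ge> 0 \<Longrightarrow> r > 0 \<Longrightarrow> epow (ennreal x) (1 / real r) = ennreal (root r x)"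
  by (simp add: epow_ennreal root_powr_inverse)

lemma lr_norm_eq:
  assumes "r > 0" "\<And>j. 0 \<le> x j"
  shows "lr_norm (of_nat r) (\<lambda>j. ennreal (x j)) = epow (\<Sum>j. ennreal (x j ^ r)) (1 / real r)"
  using assms by (simp add: lr_norm_def epow_power)

lemma lN_le_lr_norm:
  assumes r: "r > 0" and x: "\<And>j. 0 \<le> x j"
  shows "ennreal (lN r J x) \<le> lr_norm (of_nat r) (\<lambda>j. ennreal (x j))"
proof -
  have "ennreal (lN r J x) = epow (\<Sum>j<J. ennreal (x j ^ r)) (1 / real r)"
    using x by (simp add: lN_def epow_root[OF _ r] sum_nonneg sum_ennreal)
  also have "\<dots> \<le> epow (\<Sum>j. ennreal (x j ^ r)) (1 / real r)"
    using r by (intro epow_mono sum_le_suminf) auto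
  finally show ?thesis by (simp add: lr_norm_eq r x)
qed

lemma lr_norm_le:
  assumes r: "r > 0" and x: "\<And>j. 0 \<le> x j" and L: "\<And>J. lN r J x \<le> L"
  shows "lr_norm (of_nat r) (\<lambda>j. ennreal (x j)) \<le> ennreal L"
proof -
  have L0: "0 \<le> L" by (rule order_trans[OF lN_nonneg L]) (use r x in auto)
  have "(\<Sum>j<J. ennreal (x j ^ r)) \<le> ennreal (L ^ r)" for J
  proof -
    have "(\<Sum>j<J. x j ^ r) = lN r J x ^ r"
      unfolding lN_def using r x by (simp add: sum_nonneg)
    also have "\<dots> \<le> L ^ r" by (intro power_mono L lN_nonneg r x)
    finally show ?thesis using x by (simp add: sum_ennreal ennreal_leI)
  qed
  then have "(\<Sum>j. ennreal (x j ^ r)) \<le> ennreal (L ^ r)" by (intro suminf_le_const) auto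
  then have "epow (\<Sum>j. ennreal (x j ^ r)) (1 / real r) \<le> epow (ennreal (L ^ r)) (1 / real r)" using r by (intro epow_mono) auto
  also have "\<dots> = ennreal L" using r L0 by (simp add: epow_root real_root_power_cancel)
  finally show ?thesis by (simp add: lr_norm_eq r x)
qed

context lp_cutoff
begin

lemma lp_block_eq: "lp_block h j F = blk h j (fourier F)"
proof
  fix x
  let ?K = "{k. msym h j k * fourier F k \<noteq> 0}"
  have fin: "finite ?K" by (rule fsupp_mult_right) simp
  have blk: "blk h j (fourier F) x = (\<Sum>k\<in>?K. msym h j k * fourier F k * ek k x)"
    by (simp add: blk_def ker_def)
  show "lp_block h j F x = blk h j (fourier F) x"
  proof (cases "j = 0")
    case True
    have "(\<Sum>k\<in>?K. msym h j k * fourier F k * ek k x) = (\<Sum>k\<in>{0}. msym h j k * fourier F k * ek k x)"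
      by (rule sum.mono_neutral_cong_left) (auto simp: True msym_def)
    then show ?thesis unfolding blk by (simp add: True lp_block_def msym_def)
  next
    case False
    have "lp_block h j F x = (\<Sum>\<^sub>\<infinity>k. msym h j k * fourier F k * ek k x)"
      using False by (simp add: lp_block_def msym_def ek_def mult_ac)
    also have "\<dots> = (\<Sum>\<^sub>\<infinity>k\<in>?K. msym h j k * fourier F k * ek k x)"
      by (rule infsum_cong_neutral) auto
    also have "\<dots> = (\<Sum>k\<in>?K. msym h j k * fourier F k * ek k x)" by (rule infsum_finite[OF fin])
    finally show ?thesis using blk by simp
  qed
qed

lemma besov_norm1_eq: "besov_norm1 h s \<infinity> r F = lr_norm r (\<lambda>j. ennreal (wseq s (fourier F) j))"
  unfolding besov_norm1_def Lp_norm_def lp_block_eq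
  by (simp add: esssup_torus[OF cper_blk] wseq_def nb_def ennreal_mult snorm_nonneg[OF cper_blk])

lemma besov_norm_imp_bes:
  assumes a: "adm r s" and f: "besov_norm h s \<infinity> (of_nat r) F < \<infinity>"
  shows "bes r s (\<lambda>i. fourier (F $ i)) (enn2real (besov_norm h s \<infinity> (of_nat r) F))"
  unfolding bes_def
proof
  fix J
  have "ennreal (\<Sum>i\<in>UNIV. lN r J (wseq s (fourier (F $ i)))) = (\<Sum>i\<in>UNIV. ennreal (lN r J (wseq s (fourier (F $ i)))))"
    by (rule sum_ennreal[symmetric]) (rule lN_nonneg[OF adm_pos(1)[OF a] wseq_nonneg])
  also have "\<dots> \<le> besov_norm h s \<infinity> (of_nat r) F"
    unfolding besov_norm_def besov_norm1_eq by (intro sum_mono lN_le_lr_norm adm_pos(1)[OF a] wseq_nonneg)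
  finally have "enn2real (ennreal (\<Sum>i\<in>UNIV. lN r J (wseq s (fourier (F $ i))))) \<le> enn2real (besov_norm h s \<infinity> (of_nat r) F)"
    using f by (intro enn2real_mono) auto
  then show "(\<Sum>i\<in>UNIV. lN r J (wseq s (fourier (F $ i)))) \<le> enn2real (besov_norm h s \<infinity> (of_nat r) F)"
    by (simp add: sum_nonneg lN_nonneg adm_pos(1)[OF a] wseq_nonneg)
qed

text \<open>
  The truncated norms of the two components increase in \<open>J\<close>, so the bound for their sum passes to the limit.
\<close>

lemma bes_imp_besov_norm_le:
  assumes a: "adm r s" and b: "bes r s (\<lambda>i. fourier (F $ i)) M"
  shows "besov_norm h s \<infinity> (of_nat r) F \<le> ennreal M"
proof -
  let ?l = "\<lambda>i J. lN r J (wseq s (fourier (F $ i)))"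
  note r = adm_pos(1)[OF a]
  have inc: "incseq (?l i)" for i unfolding incseq_def by (intro allI impI lN_J_mono[OF r wseq_nonneg])
  have "?l i J \<le> M" for i J
  proof -
    have "?l i J \<le> (\<Sum>i\<in>UNIV. ?l i J)" by (rule member_le_sum) (auto intro: lN_nonneg[OF r wseq_nonneg])
    then show ?thesis using b unfolding bes_def by (meson order_trans)
  qed
  then have "\<exists>L. ?l i \<longlonglongrightarrow> L" for i using incseq_convergent[of "?l i" M, OF inc] by blast
  then obtain L where L: "\<And>i. ?l i \<longlonglongrightarrow> L i" by metis
  have le: "?l i J \<le> L i" for i J by (rule incseq_le[OF inc L])
  have L0: "0 \<le> L i" for i by (rule order_trans[OF lN_nonneg[OF r wseq_nonneg] le])
  have "besov_norm h s \<infinity> (of_nat r) F \<le> (\<Sum>i\<in>UNIV. ennreal (L i))"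
    unfolding besov_norm_def besov_norm1_eq by (intro sum_mono lr_norm_le r wseq_nonneg le)
  also have "\<dots> = ennreal (\<Sum>i\<in>UNIV. L i)" by (rule sum_ennreal) (rule L0)
  also have "(\<Sum>i\<in>UNIV. L i) \<le> M"
  proof (rule LIMSEQ_le_const2)
    show "(\<lambda>J. \<Sum>i\<in>UNIV. ?l i J) \<longlonglongrightarrow> (\<Sum>i\<in>UNIV. L i)" by (intro tendsto_sum L)
    show "\<exists>N. \<forall>J\<ge>N. (\<Sum>i\<in>UNIV. ?l i J) \<le> M" using b by (auto simp: bes_def)
  qed
  finally show ?thesis by (simp add: ennreal_leI)
qed

section \<open>Iterating the step\<close>

lemma fourier_minus: "fourier F (- k) = cnj (fourier F k)" if "F \<in> periodic_distr"
proof -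
  have "cosk (- k) = cosk k" "sink (- k) = (\<lambda>x. (- 1) * sink k x)"
    by (auto simp: cosk_def sink_def freq_minus)
  then show ?thesis by (simp only: fourier_eq distr_cmult[OF that test_sink]) simp
qed

text \<open>
  Discrete Gronwall with the explicit supersolution \<open>Y n = X (1 + n/M)\<close>. It stays below \<open>2 X\<close>, so one step adds at
  most \<open>2 C \<tau> (2 X)\<^sup>2 = 8 C \<tau> X\<^sup>2 \<le> X / M\<close>.
\<close>

lemma gronwall_step:
  fixes C \<tau> X :: real and M n :: nat
  assumes C: "C \<ge> 1" and \<tau>: "\<tau> > 0" and X: "X \<ge> 0" and M: "M \<ge> 1" and small: "8 * C * (\<tau> * M) * X \<le> 1" and n: "n < M"
  defines "Y \<equiv> \<lambda>n. X + X * (real n / real M)"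
  shows "C * \<tau> * Y n \<le> 1 / 2" "Y n / (1 - C * \<tau> * Y n) \<le> Y (Suc n)"
proof -
  have nM: "real n / real M \<le> 1" "0 \<le> real n / real M" using n by auto
  have Y: "0 \<le> Y n" "Y n \<le> 2 * X"
    unfolding Y_def using X mult_left_mono[OF nM(1) X] nM(2) by (auto simp: mult_nonneg_nonneg)
  have "\<tau> * 1 \<le> \<tau> * real M" using M \<tau> by (intro mult_left_mono) auto
  then have "8 * C * X * \<tau> \<le> 8 * C * X * (\<tau> * M)" using C X by (intro mult_left_mono) auto
  then have t: "8 * C * X * \<tau> \<le> 1" using small by (simp add: mult_ac)
  define q where "q = C * \<tau> * Y n"
  have "q \<le> C * \<tau> * (2 * X)" unfolding q_def using C \<tau> Y by (intro mult_left_mono) auto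
  moreover have "C * \<tau> * (2 * X) = (8 * C * X * \<tau>) / 4" by simp
  ultimately have "q \<le> 1 / 4" using t by linarith
  moreover have "0 \<le> q" unfolding q_def using C \<tau> Y(1) by (intro mult_nonneg_nonneg) auto
  ultimately have q: "0 \<le> q" "q \<le> 1 / 4" by auto
  then show "C * \<tau> * Y n \<le> 1 / 2" by (simp add: q_def)
  have "1 / (1 - q) \<le> 1 + 2 * q"
  proof -
    have "0 \<le> q * (1 - 2 * q)" using q by (intro mult_nonneg_nonneg) auto
    then have "1 \<le> (1 + 2 * q) * (1 - q)" by (simp add: algebra_simps)
    then show ?thesis using q by (simp add: divide_le_eq)
  qed
  then have "Y n * (1 / (1 - q)) \<le> Y n * (1 + 2 * q)" by (intro mult_left_mono Y)
  moreover have "Y n * (2 * q) \<le> X / real M"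
  proof -
    have "Y n * (2 * q) = 2 * C * \<tau> * (Y n * Y n)" by (simp add: q_def mult_ac)
    also have "\<dots> \<le> 2 * C * \<tau> * ((2 * X) * (2 * X))"
      using C \<tau> Y X by (intro mult_left_mono mult_mono) auto
    also have "\<dots> = 8 * C * (\<tau> * M) * X * (X / real M)" using M by (simp add: field_simps)
    also have "\<dots> \<le> 1 * (X / real M)" using X by (intro mult_right_mono small) auto
    finally show ?thesis by simp
  qed
  moreover have "Y (Suc n) = Y n + X / real M" using M by (simp add: Y_def field_simps)
  ultimately show "Y n / (1 - C * \<tau> * Y n) \<le> Y (Suc n)" unfolding q_def[symmetric] by (simp add: algebra_simps)
qed

lemma bes_mono: "bes r s c A \<Longrightarrow> A \<le> B \<Longrightarrow> bes r s c B"
  unfolding bes_def by (meson order_trans)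

lemma c1_field_eqI:
  assumes u: "c1_field u" and v: "c1_field v" and eq: "\<And>i. cof u i = cof v i" shows "u = v"
proof -
  have "cx (\<lambda>x. u x $ i) x = cx (\<lambda>x. v x $ i) x" for i x
    by (rule fc_eqI[OF cper_of_real[OF c1_cper[OF u]] cper_of_real[OF c1_cper[OF v]]]) (simp only: eq)
  then show ?thesis by (auto simp: vec_eq_iff)
qed

text \<open>
  The time \<open>T0\<close> depends only on the initial norm and on the constant of the a priori estimate. The iterates are constructed
  as families of coefficients, which gives existence, and any solution of the scheme agrees with them by \<open>step_unique\<close>, which
  gives the bound for all solutions.
\<close>

lemma scheme_bound:
  assumes a: "adm r s" and u0: "u0 \<in> besov_space h s \<infinity> (of_nat r)" and div: "ddiv u0 \<simeq>\<^sub>D zero_distr"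
  shows "\<exists>T0>0. \<forall>T (M::nat) \<nu>. 0 < T \<longrightarrow> T \<le> T0 \<longrightarrow> M \<ge> 1 \<longrightarrow> \<nu> \<ge> 0 \<longrightarrow>
     (\<exists>u. semi_implicit_scheme u0 \<nu> (T / real M) M u) \<and>
     (\<forall>u. semi_implicit_scheme u0 \<nu> (T / real M) M u \<longrightarrow>
        (SUP n\<in>{0..M}. besov_norm h s \<infinity> (of_nat r) (distr_field_of (u n))) \<le> 8 * besov_norm h s \<infinity> (of_nat r) u0)"
proof -
  have mem: "u0 $ i \<in> periodic_distr" for i using u0 by (simp add: besov_space_def)
  have fin: "besov_norm h s \<infinity> (of_nat r) u0 < \<infinity>" using u0 by (simp add: besov_space_def)
  define X where "X = enn2real (besov_norm h s \<infinity> (of_nat r) u0)"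
  have X: "X \<ge> 0" "besov_norm h s \<infinity> (of_nat r) u0 = ennreal X" using fin by (auto simp: X_def)
  define b where "b i = fourier (u0 $ i)" for i
  have b: "rsymm b" "divfree b" "bes r s b X"
    using besov_norm_imp_bes[OF a fin] distr_eqD[OF div]
    by (auto simp: rsymm_def b_def[abs_def] fourier_minus mem divfree_def X_def fourier_ddiv[OF mem] fourier_zero)
  obtain C where C: "C \<ge> 1" and step: "\<And>b \<tau> \<mu> B. \<tau> \<ge> 0 \<Longrightarrow> \<mu> \<ge> 0 \<Longrightarrow> rsymm b \<Longrightarrow> divfree b \<Longrightarrow> bes r s b B \<Longrightarrow> C * \<tau> * B \<le> 1 / 2 \<Longrightarrow>
     (\<exists>v. rsymm v \<and> divfree v \<and> bes r s v (B / (1 - C * \<tau> * B)) \<and> step_eq \<tau> \<mu> (divc (\<lambda>m. fld (b m)) (\<lambda>i. fld (v i))) b v)"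
    using step_solution[OF a] by blast
  define T0 where "T0 = 1 / (8 * C * (X + 1))"
  have "0 < 8 * C * (X + 1)" using C X by (intro mult_pos_pos) auto
  then have T0: "T0 > 0" "T0 * (8 * C * (X + 1)) = 1" by (auto simp: T0_def)
  have "(\<exists>u. semi_implicit_scheme u0 \<nu> (T / real M) M u) \<and>
     (\<forall>u. semi_implicit_scheme u0 \<nu> (T / real M) M u \<longrightarrow>
        (SUP n\<in>{0..M}. besov_norm h s \<infinity> (of_nat r) (distr_field_of (u n))) \<le> 8 * besov_norm h s \<infinity> (of_nat r) u0)"
    if T: "0 < T" "T \<le> T0" and M: "M \<ge> 1" and \<nu>: "\<nu> \<ge> 0" for T \<nu> and M :: nat
  proof -
    define \<tau> where "\<tau> = T / real M"
    have \<tau>: "\<tau> > 0" "\<tau> * real M = T" using T M by (auto simp: \<tau>_def)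
    have "T * (8 * C * X) \<le> T0 * (8 * C * (X + 1))" using T C X T0 by (intro mult_mono) auto
    then have small: "8 * C * (\<tau> * real M) * X \<le> 1" using T0 by (simp add: \<tau> mult_ac)
    define Y where "Y n = X + X * (real n / real M)" for n
    note gr = gronwall_step[OF C \<tau>(1) X(1) M small, folded Y_def]
    have Y8: "Y n \<le> 8 * X" if "n \<le> M" for n
    proof -
      have "X * (real n / real M) \<le> X * 1" using that M X by (intro mult_left_mono) auto
      then show ?thesis using X by (simp add: Y_def)
    qed
    let ?P = "\<lambda>n c. (n \<le> M \<longrightarrow> rsymm c \<and> divfree c \<and> bes r s c (Y n)) \<and> (n = 0 \<longrightarrow> c = b)"
    let ?R = "\<lambda>c v. step_eq \<tau> (\<tau> * \<nu>) (divc (\<lambda>m. fld (c m)) (\<lambda>i. fld (v i))) c v"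
    have "\<exists>c. \<forall>n. ?P n (c n) \<and> (n < M \<longrightarrow> ?R (c n) (c (Suc n)))"
    proof (rule dependent_nat_choice)
      show "\<exists>c. ?P 0 c" using b by (auto simp: Y_def)
      fix c n assume P: "?P n c"
      show "\<exists>v. ?P (Suc n) v \<and> (n < M \<longrightarrow> ?R c v)"
      proof (cases "n < M")
        case True
        then have "rsymm c" "divfree c" "bes r s c (Y n)" using P by auto
        from step[OF _ _ this gr(1)[OF True], of "\<tau> * \<nu>"] \<tau>(1) \<nu> obtain v where
          "rsymm v" "divfree v" "bes r s v (Y n / (1 - C * \<tau> * Y n))" "?R c v" by auto
        then show ?thesis using bes_mono[OF _ gr(2)[OF True]] by blast
      qed auto
    qed
    then obtain c where c: "\<And>n. ?P n (c n) \<and> (n < M \<longrightarrow> ?R (c n) (c (Suc n)))" by blast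
    have cP: "rsymm (c n)" "divfree (c n)" "bes r s (c n) (Y n)" if "n \<le> M" for n using c[of n] that by auto
    have c0: "c 0 = b" and cR: "n < M \<Longrightarrow> ?R (c n) (c (Suc n))" for n using c by auto
    define U where "U n = vfld (c n)" for n
    have U: "c1_field (U n)" "cof (U n) = c n" "(\<lambda>i. cx (\<lambda>x. U n x $ i)) = (\<lambda>i. fld (c n i))" if "n \<le> M" for n
      using vfld[OF cP(1)[OF that] bes_summable_C1[OF a cP(3)[OF that]]] by (auto simp: U_def)
    have UR: "step_eq \<tau> (\<tau> * \<nu>) (divc (\<lambda>m. cx (\<lambda>x. U n x $ m)) (\<lambda>i. cx (\<lambda>x. U (Suc n) x $ i))) (cof (U n)) (cof (U (Suc n)))" if "n < M" for n
      using cR[OF that] U(2,3)[of n] U(2,3)[of "Suc n"] that by simp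
    have dU: "divfree (cof (U n))" if "n \<le> M" for n unfolding U(2)[OF that] by (rule cP(2)[OF that])
    have "semi_implicit_scheme u0 \<nu> \<tau> M U"
      unfolding semi_implicit_scheme_def
    proof (intro conjI allI impI)
      show "c1_field (U n)" if "n \<le> M" for n by (rule U(1)[OF that])
      show "distr_field_of (U 0) $ i \<simeq>\<^sub>D u0 $ i" for i
        by (rule distr_eqI[OF field_mem[OF U(1)] mem]) (simp_all add: fourier_field U(1) U(2)[of 0, THEN fun_cong] c0 b_def)
      fix n assume n: "n < M"
      note st = coefficients_scheme_step[OF \<tau>(1) U(1) dU U(1) dU UR[OF n]]
      show "ddiv (distr_field_of (U (Suc n))) \<simeq>\<^sub>D zero_distr" by (rule st(1)) (use n in auto)
      show "\<exists>w. is_leray_projection (distr_field_of (advect (U n) (U (Suc n)))) w \<and>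
           (\<forall>i. (\<lambda>f. ((distr_field_of (U (Suc n)) $ i) f - (distr_field_of (U n) $ i) f) / \<tau> + (w $ i) f)
                \<simeq>\<^sub>D (\<lambda>f. \<nu> * dlaplacian (distr_field_of (U (Suc n)) $ i) f))"
        by (rule st(2)) (use n in auto)
    qed
    moreover have "(SUP n\<in>{0..M}. besov_norm h s \<infinity> (of_nat r) (distr_field_of (u n))) \<le> 8 * besov_norm h s \<infinity> (of_nat r) u0"
      if u: "semi_implicit_scheme u0 \<nu> \<tau> M u" for u
    proof -
      have uU: "u n = U n" if "n \<le> M" for n
        using that
      proof (induction n)
        case 0
        have c1: "c1_field (u 0)" using u by (simp add: semi_implicit_scheme_def)
        have "cof (u 0) i = c 0 i" for i
        proof
          fix k
          have "distr_field_of (u 0) $ i \<simeq>\<^sub>D u0 $ i" using u by (simp add: semi_implicit_scheme_def)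
          from distr_eqD[OF this, of k] show "cof (u 0) i k = c 0 i k" by (simp add: fourier_field c1 c0 b_def)
        qed
        then show ?case using U(2)[of 0] by (intro c1_field_eqI c1 U(1)) (simp_all add: fun_eq_iff)
      next
        case (Suc n)
        then have n: "n < M" and un: "u n = U n" by auto
        have c1: "c1_field (u (Suc n))" using u Suc.prems by (simp add: semi_implicit_scheme_def)
        obtain w where w: "ddiv (distr_field_of (u (Suc n))) \<simeq>\<^sub>D zero_distr" "is_leray_projection (distr_field_of (advect (U n) (u (Suc n)))) w"
          "\<And>i. (\<lambda>f. ((distr_field_of (u (Suc n)) $ i) f - (distr_field_of (U n) $ i) f) / \<tau> + (w $ i) f)
                \<simeq>\<^sub>D (\<lambda>f. \<nu> * dlaplacian (distr_field_of (u (Suc n)) $ i) f)"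
          using u n unfolding semi_implicit_scheme_def un[symmetric] by blast
        have nM: "n \<le> M" using n by simp
        note sc = scheme_step_coefficients[OF \<tau>(1) U(1)[OF nM] dU[OF nM] c1 w]
        have "\<tau> * \<nu> \<ge> 0" using \<tau> \<nu> by simp
        from step_unique[OF \<tau>(1) this U(1)[OF nM] dU[OF nM] c1 sc U(1)[OF Suc.prems] dU[OF Suc.prems] UR[OF n]]
        show ?case .
      qed
      have "besov_norm h s \<infinity> (of_nat r) (distr_field_of (u n)) \<le> ennreal (8 * X)" if n: "n \<in> {0..M}" for n
      proof (rule bes_imp_besov_norm_le[OF a])
        have nM: "n \<le> M" using n by simp
        have "(\<lambda>i. fourier (distr_field_of (u n) $ i)) = c n"
          unfolding uU[OF nM] using fourier_field[OF U(1)[OF nM]] U(2)[OF nM] by (auto simp: fun_eq_iff)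
        then show "bes r s (\<lambda>i. fourier (distr_field_of (u n) $ i)) (8 * X)"
          using bes_mono[OF cP(3)[OF nM] Y8[OF nM]] by simp
      qed
      then show ?thesis unfolding X(2) using X(1) by (intro SUP_least) (simp add: ennreal_mult)
    qed
    ultimately show ?thesis unfolding \<tau>_def by blast
  qed
  then show ?thesis using T0(1) by blast
qed

end

theorem theorem1p1:
  fixes h :: "real \<Rightarrow> real" and s :: real and u0 :: "distr^2"
  assumes "cutoff h"
    and "\<forall>i. u0 $ i \<in> periodic_distr"
    and "ddiv u0 \<simeq>\<^sub>D zero_distr"
  shows "\<exists>T>0. \<forall>(M::nat) (\<nu>::real). M \<ge> 1 \<longrightarrow> \<nu> \<ge> 0 \<longrightarrow>
    (s \<ge> 1 \<and> u0 \<in> besov_space h s \<infinity> 1 \<longrightarrow>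
       (\<exists>u. semi_implicit_scheme u0 \<nu> (T / real M) M u) \<and>
       (\<forall>u. semi_implicit_scheme u0 \<nu> (T / real M) M u \<longrightarrow>
          (SUP n\<in>{0..M}. besov_norm h s \<infinity> 1 (distr_field_of (u n)))
            \<le> 8 * besov_norm h s \<infinity> 1 u0)) \<and>
    (s > 1 \<and> u0 \<in> besov_space h s \<infinity> 2 \<longrightarrow>
       (\<exists>u. semi_implicit_scheme u0 \<nu> (T / real M) M u) \<and>
       (\<forall>u. semi_implicit_scheme u0 \<nu> (T / real M) M u \<longrightarrow>
          (SUP n\<in>{0..M}. besov_norm h s \<infinity> 2 (distr_field_of (u n)))
            \<le> 8 * besov_norm h s \<infinity> 2 u0))"
proof -
  interpret lp_cutoff h by unfold_locales (rule assms(1))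
  define Q where "Q r T M \<nu> \<longleftrightarrow> (\<exists>u. semi_implicit_scheme u0 \<nu> (T / real M) M u) \<and>
       (\<forall>u. semi_implicit_scheme u0 \<nu> (T / real M) M u \<longrightarrow>
          (SUP n\<in>{0..M}. besov_norm h s \<infinity> (of_nat r) (distr_field_of (u n)))
            \<le> 8 * besov_norm h s \<infinity> (of_nat r) u0)" for r M :: nat and T \<nu> :: real
  have "\<exists>T0>0. \<forall>T (M::nat) \<nu>. 0 < T \<longrightarrow> T \<le> T0 \<longrightarrow> M \<ge> 1 \<longrightarrow> \<nu> \<ge> 0 \<longrightarrow> adm r s \<and> u0 \<in> besov_space h s \<infinity> (of_nat r) \<longrightarrow> Q r T M \<nu>" for r
  proof (cases "adm r s \<and> u0 \<in> besov_space h s \<infinity> (of_nat r)")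
    case True
    then show ?thesis using scheme_bound[OF _ _ assms(3), of r s] unfolding Q_def by blast
  qed (auto intro: exI[of _ 1])
  from this[of 1] this[of 2] obtain T1 T2 where
    T1: "T1 > 0" "\<And>T M \<nu>. 0 < T \<Longrightarrow> T \<le> T1 \<Longrightarrow> M \<ge> 1 \<Longrightarrow> \<nu> \<ge> 0 \<Longrightarrow> adm 1 s \<and> u0 \<in> besov_space h s \<infinity> (of_nat 1) \<Longrightarrow> Q 1 T M \<nu>" and
    T2: "T2 > 0" "\<And>T M \<nu>. 0 < T \<Longrightarrow> T \<le> T2 \<Longrightarrow> M \<ge> 1 \<Longrightarrow> \<nu> \<ge> 0 \<Longrightarrow> adm 2 s \<and> u0 \<in> besov_space h s \<infinity> (of_nat 2) \<Longrightarrow> Q 2 T M \<nu>"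
    by blast
  show ?thesis
  proof (intro exI[of _ "min T1 T2"] conjI allI impI)
    show "0 < min T1 T2" using T1 T2 by simp
  next
    fix M :: nat and \<nu> :: real assume "M \<ge> 1" "\<nu> \<ge> 0" "s \<ge> 1 \<and> u0 \<in> besov_space h s \<infinity> 1"
    then have "Q 1 (min T1 T2) M \<nu>" using T1 T2 by (intro T1(2)) (auto simp: adm_def)
    then show "\<exists>u. semi_implicit_scheme u0 \<nu> (min T1 T2 / real M) M u"
      and "\<And>u. semi_implicit_scheme u0 \<nu> (min T1 T2 / real M) M u \<Longrightarrow> (SUP n\<in>{0..M}. besov_norm h s \<infinity> 1 (distr_field_of (u n))) \<le> 8 * besov_norm h s \<infinity> 1 u0"
      by (simp_all add: Q_def)
  next
    fix M :: nat and \<nu> :: real assume "M \<ge> 1" "\<nu> \<ge> 0" "s > 1 \<and> u0 \<in> besov_space h s \<infinity> 2"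
    then have "Q 2 (min T1 T2) M \<nu>" using T1 T2 by (intro T2(2)) (auto simp: adm_def)
    then show "\<exists>u. semi_implicit_scheme u0 \<nu> (min T1 T2 / real M) M u"
      and "\<And>u. semi_implicit_scheme u0 \<nu> (min T1 T2 / real M) M u \<Longrightarrow> (SUP n\<in>{0..M}. besov_norm h s \<infinity> 2 (distr_field_of (u n))) \<le> 8 * besov_norm h s \<infinity> 2 u0"
      by (simp_all add: Q_def)
  qed
qed

end
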